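(* Let $(A,C,\psi)$ be an entwining structure over a field $k$, let $n\ge0$, and let $g:C\otimes A^{\otimes n+1}\to k$ be a linear map. Then the following are equivalent. (1) There is an $n$-dimensional entwined cycle $((R^\bullet,D^\bullet),C,\Psi^\bullet,T,\rho)$ over $(A,C,\psi)$ such that $g(c,a_0,\dots,a_n)=T(c\otimes(\rho(a_0)\cdot D\rho(a_1)\cdots D\rho(a_n)))$ for all $a_i\in A$, $c\in C$. (2) There exists a closed graded entwined trace $t:C\otimes\Omega^nA\to k$ of dimension $n$ on $((\Omega^\bullet A,d^\bullet),C,\hat\psi)$ such that $g(c,a_0,\dots,a_n)=t(c\otimes a_0da_1\cdots da_n)$ for all $a_i\in A$, $c\in C$. (3) $g\in Z^n_\lambda(A,C,\psi)$.
   Context: Let $k$ be a field; $\otimes$ and $Hom$ are over $k$. An entwining structure $(A,C,\psi)$ over $k$ consists of a unital associative $k$-algebra $A$ with product $\theta$, a counital coassociative $k$-coalgebra $C$ (coproduct $\Delta$, counit $\varepsilon$), and a $k$-linear map $\psi:C\otimes A\to A\otimes C$, written $\psi(c\otimes a)=a_\psi\otimes c^\psi$ with summation suppressed, such that: (i) $\psi\circ(id_C\otimes\theta)=(\theta\otimes id_C)\circ(id_A\otimes\psi)\circ(\psi\otimes id_A)$; (ii) $(id_A\otimes\Delta)\circ\psi=(\psi\otimes id_C)\circ(id_C\otimes\psi)\circ(\Delta\otimes id_A)$; (iii) $a_\psi\,\varepsilon(c^\psi)=\varepsilon(c)a$; (iv) $1_\psi\otimes c^\psi=1\otimes c$. For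 a non-unital algebra, "entwining structure" means (i)–(iii) only. Iterating, $a_{1\psi}\otimes\cdots\otimes a_{m\psi}\otimes c^{\psi^m}$ denotes the image of $c\otimes a_1\otimes\cdots\otimes a_m$ under the map $C\otimes A^{\otimes m}\to A^{\otimes m}\otimes C$ that moves $C$ past $a_1$, then $a_2$, ..., then $a_m$ by $\psi$. Cyclic complex: $\mathscr C^n(A,C,\psi)=Hom(C\otimes A^{\otimes n+1},k)$ with $$\delta^n(g)(c,a_1,\dots,a_{n+2})=g(c^\psi,a_2,\dots,a_{n+1},a_{n+2}a_{1\psi})+\sum_{i=1}^{n+1}(-1)^i g(c,a_1,\dots,a_ia_{i+1},\dots,a_{n+2}).$$ $\mathscr C^n_\lambda(A,C,\psi)$ is the subspace of all $g$ with $g(c,a_1,\dots,a_{n+1})=(-1)^n g(c^\psi,a_2,\dots,a_{n+1},a_{1\psi})$; it is a subcomplex, and $Z^n_\lambda(A,C,\psi)=\{g\in\mathscr C^n_\lambda(A,C,\psi):\delta^n g=0\}$. A dg-entwining structure $((R^\bullet,D^\bullet),C,\Psi^\bullet)$ consists of a non-negatively graded, not necessarily unital, differential graded $k$-algebra $(R^\bullet,D^\bullet)$ (differential of degree $+1$), a counital coalgebra $C$ and a degree-zero $k$-linear map $\Psi^\bullet:C\otimes R^\bullet\to R^\bullet\otimes C$, written $\Psi(c\otimes r)=r_\Psi\otimes c^\Psi$, with $(D\otimes id_C)\circ\Psi=\Psi\circ(id_C\otimes D)$ and such that $(R,C,\Psi)$ is an entwining structure (in the possibly non-unital sense). A dg-entwining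 structure over $(A,C,\psi)$ is such a structure together with a (not necessarily unital) $k$-algebra morphism $\rho:A\to R^0$ satisfying $(\rho\otimes id_C)\circ\psi=\Psi^0\circ(id_C\otimes\rho)$. An $n$-dimensional closed graded entwined trace on $((R^\bullet,D^\bullet),C,\Psi^\bullet)$ is a linear map $T:C\otimes R^n\to k$ such that $T(c\otimes D(r))=0$ for $c\in C$, $r\in R^{n-1}$, and $T(c\otimes rr')=(-1)^{ij}T(c^\Psi\otimes r'r_\Psi)$ for $c\in C$, $r\in R^i$, $r'\in R^j$, $i+j=n$. An $n$-dimensional entwined cycle over $(A,C,\psi)$ is a tuple $((R^\bullet,D^\bullet),C,\Psi^\bullet,T,\rho)$ where $((R^\bullet,D^\bullet),C,\Psi^\bullet)$ with $\rho$ is a dg-entwining structure over $(A,C,\psi)$ and $T$ is an $n$-dimensional closed graded entwined trace on it. Universal dg-algebra: let $\tilde A=A\oplus k$ with $(a+\mu)(a'+\nu)=(aa'+\mu a'+\nu a)+\mu\nu$. Put $\Omega^0A=A$ and $\Omega^nA=\tilde A\otimes A^{\otimes n}$ for $n>0$; the element $(a_0+\mu)\otimes a_1\otimes\cdots\otimes a_n$ is written $(a_0+\mu)da_1\cdots da_n$ (with $\mu=0$ understood when $n=0$). The product is determined by $a_0da_1\cdots da_n=(a_0)\cdot(da_1)\cdots(da_n)$, $da_1\cdots da_n=(da_1)\cdots(da_n)$ and $(da)\cdot a'=d(aa')-a(da')$; explicitly, for $i\ge1$, $$((p_0+\mu)dp_1\cdots dp_i)\cdot((q_0+\nu)dq_1\cdots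 dq_j)=(p_0+\mu)\Big(dp_1\cdots dp_{i-1}d(p_iq_0)dq_1\cdots dq_j+\sum_{l=1}^{i-1}(-1)^{i-l}dp_1\cdots d(p_lp_{l+1})\cdots dp_i\,dq_0\cdots dq_j\Big)$$ $$+(-1)^i(p_0+\mu)p_1dp_2\cdots dp_i\,dq_0\cdots dq_j+\nu(p_0+\mu)dp_1\cdots dp_idq_1\cdots dq_j,$$ and $p_0\cdot((q_0+\nu)dq_1\cdots dq_j)=(p_0q_0+\nu p_0)dq_1\cdots dq_j$. The differential is $d((a_0+\mu)da_1\cdots da_n)=da_0da_1\cdots da_n$. The map $\hat\psi:C\otimes\Omega A\to\Omega A\otimes C$, $$\hat\psi(c\otimes(a_0+\mu)da_1\cdots da_n)=(a_{0\psi}da_{1\psi}\cdots da_{n\psi})\otimes c^{\psi^{n+1}}+\mu(da_{1\psi}\cdots da_{n\psi})\otimes c^{\psi^n},$$ makes $((\Omega^\bullet A,d^\bullet),C,\hat\psi)$ a dg-entwining structure. *)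

theory Defs
  imports "HOL-Algebra.Module" "HOL-Algebra.AbelCoset"
begin

section \<open>Linear algebra over a field\<close>

text \<open>
  A vector space over a field \<open>K\<close> is a \<open>module K V\<close> in the sense of HOL-Algebra; the fields
  \<open>mult\<close> and \<open>one\<close> of the record are irrelevant for it.
\<close>

definition linear_map ::
  "_ \<Rightarrow> ('k, 'v, _) module_scheme \<Rightarrow> ('k, 'w, _) module_scheme \<Rightarrow> ('v \<Rightarrow> 'w) \<Rightarrow> bool" where
  "linear_map K V W f \<longleftrightarrow>
     f \<in> carrier V \<rightarrow> carrier W \<and>
     (\<forall>x\<in>carrier V. \<forall>y\<in>carrier V. f (x \<oplus>\<^bsub>V\<^esub> y) = f x \<oplus>\<^bsub>W\<^esub> f y) \<and>
     (\<forall>r\<in>carrier K. \<forall>x\<in>carrier V. f (r \<odot>\<^bsub>V\<^esub> x) = r \<odot>\<^bsub>W\<^esub> f x)"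

definition scalars :: "('k, _) ring_scheme \<Rightarrow> ('k, 'k) module" where
  "scalars K = \<lparr>carrier = carrier K, mult = mult K, one = one K, zero = zero K, add = add K,
     smult = mult K\<rparr>"

definition lin_span :: "_ \<Rightarrow> ('k, 'v, _) module_scheme \<Rightarrow> 'v set \<Rightarrow> 'v set" where
  "lin_span K V S = \<Inter>{N. submodule N K V \<and> S \<subseteq> N}"

text \<open>\<open>(-1)\<^sup>i x\<close>\<close>

definition alt_sign :: "_ \<Rightarrow> nat \<Rightarrow> 'v \<Rightarrow> 'v" where
  "alt_sign V i x = (if even i then x else \<ominus>\<^bsub>V\<^esub> x)"

text \<open>The free vector space on a set \<open>S\<close>: finitely supported functions.\<close>

definition free_space :: "('k, _) ring_scheme \<Rightarrow> 's set \<Rightarrow> ('k, 's \<Rightarrow> 'k) module" where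
  "free_space K S =
     \<lparr>carrier = {p. (\<forall>x. p x \<in> carrier K) \<and> finite {x. p x \<noteq> \<zero>\<^bsub>K\<^esub>} \<and> {x. p x \<noteq> \<zero>\<^bsub>K\<^esub>} \<subseteq> S},
      mult = undefined, one = undefined,
      zero = (\<lambda>_. \<zero>\<^bsub>K\<^esub>),
      add = (\<lambda>p q x. p x \<oplus>\<^bsub>K\<^esub> q x),
      smult = (\<lambda>r p x. r \<otimes>\<^bsub>K\<^esub> p x)\<rparr>"

definition basis_elt :: "('k, _) ring_scheme \<Rightarrow> 's \<Rightarrow> 's \<Rightarrow> 'k" where
  "basis_elt K s = (\<lambda>x. if x = s then \<one>\<^bsub>K\<^esub> else \<zero>\<^bsub>K\<^esub>)"

definition quot_space :: "('k, 'v, _) module_scheme \<Rightarrow> 'v set \<Rightarrow> ('k, 'v set) module" where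
  "quot_space V N =
     \<lparr>carrier = a_rcosets\<^bsub>V\<^esub> N,
      mult = undefined, one = undefined,
      zero = N,
      add = (\<lambda>X Y. X <+>\<^bsub>V\<^esub> Y),
      smult = (\<lambda>r X. \<Union>x\<in>X. N +>\<^bsub>V\<^esub> (r \<odot>\<^bsub>V\<^esub> x))\<rparr>"

text \<open>
  The vector space generated by the set \<open>S\<close> subject to the relations \<open>E\<close> (elements of the free
  space, set to zero), and the class of a generator in it.
\<close>

definition presented ::
  "('k, _) ring_scheme \<Rightarrow> 's set \<Rightarrow> ('s \<Rightarrow> 'k) set \<Rightarrow> ('k, ('s \<Rightarrow> 'k) set) module" where
  "presented K S E = quot_space (free_space K S) (lin_span K (free_space K S) E)"

definition gen_class ::
  "('k, _) ring_scheme \<Rightarrow> 's set \<Rightarrow> ('s \<Rightarrow> 'k) set \<Rightarrow> 's \<Rightarrow> ('s \<Rightarrow> 'k) set" where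
  "gen_class K S E s = lin_span K (free_space K S) E +>\<^bsub>free_space K S\<^esub> basis_elt K s"

text \<open>
  The linear extension to \<open>presented K S E\<close> of a map \<open>f\<close> on the generators, with values in \<open>P\<close>.
  It is independent of the chosen representative whenever the linear extension of \<open>f\<close> to the free
  space maps the relations \<open>E\<close> to zero.
\<close>

definition lift ::
  "('k, _) ring_scheme \<Rightarrow> ('k, 'p, _) module_scheme \<Rightarrow> ('s \<Rightarrow> 'p) \<Rightarrow> ('s \<Rightarrow> 'k) set \<Rightarrow> 'p" where
  "lift K P f X =
     (let p = (SOME p. p \<in> X) in \<Oplus>\<^bsub>P\<^esub>x\<in>{x. p x \<noteq> \<zero>\<^bsub>K\<^esub>}. p x \<odot>\<^bsub>P\<^esub> f x)"


section \<open>Tensor products\<close>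

definition tensor_rels ::
  "('k, _) ring_scheme \<Rightarrow> ('k, 'v, _) module_scheme \<Rightarrow> ('k, 'w, _) module_scheme \<Rightarrow>
   ('v \<times> 'w \<Rightarrow> 'k) set" where
  "tensor_rels K V W =
    (let F = free_space K (carrier V \<times> carrier W); b = basis_elt K in
       {b (v \<oplus>\<^bsub>V\<^esub> v', w) \<ominus>\<^bsub>F\<^esub> (b (v, w) \<oplus>\<^bsub>F\<^esub> b (v', w)) | v v' w.
          v \<in> carrier V \<and> v' \<in> carrier V \<and> w \<in> carrier W} \<union>
       {b (v, w \<oplus>\<^bsub>W\<^esub> w') \<ominus>\<^bsub>F\<^esub> (b (v, w) \<oplus>\<^bsub>F\<^esub> b (v, w')) | v w w'.
          v \<in> carrier V \<and> w \<in> carrier W \<and> w' \<in> carrier W} \<union>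
       {b (r \<odot>\<^bsub>V\<^esub> v, w) \<ominus>\<^bsub>F\<^esub> r \<odot>\<^bsub>F\<^esub> b (v, w) | r v w.
          r \<in> carrier K \<and> v \<in> carrier V \<and> w \<in> carrier W} \<union>
       {b (v, r \<odot>\<^bsub>W\<^esub> w) \<ominus>\<^bsub>F\<^esub> r \<odot>\<^bsub>F\<^esub> b (v, w) | r v w.
          r \<in> carrier K \<and> v \<in> carrier V \<and> w \<in> carrier W})"

definition tensor ::
  "('k, _) ring_scheme \<Rightarrow> ('k, 'v, _) module_scheme \<Rightarrow> ('k, 'w, _) module_scheme \<Rightarrow>
   ('k, ('v \<times> 'w \<Rightarrow> 'k) set) module" where
  "tensor K V W = presented K (carrier V \<times> carrier W) (tensor_rels K V W)"

definition tens ::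
  "('k, _) ring_scheme \<Rightarrow> ('k, 'v, _) module_scheme \<Rightarrow> ('k, 'w, _) module_scheme \<Rightarrow>
   'v \<Rightarrow> 'w \<Rightarrow> ('v \<times> 'w \<Rightarrow> 'k) set" where
  "tens K V W v w = gen_class K (carrier V \<times> carrier W) (tensor_rels K V W) (v, w)"

text \<open>\<open>f \<otimes> g\<close>, where \<open>V\<close> and \<open>W\<close> are the codomains of \<open>f\<close> and \<open>g\<close>\<close>

definition tmap where
  "tmap K V W f g = lift K (tensor K V W) (\<lambda>(v, w). tens K V W (f v) (g w))"

text \<open>\<open>(U \<otimes> V) \<otimes> W \<rightarrow> U \<otimes> (V \<otimes> W)\<close> and its inverse\<close>

definition assoc_r where
  "assoc_r K U V W =
     lift K (tensor K U (tensor K V W))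
       (\<lambda>(x, w). lift K (tensor K U (tensor K V W))
          (\<lambda>(u, v). tens K U (tensor K V W) u (tens K V W v w)) x)"

definition assoc_l where
  "assoc_l K U V W =
     lift K (tensor K (tensor K U V) W)
       (\<lambda>(u, x). lift K (tensor K (tensor K U V) W)
          (\<lambda>(v, w). tens K (tensor K U V) W (tens K U V u v) w) x)"

text \<open>
  Higher tensor products. For a family of spaces \<open>H n\<close>, a space \<open>M\<close> and a set \<open>N\<close> of natural
  numbers, \<open>word_space K H M N\<close> is the direct sum over \<open>n \<in> N\<close> of the spaces
  \<open>H n \<otimes> M \<otimes> \<dots> \<otimes> M\<close> (\<open>n\<close> factors \<open>M\<close>), given by generators
  \<open>(h, [x\<^sub>1, \<dots>, x\<^sub>n]) = h \<otimes> x\<^sub>1 \<otimes> \<dots> \<otimes> x\<^sub>n\<close> modulo multilinearity.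
\<close>

definition words ::
  "(nat \<Rightarrow> ('k, 'h, _) module_scheme) \<Rightarrow> ('k, 'm, _) module_scheme \<Rightarrow> nat set \<Rightarrow>
   ('h \<times> 'm list) set" where
  "words H M N = {(h, xs). length xs \<in> N \<and> h \<in> carrier (H (length xs)) \<and> set xs \<subseteq> carrier M}"

definition word_rels ::
  "('k, _) ring_scheme \<Rightarrow> (nat \<Rightarrow> ('k, 'h, _) module_scheme) \<Rightarrow> ('k, 'm, _) module_scheme \<Rightarrow>
   nat set \<Rightarrow> ('h \<times> 'm list \<Rightarrow> 'k) set" where
  "word_rels K H M N =
    (let F = free_space K (words H M N); b = basis_elt K in
       {b (h \<oplus>\<^bsub>H (length xs)\<^esub> h', xs) \<ominus>\<^bsub>F\<^esub> (b (h, xs) \<oplus>\<^bsub>F\<^esub> b (h', xs)) | h h' xs.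
          (h, xs) \<in> words H M N \<and> (h', xs) \<in> words H M N} \<union>
       {b (r \<odot>\<^bsub>H (length xs)\<^esub> h, xs) \<ominus>\<^bsub>F\<^esub> r \<odot>\<^bsub>F\<^esub> b (h, xs) | r h xs.
          r \<in> carrier K \<and> (h, xs) \<in> words H M N} \<union>
       {b (h, ys @ (x \<oplus>\<^bsub>M\<^esub> x') # zs) \<ominus>\<^bsub>F\<^esub> (b (h, ys @ x # zs) \<oplus>\<^bsub>F\<^esub> b (h, ys @ x' # zs)) |
          h ys x x' zs. (h, ys @ x # zs) \<in> words H M N \<and> (h, ys @ x' # zs) \<in> words H M N} \<union>
       {b (h, ys @ (r \<odot>\<^bsub>M\<^esub> x) # zs) \<ominus>\<^bsub>F\<^esub> r \<odot>\<^bsub>F\<^esub> b (h, ys @ x # zs) | r h ys x zs.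
          r \<in> carrier K \<and> (h, ys @ x # zs) \<in> words H M N})"

definition word_space ::
  "('k, _) ring_scheme \<Rightarrow> (nat \<Rightarrow> ('k, 'h, _) module_scheme) \<Rightarrow> ('k, 'm, _) module_scheme \<Rightarrow>
   nat set \<Rightarrow> ('k, ('h \<times> 'm list \<Rightarrow> 'k) set) module" where
  "word_space K H M N = presented K (words H M N) (word_rels K H M N)"

definition word ::
  "('k, _) ring_scheme \<Rightarrow> (nat \<Rightarrow> ('k, 'h, _) module_scheme) \<Rightarrow> ('k, 'm, _) module_scheme \<Rightarrow>
   nat set \<Rightarrow> 'h \<Rightarrow> 'm list \<Rightarrow> ('h \<times> 'm list \<Rightarrow> 'k) set" where
  "word K H M N h xs = gen_class K (words H M N) (word_rels K H M N) (h, xs)"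


section \<open>Algebras, coalgebras, entwining structures\<close>

locale nonunital_algebra = field K + module K A for K (structure) and A (structure) +
  assumes mult_closed: "\<lbrakk>x \<in> carrier A; y \<in> carrier A\<rbrakk> \<Longrightarrow> x \<otimes>\<^bsub>A\<^esub> y \<in> carrier A"
    and mult_assoc: "\<lbrakk>x \<in> carrier A; y \<in> carrier A; z \<in> carrier A\<rbrakk> \<Longrightarrow>
      (x \<otimes>\<^bsub>A\<^esub> y) \<otimes>\<^bsub>A\<^esub> z = x \<otimes>\<^bsub>A\<^esub> (y \<otimes>\<^bsub>A\<^esub> z)"
    and mult_add_left: "\<lbrakk>x \<in> carrier A; y \<in> carrier A; z \<in> carrier A\<rbrakk> \<Longrightarrow>
      (x \<oplus>\<^bsub>A\<^esub> y) \<otimes>\<^bsub>A\<^esub> z = x \<otimes>\<^bsub>A\<^esub> z \<oplus>\<^bsub>A\<^esub> y \<otimes>\<^bsub>A\<^esub> z"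
    and mult_add_right: "\<lbrakk>x \<in> carrier A; y \<in> carrier A; z \<in> carrier A\<rbrakk> \<Longrightarrow>
      z \<otimes>\<^bsub>A\<^esub> (x \<oplus>\<^bsub>A\<^esub> y) = z \<otimes>\<^bsub>A\<^esub> x \<oplus>\<^bsub>A\<^esub> z \<otimes>\<^bsub>A\<^esub> y"
    and mult_smult_left: "\<lbrakk>r \<in> carrier K; x \<in> carrier A; y \<in> carrier A\<rbrakk> \<Longrightarrow>
      (r \<odot>\<^bsub>A\<^esub> x) \<otimes>\<^bsub>A\<^esub> y = r \<odot>\<^bsub>A\<^esub> (x \<otimes>\<^bsub>A\<^esub> y)"
    and mult_smult_right: "\<lbrakk>r \<in> carrier K; x \<in> carrier A; y \<in> carrier A\<rbrakk> \<Longrightarrow>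
      x \<otimes>\<^bsub>A\<^esub> (r \<odot>\<^bsub>A\<^esub> y) = r \<odot>\<^bsub>A\<^esub> (x \<otimes>\<^bsub>A\<^esub> y)"

text \<open>The locale \<^locale>\<open>algebra\<close> of HOL-Algebra is for commutative algebras only.\<close>

locale unital_algebra = nonunital_algebra K A for K (structure) and A (structure) +
  assumes unit_closed: "\<one>\<^bsub>A\<^esub> \<in> carrier A"
    and unit_left: "x \<in> carrier A \<Longrightarrow> \<one>\<^bsub>A\<^esub> \<otimes>\<^bsub>A\<^esub> x = x"
    and unit_right: "x \<in> carrier A \<Longrightarrow> x \<otimes>\<^bsub>A\<^esub> \<one>\<^bsub>A\<^esub> = x"

text \<open>The product as a linear map \<open>A \<otimes> A \<rightarrow> A\<close>\<close>

definition mult_map where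
  "mult_map K A = lift K A (\<lambda>(x, y). x \<otimes>\<^bsub>A\<^esub> y)"

record ('k, 'c) coalg = "('k, 'c) module" +
  comult :: "'c \<Rightarrow> ('c \<times> 'c \<Rightarrow> 'k) set"
  counit :: "'c \<Rightarrow> 'k"

locale coalgebra = field K + module K C for K (structure) and C (structure) +
  assumes comult_linear: "linear_map K C (tensor K C C) (comult C)"
    and counit_linear: "linear_map K C (scalars K) (counit C)"
    and coassoc: "c \<in> carrier C \<Longrightarrow>
      assoc_r K C C C (tmap K (tensor K C C) C (comult C) id (comult C c)) =
      tmap K C (tensor K C C) id (comult C) (comult C c)"
    and counit_left: "c \<in> carrier C \<Longrightarrow>
      lift K C (\<lambda>(x, y). counit C x \<odot>\<^bsub>C\<^esub> y) (comult C c) = c"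
    and counit_right: "c \<in> carrier C \<Longrightarrow>
      lift K C (\<lambda>(x, y). counit C y \<odot>\<^bsub>C\<^esub> x) (comult C c) = c"

locale nonunital_entwining = nonunital_algebra K A + coalgebra K C
  for K (structure) and A (structure) and C (structure) and \<psi> +
  assumes psi_linear: "linear_map K (tensor K C A) (tensor K A C) \<psi>"
    and psi_mult: "x \<in> carrier (tensor K (tensor K C A) A) \<Longrightarrow>
      \<psi> (tmap K C A id (mult_map K A) (assoc_r K C A A x)) =
      tmap K A C (mult_map K A) id (assoc_l K A A C (tmap K A (tensor K A C) id \<psi>
        (assoc_r K A C A (tmap K (tensor K A C) A \<psi> id x))))"
    and psi_comult: "y \<in> carrier (tensor K C A) \<Longrightarrow>
      tmap K A (tensor K C C) id (comult C) (\<psi> y) =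
      assoc_r K A C C (tmap K (tensor K A C) C \<psi> id (assoc_l K C A C
        (tmap K C (tensor K A C) id \<psi> (assoc_r K C C A (tmap K (tensor K C C) A (comult C) id y)))))"
    and psi_counit: "\<lbrakk>c \<in> carrier C; a \<in> carrier A\<rbrakk> \<Longrightarrow>
      lift K A (\<lambda>(a', c'). counit C c' \<odot>\<^bsub>A\<^esub> a') (\<psi> (tens K C A c a)) = counit C c \<odot>\<^bsub>A\<^esub> a"

locale entwining = nonunital_entwining K A C \<psi> + unital_algebra K A
  for K (structure) and A (structure) and C (structure) and \<psi> +
  assumes psi_unit: "c \<in> carrier C \<Longrightarrow> \<psi> (tens K C A c \<one>\<^bsub>A\<^esub>) = tens K A C \<one>\<^bsub>A\<^esub> c"


section \<open>The cyclic complex\<close>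

text \<open>\<open>C \<otimes> A\<^sup>\<otimes>\<^sup>m\<close> and its elements \<open>c \<otimes> a\<^sub>1 \<otimes> \<dots> \<otimes> a\<^sub>m\<close>\<close>

abbreviation CA where
  "CA K A C m \<equiv> word_space K (\<lambda>_. C) A {m}"

abbreviation ca where
  "ca K A C m \<equiv> word K (\<lambda>_. C) A {m}"

definition cochains ::
  "('k, _) ring_scheme \<Rightarrow> ('k, 'a, _) module_scheme \<Rightarrow> ('k, 'c, _) coalg_scheme \<Rightarrow> nat \<Rightarrow>
   (('c \<times> 'a list \<Rightarrow> 'k) set \<Rightarrow> 'k) set" where
  "cochains K A C n = {g. linear_map K (CA K A C (n + 1)) (scalars K) g}"

text \<open>Multiply the entries at the positions \<open>i\<close> and \<open>i + 1\<close>, counted from \<open>0\<close>.\<close>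

definition contract :: "('a, _) monoid_scheme \<Rightarrow> nat \<Rightarrow> 'a list \<Rightarrow> 'a list" where
  "contract A i as = take i as @ (as ! i \<otimes>\<^bsub>A\<^esub> as ! Suc i) # drop (Suc (Suc i)) as"

definition coboundary where
  "coboundary K A C \<psi> n g = lift K (scalars K) (\<lambda>(c, as).
     g (lift K (CA K A C (n + 1))
         (\<lambda>(a', c'). ca K A C (n + 1) c' (butlast (tl as) @ [last as \<otimes>\<^bsub>A\<^esub> a']))
         (\<psi> (tens K C A c (hd as))))
     \<oplus>\<^bsub>K\<^esub> (\<Oplus>\<^bsub>K\<^esub>i\<in>{1..n + 1}. alt_sign K i (g (ca K A C (n + 1) c (contract A (i - 1) as)))))"

definition cyclic_cochains where
  "cyclic_cochains K A C \<psi> n =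
     {g \<in> cochains K A C n. \<forall>c\<in>carrier C. \<forall>a\<in>carrier A. \<forall>as. set as \<subseteq> carrier A \<and> length as = n \<longrightarrow>
        g (ca K A C (n + 1) c (a # as)) =
        alt_sign K n (g (lift K (CA K A C (n + 1))
          (\<lambda>(a', c'). ca K A C (n + 1) c' (as @ [a'])) (\<psi> (tens K C A c a))))}"

definition cyclic_cocycles where
  "cyclic_cocycles K A C \<psi> n =
     {g \<in> cyclic_cochains K A C \<psi> n.
        \<forall>x\<in>carrier (CA K A C (n + 2)). coboundary K A C \<psi> n g x = \<zero>\<^bsub>K\<^esub>}"


section \<open>Entwined cycles\<close>

record ('k, 'r) dga = "('k, 'r) module" +
  dg_part :: "nat \<Rightarrow> 'r set"
  dg_diff :: "'r \<Rightarrow> 'r"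

locale dg_algebra = nonunital_algebra K R for K (structure) and R (structure) +
  assumes part_submodule: "submodule (dg_part R i) K R"
    and direct_sum: "r \<in> carrier R \<Longrightarrow>
      \<exists>!f. (\<forall>i. f i \<in> dg_part R i) \<and> finite {i. f i \<noteq> \<zero>\<^bsub>R\<^esub>} \<and>
           r = (\<Oplus>\<^bsub>R\<^esub>i\<in>{i. f i \<noteq> \<zero>\<^bsub>R\<^esub>}. f i)"
    and part_mult: "\<lbrakk>r \<in> dg_part R i; s \<in> dg_part R j\<rbrakk> \<Longrightarrow> r \<otimes>\<^bsub>R\<^esub> s \<in> dg_part R (i + j)"
    and diff_linear: "linear_map K R R (dg_diff R)"
    and diff_part: "r \<in> dg_part R i \<Longrightarrow> dg_diff R r \<in> dg_part R (Suc i)"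
    and diff_diff: "r \<in> carrier R \<Longrightarrow> dg_diff R (dg_diff R r) = \<zero>\<^bsub>R\<^esub>"
    and leibniz: "\<lbrakk>r \<in> dg_part R i; s \<in> carrier R\<rbrakk> \<Longrightarrow>
      dg_diff R (r \<otimes>\<^bsub>R\<^esub> s) = dg_diff R r \<otimes>\<^bsub>R\<^esub> s \<oplus>\<^bsub>R\<^esub> alt_sign R i (r \<otimes>\<^bsub>R\<^esub> dg_diff R s)"

text \<open>
  The subspaces \<open>C \<otimes> R\<^sup>n\<close> of \<open>C \<otimes> R\<close> and \<open>R\<^sup>n \<otimes> C\<close> of \<open>R \<otimes> C\<close>; over a field the canonical
  maps from the tensor products of the subspaces are injective.
\<close>

definition part_right where
  "part_right K C R n = lin_span K (tensor K C R) {tens K C R c r | c r. c \<in> carrier C \<and> r \<in> dg_part R n}"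

definition part_left where
  "part_left K R C n = lin_span K (tensor K R C) {tens K R C r c | r c. r \<in> dg_part R n \<and> c \<in> carrier C}"

locale dg_entwining = dg_algebra K R + nonunital_entwining K R C \<Psi>
  for K (structure) and R (structure) and C (structure) and \<Psi> +
  assumes Psi_degree: "x \<in> part_right K C R i \<Longrightarrow> \<Psi> x \<in> part_left K R C i"
    and Psi_diff: "x \<in> carrier (tensor K C R) \<Longrightarrow>
      tmap K R C (dg_diff R) id (\<Psi> x) = \<Psi> (tmap K C R id (dg_diff R) x)"

locale dg_entwining_over = dg_entwining K R C \<Psi>
  for K (structure) and A (structure) and C (structure) and \<psi> and R (structure) and \<Psi> and \<rho> +
  assumes rho_linear: "linear_map K A R \<rho>"
    and rho_degree: "a \<in> carrier A \<Longrightarrow> \<rho> a \<in> dg_part R 0"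
    and rho_mult: "\<lbrakk>a \<in> carrier A; b \<in> carrier A\<rbrakk> \<Longrightarrow> \<rho> (a \<otimes>\<^bsub>A\<^esub> b) = \<rho> a \<otimes>\<^bsub>R\<^esub> \<rho> b"
    and rho_psi: "x \<in> carrier (tensor K C A) \<Longrightarrow>
      tmap K R C \<rho> id (\<psi> x) = \<Psi> (tmap K C R id \<rho> x)"

text \<open>Only the values of \<open>T\<close> on \<open>C \<otimes> R\<^sup>n\<close> matter.\<close>

definition closed_graded_trace where
  "closed_graded_trace K R C \<Psi> n T \<longleftrightarrow>
     linear_map K ((tensor K C R)\<lparr>carrier := part_right K C R n\<rparr>) (scalars K) T \<and>
     (\<forall>i c r. i + 1 = n \<and> c \<in> carrier C \<and> r \<in> dg_part R i \<longrightarrow>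
        T (tens K C R c (dg_diff R r)) = \<zero>\<^bsub>K\<^esub>) \<and>
     (\<forall>i j c r r'. i + j = n \<and> c \<in> carrier C \<and> r \<in> dg_part R i \<and> r' \<in> dg_part R j \<longrightarrow>
        T (tens K C R c (r \<otimes>\<^bsub>R\<^esub> r')) =
        alt_sign K (i * j)
          (T (lift K (tensor K C R) (\<lambda>(s, c'). tens K C R c' (r' \<otimes>\<^bsub>R\<^esub> s)) (\<Psi> (tens K C R c r)))))"

definition entwined_cycle where
  "entwined_cycle K A C \<psi> n R \<Psi> T \<rho> \<longleftrightarrow>
     dg_entwining_over K A C \<psi> R \<Psi> \<rho> \<and> closed_graded_trace K R C \<Psi> n T"


section \<open>The universal differential graded algebra\<close>

definition unitization ::
  "('k, _) ring_scheme \<Rightarrow> ('k, 'a, _) module_scheme \<Rightarrow> ('k, 'a \<times> 'k) module" where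
  "unitization K A =
     \<lparr>carrier = carrier A \<times> carrier K,
      mult = (\<lambda>(a, m) (b, v). (a \<otimes>\<^bsub>A\<^esub> b \<oplus>\<^bsub>A\<^esub> m \<odot>\<^bsub>A\<^esub> b \<oplus>\<^bsub>A\<^esub> v \<odot>\<^bsub>A\<^esub> a, m \<otimes>\<^bsub>K\<^esub> v)),
      one = (\<zero>\<^bsub>A\<^esub>, \<one>\<^bsub>K\<^esub>),
      zero = (\<zero>\<^bsub>A\<^esub>, \<zero>\<^bsub>K\<^esub>),
      add = (\<lambda>(a, m) (b, v). (a \<oplus>\<^bsub>A\<^esub> b, m \<oplus>\<^bsub>K\<^esub> v)),
      smult = (\<lambda>r (a, m). (r \<odot>\<^bsub>A\<^esub> a, r \<otimes>\<^bsub>K\<^esub> m))\<rparr>"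

text \<open>
  The first tensor factor of \<open>\<Omega>\<^sup>n A\<close>: the unitization of \<open>A\<close> for \<open>n > 0\<close>, and \<open>A\<close> itself, as a
  subspace of the unitization, for \<open>n = 0\<close>.
\<close>

definition omega_head :: "_ \<Rightarrow> ('k, 'a, _) module_scheme \<Rightarrow> nat \<Rightarrow> ('k, 'a \<times> 'k) module" where
  "omega_head K A n =
     (if n = 0 then (unitization K A)\<lparr>carrier := carrier A \<times> {\<zero>\<^bsub>K\<^esub>}\<rparr> else unitization K A)"

text \<open>\<open>omega_word K A (a\<^sub>0, m) [a\<^sub>1, \<dots>, a\<^sub>n]\<close> is \<open>(a\<^sub>0 + m) da\<^sub>1 \<dots> da\<^sub>n\<close>.\<close>

abbreviation omega_space where
  "omega_space K A \<equiv> word_space K (omega_head K A) A UNIV"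

abbreviation omega_word where
  "omega_word K A \<equiv> word K (omega_head K A) A UNIV"

text \<open>The product of \<open>p dp\<^sub>1 \<dots> dp\<^sub>i\<close> and \<open>(q\<^sub>0 + v) dq\<^sub>1 \<dots> dq\<^sub>j\<close>, where \<open>p\<close> is in the unitization\<close>

definition omega_mult_words where
  "omega_mult_words K A = (\<lambda>(p, ps) ((q0, v), qs).
     let W = omega_space K A; w = omega_word K A; i = length ps in
     if ps = [] then w (p \<otimes>\<^bsub>unitization K A\<^esub> (q0, v)) qs
     else w p (butlast ps @ (last ps \<otimes>\<^bsub>A\<^esub> q0) # qs)
       \<oplus>\<^bsub>W\<^esub> (\<Oplus>\<^bsub>W\<^esub>l\<in>{1..i - 1}. alt_sign W (i - l) (w p (contract A (l - 1) ps @ q0 # qs)))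
       \<oplus>\<^bsub>W\<^esub> alt_sign W i (w (p \<otimes>\<^bsub>unitization K A\<^esub> (hd ps, \<zero>\<^bsub>K\<^esub>)) (tl ps @ q0 # qs))
       \<oplus>\<^bsub>W\<^esub> v \<odot>\<^bsub>W\<^esub> w p (ps @ qs))"

definition omega ::
  "('k, _) ring_scheme \<Rightarrow> ('k, 'a, _) module_scheme \<Rightarrow>
   ('k, (('a \<times> 'k) \<times> 'a list \<Rightarrow> 'k) set) dga" where
  "omega K A = (let W = omega_space K A in
     \<lparr>carrier = carrier W,
      mult = (\<lambda>x y. lift K W (\<lambda>p. lift K W (\<lambda>q. omega_mult_words K A p q) y) x),
      one = undefined,
      zero = zero W,
      add = add W,
      smult = smult W,
      dg_part = (\<lambda>n. lin_span K W {omega_word K A p ps | p ps. (p, ps) \<in> words (omega_head K A) A {n}}),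
      dg_diff = lift K W (\<lambda>((a0, m), as). omega_word K A (\<zero>\<^bsub>A\<^esub>, \<one>\<^bsub>K\<^esub>) (a0 # as))\<rparr>)"

text \<open>
  Iterated entwining: for a multilinear \<open>F\<close> with values in \<open>P\<close>, the sum
  \<open>F [a\<^sub>1\<^sub>\<psi>, \<dots>, a\<^sub>m\<^sub>\<psi>] c\<^sup>\<psi>\<^sup>\<dots>\<^sup>\<psi>\<close> obtained by moving \<open>c\<close> past \<open>a\<^sub>1\<close>, then \<open>a\<^sub>2\<close>, and so on up to \<open>a\<^sub>m\<close>.
\<close>

primrec psi_iter where
  "psi_iter K A C \<psi> P F c [] = F [] c"
| "psi_iter K A C \<psi> P F c (a # as) =
     lift K P (\<lambda>(a', c'). psi_iter K A C \<psi> P (\<lambda>bs. F (a' # bs)) c' as) (\<psi> (tens K C A c a))"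

text \<open>
  In the second summand the scalar \<open>m\<close> is kept inside the word, so that for \<open>n = 0\<close>, where
  \<open>m = 0\<close>, this summand vanishes.
\<close>

definition omega_psi where
  "omega_psi K A C \<psi> =
    (let P = tensor K (omega K A) C in
     lift K P (\<lambda>(c, x). lift K P (\<lambda>((a0, m), as).
       psi_iter K A C \<psi> P
         (\<lambda>bs c'. tens K (omega K A) C (omega_word K A (hd bs, \<zero>\<^bsub>K\<^esub>) (tl bs)) c') c (a0 # as)
       \<oplus>\<^bsub>P\<^esub> psi_iter K A C \<psi> P
         (\<lambda>bs c'. tens K (omega K A) C (omega_word K A (\<zero>\<^bsub>A\<^esub>, m) bs) c') c as) x))"

end

theory Submission
  imports Defs
begin

text \<open>
  Write \<open>\<Omega>\<close> for the universal dg-algebra of \<open>A\<close>. The implications form a circle.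

  A cycle gives a cyclic cocycle by a direct computation (\<open>cycle_character_cocycle\<close>). For a form
  \<open>\<omega> = \<rho>(a\<^sub>1) d\<rho>(a\<^sub>2) \<dots> d\<rho>(a\<^sub>n)\<close> the trace property moves \<open>\<rho>(a)\<close> in \<open>T(c \<otimes> \<rho>(a) d\<omega>)\<close> to the right end, and
  closedness allows integration by parts; this is cyclicity. The sum in the coboundary telescopes
  by \<open>x da b = x d(ab) - x a db\<close> (\<open>form_telescope\<close>), and what remains of it is cancelled by the entwined
  summand.

  Conversely, a cochain \<open>g\<close> has only one candidate for its trace on \<open>C \<otimes> \<Omega>\<^sup>n\<close>: the value on
  \<open>c \<otimes> a\<^sub>0 da\<^sub>1 \<dots> da\<^sub>n\<close> is prescribed, and closedness requires the value zero on the exact words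
  \<open>da\<^sub>1 \<dots> da\<^sub>n\<close>. This functional is closed for every \<open>g\<close>. If \<open>g\<close> is a cyclic cocycle, then the trace
  property holds for a left factor from \<open>A\<close> (\<open>tr_rho\<close>), by the same telescoping sum on words
  \<open>a\<^sub>0 da\<^sub>1 \<dots> da\<^sub>n\<close> and by cyclicity on exact words. The general case follows by induction
  (\<open>tr_graded\<close>), because every form is obtained from elements of \<open>A\<close> by left multiplications with
  elements of \<open>A\<close>, by \<open>d\<close> and by linear combinations (\<open>omega_graded_induct\<close>).

  Finally, a closed graded trace on \<open>\<Omega>\<close> makes \<open>\<Omega>\<close> itself a cycle over \<open>A\<close>. This requires that \<open>\<Omega>\<close> is a
  dg-algebra and that the iterated entwining makes it a dg-entwining structure. For the former, the
  product formula is replaced by operators: a word \<open>p dp\<^sub>1 \<dots> dp\<^sub>i\<close> multiplies from the left by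
  \<open>\<lambda>\<^sub>p\<close> and \<open>\<delta>\<^sub>a = d \<lambda>\<^sub>a - \<lambda>\<^sub>a d\<close> for \<open>a = p\<^sub>1, \<dots>, p\<^sub>i\<close> (\<open>omega_mult_words_eq\<close>). The Leibniz rule and the
  associativity are then consequences of \<open>d d = 0\<close> and of the associativity of \<open>A\<close>. For the latter, the
  entwining is compatible with left multiplication by \<open>A\<close> (\<open>omega_psi_left\<close>) and with \<open>d\<close>
  (\<open>omega_psi_diff\<close>), and the axioms follow by the same induction.

  All computations with tensors are done with Sweedler sums \<open>sw P X f\<close>, that is, with the linear
  extension of \<open>f\<close> evaluated at a tensor \<open>X\<close>.
\<close>

section \<open>Linear maps\<close>

context cring
begin

abbreviation lin where "lin \<equiv> linear_map R"

lemma mod_closed [simp, intro]: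
  assumes "module R V"
  shows "\<zero>\<^bsub>V\<^esub> \<in> carrier V"
    and "\<lbrakk>x \<in> carrier V; y \<in> carrier V\<rbrakk> \<Longrightarrow> x \<oplus>\<^bsub>V\<^esub> y \<in> carrier V"
    and "x \<in> carrier V \<Longrightarrow> \<ominus>\<^bsub>V\<^esub> x \<in> carrier V"
    and "\<lbrakk>x \<in> carrier V; y \<in> carrier V\<rbrakk> \<Longrightarrow> x \<ominus>\<^bsub>V\<^esub> y \<in> carrier V"
    and "\<lbrakk>r \<in> carrier R; x \<in> carrier V\<rbrakk> \<Longrightarrow> r \<odot>\<^bsub>V\<^esub> x \<in> carrier V"
    and "x \<in> carrier V \<Longrightarrow> alt_sign V i x \<in> carrier V"
proof -
  interpret V: module R V by fact
  show "\<zero>\<^bsub>V\<^esub> \<in> carrier V"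
    and "\<lbrakk>x \<in> carrier V; y \<in> carrier V\<rbrakk> \<Longrightarrow> x \<oplus>\<^bsub>V\<^esub> y \<in> carrier V"
    and "x \<in> carrier V \<Longrightarrow> \<ominus>\<^bsub>V\<^esub> x \<in> carrier V"
    and "\<lbrakk>x \<in> carrier V; y \<in> carrier V\<rbrakk> \<Longrightarrow> x \<ominus>\<^bsub>V\<^esub> y \<in> carrier V"
    and "\<lbrakk>r \<in> carrier R; x \<in> carrier V\<rbrakk> \<Longrightarrow> r \<odot>\<^bsub>V\<^esub> x \<in> carrier V"
    and "x \<in> carrier V \<Longrightarrow> alt_sign V i x \<in> carrier V"
    by (simp_all add: alt_sign_def)
qed

lemma mod_simps [simp]:
  assumes "module R V"
  shows "x \<in> carrier V \<Longrightarrow> \<zero>\<^bsub>V\<^esub> \<oplus>\<^bsub>V\<^esub> x = x"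
    and "x \<in> carrier V \<Longrightarrow> x \<oplus>\<^bsub>V\<^esub> \<zero>\<^bsub>V\<^esub> = x"
    and "x \<in> carrier V \<Longrightarrow> \<one> \<odot>\<^bsub>V\<^esub> x = x"
    and "x \<in> carrier V \<Longrightarrow> \<zero> \<odot>\<^bsub>V\<^esub> x = \<zero>\<^bsub>V\<^esub>"
    and "r \<in> carrier R \<Longrightarrow> r \<odot>\<^bsub>V\<^esub> \<zero>\<^bsub>V\<^esub> = \<zero>\<^bsub>V\<^esub>"
    and "\<ominus>\<^bsub>V\<^esub> \<zero>\<^bsub>V\<^esub> = \<zero>\<^bsub>V\<^esub>"
    and "x \<in> carrier V \<Longrightarrow> \<ominus>\<^bsub>V\<^esub> (\<ominus>\<^bsub>V\<^esub> x) = x"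
    and "alt_sign V i \<zero>\<^bsub>V\<^esub> = \<zero>\<^bsub>V\<^esub>"
    and "x \<in> carrier V \<Longrightarrow> x \<ominus>\<^bsub>V\<^esub> x = \<zero>\<^bsub>V\<^esub>"
proof -
  interpret V: module R V by fact
  show "x \<in> carrier V \<Longrightarrow> \<zero>\<^bsub>V\<^esub> \<oplus>\<^bsub>V\<^esub> x = x"
    and "x \<in> carrier V \<Longrightarrow> x \<oplus>\<^bsub>V\<^esub> \<zero>\<^bsub>V\<^esub> = x"
    and "x \<in> carrier V \<Longrightarrow> \<one> \<odot>\<^bsub>V\<^esub> x = x"
    and "x \<in> carrier V \<Longrightarrow> \<zero> \<odot>\<^bsub>V\<^esub> x = \<zero>\<^bsub>V\<^esub>"
    and "r \<in> carrier R \<Longrightarrow> r \<odot>\<^bsub>V\<^esub> \<zero>\<^bsub>V\<^esub> = \<zero>\<^bsub>V\<^esub>"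
    and "\<ominus>\<^bsub>V\<^esub> \<zero>\<^bsub>V\<^esub> = \<zero>\<^bsub>V\<^esub>"
    and "x \<in> carrier V \<Longrightarrow> \<ominus>\<^bsub>V\<^esub> (\<ominus>\<^bsub>V\<^esub> x) = x"
    and "alt_sign V i \<zero>\<^bsub>V\<^esub> = \<zero>\<^bsub>V\<^esub>"
    and "x \<in> carrier V \<Longrightarrow> x \<ominus>\<^bsub>V\<^esub> x = \<zero>\<^bsub>V\<^esub>"
    by (simp_all add: alt_sign_def V.r_neg V.minus_eq)
qed

lemma mod_minus_zeroD:
  assumes "module R V" "y \<in> carrier V" "x \<in> carrier V" "x \<ominus>\<^bsub>V\<^esub> y = \<zero>\<^bsub>V\<^esub>"
  shows "x = y"
proof -
  interpret V: module R V by fact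
  have "x = (x \<ominus>\<^bsub>V\<^esub> y) \<oplus>\<^bsub>V\<^esub> y"
    using assms(2,3) by (simp add: a_minus_def V.a_assoc V.l_neg)
  then show ?thesis using assms(2,4) by simp
qed

lemma mod_finsum_closed [simp, intro]:
  assumes "module R V" and "\<And>i. i \<in> I \<Longrightarrow> f i \<in> carrier V"
  shows "(\<Oplus>\<^bsub>V\<^esub>i\<in>I. f i) \<in> carrier V"
proof -
  interpret V: module R V by fact
  show ?thesis using assms(2) by (intro V.finsum_closed) auto
qed

lemma module_scalars [simp]: "module R (scalars R)"
proof (rule moduleI)
  show "abelian_group (scalars R)"
    by (rule abelian_groupI) (auto simp: scalars_def a_ac intro: bexI[where x = "\<ominus> x" for x] l_neg)
qed (auto simp: scalars_def is_cring m_assoc l_distr r_distr)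

lemma scalars_simps [simp]:
  "carrier (scalars R) = carrier R" "add (scalars R) = add R" "zero (scalars R) = zero R"
  "smult (scalars R) = mult R"
  by (simp_all add: scalars_def)

text \<open>
  Finite sums, negatives and signs depend only on the carrier, the addition and the zero, so they agree
  for records that differ in the other fields; this moves statements between \<open>K\<close> and \<open>scalars K\<close>.
\<close>

lemma same_add_monoid:
  assumes "carrier V = carrier W" "add V = add W" "zero V = zero W"
  shows "finsum V = finsum W" "a_inv V = a_inv W" "a_minus V = a_minus W" "alt_sign V = alt_sign W"
proof -
  show *: "finsum V = finsum W" "a_inv V = a_inv W"
    by (simp_all add: finsum_def a_inv_def finprod_def m_inv_def fun_eq_iff assms)
  show "a_minus V = a_minus W" "alt_sign V = alt_sign W"
    by (simp_all add: * assms(2) a_minus_def alt_sign_def fun_eq_iff)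
qed

lemma scalars_group [simp]:
  "finsum (scalars R) = finsum R" "a_inv (scalars R) = a_inv R" "a_minus (scalars R) = a_minus R"
  "alt_sign (scalars R) = alt_sign R"
  by (rule same_add_monoid; simp)+

lemma linI:
  assumes "\<And>x. x \<in> carrier V \<Longrightarrow> f x \<in> carrier W"
    and "\<And>x y. \<lbrakk>x \<in> carrier V; y \<in> carrier V\<rbrakk> \<Longrightarrow> f (x \<oplus>\<^bsub>V\<^esub> y) = f x \<oplus>\<^bsub>W\<^esub> f y"
    and "\<And>r x. \<lbrakk>r \<in> carrier R; x \<in> carrier V\<rbrakk> \<Longrightarrow> f (r \<odot>\<^bsub>V\<^esub> x) = r \<odot>\<^bsub>W\<^esub> f x"
  shows "lin V W f"
  using assms by (simp add: linear_map_def)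

lemma linD:
  assumes "lin V W f"
  shows lin_closed: "x \<in> carrier V \<Longrightarrow> f x \<in> carrier W"
    and lin_add: "\<lbrakk>x \<in> carrier V; y \<in> carrier V\<rbrakk> \<Longrightarrow> f (x \<oplus>\<^bsub>V\<^esub> y) = f x \<oplus>\<^bsub>W\<^esub> f y"
    and lin_smult: "\<lbrakk>r \<in> carrier R; x \<in> carrier V\<rbrakk> \<Longrightarrow> f (r \<odot>\<^bsub>V\<^esub> x) = r \<odot>\<^bsub>W\<^esub> f x"
  using assms by (auto simp add: linear_map_def)

lemma lin_zero:
  assumes "module R V" "module R W" "lin V W f" shows "f \<zero>\<^bsub>V\<^esub> = \<zero>\<^bsub>W\<^esub>"
  using lin_smult[OF assms(3), of \<zero> "\<zero>\<^bsub>V\<^esub>"] assms lin_closed[OF assms(3)] by simp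

lemma mod_neg_eq:
  assumes "module R V" "x \<in> carrier V" shows "\<ominus>\<^bsub>V\<^esub> x = (\<ominus> \<one>) \<odot>\<^bsub>V\<^esub> x"
  using module.smult_l_minus[OF assms(1) one_closed assms(2)] assms by simp

lemma lin_neg:
  assumes "module R V" "module R W" "lin V W f" "x \<in> carrier V"
  shows "f (\<ominus>\<^bsub>V\<^esub> x) = \<ominus>\<^bsub>W\<^esub> f x"
  using assms by (simp add: mod_neg_eq lin_closed lin_smult)

lemma lin_minus:
  assumes "module R V" "module R W" "lin V W f" "x \<in> carrier V" "y \<in> carrier V"
  shows "f (x \<ominus>\<^bsub>V\<^esub> y) = f x \<ominus>\<^bsub>W\<^esub> f y"
  using assms by (simp add: a_minus_def lin_add lin_neg)

lemma lin_alt_sign: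
  assumes "module R V" "module R W" "lin V W f" "x \<in> carrier V"
  shows "f (alt_sign V i x) = alt_sign W i (f x)"
  using assms by (simp add: alt_sign_def lin_neg)

text \<open>
  For a map that is linear only on a subspace \<open>N\<close>, as a graded trace is, the partial sums have to be
  kept in \<open>N\<close>; this is why membership is part of the conclusion.
\<close>

lemma lin_finsum_sub:
  assumes V: "module R V" and W: "module R W" and N: "submodule N R V"
    and f: "lin (V\<lparr>carrier := N\<rparr>) W f" and h: "\<And>i. i \<in> I \<Longrightarrow> h i \<in> N" and fin: "finite I"
  shows "(\<Oplus>\<^bsub>V\<^esub>i\<in>I. h i) \<in> N \<and> f (\<Oplus>\<^bsub>V\<^esub>i\<in>I. h i) = (\<Oplus>\<^bsub>W\<^esub>i\<in>I. f (h i))"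
  using fin h
proof (induction I rule: finite_induct)
  case empty
  interpret V: module R V by fact
  interpret W: module R W by fact
  have 0: "\<zero>\<^bsub>V\<^esub> \<in> N" using V.submoduleE[OF N] by (metis V.r_neg ex_in_conv subsetD)
  moreover have "f \<zero>\<^bsub>V\<^esub> = \<zero>\<^bsub>W\<^esub>"
    using lin_smult[OF f, of \<zero> "\<zero>\<^bsub>V\<^esub>"] lin_closed[OF f, of "\<zero>\<^bsub>V\<^esub>"] 0 V.submoduleE[OF N] by auto
  ultimately show ?case by simp
next
  case (insert i I)
  interpret V: module R V by fact
  interpret W: module R W by fact
  have sub: "\<And>x. x \<in> N \<Longrightarrow> x \<in> carrier V" using V.submoduleE[OF N] by auto
  have "(\<Oplus>\<^bsub>V\<^esub>i\<in>insert i I. h i) = h i \<oplus>\<^bsub>V\<^esub> (\<Oplus>\<^bsub>V\<^esub>i\<in>I. h i)"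
    using insert by (intro V.finsum_insert) (auto intro: sub)
  moreover have "(\<Oplus>\<^bsub>W\<^esub>i\<in>insert i I. f (h i)) = f (h i) \<oplus>\<^bsub>W\<^esub> (\<Oplus>\<^bsub>W\<^esub>i\<in>I. f (h i))"
    using insert lin_closed[OF f] by (intro W.finsum_insert) auto
  ultimately show ?case using insert V.submoduleE[OF N] lin_add[OF f] by auto
qed

lemma lin_finsum:
  assumes "module R V" "module R W" "lin V W f" "\<And>i. i \<in> I \<Longrightarrow> h i \<in> carrier V" "finite I"
  shows "f (\<Oplus>\<^bsub>V\<^esub>i\<in>I. h i) = (\<Oplus>\<^bsub>W\<^esub>i\<in>I. f (h i))"
  using lin_finsum_sub[OF assms(1,2) module.carrier_is_submodule[OF assms(1)], of f I h] assms(3-5)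
  by simp

lemma lin_cong:
  assumes "lin V W f" "\<And>x. x \<in> carrier V \<Longrightarrow> f x = g x" "module R V"
  shows "lin V W g"
  using assms by (auto simp: linear_map_def Pi_def)

lemma lin_ident: "lin V V (\<lambda>x. x)" and lin_id: "lin V V id"
  by (auto simp: linear_map_def)

lemma lin_comp: "lin V W g \<Longrightarrow> lin U V f \<Longrightarrow> lin U W (\<lambda>x. g (f x))"
  by (auto simp: linear_map_def Pi_def)

lemma lin_zero_map: "module R W \<Longrightarrow> lin V W (\<lambda>_. \<zero>\<^bsub>W\<^esub>)"
  by (auto simp: linear_map_def)

lemma lin_add_map:
  assumes "module R W" "lin V W f" "lin V W g" shows "lin V W (\<lambda>x. f x \<oplus>\<^bsub>W\<^esub> g x)"
proof -
  interpret W: module R W by fact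
  show ?thesis
    by (rule linI) (simp_all add: lin_closed[OF assms(2)] lin_closed[OF assms(3)] lin_add[OF assms(2)]
      lin_add[OF assms(3)] lin_smult[OF assms(2)] lin_smult[OF assms(3)] W.smult_r_distr W.a_ac)
qed

lemma lin_smult_map:
  assumes "module R W" "r \<in> carrier R" "lin V W f" shows "lin V W (\<lambda>x. r \<odot>\<^bsub>W\<^esub> f x)"
proof -
  interpret W: module R W by fact
  show ?thesis using assms(2)
    by (intro linI) (simp_all add: lin_closed[OF assms(3)] lin_add[OF assms(3)]
      lin_smult[OF assms(3)] W.smult_r_distr flip: W.smult_assoc1, simp add: m_comm)
qed

lemma lin_neg_map:
  assumes "module R W" "lin V W f" shows "lin V W (\<lambda>x. \<ominus>\<^bsub>W\<^esub> f x)"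
proof -
  interpret W: module R W by fact
  show ?thesis
    by (rule linI) (simp_all add: lin_closed[OF assms(2)] lin_add[OF assms(2)]
      lin_smult[OF assms(2)] W.minus_add W.smult_r_minus)
qed

lemma lin_minus_map:
  assumes "module R W" "lin V W f" "lin V W g" shows "lin V W (\<lambda>x. f x \<ominus>\<^bsub>W\<^esub> g x)"
  unfolding a_minus_def using assms by (intro lin_add_map lin_neg_map)

lemma lin_alt_map:
  assumes "module R W" "lin V W f" shows "lin V W (\<lambda>x. alt_sign W i (f x))"
  using assms lin_neg_map[OF assms] by (cases "even i") (simp_all add: alt_sign_def)

lemma lin_scale_map:
  assumes "module R W" "lin V (scalars R) f" "w \<in> carrier W" shows "lin V W (\<lambda>x. f x \<odot>\<^bsub>W\<^esub> w)"
proof -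
  interpret W: module R W by fact
  show ?thesis using assms(3) lin_closed[OF assms(2)]
    by (intro linI) (simp_all add: lin_add[OF assms(2)] lin_smult[OF assms(2)]
      W.smult_l_distr W.smult_assoc1)
qed

lemma lin_finsum_map:
  assumes W: "module R W" and V: "module R V" and "finite I" "\<And>i. i \<in> I \<Longrightarrow> lin V W (\<lambda>x. f x i)"
  shows "lin V W (\<lambda>x. \<Oplus>\<^bsub>W\<^esub>i\<in>I. f x i)"
  using assms(3,4)
proof (induction I rule: finite_induct)
  case empty
  interpret W: module R W by fact
  show ?case by (simp add: lin_zero_map W)
next
  case (insert i I)
  interpret W: module R W by fact
  show ?case
    by (rule lin_cong[OF lin_add_map[OF W insert.prems[of i] insert.IH] _ V])
      (use insert in \<open>auto intro!: W.finsum_insert[symmetric] dest: lin_closed\<close>)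
qed

lemma lin_kernel_submodule:
  assumes "module R V" "module R W" "lin V W f"
  shows "submodule {x \<in> carrier V. f x = \<zero>\<^bsub>W\<^esub>} R V"
  using assms by (intro module.submoduleI) (auto simp: lin_add lin_smult lin_neg lin_zero)

lemma lin_eq_submodule:
  assumes "module R V" "module R W" "lin V W f" "lin V W g"
  shows "submodule {x \<in> carrier V. f x = g x} R V"
  using assms by (intro module.submoduleI) (auto simp: lin_add lin_smult lin_neg lin_zero)

lemma submodule_closed:
  assumes "module R V" "submodule N R V"
  shows "\<zero>\<^bsub>V\<^esub> \<in> N" "x \<in> N \<Longrightarrow> x \<in> carrier V" "x \<in> N \<Longrightarrow> y \<in> N \<Longrightarrow> x \<oplus>\<^bsub>V\<^esub> y \<in> N"
    "x \<in> N \<Longrightarrow> \<ominus>\<^bsub>V\<^esub> x \<in> N" "x \<in> N \<Longrightarrow> y \<in> N \<Longrightarrow> x \<ominus>\<^bsub>V\<^esub> y \<in> N"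
    "r \<in> carrier R \<Longrightarrow> x \<in> N \<Longrightarrow> r \<odot>\<^bsub>V\<^esub> x \<in> N" "x \<in> N \<Longrightarrow> alt_sign V i x \<in> N"
proof -
  interpret V: module R V by fact
  show "\<zero>\<^bsub>V\<^esub> \<in> N"
    using subgroup.one_closed[OF submodule.axioms(1)[OF assms(2)]] by simp
  show "x \<in> N \<Longrightarrow> x \<in> carrier V" "x \<in> N \<Longrightarrow> y \<in> N \<Longrightarrow> x \<oplus>\<^bsub>V\<^esub> y \<in> N"
    "x \<in> N \<Longrightarrow> \<ominus>\<^bsub>V\<^esub> x \<in> N" "x \<in> N \<Longrightarrow> y \<in> N \<Longrightarrow> x \<ominus>\<^bsub>V\<^esub> y \<in> N"
    "r \<in> carrier R \<Longrightarrow> x \<in> N \<Longrightarrow> r \<odot>\<^bsub>V\<^esub> x \<in> N" "x \<in> N \<Longrightarrow> alt_sign V i x \<in> N"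
    using V.submoduleE[OF assms(2)] by (auto simp: a_minus_def alt_sign_def)
qed

lemma lin_preimage_submodule:
  assumes "module R V" "module R W" "lin V W f" "submodule N R W"
  shows "submodule {x \<in> carrier V. f x \<in> N} R V"
  using assms submodule_closed[OF assms(2,4)]
  by (intro module.submoduleI) (auto simp: lin_add lin_smult lin_neg lin_zero)

subsection \<open>Linear span\<close>

lemma lin_span_submodule:
  assumes "module R V" "S \<subseteq> carrier V"
  shows "submodule (lin_span R V S) R V"
proof -
  interpret V: module R V by fact
  have N: "submodule (carrier V) R V" by (rule V.carrier_is_submodule)
  show ?thesis
  proof (rule V.submoduleI)
    show "lin_span R V S \<subseteq> carrier V" using N assms(2) by (auto simp: lin_span_def)
    show "\<zero>\<^bsub>V\<^esub> \<in> lin_span R V S"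
      unfolding lin_span_def using submodule_closed(1)[OF assms(1)] by blast
    show "\<And>a. a \<in> lin_span R V S \<Longrightarrow> \<ominus>\<^bsub>V\<^esub> a \<in> lin_span R V S"
      unfolding lin_span_def using submodule_closed(4)[OF assms(1)] by blast
    show "\<And>a b. a \<in> lin_span R V S \<Longrightarrow> b \<in> lin_span R V S \<Longrightarrow> a \<oplus>\<^bsub>V\<^esub> b \<in> lin_span R V S"
      unfolding lin_span_def using submodule_closed(3)[OF assms(1)] by blast
    show "\<And>r x. r \<in> carrier R \<Longrightarrow> x \<in> lin_span R V S \<Longrightarrow> r \<odot>\<^bsub>V\<^esub> x \<in> lin_span R V S"
      unfolding lin_span_def using submodule_closed(6)[OF assms(1)] by blast
  qed
qed

lemma lin_span_incl: "x \<in> S \<Longrightarrow> x \<in> lin_span R V S"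
  by (auto simp: lin_span_def)

lemma lin_span_least: "submodule N R V \<Longrightarrow> S \<subseteq> N \<Longrightarrow> x \<in> lin_span R V S \<Longrightarrow> x \<in> N"
  by (auto simp: lin_span_def)

end

section \<open>Spaces given by generators and relations\<close>

context cring
begin

subsection \<open>Sums\<close>

lemma mod_finsum_swap:
  assumes V: "module R V" and fin: "finite I" "finite J"
    and f: "\<And>i j. i \<in> I \<Longrightarrow> j \<in> J \<Longrightarrow> f i j \<in> carrier V"
  shows "(\<Oplus>\<^bsub>V\<^esub>i\<in>I. \<Oplus>\<^bsub>V\<^esub>j\<in>J. f i j) = (\<Oplus>\<^bsub>V\<^esub>j\<in>J. \<Oplus>\<^bsub>V\<^esub>i\<in>I. f i j)"
  using fin(1) f
proof (induction I rule: finite_induct)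
  case empty
  interpret V: module R V by fact
  show ?case by (simp add: V.finsum_zero)
next
  case (insert i I)
  interpret V: module R V by fact
  have "(\<Oplus>\<^bsub>V\<^esub>j\<in>J. \<Oplus>\<^bsub>V\<^esub>i\<in>insert i I. f i j) = (\<Oplus>\<^bsub>V\<^esub>j\<in>J. f i j \<oplus>\<^bsub>V\<^esub> (\<Oplus>\<^bsub>V\<^esub>i\<in>I. f i j))"
    using insert by (intro V.finsum_cong' V.finsum_insert) (auto intro!: V mod_finsum_closed)
  also have "\<dots> = (\<Oplus>\<^bsub>V\<^esub>j\<in>J. f i j) \<oplus>\<^bsub>V\<^esub> (\<Oplus>\<^bsub>V\<^esub>j\<in>J. \<Oplus>\<^bsub>V\<^esub>i\<in>I. f i j)"
    using insert by (intro V.finsum_addf) (auto intro!: V mod_finsum_closed)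
  finally show ?case
    using insert by (subst V.finsum_insert) (auto intro!: V mod_finsum_closed)
qed

subsection \<open>Free spaces\<close>

definition lin_ext where
  "lin_ext P f p = (\<Oplus>\<^bsub>P\<^esub>x\<in>{x. p x \<noteq> \<zero>}. p x \<odot>\<^bsub>P\<^esub> f x)"

lemma free_simps [simp]:
  "add (free_space R S) = (\<lambda>p q x. p x \<oplus> q x)"
  "zero (free_space R S) = (\<lambda>_. \<zero>)"
  "smult (free_space R S) = (\<lambda>r p x. r \<otimes> p x)"
  by (simp_all add: free_space_def)

lemma free_carrier:
  "p \<in> carrier (free_space R S) \<longleftrightarrow> (\<forall>x. p x \<in> carrier R) \<and> finite {x. p x \<noteq> \<zero>} \<and> {x. p x \<noteq> \<zero>} \<subseteq> S"
  by (auto simp: free_space_def)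

lemma free_module [simp]: "module R (free_space R S)"
proof (rule moduleI)
  show "cring R" by (rule is_cring)
  show "abelian_group (free_space R S)"
  proof (rule abelian_groupI)
    fix p q assume pq: "p \<in> carrier (free_space R S)" "q \<in> carrier (free_space R S)"
    have "{x. p x \<oplus> q x \<noteq> \<zero>} \<subseteq> {x. p x \<noteq> \<zero>} \<union> {x. q x \<noteq> \<zero>}" by auto
    then show "p \<oplus>\<^bsub>free_space R S\<^esub> q \<in> carrier (free_space R S)"
      using pq by (auto simp: free_carrier elim!: finite_subset)
  next
    fix p assume p: "p \<in> carrier (free_space R S)"
    have "{x. \<ominus> p x \<noteq> \<zero>} = {x. p x \<noteq> \<zero>}"
      using p by (auto simp: free_carrier)
    then have "(\<lambda>x. \<ominus> p x) \<in> carrier (free_space R S)"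
      using p by (auto simp: free_carrier)
    moreover have "(\<lambda>x. \<ominus> p x) \<oplus>\<^bsub>free_space R S\<^esub> p = \<zero>\<^bsub>free_space R S\<^esub>"
      using p by (auto simp: free_carrier fun_eq_iff l_neg)
    ultimately show "\<exists>q\<in>carrier (free_space R S). q \<oplus>\<^bsub>free_space R S\<^esub> p = \<zero>\<^bsub>free_space R S\<^esub>"
      by blast
  qed (auto simp: free_carrier fun_eq_iff a_ac image_subset_iff)
next
  fix r p assume rp: "r \<in> carrier R" "p \<in> carrier (free_space R S)"
  have "{x. r \<otimes> p x \<noteq> \<zero>} \<subseteq> {x. p x \<noteq> \<zero>}" using rp by auto
  then show "r \<odot>\<^bsub>free_space R S\<^esub> p \<in> carrier (free_space R S)"
    using rp by (auto simp: free_carrier elim!: finite_subset)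
qed (auto simp: free_carrier fun_eq_iff image_subset_iff l_distr r_distr m_assoc)

lemma basis_closed [simp, intro]: "s \<in> S \<Longrightarrow> basis_elt R s \<in> carrier (free_space R S)"
  by (auto simp: free_carrier basis_elt_def)

text \<open>This brings the combinations of two formal sums to a common index set.\<close>

lemma lin_ext_superset:
  assumes P: "module R P" and p: "p \<in> carrier (free_space R S)" and f: "\<And>s. s \<in> S \<Longrightarrow> f s \<in> carrier P"
    and B: "finite B" "{x. p x \<noteq> \<zero>} \<subseteq> B" "B \<subseteq> S"
  shows "lin_ext P f p = (\<Oplus>\<^bsub>P\<^esub>x\<in>B. p x \<odot>\<^bsub>P\<^esub> f x)"
proof -
  interpret P: module R P by fact
  have "p x \<in> carrier R" for x using p by (auto simp: free_carrier)
  then show ?thesis unfolding lin_ext_def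
    using B f by (intro P.add.finprod_mono_neutral_cong_left) auto
qed

lemma lin_ext_linear:
  assumes P: "module R P" and f: "\<And>s. s \<in> S \<Longrightarrow> f s \<in> carrier P"
  shows "lin (free_space R S) P (lin_ext P f)"
proof (rule linI)
  interpret P: module R P by fact
  fix p assume p: "p \<in> carrier (free_space R S)"
  then have pc: "p x \<in> carrier R" for x by (auto simp: free_carrier)
  show "lin_ext P f p \<in> carrier P"
    unfolding lin_ext_def using p f P by (auto simp: free_carrier intro!: mod_finsum_closed)
  { fix q assume q: "q \<in> carrier (free_space R S)"
    have qc: "q x \<in> carrier R" for x using q by (auto simp: free_carrier)
    let ?B = "{x. p x \<noteq> \<zero>} \<union> {x. q x \<noteq> \<zero>}"
    have B: "finite ?B" "?B \<subseteq> S" using p q by (auto simp: free_carrier)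
    have sub: "{x. p x \<oplus> q x \<noteq> \<zero>} \<subseteq> ?B" by auto
    have pq: "p \<oplus>\<^bsub>free_space R S\<^esub> q \<in> carrier (free_space R S)"
      using p q by (intro mod_closed) auto
    have "lin_ext P f (p \<oplus>\<^bsub>free_space R S\<^esub> q) = (\<Oplus>\<^bsub>P\<^esub>x\<in>?B. (p x \<oplus> q x) \<odot>\<^bsub>P\<^esub> f x)"
      using lin_ext_superset[where f = f, OF P pq f B(1) _ B(2)] sub by simp
    also have "\<dots> = (\<Oplus>\<^bsub>P\<^esub>x\<in>?B. p x \<odot>\<^bsub>P\<^esub> f x \<oplus>\<^bsub>P\<^esub> q x \<odot>\<^bsub>P\<^esub> f x)"
      using B(2) f pc qc by (intro P.finsum_cong' P.smult_l_distr) auto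
    also have "\<dots> = (\<Oplus>\<^bsub>P\<^esub>x\<in>?B. p x \<odot>\<^bsub>P\<^esub> f x) \<oplus>\<^bsub>P\<^esub> (\<Oplus>\<^bsub>P\<^esub>x\<in>?B. q x \<odot>\<^bsub>P\<^esub> f x)"
      using B f pc qc by (intro P.finsum_addf) auto
    also have "\<dots> = lin_ext P f p \<oplus>\<^bsub>P\<^esub> lin_ext P f q"
      using lin_ext_superset[where f = f, OF P p f B(1) _ B(2)] lin_ext_superset[where f = f, OF P q f B(1) _ B(2)] by auto
    finally show "lin_ext P f (p \<oplus>\<^bsub>free_space R S\<^esub> q) = lin_ext P f p \<oplus>\<^bsub>P\<^esub> lin_ext P f q" . }
  { fix r assume r: "r \<in> carrier R"
    let ?B = "{x. p x \<noteq> \<zero>}"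
    have B: "finite ?B" "?B \<subseteq> S" using p by (auto simp: free_carrier)
    have sub: "{x. r \<otimes> p x \<noteq> \<zero>} \<subseteq> ?B" using r by auto
    have rp: "r \<odot>\<^bsub>free_space R S\<^esub> p \<in> carrier (free_space R S)"
      using p r by (intro mod_closed) auto
    have "lin_ext P f (r \<odot>\<^bsub>free_space R S\<^esub> p) = (\<Oplus>\<^bsub>P\<^esub>x\<in>?B. (r \<otimes> p x) \<odot>\<^bsub>P\<^esub> f x)"
      using lin_ext_superset[where f = f, OF P rp f B(1) _ B(2)] sub by simp
    also have "\<dots> = (\<Oplus>\<^bsub>P\<^esub>x\<in>?B. r \<odot>\<^bsub>P\<^esub> (p x \<odot>\<^bsub>P\<^esub> f x))"
      using B(2) f pc r by (intro P.finsum_cong' P.smult_assoc1) auto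
    also have "\<dots> = r \<odot>\<^bsub>P\<^esub> lin_ext P f p"
      unfolding lin_ext_def using B f pc r by (intro P.finsum_smult_ldistr[symmetric]) auto
    finally show "lin_ext P f (r \<odot>\<^bsub>free_space R S\<^esub> p) = r \<odot>\<^bsub>P\<^esub> lin_ext P f p" . }
qed

lemma lin_ext_basis:
  assumes P: "module R P" and f: "\<And>s. s \<in> S \<Longrightarrow> f s \<in> carrier P" and s: "s \<in> S"
  shows "lin_ext P f (basis_elt R s) = f s"
proof -
  interpret P: module R P by fact
  have "lin_ext P f (basis_elt R s) = (\<Oplus>\<^bsub>P\<^esub>x\<in>{s}. basis_elt R s x \<odot>\<^bsub>P\<^esub> f x)"
    using s by (intro lin_ext_superset[where f = f and S = S, OF P basis_closed[OF s] f])
      (auto simp: basis_elt_def)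
  then show ?thesis using f[OF s] by (simp add: basis_elt_def)
qed

lemma free_expand:
  assumes p: "p \<in> carrier (free_space R S)"
  shows "p = lin_ext (free_space R S) (basis_elt R) p"
proof -
  let ?F = "free_space R S" and ?B = "{x. p x \<noteq> \<zero>}"
  interpret F: module R ?F by simp
  have B: "finite ?B" "?B \<subseteq> S" and pc: "\<And>x. p x \<in> carrier R" using p by (auto simp: free_carrier)
  have ev: "finsum ?F h I y = (\<Oplus>i\<in>I. h i y)" if "finite I" "\<And>i. i \<in> I \<Longrightarrow> h i \<in> carrier ?F" for h I y
    using that
  proof (induction I rule: finite_induct)
    case (insert i I)
    then have "(\<And>j. j \<in> insert i I \<Longrightarrow> h j y \<in> carrier R)" by (fastforce simp: free_carrier)
    then show ?case using insert by (subst F.finsum_insert) (auto simp: finsum_insert)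
  qed simp
  have cl: "p x \<odot>\<^bsub>?F\<^esub> basis_elt R x \<in> carrier ?F" if "x \<in> ?B" for x
    using that B(2) pc by (intro F.smult_closed basis_closed) auto
  show ?thesis
  proof
    fix y
    have "lin_ext ?F (basis_elt R) p y = (\<Oplus>x\<in>?B. p x \<otimes> basis_elt R x y)"
      unfolding lin_ext_def
      by (subst ev[of ?B "\<lambda>x. p x \<odot>\<^bsub>?F\<^esub> basis_elt R x" y, OF B(1) cl]) simp_all
    also have "\<dots> = (\<Oplus>x\<in>?B. if y = x then p x else \<zero>)"
      using pc by (intro finsum_cong') (auto simp: basis_elt_def)
    also have "\<dots> = p y"
    proof (cases "y \<in> ?B")
      case True
      then show ?thesis using finsum_singleton[of y ?B p] B(1) pc by simp
    next
      case False
      then have "(\<Oplus>x\<in>?B. if y = x then p x else \<zero>) = (\<Oplus>x\<in>?B. \<zero>)"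
        by (intro finsum_cong') auto
      then show ?thesis using False by (simp add: finsum_zero)
    qed
    finally show "p y = lin_ext ?F (basis_elt R) p y" by simp
  qed
qed

lemma free_induct [consumes 1, case_names basis zero add smult]:
  assumes "p \<in> carrier (free_space R S)"
    and basis: "\<And>s. s \<in> S \<Longrightarrow> Q (basis_elt R s)"
    and zero: "Q \<zero>\<^bsub>free_space R S\<^esub>"
    and add: "\<And>p q. p \<in> carrier (free_space R S) \<Longrightarrow> q \<in> carrier (free_space R S) \<Longrightarrow> Q p \<Longrightarrow> Q q \<Longrightarrow>
      Q (p \<oplus>\<^bsub>free_space R S\<^esub> q)"
    and smult: "\<And>r p. r \<in> carrier R \<Longrightarrow> p \<in> carrier (free_space R S) \<Longrightarrow> Q p \<Longrightarrow>
      Q (r \<odot>\<^bsub>free_space R S\<^esub> p)"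
  shows "Q p"
proof -
  let ?F = "free_space R S"
  interpret F: module R ?F by simp
  have "Q (\<Oplus>\<^bsub>?F\<^esub>x\<in>I. h x) \<and> (\<Oplus>\<^bsub>?F\<^esub>x\<in>I. h x) \<in> carrier ?F"
    if "finite I" "\<And>x. x \<in> I \<Longrightarrow> h x \<in> carrier ?F \<and> Q (h x)" for h I
    using that
  proof (induction I rule: finite_induct)
    case empty
    show ?case using zero F.zero_closed by (simp only: F.finsum_empty)
  next
    case (insert x I)
    have *: "h \<in> I \<rightarrow> carrier ?F" "h x \<in> carrier ?F" using insert by auto
    show ?case using add[of "h x" "finsum ?F h I"] insert F.a_closed[OF *(2)]
      unfolding F.finsum_insert[OF insert(1,2) *] by blast
  qed
  note sum = this
  have "finite {x. p x \<noteq> \<zero>}" "\<And>x. p x \<noteq> \<zero> \<Longrightarrow> x \<in> S" "\<And>x. p x \<in> carrier R"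
    using assms(1) by (auto simp: free_carrier)
  then have "Q (lin_ext ?F (basis_elt R) p)"
    unfolding lin_ext_def
    by (intro sum[THEN conjunct1]) (auto simp del: free_simps intro!: smult basis basis_closed F.smult_closed)
  then show ?thesis using free_expand[OF assms(1)] by simp
qed


subsection \<open>Quotient spaces\<close>

lemma submodule_abelian_subgroup:
  assumes V: "module R V" and N: "submodule N R V"
  shows "abelian_subgroup N V"
proof -
  interpret V: module R V by (rule V)
  show ?thesis
    by (rule abelian_subgroupI3)
      (use N in \<open>auto simp: additive_subgroup_def submodule_def V.abelian_group_axioms\<close>)
qed

lemma coset_mem:
  assumes V: "module R V" and N: "submodule N R V" and xy: "x \<in> carrier V" "y \<in> carrier V"
  shows "y \<in> N +>\<^bsub>V\<^esub> x \<longleftrightarrow> y \<ominus>\<^bsub>V\<^esub> x \<in> N"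
  using abelian_subgroup.a_rcos_module[OF submodule_abelian_subgroup[OF V N] xy]
  by (simp add: a_minus_def)

lemma coset_eqI:
  assumes V: "module R V" and N: "submodule N R V" and xy: "x \<in> carrier V" "y \<in> carrier V"
    "y \<ominus>\<^bsub>V\<^esub> x \<in> N"
  shows "N +>\<^bsub>V\<^esub> y = N +>\<^bsub>V\<^esub> x"
  using abelian_subgroup.a_repr_independence'[OF submodule_abelian_subgroup[OF V N], of y x]
    coset_mem[OF V N xy(1,2)] xy by simp

lemma quot_carrier: "carrier (quot_space V N) = {N +>\<^bsub>V\<^esub> x | x. x \<in> carrier V}"
  by (auto simp: quot_space_def A_RCOSETS_def' )

lemma quot_add:
  assumes V: "module R V" and N: "submodule N R V" and xy: "x \<in> carrier V" "y \<in> carrier V"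
  shows "(N +>\<^bsub>V\<^esub> x) \<oplus>\<^bsub>quot_space V N\<^esub> (N +>\<^bsub>V\<^esub> y) = N +>\<^bsub>V\<^esub> (x \<oplus>\<^bsub>V\<^esub> y)"
  using abelian_subgroup.a_rcos_sum[OF submodule_abelian_subgroup[OF V N] xy]
  by (simp add: quot_space_def)

lemma quot_zero:
  assumes V: "module R V" and N: "submodule N R V"
  shows "\<zero>\<^bsub>quot_space V N\<^esub> = N +>\<^bsub>V\<^esub> \<zero>\<^bsub>V\<^esub>"
  using abelian_subgroup.a_rcos_const[OF submodule_abelian_subgroup[OF V N] submodule_closed(1)[OF V N]]
  by (simp add: quot_space_def)

lemma quot_smult:
  assumes V: "module R V" and N: "submodule N R V" and r: "r \<in> carrier R" and x: "x \<in> carrier V"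
  shows "r \<odot>\<^bsub>quot_space V N\<^esub> (N +>\<^bsub>V\<^esub> x) = N +>\<^bsub>V\<^esub> (r \<odot>\<^bsub>V\<^esub> x)"
proof -
  interpret V: module R V by (rule V)
  have "N +>\<^bsub>V\<^esub> (r \<odot>\<^bsub>V\<^esub> y) = N +>\<^bsub>V\<^esub> (r \<odot>\<^bsub>V\<^esub> x)" if y: "y \<in> N +>\<^bsub>V\<^esub> x" for y
  proof -
    have yV: "y \<in> carrier V"
      using y V.a_r_coset_subset_G[of N x] submodule_closed(2)[OF V N] x by auto
    then have "y \<ominus>\<^bsub>V\<^esub> x \<in> N" using coset_mem[OF V N x yV] y by simp
    then have "r \<odot>\<^bsub>V\<^esub> (y \<ominus>\<^bsub>V\<^esub> x) \<in> N" using submodule_closed(6)[OF V N r] by simp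
    moreover have "r \<odot>\<^bsub>V\<^esub> (y \<ominus>\<^bsub>V\<^esub> x) = r \<odot>\<^bsub>V\<^esub> y \<ominus>\<^bsub>V\<^esub> r \<odot>\<^bsub>V\<^esub> x"
      using r x yV by (simp add: a_minus_def V.smult_r_distr V.smult_r_minus)
    ultimately show ?thesis using coset_eqI[OF V N] r x yV by simp
  qed
  moreover have "x \<in> N +>\<^bsub>V\<^esub> x"
    using abelian_subgroup.a_rcos_self[OF submodule_abelian_subgroup[OF V N] x] .
  ultimately have "(\<Union>y\<in>N +>\<^bsub>V\<^esub> x. N +>\<^bsub>V\<^esub> (r \<odot>\<^bsub>V\<^esub> y)) = N +>\<^bsub>V\<^esub> (r \<odot>\<^bsub>V\<^esub> x)"
    by (metis (no_types, lifting) SUP_eq_const empty_iff)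
  then show ?thesis by (simp add: quot_space_def)
qed

lemma quot_module:
  assumes V: "module R V" and N: "submodule N R V"
  shows "module R (quot_space V N)"
proof (rule moduleI)
  interpret V: module R V by (rule V)
  let ?Q = "quot_space V N"
  note simps = quot_add[OF V N] quot_smult[OF V N] quot_zero[OF V N]
  have E: "\<exists>x\<in>carrier V. X = N +>\<^bsub>V\<^esub> x" if "X \<in> carrier ?Q" for X
    using that by (auto simp: quot_carrier)
  have C: "N +>\<^bsub>V\<^esub> x \<in> carrier ?Q" if "x \<in> carrier V" for x
    using that by (auto simp: quot_carrier)
  show "cring R" by (rule is_cring)
  show "abelian_group ?Q"
  proof (rule abelian_groupI)
    fix X assume "X \<in> carrier ?Q"
    then obtain x where x: "x \<in> carrier V" "X = N +>\<^bsub>V\<^esub> x" using E by blast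
    then show "\<exists>Y\<in>carrier ?Q. Y \<oplus>\<^bsub>?Q\<^esub> X = \<zero>\<^bsub>?Q\<^esub>"
      by (intro bexI[of _ "N +>\<^bsub>V\<^esub> (\<ominus>\<^bsub>V\<^esub> x)"]) (auto simp: simps V.l_neg C)
  qed (use C in \<open>auto simp: simps V.a_ac dest!: E\<close>)
next
  interpret V: module R V by (rule V)
  note simps = quot_add[OF V N] quot_smult[OF V N]
  fix X assume X: "X \<in> carrier (quot_space V N)"
  then obtain x where x: "x \<in> carrier V" "X = N +>\<^bsub>V\<^esub> x" by (auto simp: quot_carrier)
  show "\<one> \<odot>\<^bsub>quot_space V N\<^esub> X = X" using x by (auto simp: simps)
  fix r assume r: "r \<in> carrier R"
  show "r \<odot>\<^bsub>quot_space V N\<^esub> X \<in> carrier (quot_space V N)"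
    using r x by (auto simp: simps) (auto simp: quot_carrier)
  { fix s assume s: "s \<in> carrier R"
    show "(r \<oplus> s) \<odot>\<^bsub>quot_space V N\<^esub> X = r \<odot>\<^bsub>quot_space V N\<^esub> X \<oplus>\<^bsub>quot_space V N\<^esub> s \<odot>\<^bsub>quot_space V N\<^esub> X"
      and "(r \<otimes> s) \<odot>\<^bsub>quot_space V N\<^esub> X = r \<odot>\<^bsub>quot_space V N\<^esub> (s \<odot>\<^bsub>quot_space V N\<^esub> X)"
      using r s x by (simp_all add: simps V.smult_l_distr V.smult_assoc1) }
  { fix Y assume "Y \<in> carrier (quot_space V N)"
    then obtain y where y: "y \<in> carrier V" "Y = N +>\<^bsub>V\<^esub> y" by (auto simp: quot_carrier)
    show "r \<odot>\<^bsub>quot_space V N\<^esub> (X \<oplus>\<^bsub>quot_space V N\<^esub> Y) =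
        r \<odot>\<^bsub>quot_space V N\<^esub> X \<oplus>\<^bsub>quot_space V N\<^esub> r \<odot>\<^bsub>quot_space V N\<^esub> Y"
      using r x y by (simp add: simps V.smult_r_distr) }
qed

subsection \<open>The universal property\<close>

text \<open>
  The function \<open>lift\<close> evaluates the linear extension \<open>lin_ext\<close> on a representative picked by choice.
\<close>

lemma lift_eq_lin_ext: "lift R P f X = lin_ext P f (SOME p. p \<in> X)"
  by (simp add: lift_def lin_ext_def Let_def)

context
  fixes S :: "'s set" and E :: "('s \<Rightarrow> 'a) set"
  assumes E: "E \<subseteq> carrier (free_space R S)"
begin

lemma relations_submodule: "submodule (lin_span R (free_space R S) E) R (free_space R S)"
  by (rule lin_span_submodule[OF free_module E])

lemma presented_module: "module R (presented R S E)"
  unfolding presented_def by (rule quot_module[OF free_module relations_submodule])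

text \<open>
  Whatever representative of a class is picked by choice, it represents that class.
\<close>

lemma presented_cases:
  assumes "X \<in> carrier (presented R S E)"
  obtains p where "p \<in> carrier (free_space R S)" "(SOME p. p \<in> X) = p"
    "X = lin_span R (free_space R S) E +>\<^bsub>free_space R S\<^esub> p"
proof -
  let ?F = "free_space R S" and ?N = "lin_span R (free_space R S) E"
  interpret F: module R ?F by simp
  obtain q where q: "q \<in> carrier ?F" "X = ?N +>\<^bsub>?F\<^esub> q"
    using assms by (auto simp: presented_def quot_carrier)
  have "q \<in> X"
    using abelian_subgroup.a_rcos_self[OF submodule_abelian_subgroup[OF free_module relations_submodule] q(1)] q(2)
    by simp
  then have m: "(SOME p. p \<in> X) \<in> X" by (rule someI[where P = "\<lambda>p. p \<in> X"])
  have "X \<subseteq> carrier ?F"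
    using F.a_r_coset_subset_G[of ?N q] submodule_closed(2)[OF free_module relations_submodule] q by auto
  with m have p: "(SOME p. p \<in> X) \<in> carrier ?F" by blast
  show ?thesis
  proof
    show "X = ?N +>\<^bsub>?F\<^esub> (SOME p. p \<in> X)"
      using abelian_subgroup.a_repr_independence'[OF submodule_abelian_subgroup[OF free_module relations_submodule],
          of "SOME p. p \<in> X" q] m q by simp
  qed (use p in auto)
qed

lemma gen_class_closed: "s \<in> S \<Longrightarrow> gen_class R S E s \<in> carrier (presented R S E)"
  by (auto simp: gen_class_def presented_def quot_carrier)

lemma presented_induct [consumes 1, case_names gen zero add smult]:
  assumes "X \<in> carrier (presented R S E)"
    and gen: "\<And>s. s \<in> S \<Longrightarrow> Q (gen_class R S E s)"
    and zero: "Q \<zero>\<^bsub>presented R S E\<^esub>"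
    and add: "\<And>X Y. X \<in> carrier (presented R S E) \<Longrightarrow> Y \<in> carrier (presented R S E) \<Longrightarrow>
      Q X \<Longrightarrow> Q Y \<Longrightarrow> Q (X \<oplus>\<^bsub>presented R S E\<^esub> Y)"
    and smult: "\<And>r X. r \<in> carrier R \<Longrightarrow> X \<in> carrier (presented R S E) \<Longrightarrow> Q X \<Longrightarrow>
      Q (r \<odot>\<^bsub>presented R S E\<^esub> X)"
  shows "Q X"
proof -
  let ?F = "free_space R S" and ?N = "lin_span R (free_space R S) E"
  note simps = quot_add[OF free_module relations_submodule] quot_smult[OF free_module relations_submodule]
    quot_zero[OF free_module relations_submodule]
  obtain p where p: "p \<in> carrier ?F" "X = ?N +>\<^bsub>?F\<^esub> p"
    using assms(1) by (rule presented_cases)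
  have C: "?N +>\<^bsub>?F\<^esub> p \<in> carrier (presented R S E)" if "p \<in> carrier ?F" for p
    using that by (auto simp: presented_def quot_carrier)
  from p(1) have "Q (?N +>\<^bsub>?F\<^esub> p)"
  proof (induction p rule: free_induct)
    case (basis s)
    then show ?case using gen by (simp add: gen_class_def)
  next
    case zero
    then show ?case using assms(3) unfolding presented_def simps .
  next
    case (add p q)
    then show ?case using assms(4)[OF C C, of p q] unfolding presented_def simps(1)[OF add(1,2)] by simp
  next
    case (smult r p)
    then show ?case using assms(5)[OF _ C, of r p] unfolding presented_def simps(2)[OF smult(1,2)] by simp
  qed
  then show ?thesis using p(2) by simp
qed

lemma presented_eqI:
  assumes P: "module R P" and f: "lin (presented R S E) P f" and g: "lin (presented R S E) P g"
    and eq: "\<And>s. s \<in> S \<Longrightarrow> f (gen_class R S E s) = g (gen_class R S E s)"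
    and X: "X \<in> carrier (presented R S E)"
  shows "f X = g X"
  using X
  by (induction X rule: presented_induct)
    (simp_all add: eq lin_zero[OF presented_module P f] lin_zero[OF presented_module P g]
      lin_add[OF f] lin_add[OF g] lin_smult[OF f] lin_smult[OF g])

text \<open>
  By its definition, \<open>lift\<close> is a finite combination of values of \<open>f\<close>, with coefficients that depend only
  on the class. Identities between values of \<open>f\<close> therefore carry over to \<open>lift\<close>.
\<close>

lemma lift_closed:
  assumes "module R P" "X \<in> carrier (presented R S E)" "\<And>s. s \<in> S \<Longrightarrow> f s \<in> carrier P"
  shows "lift R P f X \<in> carrier P"
  using assms(2)
  by (rule presented_cases) (simp add: lift_eq_lin_ext lin_closed[OF lin_ext_linear[where f = f, OF assms(1,3)]])

lemma lift_cong:
  assumes P: "module R P" and X: "X \<in> carrier (presented R S E)"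
    and f: "\<And>s. s \<in> S \<Longrightarrow> f s \<in> carrier P" and fg: "\<And>s. s \<in> S \<Longrightarrow> f s = g s"
  shows "lift R P f X = lift R P g X"
proof -
  interpret P: module R P by fact
  obtain p where p: "p \<in> carrier (free_space R S)" "(SOME p. p \<in> X) = p"
    using X by (rule presented_cases)
  then have B: "\<And>x. p x \<noteq> \<zero> \<Longrightarrow> x \<in> S" "\<And>x. p x \<in> carrier R" by (auto simp: free_carrier)
  have "lin_ext P f p = lin_ext P g p"
    unfolding lin_ext_def using B f fg by (intro P.finsum_cong') auto
  then show ?thesis by (simp add: lift_eq_lin_ext p(2))
qed

lemma lift_lin_sub:
  assumes P: "module R P" and Q: "module R Q" and N: "submodule N R P"
    and h: "lin (P\<lparr>carrier := N\<rparr>) Q h" and X: "X \<in> carrier (presented R S E)"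
    and f: "\<And>s. s \<in> S \<Longrightarrow> f s \<in> N"
  shows "lift R P f X \<in> N \<and> h (lift R P f X) = lift R Q (\<lambda>s. h (f s)) X"
proof -
  interpret Q: module R Q by fact
  obtain p where p: "p \<in> carrier (free_space R S)" "(SOME p. p \<in> X) = p"
    using X by (rule presented_cases)
  let ?B = "{x. p x \<noteq> \<zero>}"
  have B: "finite ?B" "\<And>x. p x \<noteq> \<zero> \<Longrightarrow> x \<in> S" "\<And>x. p x \<in> carrier R" using p by (auto simp: free_carrier)
  have "lin_ext P f p \<in> N \<and> h (lin_ext P f p) = (\<Oplus>\<^bsub>Q\<^esub>x\<in>?B. h (p x \<odot>\<^bsub>P\<^esub> f x))"
    unfolding lin_ext_def
    using lin_finsum_sub[OF P Q N h, of ?B "\<lambda>x. p x \<odot>\<^bsub>P\<^esub> f x"] B f submodule_closed(6)[OF P N] by auto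
  moreover have "(\<Oplus>\<^bsub>Q\<^esub>x\<in>?B. h (p x \<odot>\<^bsub>P\<^esub> f x)) = lin_ext Q (\<lambda>s. h (f s)) p"
    unfolding lin_ext_def
    using B f lin_smult[OF h] lin_closed[OF h] by (intro Q.finsum_cong') auto
  ultimately show ?thesis by (simp add: lift_eq_lin_ext p(2))
qed

lemma lift_lin:
  assumes P: "module R P" and Q: "module R Q"
    and h: "lin P Q h" and X: "X \<in> carrier (presented R S E)"
    and f: "\<And>s. s \<in> S \<Longrightarrow> f s \<in> carrier P"
  shows "h (lift R P f X) = lift R Q (\<lambda>s. h (f s)) X"
  using lift_lin_sub[where f = f and h = h, OF P Q module.carrier_is_submodule[OF P] _ X] h f by simp

lemma lift_lin_param:
  assumes P: "module R P" and U: "module R U" and X: "X \<in> carrier (presented R S E)"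
    and f: "\<And>s. s \<in> S \<Longrightarrow> lin U P (\<lambda>u. f u s)"
  shows "lin U P (\<lambda>u. lift R P (f u) X)"
proof -
  obtain p where p: "p \<in> carrier (free_space R S)" "(SOME p. p \<in> X) = p"
    using X by (rule presented_cases)
  show ?thesis unfolding lift_eq_lin_ext p(2) lin_ext_def
    using p(1) by (intro lin_finsum_map[OF P U] lin_smult_map[OF P] f) (auto simp: free_carrier)
qed

lemma lift_add:
  assumes P: "module R P" and X: "X \<in> carrier (presented R S E)"
    and f: "\<And>s. s \<in> S \<Longrightarrow> f s \<in> carrier P" and g: "\<And>s. s \<in> S \<Longrightarrow> g s \<in> carrier P"
  shows "lift R P (\<lambda>s. f s \<oplus>\<^bsub>P\<^esub> g s) X = lift R P f X \<oplus>\<^bsub>P\<^esub> lift R P g X"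
proof -
  interpret P: module R P by fact
  obtain p where p: "p \<in> carrier (free_space R S)" "(SOME p. p \<in> X) = p"
    using X by (rule presented_cases)
  have B: "\<And>x. p x \<noteq> \<zero> \<Longrightarrow> x \<in> S" "\<And>x. p x \<in> carrier R" using p by (auto simp: free_carrier)
  have "lin_ext P (\<lambda>s. f s \<oplus>\<^bsub>P\<^esub> g s) p = (\<Oplus>\<^bsub>P\<^esub>x\<in>{x. p x \<noteq> \<zero>}. p x \<odot>\<^bsub>P\<^esub> f x \<oplus>\<^bsub>P\<^esub> p x \<odot>\<^bsub>P\<^esub> g x)"
    unfolding lin_ext_def using B f g by (intro P.finsum_cong') (auto simp: P.smult_r_distr)
  also have "\<dots> = lin_ext P f p \<oplus>\<^bsub>P\<^esub> lin_ext P g p"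
    unfolding lin_ext_def using B f g by (intro P.finsum_addf) auto
  finally show ?thesis by (simp add: lift_eq_lin_ext p(2))
qed

text \<open>
  Both sides are the same double sum over the chosen representatives of \<open>X\<close> and \<open>Y\<close>.
\<close>

lemma lift_swap:
  assumes P: "module R P" and X: "X \<in> carrier (presented R S E)"
    and E': "E' \<subseteq> carrier (free_space R S')" and Y: "Y \<in> carrier (presented R S' E')"
    and f: "\<And>s t. s \<in> S \<Longrightarrow> t \<in> S' \<Longrightarrow> f s t \<in> carrier P"
  shows "lift R P (\<lambda>s. lift R P (\<lambda>t. f s t) Y) X = lift R P (\<lambda>t. lift R P (\<lambda>s. f s t) X) Y"
proof -
  interpret P: module R P by fact
  obtain p where p: "p \<in> carrier (free_space R S)" "(SOME p. p \<in> X) = p"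
    using X by (rule presented_cases)
  obtain q where q: "q \<in> carrier (free_space R S')" "(SOME p. p \<in> Y) = q"
    using cring.presented_cases[OF is_cring E' Y] by blast
  let ?B = "{x. p x \<noteq> \<zero>}" and ?B' = "{x. q x \<noteq> \<zero>}"
  have B: "finite ?B" "\<And>x. p x \<noteq> \<zero> \<Longrightarrow> x \<in> S" "\<And>x. p x \<in> carrier R" using p by (auto simp: free_carrier)
  have B': "finite ?B'" "\<And>x. q x \<noteq> \<zero> \<Longrightarrow> x \<in> S'" "\<And>x. q x \<in> carrier R" using q by (auto simp: free_carrier)
  have "lin_ext P (\<lambda>s. lin_ext P (f s) q) p =
      (\<Oplus>\<^bsub>P\<^esub>x\<in>?B. \<Oplus>\<^bsub>P\<^esub>y\<in>?B'. p x \<odot>\<^bsub>P\<^esub> (q y \<odot>\<^bsub>P\<^esub> f x y))"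
    unfolding lin_ext_def using B B' f
    by (intro P.finsum_cong' P.finsum_smult_ldistr) (auto intro!: mod_finsum_closed[OF P])
  also have "\<dots> = (\<Oplus>\<^bsub>P\<^esub>y\<in>?B'. \<Oplus>\<^bsub>P\<^esub>x\<in>?B. p x \<odot>\<^bsub>P\<^esub> (q y \<odot>\<^bsub>P\<^esub> f x y))"
    using B B' f by (intro mod_finsum_swap[OF P]) auto
  also have "\<dots> = (\<Oplus>\<^bsub>P\<^esub>y\<in>?B'. \<Oplus>\<^bsub>P\<^esub>x\<in>?B. q y \<odot>\<^bsub>P\<^esub> (p x \<odot>\<^bsub>P\<^esub> f x y))"
    using B B' f
    by (intro P.finsum_cong') (auto intro!: mod_finsum_closed[OF P] simp: m_comm simp flip: P.smult_assoc1)
  also have "\<dots> = lin_ext P (\<lambda>t. lin_ext P (\<lambda>s. f s t) p) q"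
    unfolding lin_ext_def using B B' f
    by (intro P.finsum_cong' P.finsum_smult_ldistr[symmetric]) (auto intro!: mod_finsum_closed[OF P])
  finally show ?thesis by (simp add: lift_eq_lin_ext p(2) q(2))
qed

text \<open>Compatibility with the relations is what makes \<open>lift\<close> linear and gives it its values on generators.\<close>

lemma lift_coset:
  assumes P: "module R P" and f: "\<And>s. s \<in> S \<Longrightarrow> f s \<in> carrier P"
    and resp: "\<And>e. e \<in> E \<Longrightarrow> lin_ext P f e = \<zero>\<^bsub>P\<^esub>" and p: "p \<in> carrier (free_space R S)"
  shows "lift R P f (lin_span R (free_space R S) E +>\<^bsub>free_space R S\<^esub> p) = lin_ext P f p"
proof -
  let ?F = "free_space R S" and ?N = "lin_span R (free_space R S) E"
  interpret F: module R ?F by simp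
  interpret P: module R P by fact
  have l: "lin ?F P (lin_ext P f)" using f by (rule lin_ext_linear[OF P])
  have "?N +>\<^bsub>?F\<^esub> p \<in> carrier (presented R S E)" using p by (auto simp: presented_def quot_carrier)
  then obtain q where q: "q \<in> carrier ?F" "(SOME q. q \<in> ?N +>\<^bsub>?F\<^esub> p) = q" "?N +>\<^bsub>?F\<^esub> p = ?N +>\<^bsub>?F\<^esub> q"
    by (rule presented_cases)
  have "q \<in> ?N +>\<^bsub>?F\<^esub> q"
    using abelian_subgroup.a_rcos_self[OF submodule_abelian_subgroup[OF free_module relations_submodule] q(1)] .
  then have "q \<ominus>\<^bsub>?F\<^esub> p \<in> ?N"
    using coset_mem[OF free_module relations_submodule p q(1)] q(3) by simp
  then have "q \<ominus>\<^bsub>?F\<^esub> p \<in> {x \<in> carrier ?F. lin_ext P f x = \<zero>\<^bsub>P\<^esub>}"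
    by (rule lin_span_least[OF lin_kernel_submodule[OF free_module P l], rotated]) (use E resp in auto)
  then have "lin_ext P f q \<ominus>\<^bsub>P\<^esub> lin_ext P f p = \<zero>\<^bsub>P\<^esub>"
    using lin_minus[OF free_module P l q(1) p] by simp
  then have "lin_ext P f q = lin_ext P f p"
    by (rule mod_minus_zeroD[OF P lin_closed[OF l p] lin_closed[OF l q(1)]])
  then show ?thesis by (simp add: lift_eq_lin_ext q(2))
qed

lemma lift_gen:
  assumes P: "module R P" and f: "\<And>s. s \<in> S \<Longrightarrow> f s \<in> carrier P"
    and resp: "\<And>e. e \<in> E \<Longrightarrow> lin_ext P f e = \<zero>\<^bsub>P\<^esub>" and s: "s \<in> S"
  shows "lift R P f (gen_class R S E s) = f s"
  using lift_coset[where f = f, OF P f resp basis_closed[OF s]] lin_ext_basis[where f = f, OF P f s]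
  by (simp add: gen_class_def)

lemma lift_linear:
  assumes P: "module R P" and f: "\<And>s. s \<in> S \<Longrightarrow> f s \<in> carrier P"
    and resp: "\<And>e. e \<in> E \<Longrightarrow> lin_ext P f e = \<zero>\<^bsub>P\<^esub>"
  shows "lin (presented R S E) P (lift R P f)"
proof (rule linI)
  let ?F = "free_space R S" and ?N = "lin_span R (free_space R S) E"
  note simps = quot_add[OF free_module relations_submodule, folded presented_def]
    quot_smult[OF free_module relations_submodule, folded presented_def]
  note lc = lift_coset[where f = f, OF P f resp]
  have l: "lin ?F P (lin_ext P f)" using f by (rule lin_ext_linear[OF P])
  interpret F: module R ?F by simp
  fix X assume X: "X \<in> carrier (presented R S E)"
  then show "lift R P f X \<in> carrier P" by (rule lift_closed[OF P _ f])
  obtain p where p: "p \<in> carrier ?F" "X = ?N +>\<^bsub>?F\<^esub> p" using X by (rule presented_cases)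
  { fix Y assume "Y \<in> carrier (presented R S E)"
    then obtain q where q: "q \<in> carrier ?F" "Y = ?N +>\<^bsub>?F\<^esub> q" by (rule presented_cases)
    show "lift R P f (X \<oplus>\<^bsub>presented R S E\<^esub> Y) = lift R P f X \<oplus>\<^bsub>P\<^esub> lift R P f Y"
      unfolding p(2) q(2) simps(1)[OF p(1) q(1)]
      using lc p(1) q(1) lin_add[OF l] F.a_closed[OF p(1) q(1)] by simp }
  { fix r assume r: "r \<in> carrier R"
    show "lift R P f (r \<odot>\<^bsub>presented R S E\<^esub> X) = r \<odot>\<^bsub>P\<^esub> lift R P f X"
      unfolding p(2) simps(2)[OF r p(1)]
      using lc p(1) r lin_smult[OF l] F.smult_closed[OF r p(1)] by simp }
qed

end

end

section \<open>Tensor products\<close>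

context cring
begin

definition bilin where
  "bilin V W P f \<longleftrightarrow>
     (\<forall>v\<in>carrier V. lin W P (\<lambda>w. f v w)) \<and> (\<forall>w\<in>carrier W. lin V P (\<lambda>v. f v w))"

lemma bilinI:
  assumes "\<And>v. v \<in> carrier V \<Longrightarrow> lin W P (\<lambda>w. f v w)" "\<And>w. w \<in> carrier W \<Longrightarrow> lin V P (\<lambda>v. f v w)"
  shows "bilin V W P f"
  using assms by (simp add: bilin_def)

lemma bilinD:
  assumes "bilin V W P f"
  shows "v \<in> carrier V \<Longrightarrow> lin W P (\<lambda>w. f v w)" "w \<in> carrier W \<Longrightarrow> lin V P (\<lambda>v. f v w)"
    "v \<in> carrier V \<Longrightarrow> w \<in> carrier W \<Longrightarrow> f v w \<in> carrier P"
  using assms by (auto simp: bilin_def dest: lin_closed)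

lemma tensor_rels_closed:
  assumes "module R V" "module R W"
  shows "tensor_rels R V W \<subseteq> carrier (free_space R (carrier V \<times> carrier W))"
  unfolding tensor_rels_def Let_def using assms
  by (intro subsetI) (elim UnE CollectE exE conjE, simp_all del: free_simps)

lemma tensor_module [simp]: "module R V \<Longrightarrow> module R W \<Longrightarrow> module R (tensor R V W)"
  unfolding tensor_def by (intro presented_module tensor_rels_closed)

lemma tensor_rels_respected:
  assumes "module R V" "module R W" and P: "module R P" and f: "bilin V W P f"
    and e: "e \<in> tensor_rels R V W"
  shows "lin_ext P (\<lambda>(v, w). f v w) e = \<zero>\<^bsub>P\<^esub>"
proof -
  let ?F = "free_space R (carrier V \<times> carrier W)"
  note D = lin_closed lin_add lin_smult
  have fc: "\<And>s. s \<in> carrier V \<times> carrier W \<Longrightarrow> (\<lambda>(v, w). f v w) s \<in> carrier P"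
    using bilinD(3)[OF f] by auto
  note l = lin_ext_linear[where f = "\<lambda>(v, w). f v w", OF P fc]
  note simps = lin_minus[OF free_module P l] D(2,3)[OF l] lin_ext_basis[where f = "\<lambda>(v, w). f v w", OF P fc]
    D(2,3)[OF bilinD(1)[OF f]] D(2,3)[OF bilinD(2)[OF f]] bilinD(3)[OF f]
  show ?thesis
    using e unfolding tensor_rels_def Let_def
    by (elim UnE CollectE exE conjE) (use assms in \<open>simp_all add: simps del: free_simps\<close>)
qed

text \<open>
  Sweedler sums: if \<open>X = \<Sum>\<^sub>i v\<^sub>i \<otimes> w\<^sub>i\<close>, then \<open>sw P X f\<close> is \<open>\<Sum>\<^sub>i f v\<^sub>i w\<^sub>i\<close>. In particular
  \<open>sw P (\<psi> (c \<otimes> a)) (\<lambda>a' c'. t)\<close> is the term \<open>t\<close> in which \<open>a'\<close> and \<open>c'\<close> stand for \<open>a\<^sub>\<psi>\<close> and \<open>c\<^sup>\<psi>\<close>.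
  Evaluation on pure tensors comes from the bilinearity of \<open>f\<close>. The rules that rewrite \<open>f\<close>, apply a
  linear map to the sum or interchange two sums are rules on finite sums over the chosen representative.
\<close>

abbreviation sw where "sw P X f \<equiv> lift R P (\<lambda>(v, w). f v w) X"

lemma tens_closed [simp, intro]:
  assumes "module R V" "module R W" "v \<in> carrier V" "w \<in> carrier W"
  shows "tens R V W v w \<in> carrier (tensor R V W)"
  unfolding tens_def tensor_def
  using gen_class_closed[OF tensor_rels_closed[OF assms(1,2)]] assms by simp

context
  fixes V :: "('a, 'v, 'm) module_scheme" and W :: "('a, 'w, 'n) module_scheme"
  assumes V: "module R V" and W: "module R W"
begin

lemmas rels = tensor_rels_closed[OF V W]

lemma tensor_eqI:
  assumes P: "module R P" and f: "lin (tensor R V W) P f" and g: "lin (tensor R V W) P g"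
    and "\<And>v w. v \<in> carrier V \<Longrightarrow> w \<in> carrier W \<Longrightarrow> f (tens R V W v w) = g (tens R V W v w)"
    and "X \<in> carrier (tensor R V W)"
  shows "f X = g X"
  using presented_eqI[OF rels P f[unfolded tensor_def] g[unfolded tensor_def]] assms(4,5)
  by (auto simp: tens_def tensor_def)

lemma lin_sw:
  assumes "module R P" "bilin V W P f" shows "lin (tensor R V W) P (\<lambda>X. sw P X f)"
  unfolding tensor_def
  using tensor_rels_respected[OF V W assms] bilinD(3)[OF assms(2)]
  by (intro lift_linear[OF rels assms(1)]) auto

lemma sw_tens:
  assumes "module R P" "bilin V W P f" "v \<in> carrier V" "w \<in> carrier W"
  shows "sw P (tens R V W v w) f = f v w"
  unfolding tens_def
  using lift_gen[where f = "\<lambda>(v, w). f v w", OF rels assms(1) _ tensor_rels_respected[OF V W assms(1,2)], of "(v, w)"]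
    bilinD(3)[OF assms(2)] assms(3,4) by auto

lemma sw_closed:
  assumes "module R P" "X \<in> carrier (tensor R V W)"
    and "\<And>v w. v \<in> carrier V \<Longrightarrow> w \<in> carrier W \<Longrightarrow> f v w \<in> carrier P"
  shows "sw P X f \<in> carrier P"
  using lift_closed[OF rels assms(1), of X] assms(2,3) by (auto simp: tensor_def)

lemma sw_cong:
  assumes "module R P" "X \<in> carrier (tensor R V W)"
    and "\<And>v w. v \<in> carrier V \<Longrightarrow> w \<in> carrier W \<Longrightarrow> f v w \<in> carrier P"
    and "\<And>v w. v \<in> carrier V \<Longrightarrow> w \<in> carrier W \<Longrightarrow> f v w = g v w"
  shows "sw P X f = sw P X g"
  using lift_cong[OF rels assms(1), of X "\<lambda>(v, w). f v w"] assms(2-4) by (auto simp: tensor_def)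

lemma sw_lin_sub:
  assumes "module R P" "module R Q" "submodule N R P" "lin (P\<lparr>carrier := N\<rparr>) Q h"
    and "X \<in> carrier (tensor R V W)"
    and "\<And>v w. v \<in> carrier V \<Longrightarrow> w \<in> carrier W \<Longrightarrow> f v w \<in> N"
  shows "sw P X f \<in> N" "h (sw P X f) = sw Q X (\<lambda>v w. h (f v w))"
proof -
  have "(\<lambda>s. h (case s of (v, w) \<Rightarrow> f v w)) = (\<lambda>(v, w). h (f v w))" by auto
  then show "sw P X f \<in> N" "h (sw P X f) = sw Q X (\<lambda>v w. h (f v w))"
    using lift_lin_sub[where f = "\<lambda>(v, w). f v w", OF rels assms(1-4), of X] assms(5,6)
    by (auto simp: tensor_def)
qed

lemma lin_of_sw:
  assumes "module R P" "module R Q" "lin P Q h" "X \<in> carrier (tensor R V W)"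
    and "\<And>v w. v \<in> carrier V \<Longrightarrow> w \<in> carrier W \<Longrightarrow> f v w \<in> carrier P"
  shows "h (sw P X f) = sw Q X (\<lambda>v w. h (f v w))"
  using sw_lin_sub(2)[OF assms(1,2) module.carrier_is_submodule[OF assms(1)] _ assms(4,5)] assms(3)
  by simp

lemma lin_sw_param:
  assumes "module R P" "module R U" "X \<in> carrier (tensor R V W)"
    and "\<And>v w. v \<in> carrier V \<Longrightarrow> w \<in> carrier W \<Longrightarrow> lin U P (\<lambda>u. f u v w)"
  shows "lin U P (\<lambda>u. sw P X (f u))"
  using lift_lin_param[OF rels assms(1,2), of X "\<lambda>u (v, w). f u v w"] assms(3,4)
  by (auto simp: tensor_def)

lemma sw_add:
  assumes "module R P" "X \<in> carrier (tensor R V W)"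
    and "\<And>v w. v \<in> carrier V \<Longrightarrow> w \<in> carrier W \<Longrightarrow> f v w \<in> carrier P"
    and "\<And>v w. v \<in> carrier V \<Longrightarrow> w \<in> carrier W \<Longrightarrow> g v w \<in> carrier P"
  shows "sw P X (\<lambda>v w. f v w \<oplus>\<^bsub>P\<^esub> g v w) = sw P X f \<oplus>\<^bsub>P\<^esub> sw P X g"
proof -
  have "(\<lambda>s. (case s of (v, w) \<Rightarrow> f v w) \<oplus>\<^bsub>P\<^esub> (case s of (v, w) \<Rightarrow> g v w)) =
      (\<lambda>(v, w). f v w \<oplus>\<^bsub>P\<^esub> g v w)" by auto
  then show ?thesis
    using lift_add[OF rels assms(1), of X "\<lambda>(v, w). f v w" "\<lambda>(v, w). g v w"] assms(2-4)
    by (auto simp: tensor_def)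
qed

lemma lin_tens_right: "v \<in> carrier V \<Longrightarrow> lin W (tensor R V W) (\<lambda>w. tens R V W v w)"
  and lin_tens_left: "w \<in> carrier W \<Longrightarrow> lin V (tensor R V W) (\<lambda>v. tens R V W v w)"
proof -
  let ?F = "free_space R (carrier V \<times> carrier W)" and ?N = "lin_span R (free_space R (carrier V \<times> carrier W)) (tensor_rels R V W)"
  note N = relations_submodule[OF rels]
  have add: "tens R V W x y = tens R V W x1 y1 \<oplus>\<^bsub>tensor R V W\<^esub> tens R V W x2 y2"
    if "basis_elt R (x, y) \<ominus>\<^bsub>?F\<^esub> (basis_elt R (x1, y1) \<oplus>\<^bsub>?F\<^esub> basis_elt R (x2, y2)) \<in> tensor_rels R V W"
      "x \<in> carrier V" "x1 \<in> carrier V" "x2 \<in> carrier V" "y \<in> carrier W" "y1 \<in> carrier W" "y2 \<in> carrier W"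
    for x y x1 y1 x2 y2
    using coset_eqI[OF free_module N _ _ lin_span_incl[OF that(1)]] that(2-)
    by (simp add: tens_def gen_class_def tensor_def presented_def quot_add[OF free_module N] del: free_simps)
  have smult: "tens R V W x y = r \<odot>\<^bsub>tensor R V W\<^esub> tens R V W x1 y1"
    if "basis_elt R (x, y) \<ominus>\<^bsub>?F\<^esub> r \<odot>\<^bsub>?F\<^esub> basis_elt R (x1, y1) \<in> tensor_rels R V W"
      "r \<in> carrier R" "x \<in> carrier V" "x1 \<in> carrier V" "y \<in> carrier W" "y1 \<in> carrier W" for x y x1 y1 r
    using coset_eqI[OF free_module N _ _ lin_span_incl[OF that(1)]] that(2-)
    by (simp add: tens_def gen_class_def tensor_def presented_def quot_smult[OF free_module N] del: free_simps)
  show "v \<in> carrier V \<Longrightarrow> lin W (tensor R V W) (\<lambda>w. tens R V W v w)"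
    using V W by (intro linI add smult) (auto simp: tensor_rels_def Let_def simp del: free_simps)
  show "w \<in> carrier W \<Longrightarrow> lin V (tensor R V W) (\<lambda>v. tens R V W v w)"
    using V W by (intro linI add smult) (auto simp: tensor_rels_def Let_def simp del: free_simps)
qed

lemma bilin_tens: "bilin V W (tensor R V W) (tens R V W)"
  by (intro bilinI lin_tens_right lin_tens_left)

lemma sw_tens_self: "X \<in> carrier (tensor R V W) \<Longrightarrow> sw (tensor R V W) X (tens R V W) = X"
  using tensor_eqI[OF _ lin_sw[OF _ bilin_tens] lin_ident] V W
  by (simp add: sw_tens[OF _ bilin_tens])

end

lemma sw_swap:
  assumes "module R V" "module R W" "module R V'" "module R W'" "module R P"
    and "X \<in> carrier (tensor R V W)" "Y \<in> carrier (tensor R V' W')"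
    and "\<And>v w v' w'. v \<in> carrier V \<Longrightarrow> w \<in> carrier W \<Longrightarrow> v' \<in> carrier V' \<Longrightarrow> w' \<in> carrier W' \<Longrightarrow>
      f v w v' w' \<in> carrier P"
  shows "sw P X (\<lambda>v w. sw P Y (\<lambda>v' w'. f v w v' w')) = sw P Y (\<lambda>v' w'. sw P X (\<lambda>v w. f v w v' w'))"
  using lift_swap[OF tensor_rels_closed[OF assms(1,2)] assms(5) assms(6)[unfolded tensor_def]
      tensor_rels_closed[OF assms(3,4)] assms(7)[unfolded tensor_def], of "\<lambda>(v, w) (v', w'). f v w v' w'"] assms(8)
  by (auto simp: case_prod_unfold)

lemma lin_sw_arg:
  assumes "module R V" "module R W" "module R P" "lin U (tensor R V W) h" "bilin V W P f"
  shows "lin U P (\<lambda>u. sw P (h u) f)"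
  by (rule lin_comp[OF lin_sw assms(4)]) (use assms in auto)

lemma lin_tens_l:
  assumes "module R V" "module R W" "lin U V h" "w \<in> carrier W"
  shows "lin U (tensor R V W) (\<lambda>u. tens R V W (h u) w)"
  by (rule lin_comp[OF lin_tens_left assms(3)]) (use assms in auto)

lemma lin_tens_r:
  assumes "module R V" "module R W" "lin U W h" "v \<in> carrier V"
  shows "lin U (tensor R V W) (\<lambda>u. tens R V W v (h u))"
  by (rule lin_comp[OF lin_tens_right assms(3)]) (use assms in auto)

subsection \<open>Tensor products of maps and associativity\<close>

text \<open>
  The middle statement, for arbitrary elements, makes it possible to apply \<open>f \<otimes> g\<close> under a Sweedler sum.
\<close>

lemma tmap_tens:
  assumes "module R V" "module R W" "module R V'" "module R W'" "lin V V' f" "lin W W' g"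
  shows "lin (tensor R V W) (tensor R V' W') (tmap R V' W' f g)"
    and "X \<in> carrier (tensor R V W) \<Longrightarrow> tmap R V' W' f g X = sw (tensor R V' W') X (\<lambda>v w. tens R V' W' (f v) (g w))"
    and "v \<in> carrier V \<Longrightarrow> w \<in> carrier W \<Longrightarrow> tmap R V' W' f g (tens R V W v w) = tens R V' W' (f v) (g w)"
proof -
  have b: "bilin V W (tensor R V' W') (\<lambda>v w. tens R V' W' (f v) (g w))"
    using assms lin_closed[OF assms(5)] lin_closed[OF assms(6)]
    by (intro bilinI lin_tens_l lin_tens_r) auto
  show "lin (tensor R V W) (tensor R V' W') (tmap R V' W' f g)"
    unfolding tmap_def using lin_sw[OF assms(1,2) _ b] assms by simp
  show "X \<in> carrier (tensor R V W) \<Longrightarrow> tmap R V' W' f g X = sw (tensor R V' W') X (\<lambda>v w. tens R V' W' (f v) (g w))"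
    by (simp add: tmap_def)
  show "v \<in> carrier V \<Longrightarrow> w \<in> carrier W \<Longrightarrow> tmap R V' W' f g (tens R V W v w) = tens R V' W' (f v) (g w)"
    unfolding tmap_def using sw_tens[OF assms(1,2) _ b] assms by simp
qed

context
  fixes U :: "('a, 'u, 'l) module_scheme" and V :: "('a, 'v, 'm) module_scheme"
    and W :: "('a, 'w, 'n) module_scheme"
  assumes U: "module R U" and V: "module R V" and W: "module R W"
begin

lemma bilin_assoc_r:
  "bilin (tensor R U V) W (tensor R U (tensor R V W))
    (\<lambda>x w. sw (tensor R U (tensor R V W)) x (\<lambda>u v. tens R U (tensor R V W) u (tens R V W v w)))"
  using U V W
  by (intro bilinI lin_sw lin_sw_param[OF U V] lin_tens_l lin_tens_r lin_ident) auto

lemma lin_assoc_r: "lin (tensor R (tensor R U V) W) (tensor R U (tensor R V W)) (assoc_r R U V W)"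
  unfolding assoc_r_def using lin_sw[OF _ _ _ bilin_assoc_r] U V W by simp

lemma assoc_r_tens:
  assumes "x \<in> carrier (tensor R U V)" "w \<in> carrier W"
  shows "assoc_r R U V W (tens R (tensor R U V) W x w) =
    sw (tensor R U (tensor R V W)) x (\<lambda>u v. tens R U (tensor R V W) u (tens R V W v w))"
  unfolding assoc_r_def using sw_tens[OF _ _ _ bilin_assoc_r assms] U V W by simp

lemma bilin_assoc_l:
  "bilin U (tensor R V W) (tensor R (tensor R U V) W)
    (\<lambda>u x. sw (tensor R (tensor R U V) W) x (\<lambda>v w. tens R (tensor R U V) W (tens R U V u v) w))"
  using U V W
  by (intro bilinI lin_sw lin_sw_param[OF V W] lin_tens_l lin_tens_r lin_ident) auto

lemma lin_assoc_l: "lin (tensor R U (tensor R V W)) (tensor R (tensor R U V) W) (assoc_l R U V W)"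
  unfolding assoc_l_def using lin_sw[OF _ _ _ bilin_assoc_l] U V W by simp

lemma assoc_l_tens:
  assumes "u \<in> carrier U" "x \<in> carrier (tensor R V W)"
  shows "assoc_l R U V W (tens R U (tensor R V W) u x) =
    sw (tensor R (tensor R U V) W) x (\<lambda>v w. tens R (tensor R U V) W (tens R U V u v) w)"
  unfolding assoc_l_def using sw_tens[OF _ _ _ bilin_assoc_l assms] U V W by simp

end

section \<open>Spaces of words\<close>

lemma words_iff: "(h, xs) \<in> words H M N \<longleftrightarrow>
    length xs \<in> N \<and> h \<in> carrier (H (length xs)) \<and> set xs \<subseteq> carrier M"
  by (auto simp: words_def)

text \<open>
  Multilinearity on words. The length may vary in \<open>N\<close>, with a first factor \<open>H n\<close> that depends on it,
  because the components of the universal algebra have this form.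
\<close>

definition mlin where
  "mlin H M N P f \<longleftrightarrow>
     (\<forall>xs. length xs \<in> N \<and> set xs \<subseteq> carrier M \<longrightarrow> lin (H (length xs)) P (\<lambda>h. f h xs)) \<and>
     (\<forall>h ys zs. Suc (length ys + length zs) \<in> N \<and> h \<in> carrier (H (Suc (length ys + length zs))) \<and>
        set ys \<subseteq> carrier M \<and> set zs \<subseteq> carrier M \<longrightarrow> lin M P (\<lambda>x. f h (ys @ x # zs)))"

lemma mlinI:
  assumes "\<And>xs. length xs \<in> N \<Longrightarrow> set xs \<subseteq> carrier M \<Longrightarrow> lin (H (length xs)) P (\<lambda>h. f h xs)"
    and "\<And>h ys zs. Suc (length ys + length zs) \<in> N \<Longrightarrow> h \<in> carrier (H (Suc (length ys + length zs))) \<Longrightarrow>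
        set ys \<subseteq> carrier M \<Longrightarrow> set zs \<subseteq> carrier M \<Longrightarrow> lin M P (\<lambda>x. f h (ys @ x # zs))"
  shows "mlin H M N P f"
  using assms by (simp add: mlin_def)

lemma mlinD:
  assumes "mlin H M N P f"
  shows "length xs \<in> N \<Longrightarrow> set xs \<subseteq> carrier M \<Longrightarrow> lin (H (length xs)) P (\<lambda>h. f h xs)"
    and "Suc (length ys + length zs) \<in> N \<Longrightarrow> h \<in> carrier (H (Suc (length ys + length zs))) \<Longrightarrow>
        set ys \<subseteq> carrier M \<Longrightarrow> set zs \<subseteq> carrier M \<Longrightarrow> lin M P (\<lambda>x. f h (ys @ x # zs))"
    and "length xs \<in> N \<Longrightarrow> set xs \<subseteq> carrier M \<Longrightarrow> h \<in> carrier (H (length xs)) \<Longrightarrow> f h xs \<in> carrier P"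
  using assms by (auto simp: mlin_def dest: lin_closed)

context
  fixes H :: "nat \<Rightarrow> ('a, 'h, 'l) module_scheme" and M :: "('a, 'm, 'n) module_scheme" and N :: "nat set"
  assumes H: "\<And>i. i \<in> N \<Longrightarrow> module R (H i)" and M: "module R M"
begin

lemma word_rels_closed: "word_rels R H M N \<subseteq> carrier (free_space R (words H M N))"
  unfolding word_rels_def Let_def using H M
  by (intro subsetI) (elim UnE CollectE exE conjE, simp_all add: words_iff del: free_simps)

lemma word_space_module [simp]: "module R (word_space R H M N)"
  unfolding word_space_def by (intro presented_module word_rels_closed)

lemma word_rels_respected:
  assumes P: "module R P" and f: "mlin H M N P f" and e: "e \<in> word_rels R H M N"
  shows "lin_ext P (\<lambda>(h, xs). f h xs) e = \<zero>\<^bsub>P\<^esub>"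
proof -
  let ?F = "free_space R (words H M N)"
  note D = lin_closed lin_add lin_smult
  have fc: "\<And>s. s \<in> words H M N \<Longrightarrow> (\<lambda>(h, xs). f h xs) s \<in> carrier P"
    using mlinD(3)[OF f] by (auto simp: words_def)
  note l = lin_ext_linear[where f = "\<lambda>(h, xs). f h xs", OF P fc]
  note simps = lin_minus[OF free_module P l] D(2,3)[OF l] lin_ext_basis[where f = "\<lambda>(h, xs). f h xs", OF P fc]
    D(2,3)[OF mlinD(1)[OF f]] D(2,3)[OF mlinD(2)[OF f]] mlinD(3)[OF f]
  show ?thesis
    using e unfolding word_rels_def Let_def
    by (elim UnE CollectE exE conjE) (use H M P in \<open>simp_all add: simps words_iff del: free_simps\<close>)
qed

lemma word_closed:
  assumes "length xs \<in> N" "set xs \<subseteq> carrier M" "h \<in> carrier (H (length xs))"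
  shows "word R H M N h xs \<in> carrier (word_space R H M N)"
  unfolding word_def word_space_def
  by (rule gen_class_closed[OF word_rels_closed]) (use assms in \<open>auto simp: words_def\<close>)

lemma word_induct [consumes 1, case_names word zero add smult]:
  assumes "X \<in> carrier (word_space R H M N)"
    and "\<And>h xs. length xs \<in> N \<Longrightarrow> set xs \<subseteq> carrier M \<Longrightarrow> h \<in> carrier (H (length xs)) \<Longrightarrow> Q (word R H M N h xs)"
    and "Q \<zero>\<^bsub>word_space R H M N\<^esub>"
    and "\<And>X Y. X \<in> carrier (word_space R H M N) \<Longrightarrow> Y \<in> carrier (word_space R H M N) \<Longrightarrow>
      Q X \<Longrightarrow> Q Y \<Longrightarrow> Q (X \<oplus>\<^bsub>word_space R H M N\<^esub> Y)"
    and "\<And>r X. r \<in> carrier R \<Longrightarrow> X \<in> carrier (word_space R H M N) \<Longrightarrow> Q X \<Longrightarrow>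
      Q (r \<odot>\<^bsub>word_space R H M N\<^esub> X)"
  shows "Q X"
  by (rule presented_induct[OF word_rels_closed assms(1)[unfolded word_space_def]])
    (use assms(2-5) in \<open>auto simp: word_space_def word_def words_def\<close>)

lemma word_eqI:
  assumes P: "module R P" and f: "lin (word_space R H M N) P f" and g: "lin (word_space R H M N) P g"
    and "\<And>h xs. length xs \<in> N \<Longrightarrow> set xs \<subseteq> carrier M \<Longrightarrow> h \<in> carrier (H (length xs)) \<Longrightarrow>
      f (word R H M N h xs) = g (word R H M N h xs)"
    and "X \<in> carrier (word_space R H M N)"
  shows "f X = g X"
  using presented_eqI[OF word_rels_closed P f[unfolded word_space_def] g[unfolded word_space_def]] assms(4,5)
  by (auto simp: word_def words_def word_space_def)

lemma lin_lift_word: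
  assumes "module R P" "mlin H M N P f" shows "lin (word_space R H M N) P (\<lambda>X. sw P X f)"
  unfolding word_space_def
  using word_rels_respected[OF assms] mlinD(3)[OF assms(2)]
  by (intro lift_linear[OF word_rels_closed assms(1)]) (auto simp: words_def)

lemma lift_word:
  assumes "module R P" "mlin H M N P f" "length xs \<in> N" "set xs \<subseteq> carrier M" "h \<in> carrier (H (length xs))"
  shows "sw P (word R H M N h xs) f = f h xs"
  unfolding word_def
  using lift_gen[where f = "\<lambda>(h, xs). f h xs", OF word_rels_closed assms(1) _ word_rels_respected[OF assms(1,2)], of "(h, xs)"]
    mlinD(3)[OF assms(2)] assms(3-5) by (auto simp: words_def)

lemma lift_word_cong:
  assumes "module R P" "X \<in> carrier (word_space R H M N)"
    and "\<And>h xs. length xs \<in> N \<Longrightarrow> set xs \<subseteq> carrier M \<Longrightarrow> h \<in> carrier (H (length xs)) \<Longrightarrow> f h xs \<in> carrier P"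
    and "\<And>h xs. length xs \<in> N \<Longrightarrow> set xs \<subseteq> carrier M \<Longrightarrow> h \<in> carrier (H (length xs)) \<Longrightarrow> f h xs = g h xs"
  shows "sw P X f = sw P X g"
  using lift_cong[OF word_rels_closed assms(1), of X "\<lambda>(h, xs). f h xs"] assms(2-4)
  by (auto simp: word_space_def words_def)

lemma lin_of_lift_word:
  assumes "module R P" "module R Q" "lin P Q h" "X \<in> carrier (word_space R H M N)"
    and "\<And>h xs. length xs \<in> N \<Longrightarrow> set xs \<subseteq> carrier M \<Longrightarrow> h \<in> carrier (H (length xs)) \<Longrightarrow> f h xs \<in> carrier P"
  shows "h (sw P X f) = sw Q X (\<lambda>v w. h (f v w))"
proof -
  have "(\<lambda>s. h (case s of (v, w) \<Rightarrow> f v w)) = (\<lambda>(v, w). h (f v w))" by auto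
  then show ?thesis
    using lift_lin[OF word_rels_closed assms(1-3), of X "\<lambda>(h, xs). f h xs"] assms(4,5)
    by (auto simp: word_space_def words_def)
qed

lemma lin_lift_word_param:
  assumes "module R P" "module R U" "X \<in> carrier (word_space R H M N)"
    and "\<And>h xs. length xs \<in> N \<Longrightarrow> set xs \<subseteq> carrier M \<Longrightarrow> h \<in> carrier (H (length xs)) \<Longrightarrow>
      lin U P (\<lambda>u. f u h xs)"
  shows "lin U P (\<lambda>u. sw P X (f u))"
  using lift_lin_param[OF word_rels_closed assms(1,2), of X "\<lambda>u (h, xs). f u h xs"] assms(3,4)
  by (auto simp: word_space_def words_def)

lemma mlin_word: "mlin H M N (word_space R H M N) (word R H M N)"
proof -
  let ?F = "free_space R (words H M N)" and ?W = "word_space R H M N" and ?w = "word R H M N"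
  note Nn = relations_submodule[OF word_rels_closed]
  have add: "?w h xs = ?w h1 xs1 \<oplus>\<^bsub>?W\<^esub> ?w h2 xs2"
    if "basis_elt R (h, xs) \<ominus>\<^bsub>?F\<^esub> (basis_elt R (h1, xs1) \<oplus>\<^bsub>?F\<^esub> basis_elt R (h2, xs2)) \<in> word_rels R H M N"
      "(h, xs) \<in> words H M N" "(h1, xs1) \<in> words H M N" "(h2, xs2) \<in> words H M N"
    for h xs h1 xs1 h2 xs2
    using coset_eqI[OF free_module Nn _ _ lin_span_incl[OF that(1)]] that(2-)
    by (simp add: word_def gen_class_def word_space_def presented_def quot_add[OF free_module Nn] del: free_simps)
  have smult: "?w h xs = r \<odot>\<^bsub>?W\<^esub> ?w h1 xs1"
    if "basis_elt R (h, xs) \<ominus>\<^bsub>?F\<^esub> r \<odot>\<^bsub>?F\<^esub> basis_elt R (h1, xs1) \<in> word_rels R H M N"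
      "r \<in> carrier R" "(h, xs) \<in> words H M N" "(h1, xs1) \<in> words H M N" for h xs h1 xs1 r
    using coset_eqI[OF free_module Nn _ _ lin_span_incl[OF that(1)]] that(2-)
    by (simp add: word_def gen_class_def word_space_def presented_def quot_smult[OF free_module Nn] del: free_simps)
  show ?thesis
  proof (rule mlinI)
    fix xs assume xs: "length xs \<in> N" "set xs \<subseteq> carrier M"
    note [simp] = H[OF xs(1)]
    show "lin (H (length xs)) ?W (\<lambda>h. ?w h xs)"
    proof (rule linI)
      fix h assume h: "h \<in> carrier (H (length xs))"
      show "?w h xs \<in> carrier ?W" using word_closed[OF xs h] .
      have w: "(h, xs) \<in> words H M N" if "h \<in> carrier (H (length xs))" for h
        using xs that by (auto simp: words_def)
      { fix h' assume h': "h' \<in> carrier (H (length xs))"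
        have "(basis_elt R (h \<oplus>\<^bsub>H (length xs)\<^esub> h', xs) \<ominus>\<^bsub>?F\<^esub>
            (basis_elt R (h, xs) \<oplus>\<^bsub>?F\<^esub> basis_elt R (h', xs))) \<in> word_rels R H M N"
          unfolding word_rels_def Let_def using w[OF h] w[OF h'] by blast
        then show "?w (h \<oplus>\<^bsub>H (length xs)\<^esub> h') xs = ?w h xs \<oplus>\<^bsub>?W\<^esub> ?w h' xs"
          by (rule add) (use w h h' in auto) }
      { fix r assume r: "r \<in> carrier R"
        then have "(basis_elt R (r \<odot>\<^bsub>H (length xs)\<^esub> h, xs) \<ominus>\<^bsub>?F\<^esub>
            r \<odot>\<^bsub>?F\<^esub> basis_elt R (h, xs)) \<in> word_rels R H M N"
          unfolding word_rels_def Let_def using w[OF h] by blast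
        then show "?w (r \<odot>\<^bsub>H (length xs)\<^esub> h) xs = r \<odot>\<^bsub>?W\<^esub> ?w h xs"
          by (rule smult) (use w h r in auto) }
    qed
  next
    fix h ys zs
    assume *: "Suc (length ys + length zs) \<in> N" "h \<in> carrier (H (Suc (length ys + length zs)))"
      "set ys \<subseteq> carrier M" "set zs \<subseteq> carrier M"
    have w: "(h, ys @ x # zs) \<in> words H M N" if "x \<in> carrier M" for x
      using * that by (auto simp: words_def)
    show "lin M ?W (\<lambda>x. ?w h (ys @ x # zs))"
    proof (rule linI)
      fix x assume x: "x \<in> carrier M"
      show "?w h (ys @ x # zs) \<in> carrier ?W" using * x by (intro word_closed) auto
      { fix x' assume x': "x' \<in> carrier M"
        have "(basis_elt R (h, ys @ (x \<oplus>\<^bsub>M\<^esub> x') # zs) \<ominus>\<^bsub>?F\<^esub>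
            (basis_elt R (h, ys @ x # zs) \<oplus>\<^bsub>?F\<^esub> basis_elt R (h, ys @ x' # zs))) \<in> word_rels R H M N"
          unfolding word_rels_def Let_def using w[OF x] w[OF x'] by blast
        then show "?w h (ys @ (x \<oplus>\<^bsub>M\<^esub> x') # zs) = ?w h (ys @ x # zs) \<oplus>\<^bsub>?W\<^esub> ?w h (ys @ x' # zs)"
          by (rule add) (use w x x' M in auto) }
      { fix r assume r: "r \<in> carrier R"
        then have "(basis_elt R (h, ys @ (r \<odot>\<^bsub>M\<^esub> x) # zs) \<ominus>\<^bsub>?F\<^esub>
            r \<odot>\<^bsub>?F\<^esub> basis_elt R (h, ys @ x # zs)) \<in> word_rels R H M N"
          unfolding word_rels_def Let_def using w[OF x] by blast
        then show "?w h (ys @ (r \<odot>\<^bsub>M\<^esub> x) # zs) = r \<odot>\<^bsub>?W\<^esub> ?w h (ys @ x # zs)"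
          by (rule smult) (use w x r M in auto) }
    qed
  qed
qed

lemma lift_word_self: "X \<in> carrier (word_space R H M N) \<Longrightarrow> sw (word_space R H M N) X (word R H M N) = X"
  using word_eqI[OF word_space_module lin_lift_word[OF word_space_module mlin_word] lin_ident]
  by (simp add: lift_word[OF word_space_module mlin_word])

end

lemma mlin_comp: "lin P Q g \<Longrightarrow> mlin H M N P f \<Longrightarrow> mlin H M N Q (\<lambda>h xs. g (f h xs))"
  by (auto intro!: mlinI lin_comp[of P Q g] dest: mlinD)

end

section \<open>Entwining structures in Sweedler form\<close>

context cring
begin

context
  fixes A :: "('a, 'x, 'm) module_scheme" and C :: "('a, 'c, 'n) module_scheme" and \<psi>
  assumes A: "module R A" and C: "module R C"
    and psi: "lin (tensor R C A) (tensor R A C) \<psi>"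
begin

lemma entw_closed: "c \<in> carrier C \<Longrightarrow> a \<in> carrier A \<Longrightarrow> \<psi> (tens R C A c a) \<in> carrier (tensor R A C)"
  using lin_closed[OF psi] A C by simp

lemma lin_entw_coalg: "a \<in> carrier A \<Longrightarrow> lin U C h \<Longrightarrow> lin U (tensor R A C) (\<lambda>u. \<psi> (tens R C A (h u) a))"
  by (intro lin_comp[OF psi] lin_tens_l A C)

lemma lin_entw_alg: "c \<in> carrier C \<Longrightarrow> lin U A h \<Longrightarrow> lin U (tensor R A C) (\<lambda>u. \<psi> (tens R C A c (h u)))"
  by (intro lin_comp[OF psi] lin_tens_r A C)

lemma lin_sw_entw_coalg:
  assumes "module R P" "bilin A C P f" "a \<in> carrier A" "lin U C h"
  shows "lin U P (\<lambda>u. sw P (\<psi> (tens R C A (h u) a)) f)"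
  by (intro lin_sw_arg[OF A C assms(1) _ assms(2)] lin_entw_coalg assms)

lemma lin_sw_entw_alg:
  assumes "module R P" "bilin A C P f" "c \<in> carrier C" "lin U A h"
  shows "lin U P (\<lambda>u. sw P (\<psi> (tens R C A c (h u))) f)"
  by (intro lin_sw_arg[OF A C assms(1) _ assms(2)] lin_entw_alg assms)

lemma lin_sw_entw_param:
  assumes "module R P" "module R U" "c \<in> carrier C" "a \<in> carrier A"
    and "\<And>a' c'. a' \<in> carrier A \<Longrightarrow> c' \<in> carrier C \<Longrightarrow> lin U P (\<lambda>u. f u a' c')"
  shows "lin U P (\<lambda>u. sw P (\<psi> (tens R C A c a)) (f u))"
  by (intro lin_sw_param[OF A C assms(1,2)] entw_closed assms)

lemma sw_entw_closed:
  assumes "module R P" "c \<in> carrier C" "a \<in> carrier A"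
    and "\<And>a' c'. a' \<in> carrier A \<Longrightarrow> c' \<in> carrier C \<Longrightarrow> f a' c' \<in> carrier P"
  shows "sw P (\<psi> (tens R C A c a)) f \<in> carrier P"
  by (intro sw_closed[OF A C assms(1)] entw_closed assms)

lemma sw_entw_cong:
  assumes "module R P" "c \<in> carrier C" "a \<in> carrier A"
    and "\<And>a' c'. a' \<in> carrier A \<Longrightarrow> c' \<in> carrier C \<Longrightarrow> f a' c' \<in> carrier P"
    and "\<And>a' c'. a' \<in> carrier A \<Longrightarrow> c' \<in> carrier C \<Longrightarrow> f a' c' = g a' c'"
  shows "sw P (\<psi> (tens R C A c a)) f = sw P (\<psi> (tens R C A c a)) g"
  by (rule sw_cong[OF A C assms(1)]) (use assms entw_closed in auto)

lemma lin_of_sw_entw: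
  assumes "module R P" "module R Q" "lin P Q h" "c \<in> carrier C" "a \<in> carrier A"
    and "\<And>a' c'. a' \<in> carrier A \<Longrightarrow> c' \<in> carrier C \<Longrightarrow> f a' c' \<in> carrier P"
  shows "h (sw P (\<psi> (tens R C A c a)) f) = sw Q (\<psi> (tens R C A c a)) (\<lambda>a' c'. h (f a' c'))"
  by (intro lin_of_sw[OF A C assms(1-3)] entw_closed assms)

lemma bilin_mult_tens:
  assumes mult: "bilin A A A (\<lambda>x y. x \<otimes>\<^bsub>A\<^esub> y)" and a: "a \<in> carrier A"
  shows "bilin A C (tensor R A C) (\<lambda>b c. tens R A C (a \<otimes>\<^bsub>A\<^esub> b) c)"
  by (intro bilinI lin_tens_l lin_tens_r lin_ident bilinD[OF mult] A C a)

lemma bilin_entw_mult_tens: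
  assumes mult: "bilin A A A (\<lambda>x y. x \<otimes>\<^bsub>A\<^esub> y)" and b: "b \<in> carrier A"
  shows "bilin A C (tensor R A C)
    (\<lambda>a' c'. sw (tensor R A C) (\<psi> (tens R C A c' b)) (\<lambda>b' c''. tens R A C (a' \<otimes>\<^bsub>A\<^esub> b') c''))"
  by (intro bilinI lin_sw_entw_coalg lin_sw_entw_param lin_tens_l bilinD[OF mult] lin_ident
      bilin_mult_tens[OF mult] tensor_module A C b)

text \<open>
  The axioms on the product and on the coproduct are equations between composites of linear maps. On
  pure tensors they become the familiar identities
  \<open>(ab)\<^sub>\<psi> \<otimes> c\<^sup>\<psi> = a\<^sub>\<psi> b\<^sub>\<psi> \<otimes> c\<^sup>\<psi>\<^sup>\<psi>\<close> and \<open>a\<^sub>\<psi> \<otimes> \<Delta>(c\<^sup>\<psi>) = a\<^sub>\<psi>\<^sub>\<psi> \<otimes> c\<^sub>1\<^sup>\<psi> \<otimes> c\<^sub>2\<^sup>\<psi>\<close>.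
  The equivalences are applied twice: forwards to \<open>\<psi>\<close> and backwards to the entwining of the
  universal algebra.
\<close>

lemma psi_mult_iff:
  assumes mult: "bilin A A A (\<lambda>x y. x \<otimes>\<^bsub>A\<^esub> y)"
  shows "(\<forall>x\<in>carrier (tensor R (tensor R C A) A).
      \<psi> (tmap R C A id (mult_map R A) (assoc_r R C A A x)) =
      tmap R A C (mult_map R A) id (assoc_l R A A C (tmap R A (tensor R A C) id \<psi>
        (assoc_r R A C A (tmap R (tensor R A C) A \<psi> id x))))) \<longleftrightarrow>
    (\<forall>c\<in>carrier C. \<forall>a\<in>carrier A. \<forall>b\<in>carrier A. \<psi> (tens R C A c (a \<otimes>\<^bsub>A\<^esub> b)) =
      sw (tensor R A C) (\<psi> (tens R C A c a)) (\<lambda>a' c'.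
        sw (tensor R A C) (\<psi> (tens R C A c' b)) (\<lambda>b' c''. tens R A C (a' \<otimes>\<^bsub>A\<^esub> b') c'')))"
    (is "(\<forall>x\<in>_. ?L x = ?R x) \<longleftrightarrow> ?S")
proof -
  note [simp] = A C
  have mm: "lin (tensor R A A) A (mult_map R A)"
    unfolding mult_map_def using lin_sw[OF A A A mult] .
  have mmt: "mult_map R A (tens R A A x y) = x \<otimes>\<^bsub>A\<^esub> y" if "x \<in> carrier A" "y \<in> carrier A" for x y
    unfolding mult_map_def using sw_tens[OF A A A mult that] .
  let ?CA = "tensor R C A" and ?AC = "tensor R A C"
  have L: "lin (tensor R ?CA A) ?AC ?L"
    by (intro lin_comp[OF psi] lin_comp[OF tmap_tens(1)[OF _ _ _ _ lin_id mm]] lin_assoc_r) auto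
  have R: "lin (tensor R ?CA A) ?AC ?R"
    by (intro lin_comp[OF tmap_tens(1)[OF _ _ _ _ mm lin_id]] lin_comp[OF lin_assoc_l]
        lin_comp[OF tmap_tens(1)[OF _ _ _ _ lin_id psi]] lin_comp[OF lin_assoc_r]
        tmap_tens(1)[OF _ _ _ _ psi lin_id]) auto
  have L1: "?L (tens R ?CA A (tens R C A c a) b) = \<psi> (tens R C A c (a \<otimes>\<^bsub>A\<^esub> b))"
    if [simp]: "c \<in> carrier C" "a \<in> carrier A" "b \<in> carrier A" for c a b
  proof -
    have "assoc_r R C A A (tens R ?CA A (tens R C A c a) b) = tens R C (tensor R A A) c (tens R A A a b)"
      by (subst assoc_r_tens, simp_all, subst sw_tens)
        (auto intro!: bilinI lin_tens_l lin_tens_r lin_ident)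
    then show ?thesis by (simp add: tmap_tens(3)[OF _ _ _ _ lin_id mm] mmt)
  qed
  have R1: "?R (tens R ?CA A (tens R C A c a) b) =
      sw ?AC (\<psi> (tens R C A c a)) (\<lambda>a' c'.
        sw ?AC (\<psi> (tens R C A c' b)) (\<lambda>b' c''. tens R A C (a' \<otimes>\<^bsub>A\<^esub> b') c''))"
    if [simp]: "c \<in> carrier C" "a \<in> carrier A" "b \<in> carrier A" for c a b
  proof -
    note [simp] = entw_closed
    have p: "lin (tensor R C A) ?AC \<psi>" by (rule psi)
    have "?R (tens R ?CA A (tens R C A c a) b) =
        tmap R A C (mult_map R A) id (assoc_l R A A C (tmap R A ?AC id \<psi>
          (sw (tensor R A ?CA) (\<psi> (tens R C A c a)) (\<lambda>a' c'. tens R A ?CA a' (tens R C A c' b)))))"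
      by (simp add: tmap_tens(3)[OF _ _ _ _ psi lin_id] assoc_r_tens)
    also have "\<dots> = tmap R A C (mult_map R A) id (assoc_l R A A C
          (sw (tensor R A ?AC) (\<psi> (tens R C A c a)) (\<lambda>a' c'. tens R A ?AC a' (\<psi> (tens R C A c' b)))))"
    proof (subst lin_of_sw_entw[where h = "tmap R A ?AC id \<psi>", OF _ _ tmap_tens(1)[OF _ _ _ _ lin_id psi]])
      show "tmap R A C (mult_map R A) id (assoc_l R A A C
          (sw (tensor R A ?AC) (\<psi> (tens R C A c a)) (\<lambda>a' c'. tmap R A ?AC id \<psi> (tens R A ?CA a' (tens R C A c' b))))) =
        tmap R A C (mult_map R A) id (assoc_l R A A C
          (sw (tensor R A ?AC) (\<psi> (tens R C A c a)) (\<lambda>a' c'. tens R A ?AC a' (\<psi> (tens R C A c' b)))))"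
        by (intro arg_cong[where f = "\<lambda>x. tmap R A C (mult_map R A) id (assoc_l R A A C x)"] sw_entw_cong)
          (auto simp: tmap_tens(3)[OF _ _ _ _ lin_id psi])
    qed auto
    also have "\<dots> = tmap R A C (mult_map R A) id
          (sw (tensor R (tensor R A A) C) (\<psi> (tens R C A c a)) (\<lambda>a' c'.
            sw (tensor R (tensor R A A) C) (\<psi> (tens R C A c' b)) (\<lambda>b' c''. tens R (tensor R A A) C (tens R A A a' b') c'')))"
    proof (subst lin_of_sw_entw[where h = "assoc_l R A A C", OF _ _ lin_assoc_l])
      show "tmap R A C (mult_map R A) id (sw (tensor R (tensor R A A) C) (\<psi> (tens R C A c a)) (\<lambda>a' c'.
            assoc_l R A A C (tens R A ?AC a' (\<psi> (tens R C A c' b))))) =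
        tmap R A C (mult_map R A) id (sw (tensor R (tensor R A A) C) (\<psi> (tens R C A c a)) (\<lambda>a' c'.
            sw (tensor R (tensor R A A) C) (\<psi> (tens R C A c' b)) (\<lambda>b' c''. tens R (tensor R A A) C (tens R A A a' b') c'')))"
        by (intro arg_cong[where f = "\<lambda>x. tmap R A C (mult_map R A) id x"] sw_entw_cong)
          (auto simp: assoc_l_tens intro!: sw_entw_closed)
    qed auto
    also have "\<dots> = sw ?AC (\<psi> (tens R C A c a)) (\<lambda>a' c'.
            tmap R A C (mult_map R A) id (sw (tensor R (tensor R A A) C) (\<psi> (tens R C A c' b)) (\<lambda>b' c''. tens R (tensor R A A) C (tens R A A a' b') c'')))"
      by (subst lin_of_sw_entw[where h = "tmap R A C (mult_map R A) id", OF _ _ tmap_tens(1)[OF _ _ _ _ mm lin_id]])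
        (auto intro!: sw_entw_closed)
    also have "\<dots> = sw ?AC (\<psi> (tens R C A c a)) (\<lambda>a' c'.
        sw ?AC (\<psi> (tens R C A c' b)) (\<lambda>b' c''. tens R A C (a' \<otimes>\<^bsub>A\<^esub> b') c''))"
    proof (rule sw_entw_cong)
      fix a' c' assume [simp]: "a' \<in> carrier A" "c' \<in> carrier C"
      show "tmap R A C (mult_map R A) id (sw (tensor R (tensor R A A) C) (\<psi> (tens R C A c' b)) (\<lambda>b' c''. tens R (tensor R A A) C (tens R A A a' b') c''))
        = sw ?AC (\<psi> (tens R C A c' b)) (\<lambda>b' c''. tens R A C (a' \<otimes>\<^bsub>A\<^esub> b') c'')"
        by (subst lin_of_sw_entw[where h = "tmap R A C (mult_map R A) id", OF _ _ tmap_tens(1)[OF _ _ _ _ mm lin_id]])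
          (auto del: equalityI subsetI intro!: sw_entw_cong tens_closed bilinD(3)[OF mult] simp: tmap_tens(3)[OF _ _ _ _ mm lin_id] mmt)
    qed (auto intro!: sw_entw_closed lin_closed[OF tmap_tens(1)[OF _ _ _ _ mm lin_id]])
    finally show ?thesis .
  qed
  show ?thesis
  proof
    assume *: "\<forall>x\<in>carrier (tensor R ?CA A). ?L x = ?R x"
    show ?S
    proof (intro ballI)
      fix c a b assume [simp]: "c \<in> carrier C" "a \<in> carrier A" "b \<in> carrier A"
      show "\<psi> (tens R C A c (a \<otimes>\<^bsub>A\<^esub> b)) = sw ?AC (\<psi> (tens R C A c a)) (\<lambda>a' c'.
        sw ?AC (\<psi> (tens R C A c' b)) (\<lambda>b' c''. tens R A C (a' \<otimes>\<^bsub>A\<^esub> b') c''))"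
        using *[rule_format, of "tens R ?CA A (tens R C A c a) b"] L1[of c a b] R1[of c a b] by simp
    qed
  next
    assume *: ?S
    show "\<forall>x\<in>carrier (tensor R ?CA A). ?L x = ?R x"
    proof
      fix x assume x: "x \<in> carrier (tensor R ?CA A)"
      show "?L x = ?R x"
      proof (rule tensor_eqI[OF _ _ _ L R _ x])
        fix v w assume v: "v \<in> carrier ?CA" and w: "w \<in> carrier A"
        show "?L (tens R ?CA A v w) = ?R (tens R ?CA A v w)"
          by (rule tensor_eqI[OF _ _ _ lin_comp[OF L lin_tens_left] lin_comp[OF R lin_tens_left] _ v])
            (use w in \<open>simp_all add: L1 R1 *[rule_format]\<close>)
      qed auto
    qed
  qed
qed

lemma psi_comult_iff:
  assumes \<Delta>: "lin C (tensor R C C) \<Delta>"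
  shows "(\<forall>y\<in>carrier (tensor R C A). tmap R A (tensor R C C) id \<Delta> (\<psi> y) =
      assoc_r R A C C (tmap R (tensor R A C) C \<psi> id (assoc_l R C A C
        (tmap R C (tensor R A C) id \<psi> (assoc_r R C C A (tmap R (tensor R C C) A \<Delta> id y)))))) \<longleftrightarrow>
    (\<forall>c\<in>carrier C. \<forall>a\<in>carrier A.
      sw (tensor R A (tensor R C C)) (\<psi> (tens R C A c a)) (\<lambda>a' c'. tens R A (tensor R C C) a' (\<Delta> c')) =
      sw (tensor R A (tensor R C C)) (\<Delta> c) (\<lambda>c1 c2.
        sw (tensor R A (tensor R C C)) (\<psi> (tens R C A c2 a)) (\<lambda>a' c2'.
          sw (tensor R A (tensor R C C)) (\<psi> (tens R C A c1 a')) (\<lambda>a'' c1'.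
            tens R A (tensor R C C) a'' (tens R C C c1' c2')))))"
    (is "(\<forall>x\<in>_. ?L x = ?R x) \<longleftrightarrow> (\<forall>c\<in>_. \<forall>a\<in>_. ?LS c a = ?RS c a)")
proof -
  note [simp] = A C entw_closed
  note [simp] = lin_closed[OF \<Delta>]
  let ?CA = "tensor R C A" and ?AC = "tensor R A C" and ?CC = "tensor R C C"
  let ?T = "tensor R A ?CC"
  have L: "lin ?CA ?T ?L"
    by (intro lin_comp[OF tmap_tens(1)[OF _ _ _ _ lin_id \<Delta>]] psi) auto
  have R: "lin ?CA ?T ?R"
    by (intro lin_comp[OF lin_assoc_r] lin_comp[OF tmap_tens(1)[OF _ _ _ _ psi lin_id]] lin_comp[OF lin_assoc_l]
        lin_comp[OF tmap_tens(1)[OF _ _ _ _ lin_id psi]] tmap_tens(1)[OF _ _ _ _ \<Delta> lin_id]) auto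
  have L1: "?L (tens R C A c a) = ?LS c a" if [simp]: "c \<in> carrier C" "a \<in> carrier A" for c a
    by (subst tmap_tens(2)[OF _ _ _ _ lin_id \<Delta>]) auto
  have R1: "?R (tens R C A c a) = ?RS c a" if [simp]: "c \<in> carrier C" "a \<in> carrier A" for c a
  proof -
    note los = lin_of_sw[where V = C and W = C and X = "\<Delta> c"]
    note scc = sw_cong[where V = C and W = C and X = "\<Delta> c"]
    have "?R (tens R C A c a) = assoc_r R A C C (tmap R ?AC C \<psi> id (assoc_l R C A C
        (tmap R C ?AC id \<psi> (sw (tensor R C ?CA) (\<Delta> c) (\<lambda>c1 c2. tens R C ?CA c1 (tens R C A c2 a))))))"
      by (simp add: tmap_tens(3)[OF _ _ _ _ \<Delta> lin_id] assoc_r_tens)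
    also have "\<dots> = assoc_r R A C C (tmap R ?AC C \<psi> id (assoc_l R C A C
        (sw (tensor R C ?AC) (\<Delta> c) (\<lambda>c1 c2. tens R C ?AC c1 (\<psi> (tens R C A c2 a))))))"
    proof (subst los[where h = "tmap R C ?AC id \<psi>", OF _ _ _ _ tmap_tens(1)[OF _ _ _ _ lin_id psi]])
      show "assoc_r R A C C (tmap R ?AC C \<psi> id (assoc_l R C A C
          (sw (tensor R C ?AC) (\<Delta> c) (\<lambda>c1 c2. tmap R C ?AC id \<psi> (tens R C ?CA c1 (tens R C A c2 a)))))) =
        assoc_r R A C C (tmap R ?AC C \<psi> id (assoc_l R C A C
          (sw (tensor R C ?AC) (\<Delta> c) (\<lambda>c1 c2. tens R C ?AC c1 (\<psi> (tens R C A c2 a))))))"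
        by (intro arg_cong[where f = "\<lambda>x. assoc_r R A C C (tmap R ?AC C \<psi> id (assoc_l R C A C x))"] scc)
          (auto simp: tmap_tens(3)[OF _ _ _ _ lin_id psi])
    qed auto
    also have "\<dots> = assoc_r R A C C (tmap R ?AC C \<psi> id
        (sw (tensor R ?CA C) (\<Delta> c) (\<lambda>c1 c2. sw (tensor R ?CA C) (\<psi> (tens R C A c2 a)) (\<lambda>a' c2'.
          tens R ?CA C (tens R C A c1 a') c2'))))"
    proof (subst los[where h = "assoc_l R C A C", OF _ _ _ _ lin_assoc_l])
      show "assoc_r R A C C (tmap R ?AC C \<psi> id (sw (tensor R ?CA C) (\<Delta> c) (\<lambda>c1 c2.
            assoc_l R C A C (tens R C ?AC c1 (\<psi> (tens R C A c2 a)))))) =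
        assoc_r R A C C (tmap R ?AC C \<psi> id (sw (tensor R ?CA C) (\<Delta> c) (\<lambda>c1 c2.
            sw (tensor R ?CA C) (\<psi> (tens R C A c2 a)) (\<lambda>a' c2'. tens R ?CA C (tens R C A c1 a') c2'))))"
        by (intro arg_cong[where f = "\<lambda>x. assoc_r R A C C (tmap R ?AC C \<psi> id x)"] scc)
          (auto simp: assoc_l_tens intro!: sw_entw_closed)
    qed auto
    also have "\<dots> = assoc_r R A C C
        (sw (tensor R ?AC C) (\<Delta> c) (\<lambda>c1 c2. sw (tensor R ?AC C) (\<psi> (tens R C A c2 a)) (\<lambda>a' c2'.
          tens R ?AC C (\<psi> (tens R C A c1 a')) c2')))"
    proof (subst los[where h = "tmap R ?AC C \<psi> id", OF _ _ _ _ tmap_tens(1)[OF _ _ _ _ psi lin_id]])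
      show "assoc_r R A C C (sw (tensor R ?AC C) (\<Delta> c) (\<lambda>c1 c2. tmap R ?AC C \<psi> id
          (sw (tensor R ?CA C) (\<psi> (tens R C A c2 a)) (\<lambda>a' c2'. tens R ?CA C (tens R C A c1 a') c2')))) =
        assoc_r R A C C
        (sw (tensor R ?AC C) (\<Delta> c) (\<lambda>c1 c2. sw (tensor R ?AC C) (\<psi> (tens R C A c2 a)) (\<lambda>a' c2'.
          tens R ?AC C (\<psi> (tens R C A c1 a')) c2')))"
        by (intro arg_cong[where f = "\<lambda>x. assoc_r R A C C x"] scc)
          (auto del: equalityI subsetI simp: lin_of_sw_entw[where h = "tmap R ?AC C \<psi> id", OF _ _ tmap_tens(1)[OF _ _ _ _ psi lin_id]]
            tmap_tens(3)[OF _ _ _ _ psi lin_id]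
            intro!: sw_entw_cong sw_entw_closed lin_closed[OF tmap_tens(1)[OF _ _ _ _ psi lin_id]])
    qed (auto intro!: sw_entw_closed)
    also have "\<dots> = ?RS c a"
    proof (subst los[where h = "assoc_r R A C C", OF _ _ _ _ lin_assoc_r])
      show "sw ?T (\<Delta> c) (\<lambda>c1 c2. assoc_r R A C C (sw (tensor R ?AC C) (\<psi> (tens R C A c2 a)) (\<lambda>a' c2'.
          tens R ?AC C (\<psi> (tens R C A c1 a')) c2'))) = ?RS c a"
        by (intro scc)
          (auto del: equalityI subsetI simp: lin_of_sw_entw[where h = "assoc_r R A C C", OF _ _ lin_assoc_r] assoc_r_tens
            intro!: sw_entw_cong sw_entw_closed lin_closed[OF lin_assoc_r])
    qed (auto intro!: sw_entw_closed)
    finally show ?thesis .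
  qed
  show ?thesis
  proof
    assume *: "\<forall>x\<in>carrier ?CA. ?L x = ?R x"
    show "\<forall>c\<in>carrier C. \<forall>a\<in>carrier A. ?LS c a = ?RS c a"
    proof (intro ballI)
      fix c a assume ca: "c \<in> carrier C" "a \<in> carrier A"
      then have "tens R C A c a \<in> carrier ?CA" by simp
      from bspec[OF * this] show "?LS c a = ?RS c a" unfolding L1[OF ca] R1[OF ca] .
    qed
  next
    assume *: "\<forall>c\<in>carrier C. \<forall>a\<in>carrier A. ?LS c a = ?RS c a"
    show "\<forall>x\<in>carrier ?CA. ?L x = ?R x"
    proof
      fix x assume x: "x \<in> carrier ?CA"
      show "?L x = ?R x"
      proof (rule tensor_eqI[OF C A _ L R _ x])
        fix c a assume ca: "c \<in> carrier C" "a \<in> carrier A"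
        show "?L (tens R C A c a) = ?R (tens R C A c a)"
          unfolding L1[OF ca] R1[OF ca] using * ca by blast
      qed auto
    qed
  qed
qed

end

end

section \<open>The universal differential graded algebra\<close>

context cring
begin

lemmas ring_a_ac = a_ac
lemmas ring_l_neg = l_neg r_neg

lemma module_transfer:
  assumes V: "module R V" and eq: "carrier W = carrier V" "add W = add V" "zero W = zero V" "smult W = smult V"
  shows "module R W"
proof -
  interpret V: module R V by fact
  show ?thesis
    by (rule moduleI, rule is_cring, rule abelian_groupI)
      (auto simp: eq V.a_ac V.smult_l_distr V.smult_r_distr V.smult_assoc1
        intro: bexI[where x = "\<ominus>\<^bsub>V\<^esub> x" for x] V.l_neg)
qed

lemma submodule_transfer:
  assumes N: "submodule N R V" and V: "module R V"
    and eq: "carrier W = carrier V" "add W = add V" "zero W = zero V" "smult W = smult V"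
  shows "submodule N R W"
proof -
  have [simp]: "a_inv W = a_inv V" using same_add_monoid(2)[OF eq(1-3)] .
  show ?thesis
    using submodule_closed[OF V N]
    by (intro module.submoduleI[OF module_transfer[OF V eq]]) (auto simp: eq)
qed

end

context nonunital_algebra
begin

lemma algebra_module [simp]: "module K A" by (rule module_axioms)

lemma algebra_bilin: "bilin A A A (\<lambda>x y. x \<otimes>\<^bsub>A\<^esub> y)"
  by (intro bilinI linI)
    (auto simp: mult_closed mult_add_left mult_add_right mult_smult_left mult_smult_right)

lemma algebra_mult_zero [simp]:
  "x \<in> carrier A \<Longrightarrow> x \<otimes>\<^bsub>A\<^esub> \<zero>\<^bsub>A\<^esub> = \<zero>\<^bsub>A\<^esub>" "x \<in> carrier A \<Longrightarrow> \<zero>\<^bsub>A\<^esub> \<otimes>\<^bsub>A\<^esub> x = \<zero>\<^bsub>A\<^esub>"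
  using lin_zero[OF _ _ bilinD(1)[OF algebra_bilin]] lin_zero[OF _ _ bilinD(2)[OF algebra_bilin]] by auto

declare mult_closed [simp]

subsection \<open>Generators\<close>

abbreviation uA where "uA \<equiv> unitization K A"
abbreviation Om where "Om \<equiv> omega K A"
abbreviation ow where "ow \<equiv> omega_word K A"

text \<open>The words \<open>a da\<^sub>1 \<dots> da\<^sub>n\<close> and \<open>da\<^sub>1 \<dots> da\<^sub>n\<close>, and the product of the universal algebra\<close>

abbreviation aw where "aw a \<equiv> ow (a, \<zero>)"
abbreviation dw where "dw \<equiv> ow (\<zero>\<^bsub>A\<^esub>, \<one>)"
abbreviation omega_times (infixl "\<cdot>" 70) where "x \<cdot> y \<equiv> x \<otimes>\<^bsub>Om\<^esub> y"

lemma unitization_simps [simp]: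
  "carrier uA = carrier A \<times> carrier K" "zero uA = (\<zero>\<^bsub>A\<^esub>, \<zero>)"
  "add uA (a, m) (b, v) = (a \<oplus>\<^bsub>A\<^esub> b, m \<oplus> v)"
  "smult uA r (a, m) = (r \<odot>\<^bsub>A\<^esub> a, r \<otimes> m)"
  "mult uA (a, m) (b, v) = (a \<otimes>\<^bsub>A\<^esub> b \<oplus>\<^bsub>A\<^esub> m \<odot>\<^bsub>A\<^esub> b \<oplus>\<^bsub>A\<^esub> v \<odot>\<^bsub>A\<^esub> a, m \<otimes> v)"
  by (simp_all add: unitization_def)

lemma unitization_module [simp]: "module K uA"
proof -
  interpret S: module K "scalars K" by simp
  show ?thesis
    by (rule moduleI, rule is_cring, rule abelian_groupI)
      (auto simp: M.a_ac ring_a_ac l_distr r_distr m_assoc smult_l_distr smult_r_distr smult_assoc1 ring_l_neg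
        M.l_neg M.r_neg
        intro!: bexI[where x = "\<ominus>\<^bsub>A\<^esub> x" for x] bexI[where x = "\<ominus> x" for x])
qed

lemma omega_head_simps [simp]:
  "(a, m) \<in> carrier (omega_head K A n) \<longleftrightarrow> a \<in> carrier A \<and> m \<in> carrier K \<and> (n = 0 \<longrightarrow> m = \<zero>)"
  "add (omega_head K A n) = add uA" "zero (omega_head K A n) = zero uA"
  "smult (omega_head K A n) = smult uA"
  by (auto simp: omega_head_def)

lemma omega_head_cases:
  assumes "h \<in> carrier (omega_head K A n)"
  obtains a m where "h = (a, m)" "a \<in> carrier A" "m \<in> carrier K" "n = 0 \<Longrightarrow> m = \<zero>"
  using assms by (cases h) auto

lemma omega_head_module [simp]: "module K (omega_head K A n)"
proof -
  interpret U: module K uA by simp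
  have i: "\<ominus>\<^bsub>uA\<^esub> (a, \<zero>) = (\<ominus>\<^bsub>A\<^esub> a, \<zero>)" if "a \<in> carrier A" for a
    by (rule U.minus_equality) (use that in \<open>auto simp: M.l_neg\<close>)
  have "submodule (carrier A \<times> {\<zero>}) K uA"
    by (rule U.submoduleI) (auto simp: i)
  from submodule.submodule_is_module[OF this unitization_module] show ?thesis
    by (simp add: omega_head_def)
qed

lemma omega_simps:
  "carrier Om = carrier (omega_space K A)" "add Om = add (omega_space K A)"
  "zero Om = zero (omega_space K A)" "smult Om = smult (omega_space K A)"
  by (simp_all add: omega_def Let_def)

lemma omega_module [simp]: "module K Om"
  by (rule module_transfer[OF word_space_module omega_simps]) auto

text \<open>
  The records \<open>omega_space K A\<close> and \<open>Om\<close> describe the same vector space. All statements are turned into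
  statements about \<open>Om\<close>, which also carries the product and the differential.
\<close>

lemma omega_space_eq:
  "carrier (omega_space K A) = carrier Om" "add (omega_space K A) = add Om"
  "zero (omega_space K A) = zero Om" "smult (omega_space K A) = smult Om"
  "finsum (omega_space K A) = finsum Om" "alt_sign (omega_space K A) = alt_sign Om"
  "lift K (omega_space K A) = lift K Om"
  "linear_map K (omega_space K A) = linear_map K Om"
  "linear_map K V (omega_space K A) = linear_map K V Om"
proof -
  note [simp] = omega_simps[symmetric]
  show 1: "carrier (omega_space K A) = carrier Om" "add (omega_space K A) = add Om"
    "zero (omega_space K A) = zero Om" "smult (omega_space K A) = smult Om" by simp_all
  show 2: "finsum (omega_space K A) = finsum Om" "alt_sign (omega_space K A) = alt_sign Om"
    using same_add_monoid[OF 1(1-3)] by simp_all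
  show "lift K (omega_space K A) = lift K Om"
    unfolding lift_def fun_eq_iff by (simp add: 1 2)
  show "linear_map K (omega_space K A) = linear_map K Om" "linear_map K V (omega_space K A) = linear_map K V Om"
    by (simp_all add: linear_map_def fun_eq_iff)
qed

lemma omega_word_closed [simp]:
  assumes "set as \<subseteq> carrier A" "h \<in> carrier (omega_head K A (length as))"
  shows "ow h as \<in> carrier Om"
  using word_closed[of UNIV "omega_head K A" A as h] assms by (simp add: omega_space_eq)

lemma omega_mlin_word: "mlin (omega_head K A) A UNIV Om ow"
  using mlin_word[of UNIV "omega_head K A" A] by (simp add: mlin_def omega_space_eq)

lemma lin_omega_lift:
  assumes "module K P" "mlin (omega_head K A) A UNIV P f"
  shows "lin Om P (\<lambda>X. sw P X f)"
  using lin_lift_word[of UNIV "omega_head K A" A P f] assms by (simp add: omega_space_eq)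

lemma omega_lift_word:
  assumes "module K P" "mlin (omega_head K A) A UNIV P f" "set as \<subseteq> carrier A"
    "h \<in> carrier (omega_head K A (length as))"
  shows "sw P (ow h as) f = f h as"
  using lift_word[of UNIV "omega_head K A" A P f] assms by simp

lemma lin_omega_head:
  assumes "set as \<subseteq> carrier A"
  shows "lin A Om (\<lambda>a. aw a as)"
    "lin (omega_head K A (length as)) Om (\<lambda>h. ow h as)"
proof -
  show 1: "lin (omega_head K A (length as)) Om (\<lambda>h. ow h as)"
    using mlinD(1)[OF omega_mlin_word] assms by simp
  have "lin A (omega_head K A (length as)) (\<lambda>a. (a, \<zero>))" by (rule linI) auto
  from lin_comp[OF 1 this] show "lin A Om (\<lambda>a. aw a as)" .
qed

lemma lin_omega_slot:
  assumes "set ys \<subseteq> carrier A" "set zs \<subseteq> carrier A" "h \<in> carrier (omega_head K A (Suc (length ys + length zs)))"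
  shows "lin A Om (\<lambda>x. ow h (ys @ x # zs))"
  using mlinD(2)[OF omega_mlin_word, of ys zs h] assms by simp

lemma lin_omega_hd:
  assumes "set zs \<subseteq> carrier A" "h \<in> carrier (omega_head K A (Suc (length zs)))"
  shows "lin A Om (\<lambda>x. ow h (x # zs))"
  using lin_omega_slot[of "[]" zs h] assms by simp

lemma omega_word_split:
  assumes "as \<noteq> []" "set as \<subseteq> carrier A" "a \<in> carrier A" "m \<in> carrier K"
  shows "ow (a, m) as = aw a as \<oplus>\<^bsub>Om\<^esub> m \<odot>\<^bsub>Om\<^esub> dw as"
proof -
  note l = lin_omega_head(2)[OF assms(2)]
  show ?thesis
    using assms lin_add[OF l, of "(a, \<zero>)" "(\<zero>\<^bsub>A\<^esub>, m)"] lin_smult[OF l, of m "(\<zero>\<^bsub>A\<^esub>, \<one>)"]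
    by simp
qed

text \<open>
  A word \<open>(a\<^sub>0 + m) da\<^sub>1 \<dots> da\<^sub>n\<close> is linear in its head, and \<open>m = 0\<close> if \<open>n = 0\<close>. So the words
  \<open>a\<^sub>0 da\<^sub>1 \<dots> da\<^sub>n\<close> and, for \<open>n > 0\<close>, \<open>da\<^sub>1 \<dots> da\<^sub>n\<close> span the algebra.
\<close>

lemma omega_induct [consumes 1, case_names plain diff add smult]:
  assumes "x \<in> carrier Om"
    and plain: "\<And>a as. a \<in> carrier A \<Longrightarrow> set as \<subseteq> carrier A \<Longrightarrow> Q (aw a as)"
    and diff: "\<And>a as. a \<in> carrier A \<Longrightarrow> set as \<subseteq> carrier A \<Longrightarrow> Q (dw (a # as))"
    and add: "\<And>x y. x \<in> carrier Om \<Longrightarrow> y \<in> carrier Om \<Longrightarrow> Q x \<Longrightarrow> Q y \<Longrightarrow> Q (x \<oplus>\<^bsub>Om\<^esub> y)"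
    and smult: "\<And>r x. r \<in> carrier K \<Longrightarrow> x \<in> carrier Om \<Longrightarrow> Q x \<Longrightarrow> Q (r \<odot>\<^bsub>Om\<^esub> x)"
  shows "Q x"
proof -
  have z: "Q \<zero>\<^bsub>Om\<^esub>" using smult[of "\<zero>", OF _ _ plain[of "\<zero>\<^bsub>A\<^esub>" "[]"]] by simp
  have "x \<in> carrier (omega_space K A)" using assms(1) by (simp add: omega_space_eq)
  then show ?thesis
  proof (induction x rule: word_induct[where H = "omega_head K A" and M = A and N = UNIV, OF omega_head_module algebra_module, consumes 1])
    case (1 h xs)
    obtain a m where h': "h = (a, m)" by (cases h)
    then have h: "h = (a, m)" "a \<in> carrier A" "m \<in> carrier K" "length xs = 0 \<longrightarrow> m = \<zero>"
      using 1(3) by auto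
    show ?case
    proof (cases xs)
      case Nil
      then show ?thesis using h plain[of a "[]"] by simp
    next
      case (Cons b bs)
      then have "ow h xs = aw a xs \<oplus>\<^bsub>Om\<^esub> m \<odot>\<^bsub>Om\<^esub> dw xs"
        unfolding h(1) using 1 h by (intro omega_word_split) auto
      then show ?thesis using Cons 1 h plain[of a xs] diff[of b bs] by (auto intro!: add smult)
    qed
  qed (use z add smult in \<open>simp_all add: omega_space_eq\<close>)
qed

lemma omega_eqI:
  assumes P: "module K P" and f: "lin Om P f" and g: "lin Om P g"
    and "\<And>a as. a \<in> carrier A \<Longrightarrow> set as \<subseteq> carrier A \<Longrightarrow> f (aw a as) = g (aw a as)"
    and "\<And>a as. a \<in> carrier A \<Longrightarrow> set as \<subseteq> carrier A \<Longrightarrow>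
      f (dw (a # as)) = g (dw (a # as))"
    and "x \<in> carrier Om"
  shows "f x = g x"
  using assms(6) by (induction x rule: omega_induct)
    (simp_all add: assms(4,5) lin_add[OF f] lin_add[OF g] lin_smult[OF f] lin_smult[OF g])

subsection \<open>The differential and the left multiplications\<close>

lemma omega_diff_mlin:
  "mlin (omega_head K A) A UNIV Om (\<lambda>h as. dw (fst h # as))"
proof (rule mlinI)
  fix xs assume xs: "set xs \<subseteq> carrier A"
  have "lin (omega_head K A (length xs)) A fst"
    by (rule linI) (auto elim!: omega_head_cases)
  from lin_comp[OF lin_omega_hd this, of xs "(\<zero>\<^bsub>A\<^esub>, \<one>)"] xs
  show "lin (omega_head K A (length xs)) Om (\<lambda>h. dw (fst h # xs))" by simp
next
  fix h ys zs
  assume "h \<in> carrier (omega_head K A (Suc (length ys + length zs)))" "set ys \<subseteq> carrier A" "set zs \<subseteq> carrier A"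
  then show "lin A Om (\<lambda>x. dw (fst h # ys @ x # zs))"
    using lin_omega_slot[of "fst h # ys" zs "(\<zero>\<^bsub>A\<^esub>, \<one>)"] by (auto elim!: omega_head_cases)
qed

lemma omega_diff_eq: "dg_diff Om = (\<lambda>x. sw Om x (\<lambda>h as. dw (fst h # as)))"
proof -
  have *: "(\<lambda>((a0, m), as). dw (a0 # as)) = (\<lambda>(h, as). dw (fst h # as))"
    by (auto simp: fun_eq_iff)
  have "dg_diff Om = lift K (omega_space K A) (\<lambda>((a0, m), as). dw (a0 # as))"
    by (simp add: omega_def Let_def)
  then show ?thesis unfolding * by (simp add: omega_space_eq)
qed

lemma lin_omega_diff: "lin Om Om (dg_diff Om)"
  unfolding omega_diff_eq by (rule lin_omega_lift[OF omega_module omega_diff_mlin])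

lemma omega_diff_closed [simp]: "x \<in> carrier Om \<Longrightarrow> dg_diff Om x \<in> carrier Om"
  by (rule lin_closed[OF lin_omega_diff])

lemma omega_diff_word:
  assumes "set as \<subseteq> carrier A" "h \<in> carrier (omega_head K A (length as))"
  shows "dg_diff Om (ow h as) = dw (fst h # as)"
  unfolding omega_diff_eq by (rule omega_lift_word[OF omega_module omega_diff_mlin assms])

lemma omega_word_zero [simp]:
  "set as \<subseteq> carrier A \<Longrightarrow> h \<in> carrier (omega_head K A (Suc (length as))) \<Longrightarrow> ow h (\<zero>\<^bsub>A\<^esub> # as) = \<zero>\<^bsub>Om\<^esub>"
  "set as \<subseteq> carrier A \<Longrightarrow> ow (\<zero>\<^bsub>A\<^esub>, \<zero>) as = \<zero>\<^bsub>Om\<^esub>"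
  using lin_zero[OF _ _ lin_omega_hd] lin_zero[OF _ _ lin_omega_head(1)] by simp_all

lemma omega_diff_diff: "x \<in> carrier Om \<Longrightarrow> dg_diff Om (dg_diff Om x) = \<zero>\<^bsub>Om\<^esub>"
  by (rule omega_eqI[OF omega_module lin_comp[OF lin_omega_diff lin_omega_diff] lin_zero_map])
    (simp_all add: omega_diff_word lin_zero[OF _ _ lin_omega_diff])

text \<open>
  The operator \<open>\<lambda>\<^sub>p\<close> of left multiplication by an element \<open>p\<close> of the unitization
\<close>

definition omega_left where
  "omega_left p x = sw Om x (\<lambda>q qs. ow (p \<otimes>\<^bsub>uA\<^esub> q) qs)"

lemma uA_mult_head:
  assumes "p \<in> carrier uA" "q \<in> carrier (omega_head K A n)"
  shows "p \<otimes>\<^bsub>uA\<^esub> q \<in> carrier (omega_head K A n)"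
  using assms by (auto elim!: omega_head_cases)

lemma lin_uA_mult:
  assumes "p \<in> carrier uA"
  shows "lin (omega_head K A n) (omega_head K A n) (\<lambda>q. p \<otimes>\<^bsub>uA\<^esub> q)"
proof (rule linI)
  fix q assume q: "q \<in> carrier (omega_head K A n)"
  show "p \<otimes>\<^bsub>uA\<^esub> q \<in> carrier (omega_head K A n)" by (rule uA_mult_head[OF assms q])
  { fix q' assume "q' \<in> carrier (omega_head K A n)"
    then show "p \<otimes>\<^bsub>uA\<^esub> (q \<oplus>\<^bsub>omega_head K A n\<^esub> q') = p \<otimes>\<^bsub>uA\<^esub> q \<oplus>\<^bsub>omega_head K A n\<^esub> p \<otimes>\<^bsub>uA\<^esub> q'"
      using q assms
      by (auto elim!: omega_head_cases simp: mult_add_right smult_r_distr smult_l_distr M.a_ac r_distr) }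
  { fix r assume "r \<in> carrier K"
    then show "p \<otimes>\<^bsub>uA\<^esub> (r \<odot>\<^bsub>omega_head K A n\<^esub> q) = r \<odot>\<^bsub>omega_head K A n\<^esub> (p \<otimes>\<^bsub>uA\<^esub> q)"
      using q assms
      by (auto elim!: omega_head_cases simp: mult_smult_right smult_r_distr m_ac simp flip: smult_assoc1) }
qed

lemma omega_left_mlin:
  assumes "p \<in> carrier uA"
  shows "mlin (omega_head K A) A UNIV Om (\<lambda>q qs. ow (p \<otimes>\<^bsub>uA\<^esub> q) qs)"
  by (rule mlinI) (auto intro!: lin_comp[OF lin_omega_head(2) lin_uA_mult] lin_omega_slot uA_mult_head assms
    simp del: omega_head_simps unitization_simps)

lemma lin_omega_left:
  assumes "p \<in> carrier uA" shows "lin Om Om (omega_left p)"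
  unfolding omega_left_def using lin_omega_lift[OF omega_module omega_left_mlin[OF assms]] by simp

lemma omega_left_closed [simp]: "p \<in> carrier uA \<Longrightarrow> x \<in> carrier Om \<Longrightarrow> omega_left p x \<in> carrier Om"
  by (rule lin_closed[OF lin_omega_left])

lemma omega_left_word:
  assumes "p \<in> carrier uA" "set as \<subseteq> carrier A" "h \<in> carrier (omega_head K A (length as))"
  shows "omega_left p (ow h as) = ow (p \<otimes>\<^bsub>uA\<^esub> h) as"
  unfolding omega_left_def by (rule omega_lift_word[OF omega_module omega_left_mlin assms(2,3)]) fact

lemma uA_mult_assoc:
  assumes "p \<in> carrier uA" "q \<in> carrier uA" "s \<in> carrier uA"
  shows "(p \<otimes>\<^bsub>uA\<^esub> q) \<otimes>\<^bsub>uA\<^esub> s = p \<otimes>\<^bsub>uA\<^esub> (q \<otimes>\<^bsub>uA\<^esub> s)"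
proof -
  show ?thesis using assms
    by (auto simp: mult_assoc mult_add_left mult_add_right mult_smult_left mult_smult_right
        smult_r_distr m_assoc M.a_ac m_ac simp flip: smult_assoc1)
qed

lemma omega_left_mult:
  assumes "p \<in> carrier uA" "q \<in> carrier uA" "x \<in> carrier Om"
  shows "omega_left (p \<otimes>\<^bsub>uA\<^esub> q) x = omega_left p (omega_left q x)"
proof (rule omega_eqI[OF omega_module _ lin_comp[OF lin_omega_left lin_omega_left] _ _ assms(3)])
  have pq: "p \<otimes>\<^bsub>uA\<^esub> q \<in> carrier uA" using assms by auto
  then show "lin Om Om (omega_left (p \<otimes>\<^bsub>uA\<^esub> q))" by (rule lin_omega_left)
  have *: "omega_left (p \<otimes>\<^bsub>uA\<^esub> q) (ow h as) = omega_left p (omega_left q (ow h as))"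
    if "h \<in> carrier (omega_head K A (length as))" "set as \<subseteq> carrier A" for h as
  proof -
    have "h \<in> carrier uA" using that by (auto elim!: omega_head_cases)
    then show ?thesis
      using that assms pq uA_mult_head[OF assms(2) that(1)]
      by (simp add: omega_left_word uA_mult_assoc del: unitization_simps)
  qed
  show "omega_left (p \<otimes>\<^bsub>uA\<^esub> q) (aw a as) = omega_left p (omega_left q (aw a as))"
    if "a \<in> carrier A" "set as \<subseteq> carrier A" for a as
    using that by (intro *) auto
  show "omega_left (p \<otimes>\<^bsub>uA\<^esub> q) (dw (a # as)) = omega_left p (omega_left q (dw (a # as)))"
    if "a \<in> carrier A" "set as \<subseteq> carrier A" for a as
    using that by (intro *) auto
qed (use assms in auto)

lemma lin_uA_mult_left:
  assumes "q \<in> carrier (omega_head K A n)"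
  shows "lin uA (omega_head K A n) (\<lambda>p. p \<otimes>\<^bsub>uA\<^esub> q)"
proof (rule linI)
  fix p assume p: "p \<in> carrier uA"
  show "p \<otimes>\<^bsub>uA\<^esub> q \<in> carrier (omega_head K A n)" by (rule uA_mult_head[OF p assms])
  { fix p' assume "p' \<in> carrier uA"
    then show "(p \<oplus>\<^bsub>uA\<^esub> p') \<otimes>\<^bsub>uA\<^esub> q = p \<otimes>\<^bsub>uA\<^esub> q \<oplus>\<^bsub>omega_head K A n\<^esub> p' \<otimes>\<^bsub>uA\<^esub> q"
      using p assms
      by (auto elim!: omega_head_cases simp: mult_add_left smult_r_distr smult_l_distr M.a_ac l_distr) }
  { fix r assume "r \<in> carrier K"
    then show "(r \<odot>\<^bsub>uA\<^esub> p) \<otimes>\<^bsub>uA\<^esub> q = r \<odot>\<^bsub>omega_head K A n\<^esub> (p \<otimes>\<^bsub>uA\<^esub> q)"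
      using p assms
      by (auto elim!: omega_head_cases simp: mult_smult_left smult_r_distr m_ac simp flip: smult_assoc1) }
qed

lemma lin_omega_left_elt:
  assumes "x \<in> carrier Om"
  shows "lin uA Om (\<lambda>p. omega_left p x)"
  unfolding omega_left_def
  by (rule lin_lift_word_param[of UNIV "omega_head K A" A])
    (use assms in \<open>auto simp: omega_space_eq intro!: lin_comp[OF lin_omega_head(2) lin_uA_mult_left]
      simp del: omega_head_simps unitization_simps\<close>)

lemma lin_omega_left_alg:
  assumes "x \<in> carrier Om"
  shows "lin A Om (\<lambda>a. omega_left (a, \<zero>) x)"
proof -
  have "lin A uA (\<lambda>a. (a, \<zero>))" by (rule linI) auto
  from lin_comp[OF lin_omega_left_elt[OF assms] this] show ?thesis .
qed

lemma omega_left_one [simp]: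
  assumes "x \<in> carrier Om"
  shows "omega_left (\<zero>\<^bsub>A\<^esub>, \<one>) x = x"
  by (rule omega_eqI[OF omega_module lin_omega_left lin_ident _ _ assms]) (simp_all add: omega_left_word)

lemma omega_left_split:
  assumes "x \<in> carrier Om" "a \<in> carrier A" "m \<in> carrier K"
  shows "omega_left (a, m) x = omega_left (a, \<zero>) x \<oplus>\<^bsub>Om\<^esub> m \<odot>\<^bsub>Om\<^esub> x"
  using lin_add[OF lin_omega_left_elt[OF assms(1)], of "(a, \<zero>)" "(\<zero>\<^bsub>A\<^esub>, m)"]
    lin_smult[OF lin_omega_left_elt[OF assms(1)], of m "(\<zero>\<^bsub>A\<^esub>, \<one>)"] assms
  by simp

text \<open>
  Left multiplication by \<open>da\<close>. The definition anticipates the Leibniz rule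
  \<open>d(a x) = da x + a dx\<close>, so that the rules \<open>da b = d(ab) - a db\<close> and \<open>d(da x) = - da dx\<close> follow from
  \<open>d d = 0\<close> and from the associativity of \<open>A\<close>.
\<close>

definition omega_dleft where
  "omega_dleft a x = dg_diff Om (omega_left (a, \<zero>) x) \<ominus>\<^bsub>Om\<^esub> omega_left (a, \<zero>) (dg_diff Om x)"

lemma omega_dleft_closed [simp]: "a \<in> carrier A \<Longrightarrow> x \<in> carrier Om \<Longrightarrow> omega_dleft a x \<in> carrier Om"
  by (simp add: omega_dleft_def)

lemma lin_omega_dleft: "a \<in> carrier A \<Longrightarrow> lin Om Om (omega_dleft a)"
  unfolding omega_dleft_def
  by (intro lin_minus_map lin_comp[OF lin_omega_diff] lin_omega_left lin_comp[OF lin_omega_left lin_omega_diff]) auto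

lemma lin_omega_dleft_elt: "x \<in> carrier Om \<Longrightarrow> lin A Om (\<lambda>a. omega_dleft a x)"
  unfolding omega_dleft_def
  by (intro lin_minus_map lin_comp[OF lin_omega_diff] lin_omega_left_alg) auto

lemma omega_dleft_plain:
  assumes "a \<in> carrier A" "b \<in> carrier A" "set bs \<subseteq> carrier A"
  shows "omega_dleft a (aw b bs) =
    dw ((a \<otimes>\<^bsub>A\<^esub> b) # bs) \<ominus>\<^bsub>Om\<^esub> aw a (b # bs)"
  using assms by (simp add: omega_dleft_def omega_left_word omega_diff_word)

lemma omega_dleft_diff:
  assumes "a \<in> carrier A" "set bs \<subseteq> carrier A" "bs \<noteq> []"
  shows "omega_dleft a (dw bs) = dw (a # bs)"
  using assms by (simp add: omega_dleft_def omega_left_word omega_diff_word lin_zero[OF _ _ lin_omega_left] a_minus_def)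

lemma omega_dleft_word:
  assumes "a \<in> carrier A" "set bs \<subseteq> carrier A" "(b, v) \<in> carrier (omega_head K A (length bs))"
  shows "omega_dleft a (ow (b, v) bs) =
    dw ((a \<otimes>\<^bsub>A\<^esub> b) # bs) \<ominus>\<^bsub>Om\<^esub> aw a (b # bs) \<oplus>\<^bsub>Om\<^esub>
      v \<odot>\<^bsub>Om\<^esub> dw (a # bs)"
proof (cases "bs = []")
  case True
  then show ?thesis using assms by (simp add: omega_dleft_plain)
next
  case False
  then show ?thesis
    using assms omega_word_split[OF False, of b v] lin_omega_dleft[OF assms(1)]
    by (simp add: lin_add lin_smult omega_dleft_plain omega_dleft_diff)
qed

text \<open>
  The rule \<open>da b = d(ab) - a db\<close>, as an identity of operators
\<close>

lemma omega_dleft_left: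
  assumes "a \<in> carrier A" "b \<in> carrier A" "x \<in> carrier Om"
  shows "omega_dleft a (omega_left (b, \<zero>) x) =
    omega_dleft (a \<otimes>\<^bsub>A\<^esub> b) x \<ominus>\<^bsub>Om\<^esub> omega_left (a, \<zero>) (omega_dleft b x)"
proof -
  interpret O: module K Om by simp
  have *: "omega_left (a, \<zero>) (omega_left (b, \<zero>) y) = omega_left (a \<otimes>\<^bsub>A\<^esub> b, \<zero>) y"
    if "y \<in> carrier Om" for y
    using omega_left_mult[of "(a, \<zero>)" "(b, \<zero>)" y] assms that by simp
  have l: "omega_left (a, \<zero>) (y \<ominus>\<^bsub>Om\<^esub> z) = omega_left (a, \<zero>) y \<ominus>\<^bsub>Om\<^esub> omega_left (a, \<zero>) z"
    if "y \<in> carrier Om" "z \<in> carrier Om" for y z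
    using that assms by (intro lin_minus[OF _ _ lin_omega_left]) auto
  have m: "x \<ominus>\<^bsub>Om\<^esub> y = x \<ominus>\<^bsub>Om\<^esub> z \<ominus>\<^bsub>Om\<^esub> (y \<ominus>\<^bsub>Om\<^esub> z)"
    if "x \<in> carrier Om" "y \<in> carrier Om" "z \<in> carrier Om" for x y z
  proof -
    have "x \<ominus>\<^bsub>Om\<^esub> z \<ominus>\<^bsub>Om\<^esub> (y \<ominus>\<^bsub>Om\<^esub> z) = (x \<ominus>\<^bsub>Om\<^esub> y) \<oplus>\<^bsub>Om\<^esub> (z \<oplus>\<^bsub>Om\<^esub> \<ominus>\<^bsub>Om\<^esub> z)"
      using that by (simp add: a_minus_def O.minus_add O.a_ac)
    then show ?thesis using that by (simp add: O.r_neg)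
  qed
  show ?thesis
    unfolding omega_dleft_def using assms by (simp add: * l m[symmetric])
qed

lemma omega_diff_dleft:
  assumes "a \<in> carrier A" "x \<in> carrier Om"
  shows "dg_diff Om (omega_dleft a x) = \<ominus>\<^bsub>Om\<^esub> omega_dleft a (dg_diff Om x)"
  using assms unfolding omega_dleft_def
  by (simp add: lin_minus[OF _ _ lin_omega_diff] omega_diff_diff lin_zero[OF _ _ lin_omega_left])
    (simp add: a_minus_def)

lemma omega_diff_left:
  assumes "a \<in> carrier A" "m \<in> carrier K" "x \<in> carrier Om"
  shows "dg_diff Om (omega_left (a, m) x) = omega_dleft a x \<oplus>\<^bsub>Om\<^esub> omega_left (a, m) (dg_diff Om x)"
proof -
  interpret O: module K Om by simp
  show ?thesis
    using assms unfolding omega_dleft_def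
    by (simp add: omega_left_split[of _ a m] lin_add[OF lin_omega_diff] lin_smult[OF lin_omega_diff] a_minus_def O.a_ac)
      (simp add: O.r_neg flip: O.a_assoc)
qed

lemma omega_dlefts_closed [simp]:
  "set as \<subseteq> carrier A \<Longrightarrow> x \<in> carrier Om \<Longrightarrow> foldr omega_dleft as x \<in> carrier Om"
  by (induction as) auto

lemma lin_omega_dlefts: "set as \<subseteq> carrier A \<Longrightarrow> lin Om Om (foldr omega_dleft as)"
  by (induction as) (auto simp: lin_id o_def intro!: lin_comp[OF lin_omega_dleft])

lemma omega_dlefts_diff:
  assumes "set as \<subseteq> carrier A" "set bs \<subseteq> carrier A" "bs \<noteq> []"
  shows "foldr omega_dleft as (dw bs) = dw (as @ bs)"
  using assms by (induction as) (simp_all add: omega_dleft_diff)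

lemma omega_diff_dlefts:
  assumes "set as \<subseteq> carrier A" "x \<in> carrier Om"
  shows "dg_diff Om (foldr omega_dleft as x) = alt_sign Om (length as) (foldr omega_dleft as (dg_diff Om x))"
  using assms
  by (induction as) (auto simp: alt_sign_def omega_diff_dleft lin_neg[OF _ _ lin_omega_dleft])

subsection \<open>The product\<close>

lemma contract_Cons: "contract A (Suc i) (a # as) = a # contract A i as"
  by (simp add: contract_def)

lemma contract_closed [simp]:
  assumes "set as \<subseteq> carrier A" "Suc i < length as"
  shows "set (contract A i as) \<subseteq> carrier A"
  using assms set_take_subset[of i as] set_drop_subset[of "Suc (Suc i)" as]
  by (auto simp: contract_def intro!: mult_closed)

text \<open>
  Iterating \<open>da b = d(ab) - a db\<close> yields the explicit formula for the product.
\<close>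

lemma omega_dlefts_word:
  assumes "as \<noteq> []" "set as \<subseteq> carrier A" "set bs \<subseteq> carrier A" "(b, v) \<in> carrier (omega_head K A (length bs))"
  shows "foldr omega_dleft as (ow (b, v) bs) =
    dw (butlast as @ (last as \<otimes>\<^bsub>A\<^esub> b) # bs)
    \<oplus>\<^bsub>Om\<^esub> (\<Oplus>\<^bsub>Om\<^esub>l\<in>{1..length as - 1}. alt_sign Om (length as - l) (dw (contract A (l - 1) as @ b # bs)))
    \<oplus>\<^bsub>Om\<^esub> alt_sign Om (length as) (aw (hd as) (tl as @ b # bs))
    \<oplus>\<^bsub>Om\<^esub> v \<odot>\<^bsub>Om\<^esub> dw (as @ bs)"
  using assms(1,2)
proof (induction as rule: list_nonempty_induct)
  case (single a)
  interpret O: module K Om by simp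
  show ?case using single assms(3,4)
    by (simp add: omega_dleft_word alt_sign_def a_minus_def)
next
  case (cons a as)
  interpret O: module K Om by simp
  let ?w = "dw" and ?i = "length as"
  let ?F = "?w (butlast as @ (last as \<otimes>\<^bsub>A\<^esub> b) # bs)" and ?V = "v \<odot>\<^bsub>Om\<^esub> ?w (as @ bs)"
  let ?s = "\<lambda>l. alt_sign Om (?i - l) (?w (contract A (l - 1) as @ b # bs))"
  let ?Y = "aw (hd as) (tl as @ b # bs)"
  have a: "a \<in> carrier A" "set as \<subseteq> carrier A" "b \<in> carrier A" "v \<in> carrier K" "as \<noteq> []" "hd as \<in> carrier A"
    "last as \<in> carrier A" "set (butlast as) \<subseteq> carrier A" "set (tl as) \<subseteq> carrier A" "set bs \<subseteq> carrier A"
    using cons assms(3,4) list.set_sel(2) in_set_butlastD by (auto simp: subset_iff dest: in_set_butlastD list.set_sel(2)[rotated])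
  have c: "set (contract A (l - 1) as) \<subseteq> carrier A" if "l \<in> {1..?i - 1}" for l
    using that a by (intro contract_closed) auto
  note L = lin_omega_dleft[OF a(1)]
  have sc: "?s l \<in> carrier Om" if "l \<in> {1..?i - 1}" for l
    using c[OF that] a by simp
  have Sc: "(\<Oplus>\<^bsub>Om\<^esub>l\<in>{1..?i - 1}. ?s l) \<in> carrier Om"
    using sc by (intro mod_finsum_closed) auto
  let ?t = "\<lambda>l. alt_sign Om (Suc ?i - l) (?w (contract A (l - 1) (a # as) @ b # bs))"
  have "omega_dleft a (\<Oplus>\<^bsub>Om\<^esub>l\<in>{1..?i - 1}. ?s l) = (\<Oplus>\<^bsub>Om\<^esub>l\<in>{1..?i - 1}. omega_dleft a (?s l))"
    using sc by (intro lin_finsum[OF _ _ L]) auto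
  also have "\<dots> = (\<Oplus>\<^bsub>Om\<^esub>l\<in>{1..?i - 1}. ?t (Suc l))"
  proof (rule O.finsum_cong', rule refl)
    fix l assume l: "l \<in> {1..?i - 1}"
    then obtain l' where l': "l = Suc l'" by (cases l) auto
    show "omega_dleft a (?s l) = ?t (Suc l)"
      using c[OF l] a by (simp add: lin_alt_sign[OF _ _ L] omega_dleft_diff l' contract_Cons)
  next
    show "(\<lambda>l. ?t (Suc l)) \<in> {1..?i - 1} \<rightarrow> carrier Om"
    proof
      fix l assume l: "l \<in> {1..?i - 1}"
      then obtain l' where l': "l = Suc l'" by (cases l) auto
      show "?t (Suc l) \<in> carrier Om" using c[OF l] a by (simp add: l' contract_Cons)
    qed
  qed
  finally have S: "omega_dleft a (\<Oplus>\<^bsub>Om\<^esub>l\<in>{1..?i - 1}. ?s l) = (\<Oplus>\<^bsub>Om\<^esub>l\<in>{1..?i - 1}. ?t (Suc l))" .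
  have tc: "?t \<in> {1..?i} \<rightarrow> carrier Om"
  proof
    fix l assume "l \<in> {1..?i}"
    then have "set (contract A (l - 1) (a # as)) \<subseteq> carrier A" using a by (intro contract_closed) auto
    then show "?t l \<in> carrier Om" using a by simp
  qed
  have "{1..?i} = insert 1 (Suc ` {1..?i - 1})"
    using a(5) by (cases as) (auto simp: image_Suc_atLeastAtMost)
  then have "(\<Oplus>\<^bsub>Om\<^esub>l\<in>{1..?i}. ?t l) = ?t 1 \<oplus>\<^bsub>Om\<^esub> (\<Oplus>\<^bsub>Om\<^esub>l\<in>Suc ` {1..?i - 1}. ?t l)"
    using tc by (simp only:) (rule O.finsum_insert, auto)
  also have "(\<Oplus>\<^bsub>Om\<^esub>l\<in>Suc ` {1..?i - 1}. ?t l) = (\<Oplus>\<^bsub>Om\<^esub>l\<in>{1..?i - 1}. ?t (Suc l))"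
    using tc by (intro O.finsum_reindex) (auto simp: Pi_def)
  finally have T: "(\<Oplus>\<^bsub>Om\<^esub>l\<in>{1..?i}. ?t l) = ?t 1 \<oplus>\<^bsub>Om\<^esub> omega_dleft a (\<Oplus>\<^bsub>Om\<^esub>l\<in>{1..?i - 1}. ?s l)"
    by (simp only: S)
  have t1: "?t 1 = alt_sign Om ?i (?w ((a \<otimes>\<^bsub>A\<^esub> hd as) # tl as @ b # bs))"
    using a(5) by (cases as) (auto simp: contract_def)
  have Y: "omega_dleft a ?Y = ?w ((a \<otimes>\<^bsub>A\<^esub> hd as) # tl as @ b # bs) \<ominus>\<^bsub>Om\<^esub> aw a (as @ b # bs)"
    using a by (cases as) (simp_all add: omega_dleft_plain)
  have tc1: "?w ((a \<otimes>\<^bsub>A\<^esub> hd as) # tl as @ b # bs) \<in> carrier Om" using a by simp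
  have alt: "alt_sign Om i (x \<ominus>\<^bsub>Om\<^esub> y) = alt_sign Om i x \<oplus>\<^bsub>Om\<^esub> alt_sign Om (Suc i) y"
    if "x \<in> carrier Om" "y \<in> carrier Om" for i x y
    using that by (simp add: alt_sign_def a_minus_def O.minus_add)
  have "foldr omega_dleft (a # as) (ow (b, v) bs) =
      omega_dleft a (?F \<oplus>\<^bsub>Om\<^esub> (\<Oplus>\<^bsub>Om\<^esub>l\<in>{1..?i - 1}. ?s l) \<oplus>\<^bsub>Om\<^esub> alt_sign Om ?i ?Y \<oplus>\<^bsub>Om\<^esub> ?V)"
    using cons.IH cons.prems by simp
  also have "\<dots> = ?w (a # butlast as @ (last as \<otimes>\<^bsub>A\<^esub> b) # bs) \<oplus>\<^bsub>Om\<^esub> omega_dleft a (\<Oplus>\<^bsub>Om\<^esub>l\<in>{1..?i - 1}. ?s l)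
      \<oplus>\<^bsub>Om\<^esub> alt_sign Om ?i (omega_dleft a ?Y) \<oplus>\<^bsub>Om\<^esub> v \<odot>\<^bsub>Om\<^esub> ?w (a # as @ bs)"
    using a Sc by (simp add: lin_add[OF L] lin_smult[OF L] lin_alt_sign[OF _ _ L] omega_dleft_diff)
  also have "\<dots> = ?w (a # butlast as @ (last as \<otimes>\<^bsub>A\<^esub> b) # bs) \<oplus>\<^bsub>Om\<^esub> (\<Oplus>\<^bsub>Om\<^esub>l\<in>{1..?i}. ?t l)
      \<oplus>\<^bsub>Om\<^esub> alt_sign Om (Suc ?i) (aw a (as @ b # bs)) \<oplus>\<^bsub>Om\<^esub> v \<odot>\<^bsub>Om\<^esub> ?w (a # as @ bs)"
    unfolding T t1 Y using a Sc tc1 by (simp add: alt O.a_ac)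
  finally show ?case using a(5) by simp
qed

text \<open>
  A word \<open>p dp\<^sub>1 \<dots> dp\<^sub>i\<close> acts from the left as the composite of the operators \<open>\<lambda>\<^sub>p\<close> and
  \<open>\<delta>\<^bsub>p\<^sub>1\<^esub>, \<dots>, \<delta>\<^bsub>p\<^sub>i\<^esub>\<close>, where \<open>\<delta>\<^sub>a = omega_dleft a\<close>. This description replaces the explicit formula in all
  that follows.
\<close>

lemma omega_mult_words_eq:
  assumes "(p, ps) \<in> words (omega_head K A) A UNIV" "(q, qs) \<in> words (omega_head K A) A UNIV"
  shows "omega_mult_words K A (p, ps) (q, qs) = omega_left p (foldr omega_dleft ps (ow q qs))"
proof -
  have ps: "set ps \<subseteq> carrier A" "set qs \<subseteq> carrier A" "p \<in> carrier uA"
    and p: "p \<in> carrier (omega_head K A (length ps))" and q: "q \<in> carrier (omega_head K A (length qs))"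
    using assms by (auto simp: words_iff elim!: omega_head_cases)
  obtain q0 v where q': "q = (q0, v)" "q0 \<in> carrier A" "v \<in> carrier K" using q by (auto elim: omega_head_cases)
  show ?thesis
  proof (cases "ps = []")
    case True
    then show ?thesis
      using ps q by (simp add: omega_mult_words_def Let_def omega_left_word q'(1))
  next
    case False
    interpret O: module K Om by simp
    have h: "hd ps \<in> carrier A" "last ps \<in> carrier A" "set (butlast ps) \<subseteq> carrier A" "set (tl ps) \<subseteq> carrier A"
      using False ps by (auto simp: subset_iff dest: in_set_butlastD list.set_sel(2)[rotated])
    have c: "set (contract A (l - 1) ps) \<subseteq> carrier A" if "l \<in> {1..length ps - 1}" for l
      using that ps False by (intro contract_closed) auto
    have p1: "p \<otimes>\<^bsub>uA\<^esub> (\<zero>\<^bsub>A\<^esub>, \<one>) = p" using ps(3) by auto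
    note L = lin_omega_left[OF ps(3)]
    let ?s = "\<lambda>w l. alt_sign Om (length ps - l) (w (contract A (l - 1) ps @ q0 # qs))"
    have w: "omega_left p (dw as) = ow p as" if "as \<noteq> []" "set as \<subseteq> carrier A" for as
      using that ps by (simp add: omega_left_word p1 del: unitization_simps)
    have sc: "?s (dw) l \<in> carrier Om" if "l \<in> {1..length ps - 1}" for l
      using c[OF that] ps q' by simp
    have Sc: "(\<Oplus>\<^bsub>Om\<^esub>l\<in>{1..length ps - 1}. ?s (dw) l) \<in> carrier Om"
      using sc by (intro mod_finsum_closed) auto
    have "omega_left p (\<Oplus>\<^bsub>Om\<^esub>l\<in>{1..length ps - 1}. ?s (dw) l) =
        (\<Oplus>\<^bsub>Om\<^esub>l\<in>{1..length ps - 1}. omega_left p (?s (dw) l))"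
      using sc by (intro lin_finsum[OF _ _ L]) auto
    also have "\<dots> = (\<Oplus>\<^bsub>Om\<^esub>l\<in>{1..length ps - 1}. ?s (ow p) l)"
    proof (rule O.finsum_cong', rule refl)
      fix l assume l: "l \<in> {1..length ps - 1}"
      show "omega_left p (?s (dw) l) = ?s (ow p) l"
        using c[OF l] ps q' by (simp add: lin_alt_sign[OF _ _ L] w del: unitization_simps)
    next
      show "?s (ow p) \<in> {1..length ps - 1} \<rightarrow> carrier Om"
        using c ps(2) q'(2) ps(3) by (auto simp: subset_iff intro!: mod_closed(6))
    qed
    finally have S: "omega_left p (\<Oplus>\<^bsub>Om\<^esub>l\<in>{1..length ps - 1}. ?s (dw) l) = (\<Oplus>\<^bsub>Om\<^esub>l\<in>{1..length ps - 1}. ?s (ow p) l)" .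
    have y: "omega_left p (aw (hd ps) (tl ps @ q0 # qs)) = ow (p \<otimes>\<^bsub>uA\<^esub> (hd ps, \<zero>)) (tl ps @ q0 # qs)"
      using ps h q' by (simp add: omega_left_word del: unitization_simps)
    have "omega_left p (foldr omega_dleft ps (ow q qs)) =
       ow p (butlast ps @ (last ps \<otimes>\<^bsub>A\<^esub> q0) # qs)
       \<oplus>\<^bsub>Om\<^esub> (\<Oplus>\<^bsub>Om\<^esub>l\<in>{1..length ps - 1}. ?s (ow p) l)
       \<oplus>\<^bsub>Om\<^esub> alt_sign Om (length ps) (ow (p \<otimes>\<^bsub>uA\<^esub> (hd ps, \<zero>)) (tl ps @ q0 # qs))
       \<oplus>\<^bsub>Om\<^esub> v \<odot>\<^bsub>Om\<^esub> ow p (ps @ qs)"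
      using ps h q q' False Sc
      by (simp add: q'(1) omega_dlefts_word[OF False] lin_add[OF L] lin_smult[OF L] lin_alt_sign[OF _ _ L] S y w
          del: unitization_simps One_nat_def)
    then show ?thesis
      using False by (simp add: omega_mult_words_def Let_def q'(1) omega_space_eq)
  qed
qed

lemma omega_mult_eq:
  assumes "x \<in> carrier Om" "y \<in> carrier Om"
  shows "x \<cdot> y = sw Om x (\<lambda>p ps. omega_left p (foldr omega_dleft ps y))"
proof -
  note U = lift_word_cong[of UNIV "omega_head K A" A Om, unfolded omega_space_eq]
  note V = lin_of_lift_word[of UNIV "omega_head K A" A Om Om, unfolded omega_space_eq]
  have "x \<cdot> y = lift K (omega_space K A) (\<lambda>p. lift K (omega_space K A) (\<lambda>q. omega_mult_words K A p q) y) x"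
    by (simp add: omega_def Let_def)
  also have "\<dots> = sw Om x (\<lambda>p ps. sw Om y (\<lambda>q qs. omega_mult_words K A (p, ps) (q, qs)))"
    unfolding omega_space_eq by (simp add: case_prod_unfold)
  also have "\<dots> = sw Om x (\<lambda>p ps. omega_left p (foldr omega_dleft ps y))"
  proof (rule U[symmetric])
    fix p ps assume p: "set ps \<subseteq> carrier A" "p \<in> carrier (omega_head K A (length ps))"
    then have p': "p \<in> carrier uA" by (auto elim!: omega_head_cases)
    then show "omega_left p (foldr omega_dleft ps y) \<in> carrier Om" using p assms by simp
    have L: "lin Om Om (\<lambda>y. omega_left p (foldr omega_dleft ps y))"
      by (intro lin_comp[OF lin_omega_left lin_omega_dlefts] p p')
    have "sw Om y ow = y"
      using lift_word_self[of UNIV "omega_head K A" A y] assms by (simp add: omega_space_eq)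
    then have "omega_left p (foldr omega_dleft ps y) = omega_left p (foldr omega_dleft ps (sw Om y ow))" by simp
    also have "\<dots> = sw Om y (\<lambda>q qs. omega_left p (foldr omega_dleft ps (ow q qs)))"
      using V[OF _ _ _ _ L] assms by simp
    also have "\<dots> = sw Om y (\<lambda>q qs. omega_mult_words K A (p, ps) (q, qs))"
      by (rule U) (use p p' assms in \<open>auto simp: omega_mult_words_eq words_iff simp del: unitization_simps\<close>)
    finally show "omega_left p (foldr omega_dleft ps y) = sw Om y (\<lambda>q qs. omega_mult_words K A (p, ps) (q, qs))" .
  qed (use assms in auto)
  finally show ?thesis .
qed

end

context nonunital_algebra
begin

subsection \<open>The differential graded algebra\<close>

lemma omega_mult_mlin:
  assumes y: "y \<in> carrier Om"
  shows "mlin (omega_head K A) A UNIV Om (\<lambda>p ps. omega_left p (foldr omega_dleft ps y))"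
proof (rule mlinI)
  fix xs assume xs: "set xs \<subseteq> carrier A"
  have i: "lin (omega_head K A (length xs)) uA (\<lambda>p. p)"
    by (rule linI) (auto elim!: omega_head_cases)
  show "lin (omega_head K A (length xs)) Om (\<lambda>p. omega_left p (foldr omega_dleft xs y))"
    by (rule lin_comp[OF lin_omega_left_elt i]) (use xs y in simp)
next
  fix h ys zs
  assume *: "h \<in> carrier (omega_head K A (Suc (length ys + length zs)))" "set ys \<subseteq> carrier A" "set zs \<subseteq> carrier A"
  then have h: "h \<in> carrier uA" by (auto elim!: omega_head_cases)
  show "lin A Om (\<lambda>x. omega_left h (foldr omega_dleft (ys @ x # zs) y))"
    using * h y
    by (auto simp del: unitization_simps
        intro!: lin_comp[OF lin_omega_left] lin_comp[OF lin_omega_dlefts] lin_omega_dleft_elt)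
qed

lemma omega_word_mult:
  assumes "set ps \<subseteq> carrier A" "p \<in> carrier (omega_head K A (length ps))" "y \<in> carrier Om"
  shows "ow p ps \<cdot> y = omega_left p (foldr omega_dleft ps y)"
  using assms by (simp add: omega_mult_eq omega_lift_word[OF omega_module omega_mult_mlin])

lemma omega_bilin: "bilin Om Om Om (\<lambda>x y. x \<cdot> y)"
proof (rule bilinI)
  fix x assume x: "x \<in> carrier Om"
  have "lin Om Om (\<lambda>y. sw Om x (\<lambda>p ps. omega_left p (foldr omega_dleft ps y)))"
  proof (rule lin_lift_word_param[of UNIV "omega_head K A" A])
    fix p ps assume *: "set ps \<subseteq> carrier A" "p \<in> carrier (omega_head K A (length ps))"
    then have p: "p \<in> carrier uA" by (auto elim!: omega_head_cases)
    show "lin Om Om (\<lambda>y. omega_left p (foldr omega_dleft ps y))"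
      by (intro lin_comp[OF lin_omega_left lin_omega_dlefts] p *)
  qed (use x in \<open>auto simp: omega_space_eq\<close>)
  then show "lin Om Om (\<lambda>y. x \<cdot> y)"
    by (rule lin_cong) (simp_all add: omega_mult_eq x)
next
  fix y assume y: "y \<in> carrier Om"
  show "lin Om Om (\<lambda>x. x \<cdot> y)"
    by (rule lin_cong[OF lin_omega_lift[OF omega_module omega_mult_mlin[OF y]]]) (simp_all add: omega_mult_eq y)
qed

lemma omega_mult_closed [simp]: "x \<in> carrier Om \<Longrightarrow> y \<in> carrier Om \<Longrightarrow> x \<cdot> y \<in> carrier Om"
  by (rule bilinD(3)[OF omega_bilin])

lemmas lin_omega_mult = bilinD(1,2)[OF omega_bilin]

text \<open>
  By the description of the product by operators, associativity amounts to the statement that the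
  operators \<open>\<lambda>\<^sub>p\<close> and \<open>\<delta>\<^sub>a\<close> commute with right multiplications.
\<close>

lemma omega_left_assoc:
  assumes "a \<in> carrier A" "y \<in> carrier Om" "z \<in> carrier Om"
  shows "omega_left (a, \<zero>) y \<cdot> z = omega_left (a, \<zero>) (y \<cdot> z)"
proof (rule omega_eqI[OF omega_module _ _ _ _ assms(2)])
  show "lin Om Om (\<lambda>y. omega_left (a, \<zero>) y \<cdot> z)"
    "lin Om Om (\<lambda>y. omega_left (a, \<zero>) (y \<cdot> z))"
    using assms by (auto intro!: lin_comp[OF lin_omega_mult(2)] lin_omega_left lin_comp[OF lin_omega_left] lin_omega_mult(2))
next
  fix b bs assume b: "b \<in> carrier A" "set bs \<subseteq> carrier A"
  show "omega_left (a, \<zero>) (aw b bs) \<cdot> z = omega_left (a, \<zero>) (aw b bs \<cdot> z)"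
    using assms b omega_left_mult[of "(a, \<zero>)" "(b, \<zero>)"]
    by (simp add: omega_left_word omega_word_mult)
  show "omega_left (a, \<zero>) (dw (b # bs)) \<cdot> z =
      omega_left (a, \<zero>) (dw (b # bs) \<cdot> z)"
    using assms b by (simp add: omega_left_word omega_word_mult)
qed

lemma omega_dleft_assoc:
  assumes a: "a \<in> carrier A" and "y \<in> carrier Om" and z: "z \<in> carrier Om"
  shows "omega_dleft a y \<cdot> z = omega_dleft a (y \<cdot> z)"
proof (rule omega_eqI[OF omega_module _ _ _ _ assms(2)])
  show "lin Om Om (\<lambda>y. omega_dleft a y \<cdot> z)" "lin Om Om (\<lambda>y. omega_dleft a (y \<cdot> z))"
    using assms by (auto intro!: lin_comp[OF lin_omega_mult(2)] lin_omega_dleft lin_comp[OF lin_omega_dleft] lin_omega_mult(2))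
next
  fix b bs assume b: "b \<in> carrier A" "set bs \<subseteq> carrier A"
  show "omega_dleft a (aw b bs) \<cdot> z = omega_dleft a (aw b bs \<cdot> z)"
    using a z b
    by (simp add: omega_dleft_plain omega_word_mult omega_dleft_left lin_minus[OF _ _ lin_omega_mult(2)[OF z]])
  show "omega_dleft a (dw (b # bs)) \<cdot> z = omega_dleft a (dw (b # bs) \<cdot> z)"
    using a z b by (simp add: omega_dleft_diff omega_word_mult)
qed

lemma omega_dlefts_assoc:
  assumes "set as \<subseteq> carrier A" "y \<in> carrier Om" "z \<in> carrier Om"
  shows "foldr omega_dleft as y \<cdot> z = foldr omega_dleft as (y \<cdot> z)"
  using assms by (induction as) (simp_all add: omega_dleft_assoc)

lemma omega_mult_assoc:
  assumes "x \<in> carrier Om" "y \<in> carrier Om" "z \<in> carrier Om"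
  shows "(x \<cdot> y) \<cdot> z = x \<cdot> (y \<cdot> z)"
proof (rule omega_eqI[OF omega_module _ lin_omega_mult(2) _ _ assms(1)])
  show "lin Om Om (\<lambda>x. x \<cdot> y \<cdot> z)"
    using assms by (intro lin_comp[OF lin_omega_mult(2) lin_omega_mult(2)])
qed (use assms in \<open>simp_all add: omega_word_mult omega_left_assoc omega_dleft_assoc omega_dlefts_assoc\<close>)

lemma omega_algebra: "nonunital_algebra K Om"
  by (intro nonunital_algebra.intro nonunital_algebra_axioms.intro field_axioms omega_module)
    (simp_all add: omega_mult_assoc lin_add[OF lin_omega_mult(1)] lin_add[OF lin_omega_mult(2)]
      lin_smult[OF lin_omega_mult(1)] lin_smult[OF lin_omega_mult(2)])

lemma omega_part_eq:
  "dg_part Om n = lin_span K (omega_space K A) {ow p ps | p ps. (p, ps) \<in> words (omega_head K A) A {n}}"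
  by (simp add: omega_def Let_def)

lemma omega_space_module: "module K (omega_space K A)"
  by (rule word_space_module) auto

lemma omega_gens_closed:
  "{ow p ps | p ps. (p, ps) \<in> words (omega_head K A) A {n}} \<subseteq> carrier (omega_space K A)"
  by (auto simp: omega_space_eq words_iff)

lemma omega_part_submodule: "submodule (dg_part Om n) K Om"
  unfolding omega_part_eq
  by (rule submodule_transfer[OF lin_span_submodule[OF omega_space_module omega_gens_closed] omega_space_module])
    (simp_all add: omega_space_eq)

lemma omega_part_closed: "x \<in> dg_part Om n \<Longrightarrow> x \<in> carrier Om"
  by (rule submodule_closed(2)[OF omega_module omega_part_submodule])

lemma omega_word_part:
  "set ps \<subseteq> carrier A \<Longrightarrow> p \<in> carrier (omega_head K A (length ps)) \<Longrightarrow> ow p ps \<in> dg_part Om (length ps)"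
  unfolding omega_part_eq by (intro lin_span_incl CollectI exI conjI refl) (simp_all add: words_iff)

lemma omega_part_least:
  assumes "submodule N K Om" and x: "x \<in> dg_part Om n"
    and w: "\<And>p ps. length ps = n \<Longrightarrow> set ps \<subseteq> carrier A \<Longrightarrow> p \<in> carrier (omega_head K A (length ps)) \<Longrightarrow> ow p ps \<in> N"
  shows "x \<in> N"
proof (rule lin_span_least[OF _ _ x[unfolded omega_part_eq]])
  show "submodule N K (omega_space K A)"
    by (rule submodule_transfer[OF assms(1) omega_module]) (simp_all add: omega_space_eq)
qed (use w in \<open>auto simp: words_iff\<close>)

lemma omega_part_eqI:
  assumes "module K P" "lin Om P f" "lin Om P g" "x \<in> dg_part Om n"
    and "\<And>p ps. length ps = n \<Longrightarrow> set ps \<subseteq> carrier A \<Longrightarrow> p \<in> carrier (omega_head K A (length ps)) \<Longrightarrow>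
      f (ow p ps) = g (ow p ps)"
  shows "f x = g x"
  using omega_part_least[OF lin_eq_submodule[OF omega_module assms(1-3)] assms(4)] assms(5) by auto

lemma omega_part_into:
  assumes "lin Om Om f" "x \<in> dg_part Om n"
    and "\<And>p ps. length ps = n \<Longrightarrow> set ps \<subseteq> carrier A \<Longrightarrow> p \<in> carrier (omega_head K A (length ps)) \<Longrightarrow>
      f (ow p ps) \<in> dg_part Om m"
  shows "f x \<in> dg_part Om m"
  using omega_part_least[OF lin_preimage_submodule[OF omega_module omega_module assms(1) omega_part_submodule] assms(2)] assms(3)
  by auto

lemma omega_diff_part: "x \<in> dg_part Om n \<Longrightarrow> dg_diff Om x \<in> dg_part Om (Suc n)"
proof (rule omega_part_into[OF lin_omega_diff])
  fix p ps assume *: "length ps = n" "set ps \<subseteq> carrier A" "p \<in> carrier (omega_head K A (length ps))"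
  then have "fst p \<in> carrier A" by (auto elim!: omega_head_cases)
  then have "dw (fst p # ps) \<in> dg_part Om (length (fst p # ps))"
    using * by (intro omega_word_part) auto
  then show "dg_diff Om (ow p ps) \<in> dg_part Om (Suc n)" using * by (simp add: omega_diff_word)
qed

lemma omega_left_part:
  assumes "p \<in> carrier uA" "x \<in> dg_part Om n"
  shows "omega_left p x \<in> dg_part Om n"
proof (rule omega_part_into[OF lin_omega_left assms(2)])
  fix q qs assume "length qs = n" "set qs \<subseteq> carrier A" "q \<in> carrier (omega_head K A (length qs))"
  then show "omega_left p (ow q qs) \<in> dg_part Om n"
    using omega_word_part[of qs "p \<otimes>\<^bsub>uA\<^esub> q"] assms(1)
    by (simp add: omega_left_word uA_mult_head del: unitization_simps)
qed (rule assms(1))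

lemma omega_dleft_part:
  assumes "a \<in> carrier A" "x \<in> dg_part Om n"
  shows "omega_dleft a x \<in> dg_part Om (Suc n)"
  unfolding omega_dleft_def using assms
  by (intro submodule_closed(5)[OF omega_module omega_part_submodule] omega_left_part omega_diff_part) auto

lemma omega_dlefts_part:
  "set as \<subseteq> carrier A \<Longrightarrow> x \<in> dg_part Om n \<Longrightarrow> foldr omega_dleft as x \<in> dg_part Om (length as + n)"
  by (induction as) (auto intro: omega_dleft_part)

lemma omega_mult_part:
  assumes "x \<in> dg_part Om i" "y \<in> dg_part Om j"
  shows "x \<cdot> y \<in> dg_part Om (i + j)"
proof (rule omega_part_into[OF lin_omega_mult(2) assms(1)])
  show y: "y \<in> carrier Om" using assms(2) by (rule omega_part_closed)
  fix p ps assume *: "length ps = i" "set ps \<subseteq> carrier A" "p \<in> carrier (omega_head K A (length ps))"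
  then have "p \<in> carrier uA" by (auto elim!: omega_head_cases)
  then show "ow p ps \<cdot> y \<in> dg_part Om (i + j)"
    using omega_left_part[OF _ omega_dlefts_part[OF *(2) assms(2)]] * y by (simp add: omega_word_mult)
qed

text \<open>
  Both \<open>d \<lambda>\<^sub>p = \<delta>\<^sub>p + \<lambda>\<^sub>p d\<close> and \<open>d \<delta>\<^sub>a = - \<delta>\<^sub>a d\<close> are immediate from the definition of \<open>\<delta>\<^sub>a\<close> and
  \<open>d d = 0\<close>. Moving \<open>d\<close> past the operators of a word of length \<open>i\<close> gives the rule with its sign.
\<close>

lemma omega_leibniz:
  assumes x: "x \<in> dg_part Om i" and y: "y \<in> carrier Om"
  shows "dg_diff Om (x \<cdot> y) = dg_diff Om x \<cdot> y \<oplus>\<^bsub>Om\<^esub> alt_sign Om i (x \<cdot> dg_diff Om y)"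
proof (rule omega_part_eqI[OF omega_module _ _ x])
  show "lin Om Om (\<lambda>x. dg_diff Om (x \<cdot> y))"
    "lin Om Om (\<lambda>x. dg_diff Om x \<cdot> y \<oplus>\<^bsub>Om\<^esub> alt_sign Om i (x \<cdot> dg_diff Om y))"
    using y
    by (intro lin_comp[OF lin_omega_diff lin_omega_mult(2)] lin_add_map lin_alt_map lin_omega_mult(2)
        lin_comp[OF lin_omega_mult(2) lin_omega_diff] omega_diff_closed omega_module; assumption)+
  fix p ps assume *: "length ps = i" "set ps \<subseteq> carrier A" "p \<in> carrier (omega_head K A (length ps))"
  then have p0: "p \<in> carrier uA" and p: "(fst p, snd p) \<in> carrier uA" "fst p \<in> carrier A" "snd p \<in> carrier K" by (auto elim!: omega_head_cases)
  have "dg_diff Om (ow p ps \<cdot> y) = dg_diff Om (omega_left (fst p, snd p) (foldr omega_dleft ps y))"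
    using * y by (simp add: omega_word_mult)
  also have "\<dots> = omega_dleft (fst p) (foldr omega_dleft ps y) \<oplus>\<^bsub>Om\<^esub>
      omega_left (fst p, snd p) (alt_sign Om i (foldr omega_dleft ps (dg_diff Om y)))"
    using * p y by (simp add: omega_diff_left omega_diff_dlefts del: prod.collapse)
  also have "\<dots> = dg_diff Om (ow p ps) \<cdot> y \<oplus>\<^bsub>Om\<^esub> alt_sign Om i (ow p ps \<cdot> dg_diff Om y)"
    using * p y by (simp add: omega_diff_word omega_word_mult lin_alt_sign[OF _ _ lin_omega_left[OF p0]]
        del: unitization_simps)
  finally show "dg_diff Om (ow p ps \<cdot> y) =
    dg_diff Om (ow p ps) \<cdot> y \<oplus>\<^bsub>Om\<^esub> alt_sign Om i (ow p ps \<cdot> dg_diff Om y)" .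
qed

text \<open>
  The homogeneous component of degree \<open>n\<close>
\<close>

definition omega_proj where
  "omega_proj n x = sw Om x (\<lambda>p ps. if length ps = n then ow p ps else \<zero>\<^bsub>Om\<^esub>)"

lemma omega_proj_mlin:
  "mlin (omega_head K A) A UNIV Om (\<lambda>p ps. if length ps = n then ow p ps else \<zero>\<^bsub>Om\<^esub>)"
proof (rule mlinI)
  fix xs assume "set xs \<subseteq> carrier A"
  then show "lin (omega_head K A (length xs)) Om (\<lambda>p. if length xs = n then ow p xs else \<zero>\<^bsub>Om\<^esub>)"
    using lin_omega_head(2)[of xs] lin_zero_map[OF omega_module] by (cases "length xs = n") simp_all
next
  fix h ys zs
  assume *: "h \<in> carrier (omega_head K A (Suc (length ys + length zs)))" "set ys \<subseteq> carrier A" "set zs \<subseteq> carrier A"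
  show "lin A Om (\<lambda>x. if length (ys @ x # zs) = n then ow h (ys @ x # zs) else \<zero>\<^bsub>Om\<^esub>)"
    using lin_omega_slot[OF *(2,3,1)] lin_zero_map[OF omega_module]
    by (cases "Suc (length ys + length zs) = n") simp_all
qed

lemma lin_omega_proj: "lin Om Om (omega_proj n)"
  unfolding omega_proj_def using lin_omega_lift[OF omega_module omega_proj_mlin] by simp

lemma omega_proj_word:
  assumes "set ps \<subseteq> carrier A" "p \<in> carrier (omega_head K A (length ps))"
  shows "omega_proj n (ow p ps) = (if length ps = n then ow p ps else \<zero>\<^bsub>Om\<^esub>)"
  unfolding omega_proj_def by (rule omega_lift_word[OF omega_module omega_proj_mlin assms])

lemma omega_proj_part: "x \<in> carrier Om \<Longrightarrow> omega_proj n x \<in> dg_part Om n"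
proof (induction x rule: omega_induct)
  case (plain a as)
  then show ?case using omega_word_part[of as "(a, \<zero>)"]
    by (auto simp: omega_proj_word submodule_closed(1)[OF omega_module omega_part_submodule])
next
  case (diff a as)
  then show ?case using omega_word_part[of "a # as" "(\<zero>\<^bsub>A\<^esub>, \<one>)"]
    by (auto simp: omega_proj_word submodule_closed(1)[OF omega_module omega_part_submodule])
qed (simp_all add: lin_add[OF lin_omega_proj] lin_smult[OF lin_omega_proj] submodule_closed[OF omega_module omega_part_submodule])

lemma omega_proj_of_part:
  assumes "x \<in> dg_part Om n"
  shows "omega_proj m x = (if m = n then x else \<zero>\<^bsub>Om\<^esub>)"
  by (rule omega_part_eqI[OF omega_module lin_omega_proj _ assms])
    (cases "m = n"; auto simp: lin_ident lin_zero_map omega_proj_word)+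

lemma omega_proj_sum:
  assumes "x \<in> carrier Om"
  shows "\<exists>I. finite I \<and> (\<forall>i. i \<notin> I \<longrightarrow> omega_proj i x = \<zero>\<^bsub>Om\<^esub>) \<and> x = (\<Oplus>\<^bsub>Om\<^esub>i\<in>I. omega_proj i x)"
proof -
  interpret O: module K Om by simp
  have pc: "omega_proj i x \<in> carrier Om" if "x \<in> carrier Om" for i x
    using lin_closed[OF lin_omega_proj that] .
  have mono: "(\<Oplus>\<^bsub>Om\<^esub>i\<in>I. omega_proj i x) = (\<Oplus>\<^bsub>Om\<^esub>i\<in>J. omega_proj i x)"
    if "finite J" "I \<subseteq> J" "\<And>i. i \<notin> I \<Longrightarrow> omega_proj i x = \<zero>\<^bsub>Om\<^esub>" "x \<in> carrier Om" for I J x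
    using that by (intro O.add.finprod_mono_neutral_cong_left) (auto intro: pc)
  have w: "\<exists>I. finite I \<and> (\<forall>i. i \<notin> I \<longrightarrow> omega_proj i (ow h as) = \<zero>\<^bsub>Om\<^esub>) \<and> ow h as = (\<Oplus>\<^bsub>Om\<^esub>i\<in>I. omega_proj i (ow h as))"
    if "set as \<subseteq> carrier A" "h \<in> carrier (omega_head K A (length as))" for h as
    using that by (intro exI[of _ "{length as}"]) (auto simp: omega_proj_word)
  show ?thesis using assms
  proof (induction x rule: omega_induct)
    case (plain a as)
    then show ?case by (intro w) auto
  next
    case (diff a as)
    then show ?case by (intro w) auto
  next
    case (add x y)
    then obtain I J where IJ: "finite I" "\<And>i. i \<notin> I \<Longrightarrow> omega_proj i x = \<zero>\<^bsub>Om\<^esub>" "x = (\<Oplus>\<^bsub>Om\<^esub>i\<in>I. omega_proj i x)"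
      "finite J" "\<And>i. i \<notin> J \<Longrightarrow> omega_proj i y = \<zero>\<^bsub>Om\<^esub>" "y = (\<Oplus>\<^bsub>Om\<^esub>i\<in>J. omega_proj i y)" by metis
    have "x = (\<Oplus>\<^bsub>Om\<^esub>i\<in>I \<union> J. omega_proj i x)" "y = (\<Oplus>\<^bsub>Om\<^esub>i\<in>I \<union> J. omega_proj i y)"
      using IJ mono[of "I \<union> J" I x] mono[of "I \<union> J" J y] add by auto
    then have "x \<oplus>\<^bsub>Om\<^esub> y = (\<Oplus>\<^bsub>Om\<^esub>i\<in>I \<union> J. omega_proj i x \<oplus>\<^bsub>Om\<^esub> omega_proj i y)"
      using O.finsum_addf[of "\<lambda>i. omega_proj i x" "I \<union> J" "\<lambda>i. omega_proj i y"] add(1,2) pc by auto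
    also have "\<dots> = (\<Oplus>\<^bsub>Om\<^esub>i\<in>I \<union> J. omega_proj i (x \<oplus>\<^bsub>Om\<^esub> y))"
      using add(1,2) by (simp add: lin_add[OF lin_omega_proj])
    finally have 1: "x \<oplus>\<^bsub>Om\<^esub> y = (\<Oplus>\<^bsub>Om\<^esub>i\<in>I \<union> J. omega_proj i (x \<oplus>\<^bsub>Om\<^esub> y))" .
    have 2: "\<forall>i. i \<notin> I \<union> J \<longrightarrow> omega_proj i (x \<oplus>\<^bsub>Om\<^esub> y) = \<zero>\<^bsub>Om\<^esub>"
      using IJ(2,5) add(1,2) by (simp add: lin_add[OF lin_omega_proj])
    have 3: "finite (I \<union> J)" using IJ(1,4) by simp
    from 1 2 3 show ?case by blast
  next
    case (smult r x)
    then obtain I where I: "finite I" "\<And>i. i \<notin> I \<Longrightarrow> omega_proj i x = \<zero>\<^bsub>Om\<^esub>" "x = (\<Oplus>\<^bsub>Om\<^esub>i\<in>I. omega_proj i x)" by metis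
    have "r \<odot>\<^bsub>Om\<^esub> x = r \<odot>\<^bsub>Om\<^esub> (\<Oplus>\<^bsub>Om\<^esub>i\<in>I. omega_proj i x)" using I(3) by simp
    also have "\<dots> = (\<Oplus>\<^bsub>Om\<^esub>i\<in>I. r \<odot>\<^bsub>Om\<^esub> omega_proj i x)"
      using smult(1,2) I(1) pc by (intro O.finsum_smult_ldistr) auto
    also have "\<dots> = (\<Oplus>\<^bsub>Om\<^esub>i\<in>I. omega_proj i (r \<odot>\<^bsub>Om\<^esub> x))"
      using smult(1,2) by (simp add: lin_smult[OF lin_omega_proj])
    finally have 1: "r \<odot>\<^bsub>Om\<^esub> x = (\<Oplus>\<^bsub>Om\<^esub>i\<in>I. omega_proj i (r \<odot>\<^bsub>Om\<^esub> x))" .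
    have 2: "\<forall>i. i \<notin> I \<longrightarrow> omega_proj i (r \<odot>\<^bsub>Om\<^esub> x) = \<zero>\<^bsub>Om\<^esub>"
      using I(2) smult(1,2) by (simp add: lin_smult[OF lin_omega_proj])
    from 1 2 I(1) show ?case by blast
  qed
qed

lemma omega_direct_sum:
  assumes "x \<in> carrier Om"
  shows "\<exists>!f. (\<forall>i. f i \<in> dg_part Om i) \<and> finite {i. f i \<noteq> \<zero>\<^bsub>Om\<^esub>} \<and> x = (\<Oplus>\<^bsub>Om\<^esub>i\<in>{i. f i \<noteq> \<zero>\<^bsub>Om\<^esub>}. f i)"
proof (rule ex1I[of _ "\<lambda>i. omega_proj i x"])
  interpret O: module K Om by simp
  obtain I where I: "finite I" "\<And>i. i \<notin> I \<Longrightarrow> omega_proj i x = \<zero>\<^bsub>Om\<^esub>" "x = (\<Oplus>\<^bsub>Om\<^esub>i\<in>I. omega_proj i x)"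
    using omega_proj_sum[OF assms] by metis
  have sub: "{i. omega_proj i x \<noteq> \<zero>\<^bsub>Om\<^esub>} \<subseteq> I" using I(2) by auto
  have "(\<Oplus>\<^bsub>Om\<^esub>i\<in>{i. omega_proj i x \<noteq> \<zero>\<^bsub>Om\<^esub>}. omega_proj i x) = (\<Oplus>\<^bsub>Om\<^esub>i\<in>I. omega_proj i x)"
    using I sub lin_closed[OF lin_omega_proj assms] by (intro O.add.finprod_mono_neutral_cong_left) auto
  then show "(\<forall>i. omega_proj i x \<in> dg_part Om i) \<and> finite {i. omega_proj i x \<noteq> \<zero>\<^bsub>Om\<^esub>} \<and>
      x = (\<Oplus>\<^bsub>Om\<^esub>i\<in>{i. omega_proj i x \<noteq> \<zero>\<^bsub>Om\<^esub>}. omega_proj i x)"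
    using omega_proj_part[OF assms] finite_subset[OF sub I(1)] I(3) by simp
next
  interpret O: module K Om by simp
  fix f assume f: "(\<forall>i. f i \<in> dg_part Om i) \<and> finite {i. f i \<noteq> \<zero>\<^bsub>Om\<^esub>} \<and> x = (\<Oplus>\<^bsub>Om\<^esub>i\<in>{i. f i \<noteq> \<zero>\<^bsub>Om\<^esub>}. f i)"
  let ?I = "{i. f i \<noteq> \<zero>\<^bsub>Om\<^esub>}"
  have fc: "f i \<in> carrier Om" for i using f omega_part_closed by blast
  show "f = (\<lambda>i. omega_proj i x)"
  proof
    fix j
    have "omega_proj j x = (\<Oplus>\<^bsub>Om\<^esub>i\<in>?I. omega_proj j (f i))"
      using f fc lin_finsum[OF omega_module omega_module lin_omega_proj, of ?I f j] by simp
    also have "\<dots> = (\<Oplus>\<^bsub>Om\<^esub>i\<in>?I. if j = i then f i else \<zero>\<^bsub>Om\<^esub>)"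
      using f fc by (intro O.finsum_cong') (auto simp: omega_proj_of_part)
    also have "\<dots> = f j"
    proof (cases "j \<in> ?I")
      case True
      then show ?thesis using O.finsum_singleton[of j ?I f] f fc by simp
    next
      case False
      then have "(\<Oplus>\<^bsub>Om\<^esub>i\<in>?I. if j = i then f i else \<zero>\<^bsub>Om\<^esub>) = (\<Oplus>\<^bsub>Om\<^esub>i\<in>?I. \<zero>\<^bsub>Om\<^esub>)"
        by (intro O.finsum_cong') auto
      then show ?thesis using False by (simp add: O.finsum_zero)
    qed
    finally show "f j = omega_proj j x" ..
  qed
qed

theorem omega_dg_algebra: "dg_algebra K Om"
  by (intro dg_algebra.intro omega_algebra dg_algebra_axioms.intro omega_part_submodule omega_direct_sum
    omega_mult_part lin_omega_diff omega_diff_part omega_diff_diff omega_leibniz)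

text \<open>
  The whole algebra is generated from \<open>A\<close> by left multiplications with elements of \<open>A\<close>, the
  differential, and linear combinations. In each degree this gives an induction principle.
\<close>

lemma omega_graded_induct [consumes 1, case_names base mult diff add smult]:
  assumes "x \<in> dg_part Om n"
    and base: "\<And>a. a \<in> carrier A \<Longrightarrow> Q 0 (aw a [])"
    and mult: "\<And>n a x. a \<in> carrier A \<Longrightarrow> x \<in> dg_part Om n \<Longrightarrow> Q n x \<Longrightarrow> Q n (aw a [] \<cdot> x)"
    and diff: "\<And>n x. x \<in> dg_part Om n \<Longrightarrow> Q n x \<Longrightarrow> Q (Suc n) (dg_diff Om x)"
    and add: "\<And>n x y. x \<in> dg_part Om n \<Longrightarrow> y \<in> dg_part Om n \<Longrightarrow> Q n x \<Longrightarrow> Q n y \<Longrightarrow> Q n (x \<oplus>\<^bsub>Om\<^esub> y)"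
    and smult: "\<And>n r x. r \<in> carrier K \<Longrightarrow> x \<in> dg_part Om n \<Longrightarrow> Q n x \<Longrightarrow> Q n (r \<odot>\<^bsub>Om\<^esub> x)"
  shows "Q n x"
proof -
  note sub = submodule_closed[OF omega_module omega_part_submodule]
  have plain: "Q (length as) (aw a as)" if "a \<in> carrier A" "set as \<subseteq> carrier A" for a as
    using that
  proof (induction as arbitrary: a)
    case Nil
    then show ?case using base by simp
  next
    case (Cons b bs)
    then have "Q (length bs) (aw b bs)" "aw b bs \<in> dg_part Om (length bs)"
      using omega_word_part[of bs "(b, \<zero>)"] by auto
    then have "Q (Suc (length bs)) (dg_diff Om (aw b bs))"
      "dg_diff Om (aw b bs) \<in> dg_part Om (Suc (length bs))"
      by (auto intro: diff omega_diff_part)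
    from mult[OF Cons(2) this(2,1)] show ?case
      using Cons by (simp add: omega_diff_word omega_word_mult omega_left_word)
  qed
  have d: "Q (length as) (dw as)" if "as \<noteq> []" "set as \<subseteq> carrier A" for as
  proof -
    obtain a bs where as: "as = a # bs" using \<open>as \<noteq> []\<close> by (cases as) auto
    then have "Q (Suc (length bs)) (dg_diff Om (aw a bs))"
      using that omega_word_part[of bs "(a, \<zero>)"] by (intro diff plain) auto
    then show ?thesis using that as by (simp add: omega_diff_word)
  qed
  have "submodule {x \<in> dg_part Om n. Q n x} K Om"
  proof -
    interpret O: module K Om by simp
    have z: "Q n \<zero>\<^bsub>Om\<^esub>"
    proof -
      let ?as = "replicate n \<zero>\<^bsub>A\<^esub>"
      have as: "length ?as = n" "set ?as \<subseteq> carrier A" by auto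
      then have "Q n (ow (\<zero>\<^bsub>A\<^esub>, \<zero>) ?as)" using plain[of "\<zero>\<^bsub>A\<^esub>" ?as] by auto
      then show ?thesis using as(2) by simp
    qed
    show ?thesis
    proof (rule O.submoduleI)
      show "{x \<in> dg_part Om n. Q n x} \<subseteq> carrier Om" using omega_part_closed by auto
      fix x assume "x \<in> {x \<in> dg_part Om n. Q n x}"
      then show "\<ominus>\<^bsub>Om\<^esub> x \<in> {x \<in> dg_part Om n. Q n x}"
        using smult[of "\<ominus> \<one>" x n] sub(4)[of x] mod_neg_eq[OF omega_module, of x] omega_part_closed by auto
    qed (use z sub add smult in auto)
  qed
  then have "x \<in> {x \<in> dg_part Om n. Q n x}"
    using assms(1)
  proof (rule omega_part_least)
    fix p ps assume *: "length ps = n" "set ps \<subseteq> carrier A" "p \<in> carrier (omega_head K A (length ps))"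
    obtain a m where p: "p = (a, m)" by (cases p)
    have "Q n (ow p ps)"
    proof (cases "ps = []")
      case True
      then show ?thesis using * p plain[of a ps] by simp
    next
      case False
      have "aw a ps \<in> dg_part Om n" "dw ps \<in> dg_part Om n"
        using * p False omega_word_part[of ps "(a, \<zero>)"] omega_word_part[of ps "(\<zero>\<^bsub>A\<^esub>, \<one>)"] by auto
      then show ?thesis using * p False plain[of a ps] d[OF False] unfolding p
        by (subst omega_word_split[OF False]) (auto intro!: add smult sub)
    qed
    then show "ow p ps \<in> {x \<in> dg_part Om n. Q n x}" using omega_word_part[OF *(2,3)] * by simp
  qed
  then show ?thesis by simp
qed

end

section \<open>The entwining of the universal algebra\<close>

context cring
begin

lemma sw_in_sub:
  assumes "module R V" "module R W" "module R P" "submodule N R P" "X \<in> carrier (tensor R V W)"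
    and "\<And>v w. v \<in> carrier V \<Longrightarrow> w \<in> carrier W \<Longrightarrow> f v w \<in> N"
  shows "sw P X f \<in> N"
proof (rule sw_lin_sub(1)[OF assms(1-3,3,4) _ assms(5,6)])
  show "lin (P\<lparr>carrier := N\<rparr>) P (\<lambda>x. x)"
    by (rule linI) (auto intro: submodule_closed(2)[OF assms(3,4)])
qed

lemma mlin_Cons:
  assumes "mlin (\<lambda>_. C) A {Suc m} P f" "a \<in> carrier A"
  shows "mlin (\<lambda>_. C) A {m} P (\<lambda>c bs. f c (a # bs))"
proof (rule mlinI)
  fix xs assume "length xs \<in> {m}" "set xs \<subseteq> carrier A"
  then show "lin C P (\<lambda>c. f c (a # xs))"
    using mlinD(1)[OF assms(1), of "a # xs"] assms(2) by simp
next
  fix h ys zs assume "Suc (length ys + length zs) \<in> {m}" "h \<in> carrier C" "set ys \<subseteq> carrier A" "set zs \<subseteq> carrier A"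
  then show "lin A P (\<lambda>x. f h (a # ys @ x # zs))"
    using mlinD(2)[OF assms(1), of "a # ys" zs h] assms(2) by simp
qed

end

context coalgebra
begin

lemma coalgebra_module [simp]: "module K C" by (rule module_axioms)

end

context nonunital_entwining
begin

lemmas psi_closed = entw_closed[OF algebra_module coalgebra_module psi_linear]
lemmas lin_sw_psi_coalg = lin_sw_entw_coalg[OF algebra_module coalgebra_module psi_linear]
lemmas lin_sw_psi_alg = lin_sw_entw_alg[OF algebra_module coalgebra_module psi_linear]
lemmas lin_sw_psi_param = lin_sw_entw_param[OF algebra_module coalgebra_module psi_linear]
lemmas sw_psi_closed = sw_entw_closed[OF algebra_module coalgebra_module psi_linear]
lemmas sw_psi_cong = sw_entw_cong[OF algebra_module coalgebra_module psi_linear]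
lemmas lin_of_sw_psi = lin_of_sw_entw[OF algebra_module coalgebra_module psi_linear]

abbreviation entw_at (infix "\<rhd>" 75) where "c \<rhd> a \<equiv> \<psi> (tens K C A c a)"
abbreviation "iter \<equiv> psi_iter K A C \<psi>"

lemma psi_mult_sw:
  assumes "c \<in> carrier C" "a \<in> carrier A" "b \<in> carrier A"
  shows "c \<rhd> (a \<otimes>\<^bsub>A\<^esub> b) =
      sw (tensor K A C) (c \<rhd> a) (\<lambda>a' c'.
        sw (tensor K A C) (c' \<rhd> b) (\<lambda>b' c''. tens K A C (a' \<otimes>\<^bsub>A\<^esub> b') c''))"
  using psi_mult_iff[OF algebra_module coalgebra_module psi_linear algebra_bilin] psi_mult assms by blast

lemma psi_comult_sw:
  assumes "c \<in> carrier C" "a \<in> carrier A"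
  shows "sw (tensor K A (tensor K C C)) (c \<rhd> a) (\<lambda>a' c'. tens K A (tensor K C C) a' (comult C c')) =
      sw (tensor K A (tensor K C C)) (comult C c) (\<lambda>c1 c2.
        sw (tensor K A (tensor K C C)) (c2 \<rhd> a) (\<lambda>a' c2'.
          sw (tensor K A (tensor K C C)) (c1 \<rhd> a') (\<lambda>a'' c1'.
            tens K A (tensor K C C) a'' (tens K C C c1' c2'))))"
  using psi_comult_iff[OF algebra_module coalgebra_module psi_linear comult_linear] psi_comult assms by blast

subsection \<open>Iterated entwining\<close>

lemma psi_iter_closed:
  assumes P: "module K P" and "set as \<subseteq> carrier A" "c \<in> carrier C"
    and "\<And>bs c. set bs \<subseteq> carrier A \<Longrightarrow> length bs = length as \<Longrightarrow> c \<in> carrier C \<Longrightarrow> F bs c \<in> carrier P"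
  shows "iter P F c as \<in> carrier P"
  using assms(2-4)
  by (induction as arbitrary: F c) (auto intro!: sw_psi_closed P)

lemma psi_iter_in_sub:
  assumes P: "module K P" and N: "submodule N K P" and "set as \<subseteq> carrier A" "c \<in> carrier C"
    and "\<And>bs c. set bs \<subseteq> carrier A \<Longrightarrow> length bs = length as \<Longrightarrow> c \<in> carrier C \<Longrightarrow> F bs c \<in> N"
  shows "iter P F c as \<in> N"
  using assms(3-5)
  by (induction as arbitrary: F c)
    (auto intro!: sw_in_sub[OF algebra_module coalgebra_module P N] psi_closed)

lemma psi_iter_cong:
  assumes P: "module K P" and "set as \<subseteq> carrier A" "c \<in> carrier C"
    and "\<And>bs c. set bs \<subseteq> carrier A \<Longrightarrow> length bs = length as \<Longrightarrow> c \<in> carrier C \<Longrightarrow> F bs c \<in> carrier P"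
    and "\<And>bs c. set bs \<subseteq> carrier A \<Longrightarrow> length bs = length as \<Longrightarrow> c \<in> carrier C \<Longrightarrow> F bs c = G bs c"
  shows "iter P F c as = iter P G c as"
  using assms(2-5)
proof (induction as arbitrary: F G c)
  case (Cons a as)
  show ?case unfolding psi_iter.simps
    by (rule sw_psi_cong[OF P]) (use Cons in \<open>auto intro!: psi_iter_closed P Cons.IH\<close>)
qed simp

lemma lin_of_psi_iter:
  assumes P: "module K P" and Q: "module K Q" and h: "lin P Q h" and "set as \<subseteq> carrier A" "c \<in> carrier C"
    and "\<And>bs c. set bs \<subseteq> carrier A \<Longrightarrow> length bs = length as \<Longrightarrow> c \<in> carrier C \<Longrightarrow> F bs c \<in> carrier P"
  shows "h (iter P F c as) = iter Q (\<lambda>bs c. h (F bs c)) c as"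
  using assms(4-6)
proof (induction as arbitrary: F c)
  case (Cons a as)
  have "h (iter P F c (a # as)) =
      sw Q (c \<rhd> a) (\<lambda>a' c'. h (iter P (\<lambda>bs. F (a' # bs)) c' as))"
    unfolding psi_iter.simps by (rule lin_of_sw_psi[OF P Q h]) (use Cons in \<open>auto intro!: psi_iter_closed P\<close>)
  also have "\<dots> = iter Q (\<lambda>bs c. h (F bs c)) c (a # as)"
    unfolding psi_iter.simps
    by (rule sw_psi_cong[OF Q]) (use Cons in \<open>auto intro!: psi_iter_closed lin_closed[OF h] P Q Cons.IH\<close>)
  finally show ?case .
qed simp

lemma lin_psi_iter_param:
  assumes P: "module K P" and U: "module K U" and "set as \<subseteq> carrier A" "c \<in> carrier C"
    and "\<And>bs c. set bs \<subseteq> carrier A \<Longrightarrow> length bs = length as \<Longrightarrow> c \<in> carrier C \<Longrightarrow> lin U P (\<lambda>u. F u bs c)"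
  shows "lin U P (\<lambda>u. iter P (F u) c as)"
  using assms(3-5)
proof (induction as arbitrary: F c)
  case (Cons a as)
  show ?case unfolding psi_iter.simps
    by (rule lin_sw_psi_param[OF P U]) (use Cons in \<open>auto intro!: Cons.IH\<close>)
qed simp

lemma bilin_psi_iter_Cons:
  assumes P: "module K P" and F: "mlin (\<lambda>_. C) A {Suc m} P (\<lambda>c bs. F bs c)"
    and IH: "\<And>a. a \<in> carrier A \<Longrightarrow> mlin (\<lambda>_. C) A {m} P (\<lambda>c as. iter P (\<lambda>bs. F (a # bs)) c as)"
    and as: "set as \<subseteq> carrier A" "length as = m"
  shows "bilin A C P (\<lambda>a' c'. iter P (\<lambda>bs. F (a' # bs)) c' as)"
proof (rule bilinI)
  fix a' assume "a' \<in> carrier A"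
  then show "lin C P (\<lambda>c'. iter P (\<lambda>bs. F (a' # bs)) c' as)"
    using mlinD(1)[OF IH, of a' as] as by simp
next
  fix c' assume c': "c' \<in> carrier C"
  show "lin A P (\<lambda>a'. iter P (\<lambda>bs. F (a' # bs)) c' as)"
    by (rule lin_psi_iter_param[OF P algebra_module as(1) c'])
      (use mlinD(2)[OF F, of "[]"] as in simp)
qed

lemma psi_iter_mlin:
  assumes P: "module K P" and F: "mlin (\<lambda>_. C) A {m} P (\<lambda>c bs. F bs c)"
  shows "mlin (\<lambda>_. C) A {m} P (\<lambda>c as. iter P F c as)"
  using F
proof (induction m arbitrary: F)
  case 0
  then show ?case using mlinD(1)[OF 0, of "[]"] by (auto intro!: mlinI)
next
  case (Suc m)
  note IH = Suc.IH[OF mlin_Cons[OF Suc.prems]]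
  note b = bilin_psi_iter_Cons[OF P Suc.prems IH]
  show ?case
  proof (rule mlinI)
    fix xs assume xs: "length xs \<in> {Suc m}" "set xs \<subseteq> carrier A"
    then obtain a as where as: "xs = a # as" "length as = m" "a \<in> carrier A" "set as \<subseteq> carrier A"
      by (cases xs) auto
    show "lin C P (\<lambda>c. iter P F c xs)"
      unfolding as(1) psi_iter.simps by (intro lin_sw_psi_coalg P b as lin_ident)
  next
    fix c ys zs assume *: "Suc (length ys + length zs) \<in> {Suc m}" "c \<in> carrier C" "set ys \<subseteq> carrier A" "set zs \<subseteq> carrier A"
    show "lin A P (\<lambda>x. iter P F c (ys @ x # zs))"
    proof (cases ys)
      case Nil
      then show ?thesis using * by (auto intro!: lin_sw_psi_alg P b lin_ident)
    next
      case (Cons y ys')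
      then show ?thesis
        using * mlinD(2)[OF IH, of _ ys' zs] by (auto intro!: lin_sw_psi_param P)
    qed
  qed
qed

lemma bilin_psi_iter:
  assumes P: "module K P" and F: "mlin (\<lambda>_. C) A {Suc m} P (\<lambda>c bs. F bs c)"
    and as: "set as \<subseteq> carrier A" "length as = m"
  shows "bilin A C P (\<lambda>a' c'. iter P (\<lambda>bs. F (a' # bs)) c' as)"
  by (rule bilin_psi_iter_Cons[OF P F psi_iter_mlin[OF P mlin_Cons[OF F]] as])

text \<open>
  Moving \<open>c\<close> past \<open>ab\<close> is moving it past \<open>a\<close> and then past \<open>b\<close>; the rest of the word is not affected.
\<close>

lemma psi_iter_mult:
  assumes P: "module K P" and F: "mlin (\<lambda>_. C) A {Suc (length as)} P (\<lambda>c bs. F bs c)"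
    and [simp]: "set as \<subseteq> carrier A" "c \<in> carrier C" "a \<in> carrier A" "b \<in> carrier A"
  shows "iter P F c ((a \<otimes>\<^bsub>A\<^esub> b) # as) =
    sw P (c \<rhd> a) (\<lambda>a' c'. sw P (c' \<rhd> b) (\<lambda>b' c''.
      iter P (\<lambda>bs. F ((a' \<otimes>\<^bsub>A\<^esub> b') # bs)) c'' as))"
proof -
  let ?f = "\<lambda>a' c'. iter P (\<lambda>bs. F (a' # bs)) c' as"
  have b: "bilin A C P ?f" by (rule bilin_psi_iter[OF P F]) auto
  have h: "lin (tensor K A C) P (\<lambda>X. sw P X ?f)" using lin_sw[OF _ _ P b] by simp
  have "iter P F c ((a \<otimes>\<^bsub>A\<^esub> b) # as) = sw P (sw (tensor K A C) (c \<rhd> a) (\<lambda>a' c'.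
        sw (tensor K A C) (c' \<rhd> b) (\<lambda>b' c''. tens K A C (a' \<otimes>\<^bsub>A\<^esub> b') c''))) ?f"
    by (simp add: psi_mult_sw)
  also have "\<dots> = sw P (c \<rhd> a) (\<lambda>a' c'.
        sw P (sw (tensor K A C) (c' \<rhd> b) (\<lambda>b' c''. tens K A C (a' \<otimes>\<^bsub>A\<^esub> b') c'')) ?f)"
    by (rule lin_of_sw_psi[OF _ P h]) (auto intro!: sw_psi_closed)
  also have "\<dots> = sw P (c \<rhd> a) (\<lambda>a' c'. sw P (c' \<rhd> b) (\<lambda>b' c''. ?f (a' \<otimes>\<^bsub>A\<^esub> b') c''))"
  proof (rule sw_psi_cong[OF P])
    fix a' c' assume [simp]: "a' \<in> carrier A" "c' \<in> carrier C"
    have "sw P (sw (tensor K A C) (c' \<rhd> b) (\<lambda>b' c''. tens K A C (a' \<otimes>\<^bsub>A\<^esub> b') c'')) ?f =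
        sw P (c' \<rhd> b) (\<lambda>b' c''. sw P (tens K A C (a' \<otimes>\<^bsub>A\<^esub> b') c'') ?f)"
      by (rule lin_of_sw_psi[OF _ P h]) auto
    also have "\<dots> = sw P (c' \<rhd> b) (\<lambda>b' c''. ?f (a' \<otimes>\<^bsub>A\<^esub> b') c'')"
      by (rule sw_psi_cong[OF P]) (auto simp: sw_tens[OF _ _ P b] intro!: bilinD(3)[OF b])
    finally show "sw P (sw (tensor K A C) (c' \<rhd> b) (\<lambda>b' c''. tens K A C (a' \<otimes>\<^bsub>A\<^esub> b') c'')) ?f =
        sw P (c' \<rhd> b) (\<lambda>b' c''. ?f (a' \<otimes>\<^bsub>A\<^esub> b') c'')" .
  qed (auto intro!: lin_closed[OF h] sw_psi_closed)
  finally show ?thesis .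
qed

subsection \<open>The map on the universal algebra\<close>

abbreviation OC where "OC \<equiv> tensor K Om C"
abbreviation Psi where "Psi \<equiv> omega_psi K A C \<psi>"
abbreviation Entw_at (infix "\<unrhd>" 75) where "c \<unrhd> x \<equiv> Psi (tens K C Om c x)"

abbreviation plain_words where "plain_words \<equiv> (\<lambda>bs c. tens K Om C (aw (hd bs) (tl bs)) c)"
abbreviation diff_words where "diff_words m \<equiv> (\<lambda>bs c. tens K Om C (ow (\<zero>\<^bsub>A\<^esub>, m) bs) c)"

lemma plain_words_mlin: "mlin (\<lambda>_. C) A {Suc n} OC (\<lambda>c bs. plain_words bs c)"
proof (rule mlinI)
  fix xs assume "length xs \<in> {Suc n}" "set xs \<subseteq> carrier A"
  then show "lin C OC (plain_words xs)" by (cases xs) (auto intro!: lin_tens_right)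
next
  fix c ys zs
  assume *: "Suc (length ys + length zs) \<in> {Suc n}" "c \<in> carrier C" "set ys \<subseteq> carrier A" "set zs \<subseteq> carrier A"
  show "lin A OC (\<lambda>x. plain_words (ys @ x # zs) c)"
    using * by (cases ys) (auto intro!: lin_tens_l lin_omega_head(1) lin_omega_slot)
qed

lemma diff_words_mlin:
  assumes "m \<in> carrier K" "n = 0 \<longrightarrow> m = \<zero>"
  shows "mlin (\<lambda>_. C) A {n} OC (\<lambda>c bs. diff_words m bs c)"
proof (rule mlinI)
  fix xs assume "length xs \<in> {n}" "set xs \<subseteq> carrier A"
  then show "lin C OC (diff_words m xs)" using assms by (auto intro!: lin_tens_right)
next
  fix c ys zs
  assume *: "Suc (length ys + length zs) \<in> {n}" "c \<in> carrier C" "set ys \<subseteq> carrier A" "set zs \<subseteq> carrier A"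
  then show "lin A OC (\<lambda>x. diff_words m (ys @ x # zs) c)"
    using assms by (auto intro!: lin_tens_l lin_omega_slot)
qed

definition psi_word where
  "psi_word c h as = iter OC plain_words c (fst h # as) \<oplus>\<^bsub>OC\<^esub>
    iter OC (diff_words (snd h)) c as"

lemma lin_psi_word_coalg:
  assumes "set as \<subseteq> carrier A" "h \<in> carrier (omega_head K A (length as))"
  shows "lin C OC (\<lambda>c. psi_word c h as)"
proof -
  have h: "fst h \<in> carrier A" "snd h \<in> carrier K" "length as = 0 \<longrightarrow> snd h = \<zero>"
    using assms(2) by (auto elim!: omega_head_cases)
  show ?thesis unfolding psi_word_def
  proof (rule lin_add_map)
    show "lin C OC (\<lambda>c. iter OC plain_words c (fst h # as))"
      using mlinD(1)[OF psi_iter_mlin[OF _ plain_words_mlin], of "fst h # as" "length as"] assms h by simp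
    show "lin C OC (\<lambda>c. iter OC (diff_words (snd h)) c as)"
      using mlinD(1)[OF psi_iter_mlin[OF _ diff_words_mlin[OF h(2,3)]], of as] assms by simp
  qed simp
qed

lemma psi_word_mlin:
  assumes c: "c \<in> carrier C"
  shows "mlin (omega_head K A) A UNIV OC (psi_word c)"
proof (rule mlinI)
  fix xs assume xs: "set xs \<subseteq> carrier A"
  let ?H = "omega_head K A (length xs)"
  have 1: "lin A OC (\<lambda>x. iter OC plain_words c (x # xs))"
    using mlinD(2)[OF psi_iter_mlin[OF _ plain_words_mlin], of "[]" xs "length xs" c] xs c by simp
  have 2: "lin ?H A fst" by (rule linI) (auto elim!: omega_head_cases)
  have 3: "lin ?H (omega_head K A (length bs)) (\<lambda>h. (\<zero>\<^bsub>A\<^esub>, snd h))" if "length bs = length xs" for bs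
    by (rule linI) (use that in \<open>auto elim!: omega_head_cases\<close>)
  show "lin ?H OC (\<lambda>h. psi_word c h xs)"
    unfolding psi_word_def
    by (intro lin_add_map lin_comp[OF 1 2] lin_psi_iter_param lin_tens_l lin_comp[OF lin_omega_head(2) 3] xs c)
      auto
next
  fix h ys zs
  assume *: "h \<in> carrier (omega_head K A (Suc (length ys + length zs)))" "set ys \<subseteq> carrier A" "set zs \<subseteq> carrier A"
  have h: "fst h \<in> carrier A" "snd h \<in> carrier K"
    using *(1) by (auto elim!: omega_head_cases)
  show "lin A OC (\<lambda>x. psi_word c h (ys @ x # zs))"
    unfolding psi_word_def
  proof (rule lin_add_map)
    show "lin A OC (\<lambda>x. iter OC plain_words c (fst h # ys @ x # zs))"
      using mlinD(2)[OF psi_iter_mlin[OF _ plain_words_mlin], of "fst h # ys" zs "Suc (length ys + length zs)" c] * h c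
      by simp
    show "lin A OC (\<lambda>x. iter OC (diff_words (snd h)) c (ys @ x # zs))"
      using mlinD(2)[OF psi_iter_mlin[OF _ diff_words_mlin[OF h(2)]], of "Suc (length ys + length zs)" ys zs c] * h c
      by simp
  qed simp
qed

lemma omega_psi_eq: "Psi = (\<lambda>X. sw OC X (\<lambda>c x. sw OC x (psi_word c)))"
proof -
  have "(\<lambda>((a0, m), as). iter OC plain_words c (a0 # as) \<oplus>\<^bsub>OC\<^esub>
      iter OC (diff_words m) c as) = (\<lambda>(h, as). psi_word c h as)" for c
    by (auto simp: fun_eq_iff psi_word_def)
  then show ?thesis by (simp add: omega_psi_def Let_def)
qed

lemma psi_word_bilin: "bilin C Om OC (\<lambda>c x. sw OC x (psi_word c))"
proof (rule bilinI)
  fix c assume c: "c \<in> carrier C"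
  show "lin Om OC (\<lambda>x. sw OC x (psi_word c))"
    using lin_omega_lift[OF _ psi_word_mlin[OF c]] by simp
next
  fix x assume x: "x \<in> carrier Om"
  show "lin C OC (\<lambda>c. sw OC x (psi_word c))"
    by (rule lin_lift_word_param[of UNIV "omega_head K A" A])
      (use x in \<open>auto simp: omega_space_eq intro!: lin_psi_word_coalg\<close>)
qed

lemma lin_omega_psi: "lin (tensor K C Om) OC Psi"
  unfolding omega_psi_eq using lin_sw[OF _ _ _ psi_word_bilin] by simp

lemma omega_psi_word:
  assumes "c \<in> carrier C" "set as \<subseteq> carrier A" "h \<in> carrier (omega_head K A (length as))"
  shows "c \<unrhd> (ow h as) = psi_word c h as"
proof -
  have "c \<unrhd> (ow h as) = sw OC (ow h as) (psi_word c)"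
    unfolding omega_psi_eq by (rule sw_tens[OF _ _ _ psi_word_bilin]) (use assms in auto)
  also have "\<dots> = psi_word c h as"
    by (rule omega_lift_word[OF _ psi_word_mlin]) (use assms in auto)
  finally show ?thesis .
qed

lemma tens_zero [simp]:
  assumes "module K V" "module K W"
  shows "w \<in> carrier W \<Longrightarrow> tens K V W \<zero>\<^bsub>V\<^esub> w = \<zero>\<^bsub>tensor K V W\<^esub>"
    "v \<in> carrier V \<Longrightarrow> tens K V W v \<zero>\<^bsub>W\<^esub> = \<zero>\<^bsub>tensor K V W\<^esub>"
  by (rule lin_zero[OF _ _ lin_tens_left]; simp add: assms) (rule lin_zero[OF _ _ lin_tens_right]; simp add: assms)

lemma psi_iter_zero:
  assumes "module K P" "set as \<subseteq> carrier A" "c \<in> carrier C"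
    and "\<And>bs c. set bs \<subseteq> carrier A \<Longrightarrow> length bs = length as \<Longrightarrow> c \<in> carrier C \<Longrightarrow> F bs c = \<zero>\<^bsub>P\<^esub>"
  shows "iter P F c as = \<zero>\<^bsub>P\<^esub>"
proof -
  have "iter P F c as = iter P (\<lambda>_ _. \<zero>\<^bsub>P\<^esub>) c as"
    by (rule psi_iter_cong) (use assms in auto)
  also have "\<dots> = \<zero>\<^bsub>P\<^esub>"
    using lin_of_psi_iter[OF assms(1,1) lin_zero_map[OF assms(1)] assms(2,3), of "\<lambda>_ _. \<zero>\<^bsub>P\<^esub>"] assms(1) by simp
  finally show ?thesis .
qed

lemma omega_psi_plain:
  assumes "c \<in> carrier C" "a \<in> carrier A" "set as \<subseteq> carrier A"
  shows "c \<unrhd> (aw a as) = iter OC plain_words c (a # as)"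
proof -
  have "iter OC (diff_words \<zero>) c as = \<zero>\<^bsub>OC\<^esub>"
    by (rule psi_iter_zero) (use assms in auto)
  moreover have "iter OC plain_words c (a # as) \<in> carrier OC"
  proof (rule psi_iter_closed)
    fix bs :: "'c list" and c assume "set bs \<subseteq> carrier A" "length bs = length (a # as)" "c \<in> carrier C"
    then show "plain_words bs c \<in> carrier OC" by (cases bs) auto
  qed (use assms in auto)
  ultimately show ?thesis using assms by (simp add: omega_psi_word psi_word_def del: psi_iter.simps)
qed

lemma omega_psi_diff_word:
  assumes "c \<in> carrier C" "a \<in> carrier A" "set as \<subseteq> carrier A"
  shows "c \<unrhd> (dw (a # as)) = iter OC (diff_words \<one>) c (a # as)"
proof -
  have "lin A OC (\<lambda>x. iter OC plain_words c (x # a # as))"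
    using mlinD(2)[OF psi_iter_mlin[OF _ plain_words_mlin], of "[]" "a # as" "Suc (length as)" c] assms
    by (simp del: psi_iter.simps)
  then have "iter OC plain_words c (\<zero>\<^bsub>A\<^esub> # a # as) = \<zero>\<^bsub>OC\<^esub>"
    by (intro lin_zero[where f = "\<lambda>x. iter OC plain_words c (x # a # as)"]) auto
  moreover have "iter OC (diff_words \<one>) c (a # as) \<in> carrier OC"
    by (rule psi_iter_closed) (use assms in auto)
  ultimately show ?thesis using assms by (simp add: omega_psi_word psi_word_def del: psi_iter.simps)
qed

lemmas omega_psi_closed = entw_closed[OF omega_module coalgebra_module lin_omega_psi]
lemmas lin_sw_Psi_coalg = lin_sw_entw_coalg[OF omega_module coalgebra_module lin_omega_psi]
lemmas lin_sw_Psi_alg = lin_sw_entw_alg[OF omega_module coalgebra_module lin_omega_psi]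
lemmas lin_sw_Psi_param = lin_sw_entw_param[OF omega_module coalgebra_module lin_omega_psi]
lemmas sw_Psi_closed = sw_entw_closed[OF omega_module coalgebra_module lin_omega_psi]
lemmas sw_Psi_cong = sw_entw_cong[OF omega_module coalgebra_module lin_omega_psi]
lemmas lin_of_sw_Psi = lin_of_sw_entw[OF omega_module coalgebra_module lin_omega_psi]
lemmas lin_Psi_alg = lin_entw_alg[OF omega_module coalgebra_module lin_omega_psi]

lemma omega_psi_rho:
  assumes "c \<in> carrier C" "a \<in> carrier A"
  shows "c \<unrhd> (aw a []) =
    sw OC (c \<rhd> a) (\<lambda>a' c'. tens K Om C (aw a' []) c')"
  using assms by (simp add: omega_psi_plain)

lemmas lin_diff_OC = tmap_tens(1)[OF omega_module coalgebra_module omega_module coalgebra_module lin_omega_diff lin_id]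
lemmas diff_OC = tmap_tens(3)[OF omega_module coalgebra_module omega_module coalgebra_module lin_omega_diff lin_id]
lemmas diff_OC_sw = tmap_tens(2)[OF omega_module coalgebra_module omega_module coalgebra_module lin_omega_diff lin_id]

text \<open>
  The map \<open>Psi\<close> is the iterated entwining on the entries of a word, and \<open>d\<close> only shifts the head of the
  word to its first entry, so the two commute.
\<close>

lemma omega_psi_diff:
  assumes c: "c \<in> carrier C" and x: "x \<in> carrier Om"
  shows "c \<unrhd> (dg_diff Om x) = tmap K Om C (dg_diff Om) id (c \<unrhd> x)"
proof (rule omega_eqI[OF _ _ _ _ _ x])
  show "lin Om OC (\<lambda>x. c \<unrhd> (dg_diff Om x))"
    "lin Om OC (\<lambda>x. tmap K Om C (dg_diff Om) id (c \<unrhd> x))"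
    using c by (auto intro!: lin_Psi_alg lin_omega_diff lin_comp[OF lin_diff_OC] lin_ident)
next
  fix a as assume [simp]: "a \<in> carrier A" "set as \<subseteq> carrier A"
  have pc: "plain_words bs c \<in> carrier OC" if "set bs \<subseteq> carrier A" "length bs = length (a # as)" "c \<in> carrier C" for bs c
    using that by (cases bs) auto
  have "tmap K Om C (dg_diff Om) id (c \<unrhd> (aw a as)) =
      iter OC (\<lambda>bs c. tmap K Om C (dg_diff Om) id (plain_words bs c)) c (a # as)"
    using c by (simp add: omega_psi_plain del: psi_iter.simps)
      (rule lin_of_psi_iter[OF _ _ lin_diff_OC], use pc in auto)
  also have "\<dots> = iter OC (diff_words \<one>) c (a # as)"
  proof (rule psi_iter_cong)
    fix bs :: "'c list" and c assume *: "set bs \<subseteq> carrier A" "length bs = length (a # as)" "c \<in> carrier C"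
    then show "tmap K Om C (dg_diff Om) id (plain_words bs c) \<in> carrier OC"
      using pc[OF *] by (intro lin_closed[OF lin_diff_OC]) auto
    show "tmap K Om C (dg_diff Om) id (plain_words bs c) = diff_words \<one> bs c"
      using * by (cases bs) (auto simp: diff_OC omega_diff_word)
  qed (use c in auto)
  finally show "c \<unrhd> (dg_diff Om (aw a as)) =
      tmap K Om C (dg_diff Om) id (c \<unrhd> (aw a as))"
    using c by (simp add: omega_diff_word omega_psi_diff_word del: psi_iter.simps)
  have "tmap K Om C (dg_diff Om) id (c \<unrhd> (dw (a # as))) =
      iter OC (\<lambda>bs c. tmap K Om C (dg_diff Om) id (diff_words \<one> bs c)) c (a # as)"
    using c by (simp add: omega_psi_diff_word del: psi_iter.simps)
      (rule lin_of_psi_iter[OF _ _ lin_diff_OC], auto)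
  also have "\<dots> = \<zero>\<^bsub>OC\<^esub>"
    by (rule psi_iter_zero) (use c in \<open>auto simp: diff_OC omega_diff_word\<close>)
  finally show "c \<unrhd> (dg_diff Om (dw (a # as))) =
      tmap K Om C (dg_diff Om) id (c \<unrhd> (dw (a # as)))"
    using c by (simp add: omega_diff_word lin_zero[OF _ _ lin_omega_psi])
qed simp

lemma part_left_submodule: "submodule (part_left K Om C n) K OC"
  unfolding part_left_def by (rule lin_span_submodule) (auto simp: omega_part_closed)

lemma part_right_submodule: "submodule (part_right K C Om n) K (tensor K C Om)"
  unfolding part_right_def by (rule lin_span_submodule) (auto simp: omega_part_closed)

lemma omega_psi_part:
  assumes c: "c \<in> carrier C" and x: "x \<in> dg_part Om n"
  shows "c \<unrhd> x \<in> part_left K Om C n"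
proof -
  have l: "lin Om OC (\<lambda>x. c \<unrhd> x)" by (intro lin_Psi_alg c lin_ident)
  have "x \<in> {x \<in> carrier Om. c \<unrhd> x \<in> part_left K Om C n}"
  proof (rule omega_part_least[OF lin_preimage_submodule[OF omega_module _ l part_left_submodule] x])
    fix p ps assume *: "length ps = n" "set ps \<subseteq> carrier A" "p \<in> carrier (omega_head K A (length ps))"
    then have p: "fst p \<in> carrier A" "snd p \<in> carrier K" "n = 0 \<longrightarrow> snd p = \<zero>"
      by (auto elim!: omega_head_cases)
    have t: "tens K Om C (ow h bs) c \<in> part_left K Om C n"
      if "length bs = n" "set bs \<subseteq> carrier A" "h \<in> carrier (omega_head K A n)" "c \<in> carrier C" for h bs c
      unfolding part_left_def using that omega_word_part[of bs h] by (intro lin_span_incl) blast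
    have "psi_word c p ps \<in> part_left K Om C n"
      unfolding psi_word_def
    proof (rule submodule_closed(3)[OF _ part_left_submodule])
      show "iter OC plain_words c (fst p # ps) \<in> part_left K Om C n"
      proof (rule psi_iter_in_sub[OF _ part_left_submodule])
        fix bs :: "'c list" and c assume "set bs \<subseteq> carrier A" "length bs = length (fst p # ps)" "c \<in> carrier C"
        then show "plain_words bs c \<in> part_left K Om C n"
          using * t[of "tl bs" "(hd bs, \<zero>)" c] by (cases bs) auto
      qed (use * p c in auto)
      show "iter OC (diff_words (snd p)) c ps \<in> part_left K Om C n"
      proof (rule psi_iter_in_sub[OF _ part_left_submodule])
        fix bs :: "'c list" and c assume "set bs \<subseteq> carrier A" "length bs = length ps" "c \<in> carrier C"
        then show "diff_words (snd p) bs c \<in> part_left K Om C n"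
          by (intro t) (use * p in auto)
      qed (use * p c in auto)
    qed simp
    then show "ow p ps \<in> {x \<in> carrier Om. c \<unrhd> x \<in> part_left K Om C n}"
      using * c by (simp add: omega_psi_word)
  qed simp
  then show ?thesis by simp
qed

lemma bilin_left_tens:
  assumes "a \<in> carrier A"
  shows "bilin Om C OC (\<lambda>y c. tens K Om C (omega_left (a, \<zero>) y) c)"
  by (intro bilinI lin_tens_l lin_tens_r lin_omega_left lin_ident) (use assms in auto)

text \<open>
  The axiom on the product for a left factor from \<open>A\<close>. For \<open>y = b db\<^sub>1 \<dots> db\<^sub>n\<close> it is the multiplicativity
  of \<open>\<psi>\<close> at \<open>ab\<close>; for \<open>y = db\<^sub>1 \<dots> db\<^sub>n\<close> it is the definition of the iterated entwining.
\<close>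

lemma omega_psi_left:
  assumes c: "c \<in> carrier C" and a: "a \<in> carrier A" and y: "y \<in> carrier Om"
  shows "c \<unrhd> (omega_left (a, \<zero>) y) =
    sw OC (c \<rhd> a) (\<lambda>a' c'. sw OC (c' \<unrhd> y) (\<lambda>y' c''.
      tens K Om C (omega_left (a', \<zero>) y') c''))"
proof (rule omega_eqI[OF _ _ _ _ _ y])
  let ?g = "\<lambda>a' y' c''. tens K Om C (omega_left (a', \<zero>) y') c''"
  show "lin Om OC (\<lambda>y. c \<unrhd> (omega_left (a, \<zero>) y))"
    by (intro lin_Psi_alg c lin_omega_left) (use a in auto)
  show "lin Om OC (\<lambda>y. sw OC (c \<rhd> a) (\<lambda>a' c'. sw OC (c' \<unrhd> y) (?g a')))"
    by (intro lin_sw_psi_param lin_sw_Psi_alg bilin_left_tens lin_ident c a) auto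
  fix b bs assume b: "b \<in> carrier A" "set bs \<subseteq> carrier A"
  have h: "lin OC OC (\<lambda>X. sw OC X (?g a'))" if "a' \<in> carrier A" for a'
    using lin_sw[OF _ _ _ bilin_left_tens[OF that]] by simp
  have ev: "sw OC (tens K Om C y c) (?g a') = ?g a' y c"
    if "a' \<in> carrier A" "y \<in> carrier Om" "c \<in> carrier C" for a' y c
    using sw_tens[OF _ _ _ bilin_left_tens[OF that(1)] that(2,3)] by simp
  have "sw OC (iter OC plain_words c' (b # bs)) (?g a') =
      sw OC (c' \<rhd> b) (\<lambda>b' c''. iter OC (\<lambda>bs. plain_words ((a' \<otimes>\<^bsub>A\<^esub> b') # bs)) c'' bs)"
    if ac: "a' \<in> carrier A" "c' \<in> carrier C" for a' c'
  proof -
    have "sw OC (iter OC plain_words c' (b # bs)) (?g a') =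
        iter OC (\<lambda>bs c. sw OC (plain_words bs c) (?g a')) c' (b # bs)"
    proof (rule lin_of_psi_iter[OF _ _ h[OF ac(1)]])
      fix bs' :: "'c list" and c assume "set bs' \<subseteq> carrier A" "length bs' = length (b # bs)" "c \<in> carrier C"
      then show "plain_words bs' c \<in> carrier OC" by (cases bs') auto
    qed (use ac b in auto)
    also have "\<dots> = iter OC (\<lambda>bs c. plain_words ((a' \<otimes>\<^bsub>A\<^esub> hd bs) # tl bs) c) c' (b # bs)"
    proof (rule psi_iter_cong)
      fix bs' :: "'c list" and c assume *: "set bs' \<subseteq> carrier A" "length bs' = length (b # bs)" "c \<in> carrier C"
      then show "sw OC (plain_words bs' c) (?g a') \<in> carrier OC"
        by (intro lin_closed[OF h[OF ac(1)]]) (cases bs'; auto)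
      show "sw OC (plain_words bs' c) (?g a') = plain_words ((a' \<otimes>\<^bsub>A\<^esub> hd bs') # tl bs') c"
        using * ac by (cases bs') (auto simp: ev omega_left_word)
    qed (use ac b in auto)
    finally show ?thesis by simp
  qed
  note 1 = this
  have "c \<unrhd> (omega_left (a, \<zero>) (aw b bs)) =
      iter OC plain_words c ((a \<otimes>\<^bsub>A\<^esub> b) # bs)"
    using a b c by (simp add: omega_left_word omega_psi_plain del: psi_iter.simps)
  also have "\<dots> = sw OC (c \<rhd> a) (\<lambda>a' c'. sw OC (c' \<rhd> b) (\<lambda>b' c''.
      iter OC (\<lambda>bs. plain_words ((a' \<otimes>\<^bsub>A\<^esub> b') # bs)) c'' bs))"
    by (rule psi_iter_mult[OF _ plain_words_mlin]) (use a b c in auto)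
  also have "\<dots> = sw OC (c \<rhd> a) (\<lambda>a' c'. sw OC (c' \<unrhd> (aw b bs)) (?g a'))"
    by (rule sw_psi_cong)
      (use a b c in \<open>auto simp: omega_psi_plain 1 simp del: psi_iter.simps intro!: sw_psi_closed psi_iter_closed\<close>)
  finally show "c \<unrhd> (omega_left (a, \<zero>) (aw b bs)) =
    sw OC (c \<rhd> a) (\<lambda>a' c'. sw OC (c' \<unrhd> (aw b bs)) (?g a'))" .
  have 2: "sw OC (iter OC (diff_words \<one>) c' (b # bs)) (?g a') =
      iter OC (\<lambda>bs. plain_words (a' # bs)) c' (b # bs)"
    if ac: "a' \<in> carrier A" "c' \<in> carrier C" for a' c'
  proof -
    have "sw OC (iter OC (diff_words \<one>) c' (b # bs)) (?g a') =
        iter OC (\<lambda>bs c. sw OC (diff_words \<one> bs c) (?g a')) c' (b # bs)"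
      by (rule lin_of_psi_iter[OF _ _ h[OF ac(1)]]) (use ac b in auto)
    also have "\<dots> = iter OC (\<lambda>bs. plain_words (a' # bs)) c' (b # bs)"
      by (rule psi_iter_cong) (use ac b in \<open>auto simp: ev omega_left_word\<close>)
    finally show ?thesis .
  qed
  have "c \<unrhd> (omega_left (a, \<zero>) (dw (b # bs))) =
      sw OC (c \<rhd> a) (\<lambda>a' c'. iter OC (\<lambda>bs. plain_words (a' # bs)) c' (b # bs))"
    using a b c by (simp add: omega_left_word omega_psi_plain)
  also have "\<dots> = sw OC (c \<rhd> a) (\<lambda>a' c'. sw OC (c' \<unrhd> (dw (b # bs))) (?g a'))"
    by (rule sw_psi_cong)
      (use a b c in \<open>auto simp: omega_psi_diff_word 2 simp del: psi_iter.simps intro!: psi_iter_closed\<close>)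
  finally show "c \<unrhd> (omega_left (a, \<zero>) (dw (b # bs))) =
    sw OC (c \<rhd> a) (\<lambda>a' c'. sw OC (c' \<unrhd> (dw (b # bs))) (?g a'))" .
qed simp

end

context cring
begin

lemma sw_sw:
  assumes "module R V" "module R W" "module R V'" "module R W'" "module R P"
    and "X \<in> carrier (tensor R V W)" "bilin V' W' P f"
    and "\<And>v w. v \<in> carrier V \<Longrightarrow> w \<in> carrier W \<Longrightarrow> g v w \<in> carrier (tensor R V' W')"
  shows "sw P (sw (tensor R V' W') X g) f = sw P X (\<lambda>v w. sw P (g v w) f)"
  by (rule lin_of_sw[OF assms(1,2) _ assms(5) lin_sw[OF assms(3,4,5,7)] assms(6,8)]) (use assms in auto)

lemma sw_sw_tens:
  assumes "module R V" "module R W" "module R V'" "module R W'" "module R P"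
    and "X \<in> carrier (tensor R V W)" and f: "bilin V' W' P f"
    and pq: "\<And>v w. v \<in> carrier V \<Longrightarrow> w \<in> carrier W \<Longrightarrow> p v w \<in> carrier V'"
      "\<And>v w. v \<in> carrier V \<Longrightarrow> w \<in> carrier W \<Longrightarrow> q v w \<in> carrier W'"
  shows "sw P (sw (tensor R V' W') X (\<lambda>v w. tens R V' W' (p v w) (q v w))) f = sw P X (\<lambda>v w. f (p v w) (q v w))"
proof -
  have "sw P (sw (tensor R V' W') X (\<lambda>v w. tens R V' W' (p v w) (q v w))) f =
      sw P X (\<lambda>v w. sw P (tens R V' W' (p v w) (q v w)) f)"
    by (rule sw_sw[OF assms(1-7)]) (use assms in auto)
  also have "\<dots> = sw P X (\<lambda>v w. f (p v w) (q v w))"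
    by (rule sw_cong[OF assms(1,2,5,6)])
      (use assms in \<open>auto simp: sw_tens[OF assms(3,4,5) f] intro!: bilinD(3)[OF f]\<close>)
  finally show ?thesis .
qed

end

context nonunital_entwining
begin

subsection \<open>The axioms of a dg-entwining structure\<close>

abbreviation rho where "rho a \<equiv> aw a []"
abbreviation CC where "CC \<equiv> tensor K C C"
abbreviation OCC where "OCC \<equiv> tensor K Om CC"

lemma lin_rho: "lin A Om (\<lambda>a. rho a)" by (rule lin_omega_head(1)) simp

lemma rho_mult_left: "a \<in> carrier A \<Longrightarrow> y \<in> carrier Om \<Longrightarrow> rho a \<cdot> y = omega_left (a, \<zero>) y"
  by (simp add: omega_word_mult)

lemmas Psi_data = omega_module coalgebra_module lin_omega_psi

lemma omega_psi_rho_mult: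
  assumes "c \<in> carrier C" "a \<in> carrier A" "y \<in> carrier Om"
  shows "c \<unrhd> (rho a \<cdot> y) =
    sw OC (c \<rhd> a) (\<lambda>a' c'. sw OC (c' \<unrhd> y) (\<lambda>y' c''.
      tens K Om C (rho a' \<cdot> y') c''))"
  unfolding rho_mult_left[OF assms(2,3)] omega_psi_left[OF assms]
  by (intro sw_psi_cong sw_Psi_cong sw_Psi_closed assms) (auto simp: rho_mult_left)

text \<open>
  Every form arises from elements \<open>\<rho>(a)\<close> by left multiplications with such elements, by \<open>d\<close>, and by
  linear combinations. The next three rules compute Sweedler sums over \<open>Psi\<close> along this construction.
\<close>

lemma sw_Psi_rho:
  assumes "module K P" "bilin Om C P f" "c \<in> carrier C" "a \<in> carrier A"
  shows "sw P (c \<unrhd> (rho a)) f = sw P (c \<rhd> a) (\<lambda>a' c'. f (rho a') c')"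
  unfolding omega_psi_rho[OF assms(3,4)]
  by (rule sw_sw_tens[OF algebra_module coalgebra_module omega_module coalgebra_module assms(1) _ assms(2)])
    (use assms psi_closed in auto)

lemma sw_Psi_rho_mult:
  assumes P: "module K P" and f: "bilin Om C P f" and [simp]: "c \<in> carrier C" "a \<in> carrier A" "y \<in> carrier Om"
  shows "sw P (c \<unrhd> (rho a \<cdot> y)) f =
    sw P (c \<rhd> a) (\<lambda>a' c'. sw P (c' \<unrhd> y) (\<lambda>y' c''. f (rho a' \<cdot> y') c''))"
proof -
  have "sw P (c \<unrhd> (rho a \<cdot> y)) f =
    sw P (c \<rhd> a) (\<lambda>a' c'. sw P (sw OC (c' \<unrhd> y) (\<lambda>y' c''.
      tens K Om C (rho a' \<cdot> y') c'')) f)"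
    unfolding omega_psi_rho_mult[OF assms(3-5)]
    by (rule sw_sw[OF algebra_module coalgebra_module omega_module coalgebra_module P _ f])
      (auto intro!: psi_closed sw_Psi_closed)
  also have "\<dots> = sw P (c \<rhd> a) (\<lambda>a' c'. sw P (c' \<unrhd> y) (\<lambda>y' c''. f (rho a' \<cdot> y') c''))"
  proof (rule sw_psi_cong[OF P])
    fix a' c' assume [simp]: "a' \<in> carrier A" "c' \<in> carrier C"
    show "sw P (sw OC (c' \<unrhd> y) (\<lambda>y' c''. tens K Om C (rho a' \<cdot> y') c'')) f =
        sw P (c' \<unrhd> y) (\<lambda>y' c''. f (rho a' \<cdot> y') c'')"
      by (rule sw_sw_tens[OF omega_module coalgebra_module omega_module coalgebra_module P _ f])
        (auto intro!: omega_psi_closed)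
  qed (auto intro!: lin_closed[OF lin_sw[OF omega_module coalgebra_module P f]] sw_Psi_closed)
  finally show ?thesis .
qed

lemma sw_Psi_diff:
  assumes P: "module K P" and f: "bilin Om C P f" and "c \<in> carrier C" "y \<in> carrier Om"
  shows "sw P (c \<unrhd> (dg_diff Om y)) f =
    sw P (c \<unrhd> y) (\<lambda>y' c'. f (dg_diff Om y') c')"
  unfolding omega_psi_diff[OF assms(3,4)] diff_OC_sw[OF omega_psi_closed[OF assms(3,4)]] id_apply
  by (rule sw_sw_tens[OF omega_module coalgebra_module omega_module coalgebra_module P _ f])
    (use assms in \<open>auto intro!: omega_psi_closed\<close>)

text \<open>
  The Leibniz rule has a sign that depends on the degree, hence it can be applied under a Sweedler sum
  over \<open>Psi\<close> only because \<open>Psi\<close> preserves degrees.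
\<close>

lemma part_left_eqI:
  assumes P: "module K P" and f: "lin OC P f" and g: "lin OC P g" and X: "X \<in> part_left K Om C n"
    and eq: "\<And>r c. r \<in> dg_part Om n \<Longrightarrow> c \<in> carrier C \<Longrightarrow> f (tens K Om C r c) = g (tens K Om C r c)"
  shows "f X = g X"
proof -
  have "X \<in> {X \<in> carrier OC. f X = g X}"
    by (rule lin_span_least[OF lin_eq_submodule[OF _ P f g] _ X[unfolded part_left_def]])
      (auto simp: eq omega_part_closed)
  then show ?thesis by simp
qed

abbreviation mult_sum where
  "mult_sum y \<equiv> (\<lambda>x' c'. sw OC (c' \<unrhd> y) (\<lambda>y' c''. tens K Om C (x' \<cdot> y') c''))"

lemmas bilin_mult_sum = bilin_entw_mult_tens[OF Psi_data omega_bilin]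
lemmas bilin_omega_mult_tens = bilin_mult_tens[OF Psi_data omega_bilin]

lemma mult_sum_closed:
  assumes "x \<in> carrier Om" "y \<in> carrier Om" "c \<in> carrier C"
  shows "mult_sum y x c \<in> carrier OC"
  by (rule bilinD(3)[OF bilin_mult_sum]) (use assms in auto)

text \<open>
  For \<open>x = \<rho>(a) x'\<close> the claim follows from the compatibility with left multiplication by \<open>\<rho>(a)\<close> and the
  associativity of the product. For \<open>x = dx'\<close> it is
  obtained by applying \<open>d\<close> to the claim for \<open>x'\<close> and subtracting the claim for \<open>x'\<close> and \<open>dy\<close>.
\<close>

lemma omega_psi_mult_graded:
  assumes "x \<in> dg_part Om n"
  shows "\<forall>c\<in>carrier C. \<forall>y\<in>carrier Om. c \<unrhd> (x \<cdot> y) =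
    sw OC (c \<unrhd> x) (mult_sum y)"
  using assms
proof (induction x rule: omega_graded_induct)
  case (base a)
  show ?case
    using base by (auto simp: sw_Psi_rho[OF _ bilin_mult_sum] omega_psi_rho_mult)
next
  case (mult n a x)
  then have x: "x \<in> carrier Om" by (simp add: omega_part_closed)
  show ?case
  proof (intro ballI)
    fix c y assume [simp]: "c \<in> carrier C" "y \<in> carrier Om"
    note [simp] = x \<open>a \<in> carrier A\<close>
    have "c \<unrhd> ((rho a \<cdot> x) \<cdot> y) =
        sw OC (c \<rhd> a) (\<lambda>a' c'. sw OC (c' \<unrhd> (x \<cdot> y)) (\<lambda>z c''. tens K Om C (rho a' \<cdot> z) c''))"
      by (simp add: omega_mult_assoc omega_psi_rho_mult)
    also have "\<dots> = sw OC (c \<rhd> a) (\<lambda>a' c'. sw OC (c' \<unrhd> x) (\<lambda>x' c1. mult_sum y (rho a' \<cdot> x') c1))"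
    proof (rule sw_psi_cong)
      fix a' c' assume [simp]: "a' \<in> carrier A" "c' \<in> carrier C"
      have b: "bilin Om C OC (\<lambda>z c''. tens K Om C (rho a' \<cdot> z) c'')"
        by (rule bilin_omega_mult_tens) simp
      have "sw OC (c' \<unrhd> (x \<cdot> y)) (\<lambda>z c''. tens K Om C (rho a' \<cdot> z) c'') =
          sw OC (c' \<unrhd> x) (\<lambda>x' c1. sw OC (mult_sum y x' c1) (\<lambda>z c''. tens K Om C (rho a' \<cdot> z) c''))"
        using mult.IH
        by (simp, intro sw_sw[OF omega_module coalgebra_module omega_module coalgebra_module _ _ b])
          (auto intro!: omega_psi_closed mult_sum_closed)
      also have "\<dots> = sw OC (c' \<unrhd> x) (\<lambda>x' c1. mult_sum y (rho a' \<cdot> x') c1)"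
      proof (rule sw_Psi_cong)
        fix x' c1 assume [simp]: "x' \<in> carrier Om" "c1 \<in> carrier C"
        show "sw OC (mult_sum y x' c1) (\<lambda>z c''. tens K Om C (rho a' \<cdot> z) c'') = mult_sum y (rho a' \<cdot> x') c1"
          by (subst sw_sw_tens[OF omega_module coalgebra_module omega_module coalgebra_module _ _ b])
            (auto intro!: omega_psi_closed sw_Psi_cong simp: omega_mult_assoc del: equalityI subsetI)
      qed (auto intro!: lin_closed[OF lin_sw[OF omega_module coalgebra_module _ b]] mult_sum_closed)
      finally show "sw OC (c' \<unrhd> (x \<cdot> y)) (\<lambda>z c''. tens K Om C (rho a' \<cdot> z) c'') =
          sw OC (c' \<unrhd> x) (\<lambda>x' c1. mult_sum y (rho a' \<cdot> x') c1)" .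
    qed (auto intro!: sw_Psi_closed)
    also have "\<dots> = sw OC (c \<unrhd> (rho a \<cdot> x)) (mult_sum y)"
      by (rule sw_Psi_rho_mult[OF _ bilin_mult_sum, symmetric]) auto
    finally show "c \<unrhd> ((rho a \<cdot> x) \<cdot> y) =
      sw OC (c \<unrhd> (rho a \<cdot> x)) (mult_sum y)" .
  qed
next
  case (diff n x)
  then have x [simp]: "x \<in> carrier Om" by (simp add: omega_part_closed)
  show ?case
  proof (intro ballI)
    fix c y assume [simp]: "c \<in> carrier C" "y \<in> carrier Om"
    interpret O: module K OC by simp
    let ?d = "dg_diff Om"
    let ?TD = "tmap K Om C ?d id"
    note l = lin_Psi_alg[OF \<open>c \<in> carrier C\<close> lin_ident]
    let ?Z = "alt_sign OC n (c \<unrhd> (x \<cdot> ?d y))"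
    have "c \<unrhd> (?d x \<cdot> y) \<oplus>\<^bsub>OC\<^esub> ?Z = c \<unrhd> (?d (x \<cdot> y))"
      using diff.hyps by (simp add: omega_leibniz lin_add[OF l] lin_alt_sign[OF _ _ l])
    also have "\<dots> = ?TD (sw OC (c \<unrhd> x) (mult_sum y))"
      using diff.IH by (simp add: omega_psi_diff)
    also have "\<dots> = sw OC (c \<unrhd> x) (\<lambda>x' c'. ?TD (mult_sum y x' c'))"
      by (rule lin_of_sw_Psi[OF _ _ lin_diff_OC]) (auto intro!: mult_sum_closed)
    also have "\<dots> = sw OC (c \<unrhd> x) (\<lambda>x' c'. mult_sum y (?d x') c' \<oplus>\<^bsub>OC\<^esub> alt_sign OC n (mult_sum (?d y) x' c'))"
    proof (rule part_left_eqI[OF _ lin_sw lin_sw omega_psi_part[OF _ diff.hyps]])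
      show b1: "bilin Om C OC (\<lambda>x' c'. ?TD (mult_sum y x' c'))"
        by (intro bilinI lin_comp[OF lin_diff_OC] bilinD[OF bilin_mult_sum]) auto
      show b2: "bilin Om C OC (\<lambda>x' c'. mult_sum y (?d x') c' \<oplus>\<^bsub>OC\<^esub> alt_sign OC n (mult_sum (?d y) x' c'))"
        by (intro bilinI lin_add_map lin_alt_map lin_comp[OF bilinD(2)[OF bilin_mult_sum] lin_omega_diff] bilinD[OF bilin_mult_sum])
          auto
      fix x' c' assume x': "x' \<in> dg_part Om n" and [simp]: "c' \<in> carrier C"
      then have [simp]: "x' \<in> carrier Om" by (simp add: omega_part_closed)
      have "?TD (mult_sum y x' c') = sw OC (c' \<unrhd> y) (\<lambda>y' c''. ?TD (tens K Om C (x' \<cdot> y') c''))"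
        by (rule lin_of_sw_Psi[OF _ _ lin_diff_OC]) auto
      also have "\<dots> = sw OC (c' \<unrhd> y) (\<lambda>y' c''. tens K Om C (?d x' \<cdot> y') c'' \<oplus>\<^bsub>OC\<^esub>
          alt_sign OC n (tens K Om C (x' \<cdot> ?d y') c''))"
      proof (rule sw_Psi_cong)
        fix y' c'' assume [simp]: "y' \<in> carrier Om" "c'' \<in> carrier C"
        have lt: "lin Om OC (\<lambda>z. tens K Om C z c'')" by (rule lin_tens_left) auto
        show "?TD (tens K Om C (x' \<cdot> y') c'') =
            tens K Om C (?d x' \<cdot> y') c'' \<oplus>\<^bsub>OC\<^esub> alt_sign OC n (tens K Om C (x' \<cdot> ?d y') c'')"
          by (simp add: diff_OC omega_leibniz[OF x'] lin_add[OF lt] lin_alt_sign[OF _ _ lt])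
      qed (auto simp: diff_OC)
      also have "\<dots> = mult_sum y (?d x') c' \<oplus>\<^bsub>OC\<^esub>
          sw OC (c' \<unrhd> y) (\<lambda>y' c''. alt_sign OC n (tens K Om C (x' \<cdot> ?d y') c''))"
        by (rule sw_add) (auto intro!: omega_psi_closed)
      also have "sw OC (c' \<unrhd> y) (\<lambda>y' c''. alt_sign OC n (tens K Om C (x' \<cdot> ?d y') c'')) =
          alt_sign OC n (sw OC (c' \<unrhd> y) (\<lambda>y' c''. tens K Om C (x' \<cdot> ?d y') c''))"
        by (rule lin_of_sw_Psi[symmetric]) (auto intro!: lin_alt_map lin_ident)
      also have "sw OC (c' \<unrhd> y) (\<lambda>y' c''. tens K Om C (x' \<cdot> ?d y') c'') = mult_sum (?d y) x' c'"
        by (rule sw_Psi_diff[symmetric]) (auto intro!: bilin_omega_mult_tens)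
      finally have "?TD (mult_sum y x' c') = mult_sum y (?d x') c' \<oplus>\<^bsub>OC\<^esub> alt_sign OC n (mult_sum (?d y) x' c')" .
      moreover have "sw OC (tens K Om C x' c') (\<lambda>x' c'. ?TD (mult_sum y x' c')) = ?TD (mult_sum y x' c')"
        by (rule sw_tens[OF _ _ _ b1]) auto
      moreover have "sw OC (tens K Om C x' c') (\<lambda>x' c'. mult_sum y (?d x') c' \<oplus>\<^bsub>OC\<^esub> alt_sign OC n (mult_sum (?d y) x' c')) =
          mult_sum y (?d x') c' \<oplus>\<^bsub>OC\<^esub> alt_sign OC n (mult_sum (?d y) x' c')"
        by (rule sw_tens[OF _ _ _ b2]) auto
      ultimately show "sw OC (tens K Om C x' c') (\<lambda>x' c'. ?TD (mult_sum y x' c')) =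
          sw OC (tens K Om C x' c') (\<lambda>x' c'. mult_sum y (?d x') c' \<oplus>\<^bsub>OC\<^esub> alt_sign OC n (mult_sum (?d y) x' c'))"
        by (simp only:)
    qed auto
    also have "\<dots> = sw OC (c \<unrhd> x) (\<lambda>x' c'. mult_sum y (?d x') c') \<oplus>\<^bsub>OC\<^esub>
        sw OC (c \<unrhd> x) (\<lambda>x' c'. alt_sign OC n (mult_sum (?d y) x' c'))"
      by (rule sw_add) (auto intro!: omega_psi_closed mult_sum_closed)
    also have "sw OC (c \<unrhd> x) (\<lambda>x' c'. mult_sum y (?d x') c') = sw OC (c \<unrhd> (?d x)) (mult_sum y)"
      by (rule sw_Psi_diff[OF _ bilin_mult_sum, symmetric]) auto
    also have "sw OC (c \<unrhd> x) (\<lambda>x' c'. alt_sign OC n (mult_sum (?d y) x' c')) =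
        alt_sign OC n (sw OC (c \<unrhd> x) (mult_sum (?d y)))"
      by (rule lin_of_sw_Psi[symmetric]) (auto intro!: lin_alt_map lin_ident mult_sum_closed)
    also have "sw OC (c \<unrhd> x) (mult_sum (?d y)) = c \<unrhd> (x \<cdot> ?d y)"
      using diff.IH by simp
    finally have "c \<unrhd> (?d x \<cdot> y) \<oplus>\<^bsub>OC\<^esub> ?Z =
        sw OC (c \<unrhd> (?d x)) (mult_sum y) \<oplus>\<^bsub>OC\<^esub> ?Z" .
    then show "c \<unrhd> (?d x \<cdot> y) = sw OC (c \<unrhd> (?d x)) (mult_sum y)"
      by (subst (asm) O.add.right_cancel) (auto intro!: omega_psi_closed sw_Psi_closed mult_sum_closed)
  qed
next
  case (add n x y)
  then have xy: "x \<in> carrier Om" "y \<in> carrier Om" by (simp_all add: omega_part_closed)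
  show ?case
  proof (intro ballI)
    fix c z assume cz: "c \<in> carrier C" "z \<in> carrier Om"
    note l = lin_Psi_alg[OF cz(1) lin_ident]
    note L = lin_sw[OF omega_module coalgebra_module _ bilin_mult_sum[OF cz(2)]]
    show "c \<unrhd> ((x \<oplus>\<^bsub>Om\<^esub> y) \<cdot> z) = sw OC (c \<unrhd> (x \<oplus>\<^bsub>Om\<^esub> y)) (mult_sum z)"
      using xy cz add.IH by (simp add: lin_add[OF lin_omega_mult(2)] lin_add[OF l] lin_add[OF L] omega_psi_closed)
  qed
next
  case (smult n r x)
  then have x: "x \<in> carrier Om" by (simp add: omega_part_closed)
  show ?case
  proof (intro ballI)
    fix c z assume cz: "c \<in> carrier C" "z \<in> carrier Om"
    note l = lin_Psi_alg[OF cz(1) lin_ident]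
    note L = lin_sw[OF omega_module coalgebra_module _ bilin_mult_sum[OF cz(2)]]
    show "c \<unrhd> ((r \<odot>\<^bsub>Om\<^esub> x) \<cdot> z) = sw OC (c \<unrhd> (r \<odot>\<^bsub>Om\<^esub> x)) (mult_sum z)"
      using x cz smult by (simp add: lin_smult[OF lin_omega_mult(2)] lin_smult[OF l] lin_smult[OF L] omega_psi_closed)
  qed
qed

lemma omega_psi_mult:
  assumes "c \<in> carrier C" "x \<in> carrier Om" "y \<in> carrier Om"
  shows "c \<unrhd> (x \<cdot> y) = sw OC (c \<unrhd> x) (mult_sum y)"
proof (rule omega_eqI[OF _ _ _ _ _ assms(2)])
  show "lin Om OC (\<lambda>x. c \<unrhd> (x \<cdot> y))"
    by (intro lin_Psi_alg lin_omega_mult(2) assms)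
  show "lin Om OC (\<lambda>x. sw OC (c \<unrhd> x) (mult_sum y))"
    by (intro lin_sw_Psi_alg bilin_mult_sum lin_ident assms) auto
qed (use assms omega_psi_mult_graded[OF omega_word_part] in auto)

subsubsection \<open>Comultiplication and counit\<close>

lemma bilin_tens_comult: "bilin Om C OCC (\<lambda>x c. tens K Om CC x (comult C c))"
  using lin_closed[OF comult_linear] by (intro bilinI lin_tens_l lin_tens_r lin_ident comult_linear) auto

text \<open>
  The axiom on the coproduct, evaluated on a trilinear map \<open>H\<close>
\<close>

lemma psi_comult_general:
  assumes P: "module K P" and H: "\<And>a. a \<in> carrier A \<Longrightarrow> bilin C C P (H a)"
      "\<And>c1 c2. c1 \<in> carrier C \<Longrightarrow> c2 \<in> carrier C \<Longrightarrow> lin A P (\<lambda>a. H a c1 c2)"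
    and [simp]: "c \<in> carrier C" "a \<in> carrier A"
  shows "sw P (c \<rhd> a) (\<lambda>a' c'. sw P (comult C c') (H a')) =
      sw P (comult C c) (\<lambda>c1 c2. sw P (c2 \<rhd> a) (\<lambda>a' c2'.
          sw P (c1 \<rhd> a') (\<lambda>a'' c1'. H a'' c1' c2')))"
proof -
  let ?f = "\<lambda>a' z. sw P z (H a')"
  note [simp] = lin_closed[OF comult_linear] psi_closed
  have f: "bilin A CC P ?f"
    by (intro bilinI lin_sw lin_sw_param[OF coalgebra_module coalgebra_module] H P) auto
  note S = sw_sw[OF coalgebra_module coalgebra_module algebra_module _ P _ f]
  note S' = sw_sw[OF algebra_module coalgebra_module algebra_module _ P _ f]
  note T = sw_sw_tens[OF algebra_module coalgebra_module algebra_module _ P _ f]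
  note fc = lin_closed[OF lin_sw[OF _ _ P f]]
  have Hc: "H a c1 c2 \<in> carrier P" if "a \<in> carrier A" "c1 \<in> carrier C" "c2 \<in> carrier C" for a c1 c2
    using bilinD(3)[OF H(1)] that by auto
  have "sw P (c \<rhd> a) (\<lambda>a' c'. ?f a' (comult C c')) =
      sw P (sw (tensor K A CC) (c \<rhd> a) (\<lambda>a' c'. tens K A CC a' (comult C c'))) ?f"
    by (rule T[symmetric]) auto
  also have "\<dots> = sw P (sw (tensor K A CC) (comult C c) (\<lambda>c1 c2.
        sw (tensor K A CC) (c2 \<rhd> a) (\<lambda>a' c2'.
          sw (tensor K A CC) (c1 \<rhd> a') (\<lambda>a'' c1'.
            tens K A CC a'' (tens K C C c1' c2'))))) ?f"
    by (simp add: psi_comult_sw)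
  also have "\<dots> = sw P (comult C c) (\<lambda>c1 c2. sw P (sw (tensor K A CC) (c2 \<rhd> a) (\<lambda>a' c2'.
          sw (tensor K A CC) (c1 \<rhd> a') (\<lambda>a'' c1'.
            tens K A CC a'' (tens K C C c1' c2')))) ?f)"
    by (rule S) (auto intro!: sw_psi_closed)
  also have "\<dots> = sw P (comult C c) (\<lambda>c1 c2. sw P (c2 \<rhd> a) (\<lambda>a' c2'.
          sw P (c1 \<rhd> a') (\<lambda>a'' c1'. H a'' c1' c2')))"
  proof (rule sw_cong[OF coalgebra_module coalgebra_module P])
    fix c1 c2 assume [simp]: "c1 \<in> carrier C" "c2 \<in> carrier C"
    have "sw P (sw (tensor K A CC) (c2 \<rhd> a) (\<lambda>a' c2'.
          sw (tensor K A CC) (c1 \<rhd> a') (\<lambda>a'' c1'. tens K A CC a'' (tens K C C c1' c2')))) ?f =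
        sw P (c2 \<rhd> a) (\<lambda>a' c2'. sw P (sw (tensor K A CC) (c1 \<rhd> a') (\<lambda>a'' c1'.
            tens K A CC a'' (tens K C C c1' c2'))) ?f)"
      by (rule S') (auto intro!: sw_psi_closed)
    also have "\<dots> = sw P (c2 \<rhd> a) (\<lambda>a' c2'. sw P (c1 \<rhd> a') (\<lambda>a'' c1'. H a'' c1' c2'))"
    proof (rule sw_psi_cong[OF P])
      fix a' c2' assume [simp]: "a' \<in> carrier A" "c2' \<in> carrier C"
      have "sw P (sw (tensor K A CC) (c1 \<rhd> a') (\<lambda>a'' c1'. tens K A CC a'' (tens K C C c1' c2'))) ?f =
          sw P (c1 \<rhd> a') (\<lambda>a'' c1'. ?f a'' (tens K C C c1' c2'))"
        by (rule T) auto
      also have "\<dots> = sw P (c1 \<rhd> a') (\<lambda>a'' c1'. H a'' c1' c2')"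
        by (rule sw_psi_cong[OF P]) (auto simp: sw_tens[OF _ _ P H(1)] intro!: Hc)
      finally show "sw P (sw (tensor K A CC) (c1 \<rhd> a') (\<lambda>a'' c1'. tens K A CC a'' (tens K C C c1' c2'))) ?f =
          sw P (c1 \<rhd> a') (\<lambda>a'' c1'. H a'' c1' c2')" .
    qed (auto intro!: fc sw_psi_closed)
    finally show "sw P (sw (tensor K A CC) (c2 \<rhd> a) (\<lambda>a' c2'.
          sw (tensor K A CC) (c1 \<rhd> a') (\<lambda>a'' c1'. tens K A CC a'' (tens K C C c1' c2')))) ?f =
        sw P (c2 \<rhd> a) (\<lambda>a' c2'. sw P (c1 \<rhd> a') (\<lambda>a'' c1'. H a'' c1' c2'))" .
  qed (auto intro!: fc sw_psi_closed)
  finally show ?thesis .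
qed

abbreviation comult_sum where
  "comult_sum x c \<equiv> sw OCC (comult C c) (\<lambda>c1 c2. sw OCC (c2 \<unrhd> x) (\<lambda>x' c2'.
      sw OCC (c1 \<unrhd> x') (\<lambda>x'' c1'. tens K Om CC x'' (tens K C C c1' c2'))))"

lemma bilin_tens_assoc:
  assumes "c2 \<in> carrier C" "lin Om Om f"
  shows "bilin Om C OCC (\<lambda>x c1. tens K Om CC (f x) (tens K C C c1 c2))"
  using assms lin_closed[OF assms(2)] by (intro bilinI lin_tens_l lin_tens_r lin_ident) auto

lemma bilin_comult_inner:
  assumes c1: "c1 \<in> carrier C" and f: "lin Om Om f"
  shows "bilin Om C OCC (\<lambda>x' c2'. sw OCC (c1 \<unrhd> x') (\<lambda>x'' c1'. tens K Om CC (f x'') (tens K C C c1' c2')))"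
proof (rule bilinI)
  fix x' assume x': "x' \<in> carrier Om"
  show "lin C OCC (\<lambda>c2'. sw OCC (c1 \<unrhd> x') (\<lambda>x'' c1'. tens K Om CC (f x'') (tens K C C c1' c2')))"
    by (intro lin_sw_Psi_param lin_tens_r lin_ident c1 x') (auto simp: lin_closed[OF f])
next
  fix c2' assume c2': "c2' \<in> carrier C"
  show "lin Om OCC (\<lambda>x'. sw OCC (c1 \<unrhd> x') (\<lambda>x'' c1'. tens K Om CC (f x'') (tens K C C c1' c2')))"
    by (intro lin_sw_Psi_alg bilin_tens_assoc f c1 c2' lin_ident) auto
qed

lemma bilin_comult_sum:
  assumes x: "x \<in> carrier Om" and f: "lin Om Om f"
  shows "bilin C C OCC (\<lambda>c1 c2. sw OCC (c2 \<unrhd> x) (\<lambda>x' c2'.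
      sw OCC (c1 \<unrhd> x') (\<lambda>x'' c1'. tens K Om CC (f x'') (tens K C C c1' c2'))))"
proof (rule bilinI)
  fix c1 assume c1: "c1 \<in> carrier C"
  show "lin C OCC (\<lambda>c2. sw OCC (c2 \<unrhd> x) (\<lambda>x' c2'.
      sw OCC (c1 \<unrhd> x') (\<lambda>x'' c1'. tens K Om CC (f x'') (tens K C C c1' c2'))))"
    by (intro lin_sw_Psi_coalg bilin_comult_inner x f c1 lin_ident) auto
next
  fix c2 assume c2: "c2 \<in> carrier C"
  show "lin C OCC (\<lambda>c1. sw OCC (c2 \<unrhd> x) (\<lambda>x' c2'.
      sw OCC (c1 \<unrhd> x') (\<lambda>x'' c1'. tens K Om CC (f x'') (tens K C C c1' c2'))))"
    by (intro lin_sw_Psi_param lin_sw_Psi_coalg bilin_tens_assoc x f c2 lin_ident) auto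
qed

lemma lin_comult_sum: "c \<in> carrier C \<Longrightarrow> lin Om OCC (\<lambda>x. comult_sum x c)"
  using lin_closed[OF comult_linear]
  by (intro lin_sw_param[OF coalgebra_module coalgebra_module] lin_sw_Psi_alg
      bilin_comult_inner[where f = "\<lambda>x. x"] lin_ident) auto

text \<open>
  In the induction for the axiom on the coproduct, \<open>f \<otimes> id\<close> is applied to both sides of the induction
  hypothesis, with \<open>f = d\<close> or \<open>f\<close> the left multiplication by \<open>\<rho>(a)\<close>.
\<close>

lemma tmap_comult_sum:
  assumes f: "lin Om Om f" and [simp]: "x \<in> carrier Om" "c \<in> carrier C"
  shows "tmap K Om CC f id (comult_sum x c) =
    sw OCC (comult C c) (\<lambda>c1 c2. sw OCC (c2 \<unrhd> x) (\<lambda>x' c2'.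
      sw OCC (c1 \<unrhd> x') (\<lambda>x'' c1'. tens K Om CC (f x'') (tens K C C c1' c2'))))"
proof -
  note [simp] = lin_closed[OF comult_linear] lin_closed[OF f]
  have l: "lin OCC OCC (tmap K Om CC f id)" by (rule tmap_tens(1)) (auto intro: f lin_id)
  have ev: "tmap K Om CC f id (tens K Om CC y z) = tens K Om CC (f y) z" if "y \<in> carrier Om" "z \<in> carrier CC" for y z
    using tmap_tens(3)[OF _ _ _ _ f lin_id that] by simp
  have "tmap K Om CC f id (comult_sum x c) = sw OCC (comult C c) (\<lambda>c1 c2. tmap K Om CC f id
      (sw OCC (c2 \<unrhd> x) (\<lambda>x' c2'.
      sw OCC (c1 \<unrhd> x') (\<lambda>x'' c1'. tens K Om CC x'' (tens K C C c1' c2')))))"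
    by (rule lin_of_sw[OF coalgebra_module coalgebra_module _ _ l]) (auto intro!: sw_Psi_closed)
  also have "\<dots> = sw OCC (comult C c) (\<lambda>c1 c2. sw OCC (c2 \<unrhd> x) (\<lambda>x' c2'.
      sw OCC (c1 \<unrhd> x') (\<lambda>x'' c1'. tens K Om CC (f x'') (tens K C C c1' c2'))))"
  proof (rule sw_cong[OF coalgebra_module coalgebra_module])
    fix c1 c2 assume [simp]: "c1 \<in> carrier C" "c2 \<in> carrier C"
    have "tmap K Om CC f id (sw OCC (c2 \<unrhd> x) (\<lambda>x' c2'.
      sw OCC (c1 \<unrhd> x') (\<lambda>x'' c1'. tens K Om CC x'' (tens K C C c1' c2')))) =
      sw OCC (c2 \<unrhd> x) (\<lambda>x' c2'. tmap K Om CC f id (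
      sw OCC (c1 \<unrhd> x') (\<lambda>x'' c1'. tens K Om CC x'' (tens K C C c1' c2'))))"
      by (rule lin_of_sw_Psi[OF _ _ l]) (auto intro!: sw_Psi_closed)
    also have "\<dots> = sw OCC (c2 \<unrhd> x) (\<lambda>x' c2'.
      sw OCC (c1 \<unrhd> x') (\<lambda>x'' c1'. tens K Om CC (f x'') (tens K C C c1' c2')))"
    proof (rule sw_Psi_cong)
      fix x' c2' assume [simp]: "x' \<in> carrier Om" "c2' \<in> carrier C"
      have "tmap K Om CC f id (sw OCC (c1 \<unrhd> x') (\<lambda>x'' c1'. tens K Om CC x'' (tens K C C c1' c2'))) =
        sw OCC (c1 \<unrhd> x') (\<lambda>x'' c1'. tmap K Om CC f id (tens K Om CC x'' (tens K C C c1' c2')))"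
        by (rule lin_of_sw_Psi[OF _ _ l]) auto
      also have "\<dots> = sw OCC (c1 \<unrhd> x') (\<lambda>x'' c1'. tens K Om CC (f x'') (tens K C C c1' c2'))"
        by (rule sw_Psi_cong) (auto simp: ev)
      finally show "tmap K Om CC f id (sw OCC (c1 \<unrhd> x') (\<lambda>x'' c1'. tens K Om CC x'' (tens K C C c1' c2'))) =
        sw OCC (c1 \<unrhd> x') (\<lambda>x'' c1'. tens K Om CC (f x'') (tens K C C c1' c2'))" .
    qed (auto intro!: lin_closed[OF l] sw_Psi_closed)
    finally show "tmap K Om CC f id (sw OCC (c2 \<unrhd> x) (\<lambda>x' c2'.
      sw OCC (c1 \<unrhd> x') (\<lambda>x'' c1'. tens K Om CC x'' (tens K C C c1' c2')))) =
      sw OCC (c2 \<unrhd> x) (\<lambda>x' c2'.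
      sw OCC (c1 \<unrhd> x') (\<lambda>x'' c1'. tens K Om CC (f x'') (tens K C C c1' c2')))" .
  qed (auto intro!: lin_closed[OF l] sw_Psi_closed)
  finally show ?thesis .
qed

lemma tmap_sw_comult:
  assumes f: "lin Om Om f" and [simp]: "x \<in> carrier Om" "c \<in> carrier C"
  shows "tmap K Om CC f id (sw OCC (c \<unrhd> x) (\<lambda>x' c'. tens K Om CC x' (comult C c'))) =
    sw OCC (c \<unrhd> x) (\<lambda>x' c'. tens K Om CC (f x') (comult C c'))"
proof -
  note [simp] = lin_closed[OF comult_linear] lin_closed[OF f]
  have l: "lin OCC OCC (tmap K Om CC f id)" by (rule tmap_tens(1)) (auto intro: f lin_id)
  have ev: "tmap K Om CC f id (tens K Om CC y z) = tens K Om CC (f y) z" if "y \<in> carrier Om" "z \<in> carrier CC" for y z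
    using tmap_tens(3)[OF _ _ _ _ f lin_id that] by simp
  have "tmap K Om CC f id (sw OCC (c \<unrhd> x) (\<lambda>x' c'. tens K Om CC x' (comult C c'))) =
    sw OCC (c \<unrhd> x) (\<lambda>x' c'. tmap K Om CC f id (tens K Om CC x' (comult C c')))"
    by (rule lin_of_sw_Psi[OF _ _ l]) auto
  also have "\<dots> = sw OCC (c \<unrhd> x) (\<lambda>x' c'. tens K Om CC (f x') (comult C c'))"
    by (rule sw_Psi_cong) (auto simp: ev)
  finally show ?thesis .
qed

text \<open>
  For \<open>\<rho>(a) x\<close> the axiom for \<open>\<psi>\<close> at \<open>a\<close> and the induction hypothesis at \<open>x\<close> produce the entwinings of
  \<open>c\<^sub>2\<close> past \<open>a\<close>, of \<open>c\<^sub>1\<close> past \<open>a\<close>, of \<open>c\<^sub>2\<close> past \<open>x\<close>, of \<open>c\<^sub>1\<close> past \<open>x\<close>, in this order. The two in the middle are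
  independent and have to be interchanged.
\<close>

lemma omega_psi_comult_graded:
  assumes "x \<in> dg_part Om n"
  shows "\<forall>c\<in>carrier C. sw OCC (c \<unrhd> x) (\<lambda>x' c'. tens K Om CC x' (comult C c')) = comult_sum x c"
  using assms
proof (induction x rule: omega_graded_induct)
  case (base a)
  note [simp] = lin_closed[OF comult_linear] \<open>a \<in> carrier A\<close>
  show ?case
  proof
    fix c assume [simp]: "c \<in> carrier C"
    have H: "bilin C C OCC (\<lambda>c1 c2. tens K Om CC (rho a) (tens K C C c1 c2))" if "a \<in> carrier A" for a
      using that by (intro bilinI lin_tens_r lin_tens_l lin_ident) auto
    have "sw OCC (c \<unrhd> (rho a)) (\<lambda>x' c'. tens K Om CC x' (comult C c')) =
        sw OCC (c \<rhd> a) (\<lambda>a' c'. tens K Om CC (rho a') (comult C c'))"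
      by (rule sw_Psi_rho[OF _ bilin_tens_comult]) auto
    also have "\<dots> = sw OCC (c \<rhd> a) (\<lambda>a' c'. sw OCC (comult C c') (\<lambda>c1 c2. tens K Om CC (rho a') (tens K C C c1 c2)))"
    proof (rule sw_psi_cong)
      fix a' c' assume [simp]: "a' \<in> carrier A" "c' \<in> carrier C"
      have "tens K Om CC (rho a') (sw CC (comult C c') (tens K C C)) =
          sw OCC (comult C c') (\<lambda>c1 c2. tens K Om CC (rho a') (tens K C C c1 c2))"
        by (rule lin_of_sw[OF coalgebra_module coalgebra_module _ _ lin_tens_right]) auto
      then show "tens K Om CC (rho a') (comult C c') = sw OCC (comult C c') (\<lambda>c1 c2. tens K Om CC (rho a') (tens K C C c1 c2))"
        by (simp add: sw_tens_self)
    qed auto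
    also have "\<dots> = sw OCC (comult C c) (\<lambda>c1 c2. sw OCC (c2 \<rhd> a) (\<lambda>a' c2'.
        sw OCC (c1 \<rhd> a') (\<lambda>a'' c1'. tens K Om CC (rho a'') (tens K C C c1' c2'))))"
      by (rule psi_comult_general[OF _ H]) (auto intro!: lin_tens_l lin_rho)
    also have "\<dots> = comult_sum (rho a) c"
    proof (rule sw_cong[OF coalgebra_module coalgebra_module])
      fix c1 c2 assume [simp]: "c1 \<in> carrier C" "c2 \<in> carrier C"
      have "sw OCC (c2 \<unrhd> (rho a)) (\<lambda>x' c2'.
          sw OCC (c1 \<unrhd> x') (\<lambda>x'' c1'. tens K Om CC x'' (tens K C C c1' c2'))) =
        sw OCC (c2 \<rhd> a) (\<lambda>a' c2'. sw OCC (c1 \<unrhd> (rho a')) (\<lambda>x'' c1'. tens K Om CC x'' (tens K C C c1' c2')))"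
        by (rule sw_Psi_rho[OF _ bilin_comult_inner[OF _ lin_ident]]) auto
      also have "\<dots> = sw OCC (c2 \<rhd> a) (\<lambda>a' c2'.
        sw OCC (c1 \<rhd> a') (\<lambda>a'' c1'. tens K Om CC (rho a'') (tens K C C c1' c2')))"
        by (rule sw_psi_cong) (auto intro!: sw_Psi_closed sw_Psi_rho[OF _ bilin_tens_assoc[OF _ lin_ident]] del: equalityI subsetI)
      finally show "sw OCC (c2 \<rhd> a) (\<lambda>a' c2'.
        sw OCC (c1 \<rhd> a') (\<lambda>a'' c1'. tens K Om CC (rho a'') (tens K C C c1' c2'))) =
        sw OCC (c2 \<unrhd> (rho a)) (\<lambda>x' c2'.
          sw OCC (c1 \<unrhd> x') (\<lambda>x'' c1'. tens K Om CC x'' (tens K C C c1' c2')))" ..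
    qed (auto intro!: sw_psi_closed)
    finally show "sw OCC (c \<unrhd> (rho a)) (\<lambda>x' c'. tens K Om CC x' (comult C c')) = comult_sum (rho a) c" .
  qed
next
  case (mult n a x)
  note [simp] = lin_closed[OF comult_linear] \<open>a \<in> carrier A\<close> omega_part_closed[OF mult.hyps(2)]
  note L = lin_omega_mult(1)
  let ?H = "\<lambda>a' c1 c2. sw OCC (c2 \<unrhd> x) (\<lambda>x' c2'.
      sw OCC (c1 \<unrhd> x') (\<lambda>x'' c1'. tens K Om CC (rho a' \<cdot> x'') (tens K C C c1' c2')))"
  have H: "bilin C C OCC (?H a')" if "a' \<in> carrier A" for a'
    using that by (intro bilin_comult_sum L) auto
  have H2: "lin A OCC (\<lambda>a'. ?H a' c1 c2)" if "c1 \<in> carrier C" "c2 \<in> carrier C" for c1 c2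
    using that by (intro lin_sw_Psi_param lin_tens_l lin_comp[OF lin_omega_mult(2) lin_rho]) auto
  show ?case
  proof
    fix c assume [simp]: "c \<in> carrier C"
    have "sw OCC (c \<unrhd> (rho a \<cdot> x)) (\<lambda>x' c'. tens K Om CC x' (comult C c')) =
        sw OCC (c \<rhd> a) (\<lambda>a' c'. sw OCC (c' \<unrhd> x) (\<lambda>x' c''. tens K Om CC (rho a' \<cdot> x') (comult C c'')))"
      by (rule sw_Psi_rho_mult[OF _ bilin_tens_comult]) auto
    also have "\<dots> = sw OCC (c \<rhd> a) (\<lambda>a' c'. sw OCC (comult C c') (?H a'))"
    proof (rule sw_psi_cong)
      fix a' c' assume [simp]: "a' \<in> carrier A" "c' \<in> carrier C"
      have "sw OCC (c' \<unrhd> x) (\<lambda>x' c''. tens K Om CC (rho a' \<cdot> x') (comult C c'')) =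
          tmap K Om CC (\<lambda>z. rho a' \<cdot> z) id (sw OCC (c' \<unrhd> x) (\<lambda>x' c'. tens K Om CC x' (comult C c')))"
        by (rule tmap_sw_comult[OF L, symmetric]) auto
      also have "\<dots> = tmap K Om CC (\<lambda>z. rho a' \<cdot> z) id (comult_sum x c')"
        using mult.IH by simp
      also have "\<dots> = sw OCC (comult C c') (?H a')" by (rule tmap_comult_sum[OF L]) auto
      finally show "sw OCC (c' \<unrhd> x) (\<lambda>x' c''. tens K Om CC (rho a' \<cdot> x') (comult C c'')) =
        sw OCC (comult C c') (?H a')" .
    qed (auto intro!: sw_Psi_closed)
    also have "\<dots> = sw OCC (comult C c) (\<lambda>c1 c2. sw OCC (c2 \<rhd> a) (\<lambda>a' c2'.
        sw OCC (c1 \<rhd> a') (\<lambda>a'' c1'. ?H a'' c1' c2')))"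
      by (rule psi_comult_general[OF _ H H2]) auto
    also have "\<dots> = comult_sum (rho a \<cdot> x) c"
    proof (rule sw_cong[OF coalgebra_module coalgebra_module])
      fix c1 c2 assume [simp]: "c1 \<in> carrier C" "c2 \<in> carrier C"
      have "sw OCC (c2 \<unrhd> (rho a \<cdot> x)) (\<lambda>x' c2'.
          sw OCC (c1 \<unrhd> x') (\<lambda>x'' c1'. tens K Om CC x'' (tens K C C c1' c2'))) =
        sw OCC (c2 \<rhd> a) (\<lambda>a' c2'. sw OCC (c2' \<unrhd> x) (\<lambda>x' c2''.
          sw OCC (c1 \<unrhd> (rho a' \<cdot> x')) (\<lambda>x'' c1'. tens K Om CC x'' (tens K C C c1' c2''))))"
        by (rule sw_Psi_rho_mult[OF _ bilin_comult_inner[OF _ lin_ident]]) auto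
      also have "\<dots> = sw OCC (c2 \<rhd> a) (\<lambda>a' c2'. sw OCC (c1 \<rhd> a') (\<lambda>a'' c1'. ?H a'' c1' c2'))"
      proof (rule sw_psi_cong)
        fix a' c2' assume [simp]: "a' \<in> carrier A" "c2' \<in> carrier C"
        have "sw OCC (c2' \<unrhd> x) (\<lambda>x' c2''.
            sw OCC (c1 \<unrhd> (rho a' \<cdot> x')) (\<lambda>x'' c1'. tens K Om CC x'' (tens K C C c1' c2''))) =
          sw OCC (c2' \<unrhd> x) (\<lambda>x' c2''. sw OCC (c1 \<rhd> a') (\<lambda>a'' c1'.
            sw OCC (c1' \<unrhd> x') (\<lambda>x'' c1''. tens K Om CC (rho a'' \<cdot> x'') (tens K C C c1'' c2''))))"
          by (rule sw_Psi_cong)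
            (auto intro!: sw_Psi_closed sw_Psi_rho_mult[OF _ bilin_tens_assoc[OF _ lin_ident]] del: equalityI subsetI)
        also have "\<dots> = sw OCC (c1 \<rhd> a') (\<lambda>a'' c1'. ?H a'' c1' c2')"
          by (rule sw_swap[OF omega_module coalgebra_module algebra_module coalgebra_module])
            (auto intro!: omega_psi_closed psi_closed sw_Psi_closed)
        finally show "sw OCC (c2' \<unrhd> x) (\<lambda>x' c2''.
            sw OCC (c1 \<unrhd> (rho a' \<cdot> x')) (\<lambda>x'' c1'. tens K Om CC x'' (tens K C C c1' c2''))) =
          sw OCC (c1 \<rhd> a') (\<lambda>a'' c1'. ?H a'' c1' c2')" .
      qed (auto intro!: sw_Psi_closed)
      finally show "sw OCC (c2 \<rhd> a) (\<lambda>a' c2'. sw OCC (c1 \<rhd> a') (\<lambda>a'' c1'. ?H a'' c1' c2')) =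
        sw OCC (c2 \<unrhd> (rho a \<cdot> x)) (\<lambda>x' c2'.
          sw OCC (c1 \<unrhd> x') (\<lambda>x'' c1'. tens K Om CC x'' (tens K C C c1' c2')))" ..
    qed (auto intro!: sw_psi_closed sw_Psi_closed)
    finally show "sw OCC (c \<unrhd> (rho a \<cdot> x)) (\<lambda>x' c'. tens K Om CC x' (comult C c')) =
      comult_sum (rho a \<cdot> x) c" .
  qed
next
  case (diff n x)
  note [simp] = lin_closed[OF comult_linear] omega_part_closed[OF diff.hyps]
  show ?case
  proof
    fix c assume [simp]: "c \<in> carrier C"
    let ?d = "dg_diff Om"
    have "sw OCC (c \<unrhd> (?d x)) (\<lambda>x' c'. tens K Om CC x' (comult C c')) =
        sw OCC (c \<unrhd> x) (\<lambda>x' c'. tens K Om CC (?d x') (comult C c'))"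
      by (rule sw_Psi_diff[OF _ bilin_tens_comult]) auto
    also have "\<dots> = tmap K Om CC ?d id (sw OCC (c \<unrhd> x) (\<lambda>x' c'. tens K Om CC x' (comult C c')))"
      by (rule tmap_sw_comult[OF lin_omega_diff, symmetric]) auto
    also have "\<dots> = tmap K Om CC ?d id (comult_sum x c)" using diff.IH by simp
    also have "\<dots> = sw OCC (comult C c) (\<lambda>c1 c2. sw OCC (c2 \<unrhd> x) (\<lambda>x' c2'.
      sw OCC (c1 \<unrhd> x') (\<lambda>x'' c1'. tens K Om CC (?d x'') (tens K C C c1' c2'))))"
      by (rule tmap_comult_sum[OF lin_omega_diff]) auto
    also have "\<dots> = comult_sum (?d x) c"
    proof (rule sw_cong[OF coalgebra_module coalgebra_module])
      fix c1 c2 assume [simp]: "c1 \<in> carrier C" "c2 \<in> carrier C"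
      have "sw OCC (c2 \<unrhd> (?d x)) (\<lambda>x' c2'.
          sw OCC (c1 \<unrhd> x') (\<lambda>x'' c1'. tens K Om CC x'' (tens K C C c1' c2'))) =
        sw OCC (c2 \<unrhd> x) (\<lambda>x' c2'.
          sw OCC (c1 \<unrhd> (?d x')) (\<lambda>x'' c1'. tens K Om CC x'' (tens K C C c1' c2')))"
        by (rule sw_Psi_diff[OF _ bilin_comult_inner[OF _ lin_ident]]) auto
      also have "\<dots> = sw OCC (c2 \<unrhd> x) (\<lambda>x' c2'.
          sw OCC (c1 \<unrhd> x') (\<lambda>x'' c1'. tens K Om CC (?d x'') (tens K C C c1' c2')))"
        by (rule sw_Psi_cong) (auto intro!: sw_Psi_closed sw_Psi_diff[OF _ bilin_tens_assoc[OF _ lin_ident]] del: equalityI subsetI)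
      finally show "sw OCC (c2 \<unrhd> x) (\<lambda>x' c2'.
          sw OCC (c1 \<unrhd> x') (\<lambda>x'' c1'. tens K Om CC (?d x'') (tens K C C c1' c2'))) =
        sw OCC (c2 \<unrhd> (?d x)) (\<lambda>x' c2'.
          sw OCC (c1 \<unrhd> x') (\<lambda>x'' c1'. tens K Om CC x'' (tens K C C c1' c2')))" ..
    qed (auto intro!: sw_Psi_closed)
    finally show "sw OCC (c \<unrhd> (?d x)) (\<lambda>x' c'. tens K Om CC x' (comult C c')) = comult_sum (?d x) c" .
  qed
next
  case (add n x y)
  then have xy: "x \<in> carrier Om" "y \<in> carrier Om" by (simp_all add: omega_part_closed)
  then show ?case
    using add.IH by (auto simp: lin_add[OF lin_comult_sum] lin_add[OF lin_sw_Psi_alg[OF _ bilin_tens_comult _ lin_ident]])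
next
  case (smult n r x)
  then have x: "x \<in> carrier Om" by (simp add: omega_part_closed)
  then show ?case
    using smult by (auto simp: lin_smult[OF lin_comult_sum] lin_smult[OF lin_sw_Psi_alg[OF _ bilin_tens_comult _ lin_ident]])
qed

lemma omega_psi_comult:
  assumes "c \<in> carrier C" "x \<in> carrier Om"
  shows "sw OCC (c \<unrhd> x) (\<lambda>x' c'. tens K Om CC x' (comult C c')) = comult_sum x c"
  by (rule omega_eqI[OF _ lin_sw_Psi_alg[OF _ bilin_tens_comult _ lin_ident] lin_comult_sum _ _ assms(2)])
    (use assms omega_psi_comult_graded[OF omega_word_part] in auto)

lemma bilin_counit: "bilin Om C Om (\<lambda>x c. counit C c \<odot>\<^bsub>Om\<^esub> x)"
  using lin_closed[OF counit_linear]
  by (intro bilinI lin_scale_map[OF omega_module counit_linear] lin_smult_map lin_ident) auto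

lemma counit_closed [simp]: "c \<in> carrier C \<Longrightarrow> counit C c \<in> carrier K"
  using lin_closed[OF counit_linear] by simp

lemma psi_counit_map:
  assumes P: "module K P" and f: "lin A P f" and "c \<in> carrier C" "a \<in> carrier A"
  shows "sw P (c \<rhd> a) (\<lambda>a' c'. counit C c' \<odot>\<^bsub>P\<^esub> f a') = counit C c \<odot>\<^bsub>P\<^esub> f a"
proof -
  have "sw P (c \<rhd> a) (\<lambda>a' c'. counit C c' \<odot>\<^bsub>P\<^esub> f a') =
      sw P (c \<rhd> a) (\<lambda>a' c'. f (counit C c' \<odot>\<^bsub>A\<^esub> a'))"
    by (rule sw_psi_cong) (use assms in \<open>auto simp: lin_smult[OF f] lin_closed[OF f]\<close>)
  also have "\<dots> = f (sw A (c \<rhd> a) (\<lambda>a' c'. counit C c' \<odot>\<^bsub>A\<^esub> a'))"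
    by (rule lin_of_sw_psi[symmetric]) (use assms in auto)
  also have "\<dots> = counit C c \<odot>\<^bsub>P\<^esub> f a"
    using assms by (simp add: psi_counit lin_smult[OF f])
  finally show ?thesis .
qed

lemma omega_psi_counit_graded:
  assumes "x \<in> dg_part Om n"
  shows "\<forall>c\<in>carrier C. sw Om (c \<unrhd> x) (\<lambda>x' c'. counit C c' \<odot>\<^bsub>Om\<^esub> x') = counit C c \<odot>\<^bsub>Om\<^esub> x"
  using assms
proof (induction x rule: omega_graded_induct)
  case (base a)
  then show ?case
    by (auto simp: sw_Psi_rho[OF _ bilin_counit] psi_counit_map[OF _ lin_rho])
next
  case (mult n a x)
  note [simp] = \<open>a \<in> carrier A\<close> omega_part_closed[OF mult.hyps(2)]
  show ?case
  proof
    fix c assume [simp]: "c \<in> carrier C"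
    have "sw Om (c \<unrhd> (rho a \<cdot> x)) (\<lambda>x' c'. counit C c' \<odot>\<^bsub>Om\<^esub> x') =
        sw Om (c \<rhd> a) (\<lambda>a' c'. sw Om (c' \<unrhd> x) (\<lambda>x' c''. counit C c'' \<odot>\<^bsub>Om\<^esub> (rho a' \<cdot> x')))"
      by (rule sw_Psi_rho_mult[OF _ bilin_counit]) auto
    also have "\<dots> = sw Om (c \<rhd> a) (\<lambda>a' c'. counit C c' \<odot>\<^bsub>Om\<^esub> (rho a' \<cdot> x))"
    proof (rule sw_psi_cong)
      fix a' c' assume [simp]: "a' \<in> carrier A" "c' \<in> carrier C"
      have l: "lin Om Om (\<lambda>z. rho a' \<cdot> z)" by (rule lin_omega_mult(1)) simp
      have "sw Om (c' \<unrhd> x) (\<lambda>x' c''. counit C c'' \<odot>\<^bsub>Om\<^esub> (rho a' \<cdot> x')) =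
          sw Om (c' \<unrhd> x) (\<lambda>x' c''. rho a' \<cdot> (counit C c'' \<odot>\<^bsub>Om\<^esub> x'))"
        by (rule sw_Psi_cong) (auto simp: lin_smult[OF l])
      also have "\<dots> = rho a' \<cdot> sw Om (c' \<unrhd> x) (\<lambda>x' c''. counit C c'' \<odot>\<^bsub>Om\<^esub> x')"
        by (rule lin_of_sw_Psi[OF _ _ l, symmetric]) auto
      also have "\<dots> = counit C c' \<odot>\<^bsub>Om\<^esub> (rho a' \<cdot> x)"
        using mult.IH by (simp add: lin_smult[OF l])
      finally show "sw Om (c' \<unrhd> x) (\<lambda>x' c''. counit C c'' \<odot>\<^bsub>Om\<^esub> (rho a' \<cdot> x')) =
        counit C c' \<odot>\<^bsub>Om\<^esub> (rho a' \<cdot> x)" .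
    qed (auto intro!: sw_Psi_closed)
    also have "\<dots> = counit C c \<odot>\<^bsub>Om\<^esub> (rho a \<cdot> x)"
      by (rule psi_counit_map[OF _ lin_comp[OF lin_omega_mult(2) lin_rho]]) auto
    finally show "sw Om (c \<unrhd> (rho a \<cdot> x)) (\<lambda>x' c'. counit C c' \<odot>\<^bsub>Om\<^esub> x') =
      counit C c \<odot>\<^bsub>Om\<^esub> (rho a \<cdot> x)" .
  qed
next
  case (diff n x)
  note [simp] = omega_part_closed[OF diff.hyps]
  show ?case
  proof
    fix c assume [simp]: "c \<in> carrier C"
    have "sw Om (c \<unrhd> (dg_diff Om x)) (\<lambda>x' c'. counit C c' \<odot>\<^bsub>Om\<^esub> x') =
        sw Om (c \<unrhd> x) (\<lambda>x' c'. counit C c' \<odot>\<^bsub>Om\<^esub> dg_diff Om x')"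
      by (rule sw_Psi_diff[OF _ bilin_counit]) auto
    also have "\<dots> = sw Om (c \<unrhd> x) (\<lambda>x' c'. dg_diff Om (counit C c' \<odot>\<^bsub>Om\<^esub> x'))"
      by (rule sw_Psi_cong) (auto simp: lin_smult[OF lin_omega_diff])
    also have "\<dots> = dg_diff Om (sw Om (c \<unrhd> x) (\<lambda>x' c'. counit C c' \<odot>\<^bsub>Om\<^esub> x'))"
      by (rule lin_of_sw_Psi[OF _ _ lin_omega_diff, symmetric]) auto
    also have "\<dots> = counit C c \<odot>\<^bsub>Om\<^esub> dg_diff Om x"
      using diff.IH by (simp add: lin_smult[OF lin_omega_diff])
    finally show "sw Om (c \<unrhd> (dg_diff Om x)) (\<lambda>x' c'. counit C c' \<odot>\<^bsub>Om\<^esub> x') =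
      counit C c \<odot>\<^bsub>Om\<^esub> dg_diff Om x" .
  qed
next
  case (add n x y)
  then have xy: "x \<in> carrier Om" "y \<in> carrier Om" by (simp_all add: omega_part_closed)
  then show ?case
    using add.IH module.smult_r_distr[OF omega_module]
    by (auto simp: lin_add[OF lin_sw_Psi_alg[OF _ bilin_counit _ lin_ident]])
next
  case (smult n r x)
  then have x: "x \<in> carrier Om" by (simp add: omega_part_closed)
  then show ?case
    using smult module.smult_assoc1[OF omega_module, symmetric]
    by (auto simp: lin_smult[OF lin_sw_Psi_alg[OF _ bilin_counit _ lin_ident]] m_comm)
qed

lemma omega_psi_counit:
  assumes "c \<in> carrier C" "x \<in> carrier Om"
  shows "sw Om (c \<unrhd> x) (\<lambda>x' c'. counit C c' \<odot>\<^bsub>Om\<^esub> x') = counit C c \<odot>\<^bsub>Om\<^esub> x"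
  by (rule omega_eqI[OF _ lin_sw_Psi_alg[OF _ bilin_counit _ lin_ident] lin_smult_map[OF _ _ lin_ident] _ _ assms(2)])
    (use assms omega_psi_counit_graded[OF omega_word_part] in auto)

theorem omega_entwining: "nonunital_entwining K Om C Psi"
proof (intro nonunital_entwining.intro nonunital_entwining_axioms.intro omega_algebra coalgebra_axioms lin_omega_psi)
  fix x assume "x \<in> carrier (tensor K (tensor K C Om) Om)"
  then show "Psi (tmap K C Om id (mult_map K Om) (assoc_r K C Om Om x)) =
      tmap K Om C (mult_map K Om) id (assoc_l K Om Om C (tmap K Om (tensor K Om C) id Psi
        (assoc_r K Om C Om (tmap K (tensor K Om C) Om Psi id x))))"
    using psi_mult_iff[OF Psi_data omega_bilin] omega_psi_mult by blast
next
  fix y assume "y \<in> carrier (tensor K C Om)"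
  then show "tmap K Om CC id (comult C) (Psi y) =
      assoc_r K Om C C (tmap K (tensor K Om C) C Psi id (assoc_l K C Om C
        (tmap K C (tensor K Om C) id Psi (assoc_r K C C Om (tmap K CC Om (comult C) id y)))))"
    using psi_comult_iff[OF Psi_data comult_linear] omega_psi_comult by blast
qed (rule omega_psi_counit)

theorem omega_dg_entwining: "dg_entwining K Om C Psi"
proof (intro dg_entwining.intro dg_entwining_axioms.intro omega_dg_algebra omega_entwining)
  fix x i assume x: "x \<in> part_right K C Om i"
  have "x \<in> {x \<in> carrier (tensor K C Om). Psi x \<in> part_left K Om C i}"
    by (rule lin_span_least[OF lin_preimage_submodule[OF _ _ lin_omega_psi part_left_submodule] _ x[unfolded part_right_def]])
      (auto simp: omega_psi_part omega_part_closed)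
  then show "Psi x \<in> part_left K Om C i" by simp
next
  fix x assume x: "x \<in> carrier (tensor K C Om)"
  note l = tmap_tens(1)[OF coalgebra_module omega_module coalgebra_module omega_module lin_id lin_omega_diff]
  show "tmap K Om C (dg_diff Om) id (Psi x) = Psi (tmap K C Om id (dg_diff Om) x)"
    by (rule tensor_eqI[OF _ _ _ lin_comp[OF lin_diff_OC lin_omega_psi] lin_comp[OF lin_omega_psi l] _ x])
      (auto simp: tmap_tens(3)[OF coalgebra_module omega_module coalgebra_module omega_module lin_id lin_omega_diff] omega_psi_diff)
qed

theorem omega_dg_entwining_over: "dg_entwining_over K A C \<psi> Om Psi (\<lambda>a. rho a)"
proof (intro dg_entwining_over.intro dg_entwining_over_axioms.intro omega_dg_entwining lin_rho)
  show "rho a \<in> dg_part Om 0" if "a \<in> carrier A" for a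
    using omega_word_part[of "[]" "(a, \<zero>)"] that by simp
  show "rho (a \<otimes>\<^bsub>A\<^esub> b) = rho a \<cdot> rho b" if "a \<in> carrier A" "b \<in> carrier A" for a b
    using that by (simp add: omega_word_mult omega_left_word)
  fix x assume x: "x \<in> carrier (tensor K C A)"
  note l = tmap_tens(1)[OF algebra_module coalgebra_module omega_module coalgebra_module lin_rho lin_id]
  note l' = tmap_tens(1)[OF coalgebra_module algebra_module coalgebra_module omega_module lin_id lin_rho]
  show "tmap K Om C (\<lambda>a. rho a) id (\<psi> x) = Psi (tmap K C Om id (\<lambda>a. rho a) x)"
    by (rule tensor_eqI[OF _ _ _ lin_comp[OF l psi_linear] lin_comp[OF lin_omega_psi l'] _ x])
      (auto simp: tmap_tens(3)[OF coalgebra_module algebra_module coalgebra_module omega_module lin_id lin_rho] omega_psi_rho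
        tmap_tens(2)[OF algebra_module coalgebra_module omega_module coalgebra_module lin_rho lin_id psi_closed])
qed

end

section \<open>Cycles give cyclic cocycles\<close>

context cring
begin

lemmas ring_finsum_cong' = finsum_cong'

lemma alt_sign_simps:
  assumes "module R V"
  shows "x \<in> carrier V \<Longrightarrow> alt_sign V i (alt_sign V j x) = alt_sign V (i + j) x"
    and "x \<in> carrier V \<Longrightarrow> \<ominus>\<^bsub>V\<^esub> alt_sign V i x = alt_sign V (Suc i) x"
    and "x \<in> carrier V \<Longrightarrow> y \<in> carrier V \<Longrightarrow> alt_sign V i (x \<oplus>\<^bsub>V\<^esub> y) = alt_sign V i x \<oplus>\<^bsub>V\<^esub> alt_sign V i y"
    and "x \<in> carrier V \<Longrightarrow> alt_sign V i x \<oplus>\<^bsub>V\<^esub> alt_sign V (Suc i) x = \<zero>\<^bsub>V\<^esub>"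
    and "x \<in> carrier V \<Longrightarrow> alt_sign V (i + i) x = x"
proof -
  interpret V: module R V by fact
  show "x \<in> carrier V \<Longrightarrow> alt_sign V i (alt_sign V j x) = alt_sign V (i + j) x"
    and "x \<in> carrier V \<Longrightarrow> \<ominus>\<^bsub>V\<^esub> alt_sign V i x = alt_sign V (Suc i) x"
    and "x \<in> carrier V \<Longrightarrow> y \<in> carrier V \<Longrightarrow> alt_sign V i (x \<oplus>\<^bsub>V\<^esub> y) = alt_sign V i x \<oplus>\<^bsub>V\<^esub> alt_sign V i y"
    and "x \<in> carrier V \<Longrightarrow> alt_sign V i x \<oplus>\<^bsub>V\<^esub> alt_sign V (Suc i) x = \<zero>\<^bsub>V\<^esub>"
    and "x \<in> carrier V \<Longrightarrow> alt_sign V (i + i) x = x"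
    by (auto simp: alt_sign_def V.minus_add V.r_neg V.l_neg)
qed

lemma add_zero_alt:
  assumes "module R V" "x \<in> carrier V" "y \<in> carrier V" "x \<oplus>\<^bsub>V\<^esub> alt_sign V i y = \<zero>\<^bsub>V\<^esub>"
  shows "x = alt_sign V (Suc i) y"
proof -
  interpret V: module R V by fact
  have "x = \<ominus>\<^bsub>V\<^esub> alt_sign V i y" using assms V.minus_equality[of x "alt_sign V i y"] by simp
  then show ?thesis using alt_sign_simps(2)[OF assms(1,3), of i] by simp
qed

end

context dg_algebra
begin

lemma part_closed: "r \<in> dg_part R i \<Longrightarrow> r \<in> carrier R"
  using submodule_closed(2)[OF algebra_module part_submodule] .

lemma diff_closed [simp]: "r \<in> carrier R \<Longrightarrow> dg_diff R r \<in> carrier R"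
  using lin_closed[OF diff_linear] .

text \<open>
  The form \<open>\<rho>(a\<^sub>0) d\<rho>(a\<^sub>1) \<dots> d\<rho>(a\<^sub>n)\<close> of a nonempty list
\<close>

abbreviation form where
  "form \<rho> as \<equiv> foldl (\<lambda>x y. x \<otimes>\<^bsub>R\<^esub> y) (\<rho> (hd as)) (map (\<lambda>b. dg_diff R (\<rho> b)) (tl as))"

context
  fixes A :: "('a, 'x, 'y) module_scheme" and \<rho>
  assumes A: "nonunital_algebra K A" and rho: "lin A R \<rho>"
    and rho_part0: "\<forall>a\<in>carrier A. \<rho> a \<in> dg_part R 0"
    and rho_hom: "\<forall>a\<in>carrier A. \<forall>b\<in>carrier A. \<rho> (a \<otimes>\<^bsub>A\<^esub> b) = \<rho> a \<otimes>\<^bsub>R\<^esub> \<rho> b"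
begin

lemmas rho0 = rho_part0[rule_format] and rhom = rho_hom[rule_format]

lemma drho_part: "a \<in> carrier A \<Longrightarrow> dg_diff R (\<rho> a) \<in> dg_part R 1"
  using diff_part[OF rho0] by simp

lemma drho_closed: "a \<in> carrier A \<Longrightarrow> dg_diff R (\<rho> a) \<in> carrier R"
  using part_closed[OF drho_part] .

lemma foldl_drho_part:
  assumes "x \<in> dg_part R i" "set as \<subseteq> carrier A"
  shows "foldl (\<lambda>x y. x \<otimes>\<^bsub>R\<^esub> y) x (map (\<lambda>b. dg_diff R (\<rho> b)) as) \<in> dg_part R (i + length as)"
  using assms
proof (induction as arbitrary: x i)
  case (Cons a as)
  then show ?case using Cons.IH[of "x \<otimes>\<^bsub>R\<^esub> dg_diff R (\<rho> a)" "Suc i"] part_mult[OF Cons.prems(1) drho_part] by simp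
qed simp

lemma form_part: "as \<noteq> [] \<Longrightarrow> set as \<subseteq> carrier A \<Longrightarrow> form \<rho> as \<in> dg_part R (length as - 1)"
  using foldl_drho_part[OF rho0, of "hd as" "tl as"] by (cases as) auto

lemma form_closed: "as \<noteq> [] \<Longrightarrow> set as \<subseteq> carrier A \<Longrightarrow> form \<rho> as \<in> carrier R"
  using part_closed[OF form_part] .

lemma form_snoc: "as \<noteq> [] \<Longrightarrow> form \<rho> (as @ [b]) = form \<rho> as \<otimes>\<^bsub>R\<^esub> dg_diff R (\<rho> b)"
  by (cases as) auto

lemma foldl_drho_mult:
  assumes "x \<in> carrier R" "y \<in> carrier R" "set as \<subseteq> carrier A"
  shows "foldl (\<lambda>x y. x \<otimes>\<^bsub>R\<^esub> y) (y \<otimes>\<^bsub>R\<^esub> x) (map (\<lambda>b. dg_diff R (\<rho> b)) as) =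
    y \<otimes>\<^bsub>R\<^esub> foldl (\<lambda>x y. x \<otimes>\<^bsub>R\<^esub> y) x (map (\<lambda>b. dg_diff R (\<rho> b)) as)"
  using assms by (induction as arbitrary: x) (auto simp: mult_assoc drho_closed)

lemma foldl_drho_diff:
  assumes "x \<in> dg_part R i" "set as \<subseteq> carrier A"
  shows "dg_diff R (foldl (\<lambda>x y. x \<otimes>\<^bsub>R\<^esub> y) x (map (\<lambda>b. dg_diff R (\<rho> b)) as)) =
    foldl (\<lambda>x y. x \<otimes>\<^bsub>R\<^esub> y) (dg_diff R x) (map (\<lambda>b. dg_diff R (\<rho> b)) as)"
  using assms
proof (induction as arbitrary: x i)
  case (Cons a as)
  have x: "x \<in> carrier R" "x \<otimes>\<^bsub>R\<^esub> dg_diff R (\<rho> a) \<in> dg_part R (i + 1)"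
    using Cons.prems part_closed part_mult[OF Cons.prems(1) drho_part] by auto
  have "dg_diff R (x \<otimes>\<^bsub>R\<^esub> dg_diff R (\<rho> a)) = dg_diff R x \<otimes>\<^bsub>R\<^esub> dg_diff R (\<rho> a)"
    using Cons.prems x drho_closed part_closed[OF rho0]
    by (simp add: leibniz[OF Cons.prems(1)] diff_diff)
  then show ?case using Cons.IH[OF x(2)] Cons.prems by simp
qed simp

lemma form_Cons:
  assumes "a \<in> carrier A" "set as \<subseteq> carrier A" "as \<noteq> []"
  shows "form \<rho> (a # as) = \<rho> a \<otimes>\<^bsub>R\<^esub> dg_diff R (form \<rho> as)"
proof -
  obtain b bs where as: "as = b # bs" using assms(3) by (cases as) auto
  then show ?thesis
    using assms foldl_drho_mult[of "dg_diff R (\<rho> b)" "\<rho> a" bs] foldl_drho_diff[OF rho0, of b bs]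
      drho_closed part_closed[OF rho0] by simp
qed

text \<open>
  By \<open>x da b = x d(ab) - x a db\<close>, the alternating sum below telescopes. This is why a trace yields
  a cocycle; applied to the universal algebra, it also shows that a cyclic cocycle yields a trace.
\<close>

lemma form_telescope:
  assumes "length as = n + 2" "set as \<subseteq> carrier A"
  shows "(\<Oplus>\<^bsub>R\<^esub>i\<in>{1..n + 1}. alt_sign R i (form \<rho> (contract A (i - 1) as))) =
    alt_sign R (n + 1) (form \<rho> (butlast as) \<otimes>\<^bsub>R\<^esub> \<rho> (last as))"
  using assms
proof (induction n arbitrary: as)
  case 0
  interpret A: nonunital_algebra K A by (rule A)
  obtain a b where "as = [a, b]" using 0 by (auto simp: numeral_2_eq_2 length_Suc_conv)
  then show ?case using 0 rhom[of a b] part_closed[OF rho0] by (simp add: contract_def)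
next
  case (Suc n)
  interpret A: nonunital_algebra K A by (rule A)
  obtain bs b where as: "as = bs @ [b]" using Suc.prems by (cases as rule: rev_cases) auto
  obtain cs l where bs: "bs = cs @ [l]" using Suc.prems as by (cases bs rule: rev_cases) auto
  have len: "length bs = n + 2" "cs \<noteq> []" "length cs = n + 1" and mem: "set bs \<subseteq> carrier A" "set cs \<subseteq> carrier A" "b \<in> carrier A" "l \<in> carrier A"
    using Suc.prems as bs by auto
  let ?db = "dg_diff R (\<rho> b)" and ?dl = "dg_diff R (\<rho> l)"
  have cl: "?db \<in> carrier R" "?dl \<in> carrier R" "\<rho> b \<in> carrier R" "\<rho> l \<in> carrier R" "form \<rho> cs \<in> carrier R"
    using mem len drho_closed part_closed[OF rho0] form_closed by auto
  have c: "contract A (i - 1) (bs @ [b]) = contract A (i - 1) bs @ [b]" "contract A (i - 1) bs \<noteq> []"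
      "set (contract A (i - 1) bs) \<subseteq> carrier A" if "i \<in> {1..n + 1}" for i
    subgoal using that len by (auto simp: contract_def nth_append)
    subgoal by (simp add: contract_def)
    subgoal using that len mem by (intro A.contract_closed) auto
    done
  have last: "contract A (n + 1) (bs @ [b]) = cs @ [l \<otimes>\<^bsub>A\<^esub> b]"
    using len by (simp add: contract_def bs nth_append)
  let ?u = "\<lambda>i. alt_sign R i (form \<rho> (contract A (i - 1) bs))"
  have uc: "?u i \<in> carrier R" if "i \<in> {1..n + 1}" for i
    using form_closed[OF c(2,3)[OF that]] by simp
  have "(\<Oplus>\<^bsub>R\<^esub>i\<in>{1..Suc n + 1}. alt_sign R i (form \<rho> (contract A (i - 1) as))) =
      alt_sign R (n + 2) (form \<rho> (contract A (n + 1) as)) \<oplus>\<^bsub>R\<^esub>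
      (\<Oplus>\<^bsub>R\<^esub>i\<in>{1..n + 1}. alt_sign R i (form \<rho> (contract A (i - 1) as)))"
  proof -
    have "{1..Suc n + 1} = insert (n + 2) {1..n + 1}" by auto
    moreover have cc: "alt_sign R i (form \<rho> (contract A (i - 1) as)) \<in> carrier R" if "i \<in> {1..Suc n + 1}" for i
    proof -
      have "contract A (i - 1) as \<noteq> []" by (simp add: contract_def)
      moreover have "set (contract A (i - 1) as) \<subseteq> carrier A" using Suc.prems that by (intro A.contract_closed) auto
      ultimately show ?thesis using form_closed by simp
    qed
    moreover have "alt_sign R (n + 2) (form \<rho> (contract A (n + 1) as)) \<in> carrier R"
      using cc[of "n + 2"] by simp
    ultimately show ?thesis
      using M.finsum_insert[of "{1..n + 1}" "n + 2" "\<lambda>i. alt_sign R i (form \<rho> (contract A (i - 1) as))"]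
      by (simp add: Pi_def)
  qed
  also have "(\<Oplus>\<^bsub>R\<^esub>i\<in>{1..n + 1}. alt_sign R i (form \<rho> (contract A (i - 1) as))) = (\<Oplus>\<^bsub>R\<^esub>i\<in>{1..n + 1}. ?u i \<otimes>\<^bsub>R\<^esub> ?db)"
  proof (rule M.finsum_cong', rule refl)
    fix i assume i: "i \<in> {1..n + 1}"
    show "alt_sign R i (form \<rho> (contract A (i - 1) as)) = ?u i \<otimes>\<^bsub>R\<^esub> ?db"
      using c[OF i] cl form_closed[OF c(2,3)[OF i]]
      by (simp add: as form_snoc lin_alt_sign[OF _ _ bilinD(2)[OF algebra_bilin cl(1)]])
  qed (use uc cl in auto)
  also have "\<dots> = (\<Oplus>\<^bsub>R\<^esub>i\<in>{1..n + 1}. ?u i) \<otimes>\<^bsub>R\<^esub> ?db"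
    using uc by (intro lin_finsum[OF _ _ bilinD(2)[OF algebra_bilin cl(1)], symmetric]) auto
  also have "(\<Oplus>\<^bsub>R\<^esub>i\<in>{1..n + 1}. ?u i) = alt_sign R (n + 1) (form \<rho> cs \<otimes>\<^bsub>R\<^esub> \<rho> l)"
    using Suc.IH[OF len(1) mem(1)] by (simp only: bs butlast_snoc last_snoc)
  also have "form \<rho> (contract A (n + 1) as) = form \<rho> cs \<otimes>\<^bsub>R\<^esub> (?dl \<otimes>\<^bsub>R\<^esub> \<rho> b \<oplus>\<^bsub>R\<^esub> \<rho> l \<otimes>\<^bsub>R\<^esub> ?db)"
    unfolding as last using len mem cl
    by (simp add: form_snoc rhom leibniz[OF rho0] alt_sign_def)
  finally have "(\<Oplus>\<^bsub>R\<^esub>i\<in>{1..Suc n + 1}. alt_sign R i (form \<rho> (contract A (i - 1) as))) =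
      alt_sign R (n + 2) (form \<rho> cs \<otimes>\<^bsub>R\<^esub> (?dl \<otimes>\<^bsub>R\<^esub> \<rho> b \<oplus>\<^bsub>R\<^esub> \<rho> l \<otimes>\<^bsub>R\<^esub> ?db)) \<oplus>\<^bsub>R\<^esub>
      alt_sign R (n + 1) (form \<rho> cs \<otimes>\<^bsub>R\<^esub> \<rho> l) \<otimes>\<^bsub>R\<^esub> ?db" .
  also have "alt_sign R (n + 1) (form \<rho> cs \<otimes>\<^bsub>R\<^esub> \<rho> l) \<otimes>\<^bsub>R\<^esub> ?db = alt_sign R (n + 1) (form \<rho> cs \<otimes>\<^bsub>R\<^esub> (\<rho> l \<otimes>\<^bsub>R\<^esub> ?db))"
    using cl by (simp add: lin_alt_sign[OF _ _ bilinD(2)[OF algebra_bilin cl(1)]] mult_assoc)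
  also have "alt_sign R (n + 2) (form \<rho> cs \<otimes>\<^bsub>R\<^esub> (?dl \<otimes>\<^bsub>R\<^esub> \<rho> b \<oplus>\<^bsub>R\<^esub> \<rho> l \<otimes>\<^bsub>R\<^esub> ?db)) =
      alt_sign R (n + 2) (form \<rho> bs \<otimes>\<^bsub>R\<^esub> \<rho> b) \<oplus>\<^bsub>R\<^esub> alt_sign R (n + 2) (form \<rho> cs \<otimes>\<^bsub>R\<^esub> (\<rho> l \<otimes>\<^bsub>R\<^esub> ?db))"
    using cl len by (simp add: mult_add_right alt_sign_simps(3) bs form_snoc mult_assoc)
  also have "alt_sign R (n + 2) (form \<rho> bs \<otimes>\<^bsub>R\<^esub> \<rho> b) \<oplus>\<^bsub>R\<^esub> alt_sign R (n + 2) (form \<rho> cs \<otimes>\<^bsub>R\<^esub> (\<rho> l \<otimes>\<^bsub>R\<^esub> ?db)) \<oplus>\<^bsub>R\<^esub>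
      alt_sign R (n + 1) (form \<rho> cs \<otimes>\<^bsub>R\<^esub> (\<rho> l \<otimes>\<^bsub>R\<^esub> ?db)) = alt_sign R (n + 2) (form \<rho> bs \<otimes>\<^bsub>R\<^esub> \<rho> b)"
  proof -
    let ?z = "form \<rho> cs \<otimes>\<^bsub>R\<^esub> (\<rho> l \<otimes>\<^bsub>R\<^esub> ?db)" and ?x = "alt_sign R (n + 2) (form \<rho> bs \<otimes>\<^bsub>R\<^esub> \<rho> b)"
    have z: "?z \<in> carrier R" using cl by simp
    have x: "?x \<in> carrier R" using cl form_closed[of bs] mem bs by (simp del: foldl_append)
    have "alt_sign R (n + 2) ?z \<oplus>\<^bsub>R\<^esub> alt_sign R (n + 1) ?z = \<zero>\<^bsub>R\<^esub>"
      using alt_sign_simps(4)[OF algebra_module z, of "n + 1"] z by (simp add: M.a_comm)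
    then show ?thesis using x z M.a_assoc[of ?x "alt_sign R (n + 2) ?z" "alt_sign R (n + 1) ?z"] by simp
  qed
  finally show ?case by (simp add: as)
qed

end

end

context dg_entwining
begin

text \<open>
  A trace is only linear on \<open>C \<otimes> R\<^sup>n\<close>, so all arguments have to be kept in that subspace.
\<close>

lemma part_right_sub: "submodule (part_right K C R n) K (tensor K C R)"
  unfolding part_right_def by (rule lin_span_submodule) (auto simp: part_closed)

lemma tens_part_right: "c \<in> carrier C \<Longrightarrow> r \<in> dg_part R n \<Longrightarrow> tens K C R c r \<in> part_right K C R n"
  unfolding part_right_def by (rule lin_span_incl) blast

lemma lin_trace_part:
  assumes "closed_graded_trace K R C \<Psi> n T" "c \<in> carrier C"
  shows "lin (R\<lparr>carrier := dg_part R n\<rparr>) (scalars K) (\<lambda>r. T (tens K C R c r))"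
proof -
  have T: "lin ((tensor K C R)\<lparr>carrier := part_right K C R n\<rparr>) (scalars K) T"
    using assms(1) by (simp add: closed_graded_trace_def)
  have l: "lin R (tensor K C R) (\<lambda>r. tens K C R c r)" by (rule lin_tens_right) (use assms in auto)
  have "lin (R\<lparr>carrier := dg_part R n\<rparr>) ((tensor K C R)\<lparr>carrier := part_right K C R n\<rparr>) (\<lambda>r. tens K C R c r)"
    by (rule linI) (use assms lin_add[OF l] lin_smult[OF l] in \<open>auto simp: tens_part_right part_closed\<close>)
  from lin_comp[OF T this] show ?thesis .
qed

end

context dg_entwining_over
begin

lemma trace_rho:
  assumes A: "module K A" and \<psi>: "lin (tensor K C A) (tensor K A C) \<psi>" and T: "closed_graded_trace K R C \<Psi> n T"
    and [simp]: "c \<in> carrier C" "a \<in> carrier A" and r: "r \<in> dg_part R n"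
  shows "T (tens K C R c (\<rho> a \<otimes>\<^bsub>R\<^esub> r)) = sw (scalars K) (\<psi> (tens K C A c a)) (\<lambda>a' c'. T (tens K C R c' (r \<otimes>\<^bsub>R\<^esub> \<rho> a')))"
proof -
  note [simp] = A part_closed[OF r] lin_closed[OF rho_linear] entw_closed[OF A coalgebra_module \<psi>]
  have b: "bilin R C (tensor K C R) (\<lambda>s c'. tens K C R c' (r \<otimes>\<^bsub>R\<^esub> s))"
    by (intro bilinI lin_tens_l lin_tens_r lin_ident bilinD(1)[OF algebra_bilin]) auto
  have t: "tens K C A c a \<in> carrier (tensor K C A)" by simp
  have m: "tmap K C R id \<rho> (tens K C A c a) = tens K C R c (\<rho> a)"
    using tmap_tens(3)[OF coalgebra_module A coalgebra_module algebra_module lin_id rho_linear] by simp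
  have "T (tens K C R c (\<rho> a \<otimes>\<^bsub>R\<^esub> r)) =
      T (sw (tensor K C R) (\<Psi> (tens K C R c (\<rho> a))) (\<lambda>s c'. tens K C R c' (r \<otimes>\<^bsub>R\<^esub> s)))"
    using T[unfolded closed_graded_trace_def, THEN conjunct2, THEN conjunct2, rule_format, of 0 n c "\<rho> a" r] r rho_degree[of a]
    by (simp add: alt_sign_def)
  also have "\<Psi> (tens K C R c (\<rho> a)) = sw (tensor K R C) (\<psi> (tens K C A c a)) (\<lambda>a' c'. tens K R C (\<rho> a') c')"
    using rho_psi[OF t] tmap_tens(2)[OF A coalgebra_module algebra_module coalgebra_module rho_linear lin_id, of "\<psi> (tens K C A c a)"] m
    by simp
  also have "sw (tensor K C R) (sw (tensor K R C) (\<psi> (tens K C A c a)) (\<lambda>a' c'. tens K R C (\<rho> a') c')) (\<lambda>s c'. tens K C R c' (r \<otimes>\<^bsub>R\<^esub> s)) =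
      sw (tensor K C R) (\<psi> (tens K C A c a)) (\<lambda>a' c'. tens K C R c' (r \<otimes>\<^bsub>R\<^esub> \<rho> a'))"
    by (rule sw_sw_tens[OF A coalgebra_module algebra_module coalgebra_module _ _ b]) auto
  also have "T \<dots> = sw (scalars K) (\<psi> (tens K C A c a)) (\<lambda>a' c'. T (tens K C R c' (r \<otimes>\<^bsub>R\<^esub> \<rho> a')))"
  proof (rule sw_lin_sub(2)[OF A coalgebra_module _ _ part_right_sub])
    show "lin ((tensor K C R)\<lparr>carrier := part_right K C R n\<rparr>) (scalars K) T"
      using T by (simp add: closed_graded_trace_def)
    fix a' c' assume "a' \<in> carrier A" "c' \<in> carrier C"
    then show "tens K C R c' (r \<otimes>\<^bsub>R\<^esub> \<rho> a') \<in> part_right K C R n"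
      using part_mult[OF r rho_degree[of a']] by (intro tens_part_right) auto
  qed auto
  finally show ?thesis .
qed

lemma trace_diff:
  assumes T: "closed_graded_trace K R C \<Psi> n T" and c: "c \<in> carrier C" and a: "a \<in> carrier A"
    and x: "x \<in> dg_part R i" and n: "n = Suc i"
  shows "T (tens K C R c (dg_diff R x \<otimes>\<^bsub>R\<^esub> \<rho> a)) = alt_sign K n (T (tens K C R c (x \<otimes>\<^bsub>R\<^esub> dg_diff R (\<rho> a))))"
proof -
  note l = lin_trace_part[OF T c]
  let ?x = "dg_diff R x \<otimes>\<^bsub>R\<^esub> \<rho> a" and ?y = "x \<otimes>\<^bsub>R\<^esub> dg_diff R (\<rho> a)"
  have p: "?x \<in> dg_part R n" "?y \<in> dg_part R n" "x \<otimes>\<^bsub>R\<^esub> \<rho> a \<in> dg_part R i"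
    using part_mult[OF diff_part[OF x] rho_degree[OF a]] part_mult[OF x diff_part[OF rho_degree[OF a]]]
      part_mult[OF x rho_degree[OF a]] n by auto
  have pm: "alt_sign R i ?y \<in> dg_part R n" by (rule submodule_closed(7)[OF algebra_module part_submodule p(2)])
  have "T (tens K C R c (dg_diff R (x \<otimes>\<^bsub>R\<^esub> \<rho> a))) = \<zero>"
    using T c p(3) n by (simp add: closed_graded_trace_def)
  then have 1: "T (tens K C R c (?x \<oplus>\<^bsub>R\<^esub> alt_sign R i ?y)) = \<zero>"
    using leibniz[OF x part_closed[OF rho_degree[OF a]]] by simp
  have "T (tens K C R c (\<ominus>\<^bsub>R\<^esub> ?y)) = \<ominus> T (tens K C R c ?y)"
    using lin_smult[OF l, of "\<ominus> \<one>" ?y] p(2) mod_neg_eq[OF algebra_module part_closed[OF p(2)]]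
      mod_neg_eq[OF module_scalars, of "T (tens K C R c ?y)"] lin_closed[OF l, of ?y]
    by simp
  then have "T (tens K C R c (alt_sign R i ?y)) = alt_sign K i (T (tens K C R c ?y))"
    by (simp add: alt_sign_def)
  then have "T (tens K C R c ?x) \<oplus> alt_sign K i (T (tens K C R c ?y)) = \<zero>"
    using 1 lin_add[OF l, of ?x "alt_sign R i ?y"] p pm by simp
  then show ?thesis
    using add_zero_alt[OF module_scalars, of "T (tens K C R c ?x)" "T (tens K C R c ?y)" i]
      lin_closed[OF l] p n by simp
qed

text \<open>
  Let \<open>\<omega> = \<rho>(a\<^sub>1) d\<rho>(a\<^sub>2) \<dots> d\<rho>(a\<^sub>n)\<close>. The trace property moves \<open>\<rho>(a)\<close> in \<open>T(c \<otimes> \<rho>(a) d\<omega>)\<close> to the right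
  end, and closedness turns \<open>d\<omega> \<rho>(a\<^sub>\<psi>)\<close> into \<open>(-1)\<^sup>n \<omega> d\<rho>(a\<^sub>\<psi>)\<close>; this is cyclicity. In the coboundary at
  \<open>a, b\<^sub>1, \<dots>, b\<^sub>n, b\<close> the first summand is in the same way \<open>(-1)\<^sup>n T(c \<otimes> \<rho>(a) d\<rho>(b\<^sub>1) \<dots> d\<rho>(b\<^sub>n) \<rho>(b))\<close>, and it
  cancels against the telescoping sum. For \<open>n = 0\<close> there is no \<open>\<omega>\<close>; in this case cyclicity is the trace
  property of the product \<open>\<rho>(a) \<rho>(1)\<close>.
\<close>

theorem cycle_character_cocycle:
  assumes E: "entwining K A C \<psi>" and T: "closed_graded_trace K R C \<Psi> n T"
    and g: "linear_map K (CA K A C (n + 1)) (scalars K) g"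
    and gT: "\<And>c as. c \<in> carrier C \<Longrightarrow> set as \<subseteq> carrier A \<Longrightarrow> length as = n + 1 \<Longrightarrow>
      g (ca K A C (n + 1) c as) = T (tens K C R c (form \<rho> as))"
  shows "g \<in> cyclic_cocycles K A C \<psi> n"
proof -
  interpret A: entwining K A C \<psi> by (rule E)
  note aA = A.nonunital_algebra_axioms
  have fd: "\<forall>a\<in>carrier A. \<rho> a \<in> dg_part R 0"
      "\<forall>a\<in>carrier A. \<forall>b\<in>carrier A. \<rho> (a \<otimes>\<^bsub>A\<^esub> b) = \<rho> a \<otimes>\<^bsub>R\<^esub> \<rho> b"
    using rho_degree rho_mult by auto
  note fpart = form_part[OF aA rho_linear fd] and fclosed = form_closed[OF aA rho_linear fd]
    and fCons = form_Cons[OF aA rho_linear fd] and fsnoc = form_snoc[OF aA rho_linear fd]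
    and ftele = form_telescope[OF aA rho_linear fd]
  note tr = trace_rho[OF A.algebra_module A.psi_linear T] and td = trace_diff[OF T]
  note [simp] = word_space_module[of "{m}" "\<lambda>_. C" A for m, OF coalgebra_module A.algebra_module]
  have wc: "ca K A C m c as \<in> carrier (CA K A C m)" if "c \<in> carrier C" "set as \<subseteq> carrier A" "length as = m" for c as m
    using that by (intro word_closed) auto
  have rc: "\<rho> a \<in> carrier R" if "a \<in> carrier A" for a using lin_closed[OF rho_linear that] .
  have tcl: "T (tens K C R c (form \<rho> as)) \<in> carrier K"
    if "c \<in> carrier C" "set as \<subseteq> carrier A" "length as = n + 1" for c as
  proof -
    have "as \<noteq> []" using that by auto
    then show ?thesis using lin_closed[OF lin_trace_part[OF T that(1)]] fpart[of as] that by simp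
  qed
  \<comment> \<open>integration by parts: \<open>d\<omega> \<rho>(a)\<close> and \<open>\<omega> d\<rho>(a)\<close> agree up to the sign and the exact form \<open>d(\<omega> \<rho>(a))\<close>\<close>
  have last: "T (tens K C R c (form \<rho> (as @ [a]))) = alt_sign K n (T (tens K C R c (dg_diff R (form \<rho> as) \<otimes>\<^bsub>R\<^esub> \<rho> a)))"
    if "c \<in> carrier C" "a \<in> carrier A" "set as \<subseteq> carrier A" "length as = n" "n \<noteq> 0" for c a as
  proof -
    have as: "as \<noteq> []" using that by auto
    have p: "form \<rho> (as @ [a]) \<in> dg_part R n" using fpart[of "as @ [a]"] that by simp
    have "T (tens K C R c (dg_diff R (form \<rho> as) \<otimes>\<^bsub>R\<^esub> \<rho> a)) = alt_sign K n (T (tens K C R c (form \<rho> (as @ [a]))))"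
      using td[OF that(1,2) fpart[OF as that(3)]] that fsnoc[OF as] by simp
    then show ?thesis
      using alt_sign_simps(1,5)[OF module_scalars] lin_closed[OF lin_trace_part[OF T that(1)]] p by simp
  qed
  have cyc: "g \<in> cyclic_cochains K A C \<psi> n"
    unfolding cyclic_cochains_def
  proof (intro CollectI conjI ballI allI impI)
    show "g \<in> cochains K A C n" using g by (simp add: cochains_def)
    fix c a as assume c: "c \<in> carrier C" and a: "a \<in> carrier A" and as: "set as \<subseteq> carrier A \<and> length as = n"
    have "g (sw (CA K A C (n + 1)) (\<psi> (tens K C A c a)) (\<lambda>a' c'. ca K A C (n + 1) c' (as @ [a']))) =
        sw (scalars K) (\<psi> (tens K C A c a)) (\<lambda>a' c'. g (ca K A C (n + 1) c' (as @ [a'])))"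
      by (rule A.lin_of_sw_psi[OF _ _ g]) (use a c as in \<open>auto intro!: wc\<close>)
    also have "\<dots> = sw (scalars K) (\<psi> (tens K C A c a)) (\<lambda>a' c'. T (tens K C R c' (form \<rho> (as @ [a']))))"
      by (rule A.sw_psi_cong) (use a c as gT tcl in simp_all)
    also have "\<dots> = alt_sign K n (T (tens K C R c (form \<rho> (a # as))))"
    proof (cases "as = []")
      case True
      have f: "form \<rho> [a] = \<rho> a \<otimes>\<^bsub>R\<^esub> \<rho> \<one>\<^bsub>A\<^esub>"
        using rho_mult[OF a A.unit_closed] A.unit_right[OF a] by simp
      have "T (tens K C R c (form \<rho> [a])) = sw (scalars K) (\<psi> (tens K C A c a)) (\<lambda>a' c'. T (tens K C R c' (\<rho> \<one>\<^bsub>A\<^esub> \<otimes>\<^bsub>R\<^esub> \<rho> a')))"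
        unfolding f using tr[OF c a, of "\<rho> \<one>\<^bsub>A\<^esub>"] rho_degree[OF A.unit_closed] True as by simp
      also have "\<dots> = sw (scalars K) (\<psi> (tens K C A c a)) (\<lambda>a' c'. T (tens K C R c' (form \<rho> (as @ [a']))))"
        by (rule A.sw_psi_cong)
          (use a c as True lin_closed[OF lin_trace_part[OF T]] rho_mult[OF A.unit_closed] A.unit_left rho_degree in \<open>auto simp flip: rho_mult\<close>)
      finally show ?thesis using True as by (simp add: alt_sign_def)
    next
      case False
      have p: "dg_diff R (form \<rho> as) \<in> dg_part R n"
        using diff_part[OF fpart[OF False]] as False by (cases as) auto
      have "sw (scalars K) (\<psi> (tens K C A c a)) (\<lambda>a' c'. T (tens K C R c' (form \<rho> (as @ [a'])))) =
          sw (scalars K) (\<psi> (tens K C A c a)) (\<lambda>a' c'. alt_sign K n (T (tens K C R c' (dg_diff R (form \<rho> as) \<otimes>\<^bsub>R\<^esub> \<rho> a'))))"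
      proof (rule A.sw_psi_cong)
        fix a' c' assume a': "a' \<in> carrier A" "c' \<in> carrier C"
        show "T (tens K C R c' (form \<rho> (as @ [a']))) \<in> carrier (scalars K)"
          using tcl[OF a'(2), of "as @ [a']"] a' as by simp
        show "T (tens K C R c' (form \<rho> (as @ [a']))) = alt_sign K n (T (tens K C R c' (dg_diff R (form \<rho> as) \<otimes>\<^bsub>R\<^esub> \<rho> a')))"
          by (rule last) (use a' as False in auto)
      qed (use a c in auto)
      also have "\<dots> = alt_sign K n (sw (scalars K) (\<psi> (tens K C A c a)) (\<lambda>a' c'. T (tens K C R c' (dg_diff R (form \<rho> as) \<otimes>\<^bsub>R\<^esub> \<rho> a'))))"
      proof (rule A.lin_of_sw_psi[symmetric])
        show "lin (scalars K) (scalars K) (alt_sign K n)"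
          using lin_alt_map[OF module_scalars lin_ident, of n] by simp
        fix a' c' assume "a' \<in> carrier A" "c' \<in> carrier C"
        then show "T (tens K C R c' (dg_diff R (form \<rho> as) \<otimes>\<^bsub>R\<^esub> \<rho> a')) \<in> carrier (scalars K)"
          using lin_closed[OF lin_trace_part[OF T]] part_mult[OF p rho_degree[of a']] by simp
      qed (use a c in auto)
      also have "\<dots> = alt_sign K n (T (tens K C R c (\<rho> a \<otimes>\<^bsub>R\<^esub> dg_diff R (form \<rho> as))))"
        using tr[OF c a p] by simp
      finally show ?thesis using fCons[OF a _ False] as by simp
    qed
    finally have e: "g (sw (CA K A C (n + 1)) (\<psi> (tens K C A c a)) (\<lambda>a' c'. ca K A C (n + 1) c' (as @ [a']))) =
        alt_sign K n (T (tens K C R c (form \<rho> (a # as))))" .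
    have tc: "T (tens K C R c (form \<rho> (a # as))) \<in> carrier K"
      using lin_closed[OF lin_trace_part[OF T c]] fpart[of "a # as"] a as by simp
    show "g (ca K A C (n + 1) c (a # as)) = alt_sign K n (g (sw (CA K A C (n + 1)) (\<psi> (tens K C A c a)) (\<lambda>a' c'. ca K A C (n + 1) c' (as @ [a']))))"
      unfolding e using gT[of c "a # as"] a c as alt_sign_simps(1,5)[OF module_scalars] tc by simp
  qed
  let ?F = "\<lambda>c as. g (sw (CA K A C (n + 1)) (\<psi> (tens K C A c (hd as)))
         (\<lambda>a' c'. ca K A C (n + 1) c' (butlast (tl as) @ [last as \<otimes>\<^bsub>A\<^esub> a'])))
     \<oplus> (\<Oplus>i\<in>{1..n + 1}. alt_sign K i (g (ca K A C (n + 1) c (contract A (i - 1) as))))"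
  have F: "?F c as = \<zero>" if c: "c \<in> carrier C" and as: "set as \<subseteq> carrier A" "length as = n + 2" for c as
  proof -
    obtain a xs where ax: "as = a # xs" using as by (cases as) auto
    obtain bs b where xb: "xs = bs @ [b]" using ax as by (cases xs rule: rev_cases) auto
    have mem: "a \<in> carrier A" "b \<in> carrier A" "set bs \<subseteq> carrier A" "length bs = n" using ax xb as by auto
    let ?z = "form \<rho> (a # bs) \<otimes>\<^bsub>R\<^esub> \<rho> b"
    have z: "?z \<in> dg_part R n"
      using part_mult[OF fpart[of "a # bs"] rho_degree[OF mem(2)]] mem by simp
    have "g (sw (CA K A C (n + 1)) (\<psi> (tens K C A c a)) (\<lambda>a' c'. ca K A C (n + 1) c' (bs @ [b \<otimes>\<^bsub>A\<^esub> a']))) =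
        sw (scalars K) (\<psi> (tens K C A c a)) (\<lambda>a' c'. g (ca K A C (n + 1) c' (bs @ [b \<otimes>\<^bsub>A\<^esub> a'])))"
      by (rule A.lin_of_sw_psi[OF _ _ g]) (use c mem in \<open>auto intro!: wc\<close>)
    also have "\<dots> = sw (scalars K) (\<psi> (tens K C A c a)) (\<lambda>a' c'. T (tens K C R c' (form \<rho> (bs @ [b \<otimes>\<^bsub>A\<^esub> a']))))"
      by (rule A.sw_psi_cong) (use c mem gT tcl in simp_all)
    also have "\<dots> = alt_sign K n (T (tens K C R c ?z))"
    proof (cases "bs = []")
      case True
      have "sw (scalars K) (\<psi> (tens K C A c a)) (\<lambda>a' c'. T (tens K C R c' (form \<rho> (bs @ [b \<otimes>\<^bsub>A\<^esub> a'])))) =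
          sw (scalars K) (\<psi> (tens K C A c a)) (\<lambda>a' c'. T (tens K C R c' (\<rho> b \<otimes>\<^bsub>R\<^esub> \<rho> a')))"
        by (rule A.sw_psi_cong)
          (use c mem True rho_mult lin_closed[OF lin_trace_part[OF T]] rho_degree part_mult[of _ 0 _ 0, simplified] in auto)
      also have "\<dots> = T (tens K C R c ?z)"
        using tr[OF c mem(1) , of "\<rho> b"] rho_degree[OF mem(2)] True mem(4) by simp
      finally show ?thesis using True mem(4) by (simp add: alt_sign_def)
    next
      case False
      have p: "dg_diff R (form \<rho> bs) \<otimes>\<^bsub>R\<^esub> \<rho> b \<in> dg_part R n"
        using part_mult[OF diff_part[OF fpart[OF False mem(3)]] rho_degree[OF mem(2)]] mem False by (cases bs) auto
      have "sw (scalars K) (\<psi> (tens K C A c a)) (\<lambda>a' c'. T (tens K C R c' (form \<rho> (bs @ [b \<otimes>\<^bsub>A\<^esub> a'])))) =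
          sw (scalars K) (\<psi> (tens K C A c a)) (\<lambda>a' c'. alt_sign K n (T (tens K C R c' (dg_diff R (form \<rho> bs) \<otimes>\<^bsub>R\<^esub> \<rho> b \<otimes>\<^bsub>R\<^esub> \<rho> a'))))"
      proof (rule A.sw_psi_cong)
        fix a' c' assume a': "a' \<in> carrier A" "c' \<in> carrier C"
        have n0: "n \<noteq> 0" using False mem(4) by auto
        show "T (tens K C R c' (form \<rho> (bs @ [b \<otimes>\<^bsub>A\<^esub> a']))) \<in> carrier (scalars K)"
          using lin_closed[OF lin_trace_part[OF T a'(2)]] fpart[of "bs @ [b \<otimes>\<^bsub>A\<^esub> a']"] a' mem by simp
        show "T (tens K C R c' (form \<rho> (bs @ [b \<otimes>\<^bsub>A\<^esub> a']))) =
            alt_sign K n (T (tens K C R c' (dg_diff R (form \<rho> bs) \<otimes>\<^bsub>R\<^esub> \<rho> b \<otimes>\<^bsub>R\<^esub> \<rho> a')))"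
          using last[OF a'(2) _ mem(3,4) n0, of "b \<otimes>\<^bsub>A\<^esub> a'"] a' mem rho_mult[of b a'] rc
            diff_closed[OF fclosed[OF False mem(3)]] by (simp add: mult_assoc)
      qed (use c mem in auto)
      also have "\<dots> = alt_sign K n (sw (scalars K) (\<psi> (tens K C A c a)) (\<lambda>a' c'. T (tens K C R c' (dg_diff R (form \<rho> bs) \<otimes>\<^bsub>R\<^esub> \<rho> b \<otimes>\<^bsub>R\<^esub> \<rho> a'))))"
      proof (rule A.lin_of_sw_psi[symmetric])
        show "lin (scalars K) (scalars K) (alt_sign K n)"
          using lin_alt_map[OF module_scalars lin_ident, of n] by simp
        fix a' c' assume "a' \<in> carrier A" "c' \<in> carrier C"
        then show "T (tens K C R c' (dg_diff R (form \<rho> bs) \<otimes>\<^bsub>R\<^esub> \<rho> b \<otimes>\<^bsub>R\<^esub> \<rho> a')) \<in> carrier (scalars K)"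
          using lin_closed[OF lin_trace_part[OF T]] part_mult[OF p rho_degree[of a']] by simp
      qed (use c mem in auto)
      also have "\<dots> = alt_sign K n (T (tens K C R c (\<rho> a \<otimes>\<^bsub>R\<^esub> (dg_diff R (form \<rho> bs) \<otimes>\<^bsub>R\<^esub> \<rho> b))))"
        using tr[OF c mem(1) p] by simp
      also have "\<rho> a \<otimes>\<^bsub>R\<^esub> (dg_diff R (form \<rho> bs) \<otimes>\<^bsub>R\<^esub> \<rho> b) = ?z"
        using fCons[OF mem(1,3) False] rc mem diff_closed[OF fclosed[OF False mem(3)]] by (simp add: mult_assoc)
      finally show ?thesis .
    qed
    finally have 1: "g (sw (CA K A C (n + 1)) (\<psi> (tens K C A c (hd as)))
         (\<lambda>a' c'. ca K A C (n + 1) c' (butlast (tl as) @ [last as \<otimes>\<^bsub>A\<^esub> a']))) = alt_sign K n (T (tens K C R c ?z))"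
      by (simp add: ax xb)
    have ct: "set (contract A (i - 1) as) \<subseteq> carrier A" "length (contract A (i - 1) as) = n + 1" "contract A (i - 1) as \<noteq> []"
      if "i \<in> {1..n + 1}" for i
      subgoal using that as by (intro A.contract_closed) auto
      subgoal using that as by (auto simp: contract_def)
      subgoal by (simp add: contract_def)
      done
    have fp: "form \<rho> (contract A (i - 1) as) \<in> dg_part R n" if "i \<in> {1..n + 1}" for i
      using fpart[OF ct(3,1)[OF that]] ct(2)[OF that] by simp
    note l = lin_trace_part[OF T c]
    have Tneg: "T (tens K C R c (alt_sign R i r)) = alt_sign K i (T (tens K C R c r))" if "r \<in> dg_part R n" for r i
    proof -
      have "T (tens K C R c (\<ominus>\<^bsub>R\<^esub> r)) = \<ominus> T (tens K C R c r)"
        using lin_smult[OF l, of "\<ominus> \<one>" r] that mod_neg_eq[OF algebra_module part_closed[OF that]]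
          mod_neg_eq[OF module_scalars, of "T (tens K C R c r)"] lin_closed[OF l, of r]
        by simp
      then show ?thesis by (simp add: alt_sign_def)
    qed
    have "(\<Oplus>i\<in>{1..n + 1}. alt_sign K i (g (ca K A C (n + 1) c (contract A (i - 1) as)))) =
        (\<Oplus>\<^bsub>scalars K\<^esub>i\<in>{1..n + 1}. T (tens K C R c (alt_sign R i (form \<rho> (contract A (i - 1) as)))))"
      unfolding scalars_group
    proof (rule ring_finsum_cong', rule refl)
      fix i assume i: "i \<in> {1..n + 1}"
      show "alt_sign K i (g (ca K A C (n + 1) c (contract A (i - 1) as))) = T (tens K C R c (alt_sign R i (form \<rho> (contract A (i - 1) as))))"
        using gT[OF c ct(1,2)[OF i]] Tneg[OF fp[OF i]] by simp
    next
      show "(\<lambda>i. T (tens K C R c (alt_sign R i (form \<rho> (contract A (i - 1) as))))) \<in> {1..n + 1} \<rightarrow> carrier K"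
        using Tneg fp lin_closed[OF l] mod_closed(6)[OF module_scalars] by (auto simp: Pi_def)
    qed
    also have "\<dots> = T (tens K C R c (\<Oplus>\<^bsub>R\<^esub>i\<in>{1..n + 1}. alt_sign R i (form \<rho> (contract A (i - 1) as))))"
      by (rule lin_finsum_sub[OF algebra_module module_scalars part_submodule l, THEN conjunct2, symmetric])
        (use fp submodule_closed(7)[OF algebra_module part_submodule] in auto)
    also have "\<dots> = T (tens K C R c (alt_sign R (n + 1) ?z))"
      using ftele[OF as(2,1)] by (simp add: ax xb)
    also have "\<dots> = alt_sign K (Suc n) (T (tens K C R c ?z))" using Tneg[OF z] by simp
    finally show ?thesis
      unfolding 1 using alt_sign_simps(4)[OF module_scalars, of "T (tens K C R c ?z)" n] lin_closed[OF l] z by simp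
  qed
  have "coboundary K A C \<psi> n g x = \<zero>" if x: "x \<in> carrier (CA K A C (n + 2))" for x
  proof -
    have "coboundary K A C \<psi> n g x = sw (scalars K) x ?F" by (simp add: coboundary_def)
    also have "\<dots> = sw (scalars K) x (\<lambda>_ _. \<zero>)"
      by (rule lift_word_cong[OF _ A.algebra_module _ x]) (use F in \<open>auto simp: eval_nat_numeral\<close>)
    also have "\<dots> = \<zero>"
      using lin_of_lift_word[of "{n + 2}" "\<lambda>_. C" A "scalars K" "scalars K" "\<lambda>_. \<zero>" x "\<lambda>_ _. \<zero>"]
        lin_zero_map[OF module_scalars, of "scalars K"] x by simp
    finally show ?thesis .
  qed
  then show ?thesis using cyc by (simp add: cyclic_cocycles_def)
qed

end

section \<open>Cyclic cocycles give closed graded traces\<close>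

context cring
begin

lemma sw_zero:
  assumes "module R V" "module R W" "module R P" "X \<in> carrier (tensor R V W)"
  shows "sw P X (\<lambda>_ _. \<zero>\<^bsub>P\<^esub>) = \<zero>\<^bsub>P\<^esub>"
  by (rule lin_of_sw[OF assms(1,2,3,3) lin_zero_map[OF assms(3)] assms(4), of "\<lambda>_ _. \<zero>\<^bsub>P\<^esub>", symmetric])
    (use assms in simp)

lemma sw_finsum:
  assumes VWP: "module R V" "module R W" "module R P" and X: "X \<in> carrier (tensor R V W)" and fin: "finite I"
    and f: "\<And>i v w. i \<in> I \<Longrightarrow> v \<in> carrier V \<Longrightarrow> w \<in> carrier W \<Longrightarrow> f i v w \<in> carrier P"
  shows "sw P X (\<lambda>v w. \<Oplus>\<^bsub>P\<^esub>i\<in>I. f i v w) = (\<Oplus>\<^bsub>P\<^esub>i\<in>I. sw P X (f i))"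
  using fin f
proof (induction I rule: finite_induct)
  case empty
  interpret P: module R P by fact
  show ?case unfolding P.finsum_empty by (rule sw_zero[OF VWP X])
next
  case (insert i I)
  interpret P: module R P by fact
  have "sw P X (\<lambda>v w. \<Oplus>\<^bsub>P\<^esub>j\<in>insert i I. f j v w) = sw P X (\<lambda>v w. f i v w \<oplus>\<^bsub>P\<^esub> (\<Oplus>\<^bsub>P\<^esub>j\<in>I. f j v w))"
    by (rule sw_cong[OF VWP X]) (use insert in \<open>auto intro!: mod_finsum_closed[OF VWP(3)]\<close>)
  also have "\<dots> = sw P X (f i) \<oplus>\<^bsub>P\<^esub> sw P X (\<lambda>v w. \<Oplus>\<^bsub>P\<^esub>j\<in>I. f j v w)"
    by (rule sw_add[OF VWP X]) (use insert in \<open>auto intro!: mod_finsum_closed[OF VWP(3)]\<close>)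
  also have "\<dots> = (\<Oplus>\<^bsub>P\<^esub>j\<in>insert i I. sw P X (f j))"
    using insert by (subst P.finsum_insert) (auto intro!: sw_closed[OF VWP X])
  finally show ?case .
qed

lemma mlin_add:
  assumes "module R P" "mlin H M N P f" "mlin H M N P g"
  shows "mlin H M N P (\<lambda>h xs. f h xs \<oplus>\<^bsub>P\<^esub> g h xs)"
  by (intro mlinI lin_add_map assms(1) mlinD[OF assms(2)] mlinD[OF assms(3)])

lemma mlin_finsum:
  assumes "module R P" "module R M" "\<And>i. i \<in> N \<Longrightarrow> module R (H i)" "finite I" "\<And>i. i \<in> I \<Longrightarrow> mlin H M N P (f i)"
  shows "mlin H M N P (\<lambda>h xs. \<Oplus>\<^bsub>P\<^esub>i\<in>I. f i h xs)"
  by (intro mlinI lin_finsum_map assms(1-4) mlinD[OF assms(5)])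

lemma mlin_alt:
  assumes "module R P" "mlin H M N P f"
  shows "mlin H M N P (\<lambda>h xs. alt_sign P i (f h xs))"
  by (intro mlinI lin_alt_map assms(1) mlinD[OF assms(2)])

end

context nonunital_algebra
begin

lemma length_contract: "Suc i < length as \<Longrightarrow> length (contract A i as) = length as - 1"
  by (auto simp: contract_def)

lemma contract_append: "Suc i < length as \<Longrightarrow> contract A i (as @ bs) = contract A i as @ bs"
  by (auto simp: contract_def nth_append)

lemma contract_skip: "contract A (length ys + i) (ys @ zs) = ys @ contract A i zs"
  by (simp add: contract_def nth_append)

lemma mlin_contract:
  assumes f: "mlin (\<lambda>_. C) A {m} P f" and i: "i < m"
  shows "mlin (\<lambda>_. C) A {Suc m} P (\<lambda>c as. f c (contract A i as))"
proof (rule mlinI)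
  fix xs assume "length xs \<in> {Suc m}" "set xs \<subseteq> carrier A"
  then show "lin C P (\<lambda>c. f c (contract A i xs))"
    using i by (intro mlinD(1)[OF f]) (auto simp: length_contract)
next
  fix c ys zs
  assume *: "Suc (length ys + length zs) \<in> {Suc m}" "c \<in> carrier C" "set ys \<subseteq> carrier A" "set zs \<subseteq> carrier A"
  consider "length ys < i" | "length ys = i" | "length ys = Suc i" | "Suc i < length ys" by linarith
  then show "lin A P (\<lambda>x. f c (contract A i (ys @ x # zs)))"
  proof cases
    case 1
    obtain k where k: "i = length ys + Suc k" using less_imp_Suc_add[OF 1] by auto
    have "contract A i (ys @ x # zs) = ys @ x # contract A k zs" for x
      unfolding k contract_skip contract_Cons ..
    then show ?thesis
      using * i k mlinD(2)[OF f, of ys "contract A k zs" c] by (auto simp: length_contract)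
  next
    case 2
    then obtain z zs' where z: "zs = z # zs'" using * i by (cases zs) auto
    have "contract A i (ys @ x # zs) = ys @ (x \<otimes>\<^bsub>A\<^esub> z) # zs'" for x
      using contract_skip[of ys 0 "x # zs"] by (simp add: 2 z contract_def)
    then show ?thesis
      using * z by (auto intro!: lin_comp[OF mlinD(2)[OF f, of ys zs' c] bilinD(2)[OF algebra_bilin]])
  next
    case 3
    then obtain ys' y where y: "ys = ys' @ [y]" "length ys' = i" by (cases ys rule: rev_cases) auto
    have "contract A i (ys @ x # zs) = ys' @ (y \<otimes>\<^bsub>A\<^esub> x) # zs" for x
      using contract_skip[of ys' 0 "y # x # zs"] by (simp add: y contract_def)
    then show ?thesis
      using * y by (auto intro!: lin_comp[OF mlinD(2)[OF f, of ys' zs c] bilinD(1)[OF algebra_bilin]])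
  next
    case 4
    then show ?thesis
      using * mlinD(2)[OF f, of "contract A i ys" zs c] by (auto simp: contract_append length_contract)
  qed
qed

lemma omega_form:
  assumes "a \<in> carrier A" "set as \<subseteq> carrier A" "set bs \<subseteq> carrier A"
  shows "foldl (\<lambda>x y. x \<cdot> y) (aw a bs) (map (\<lambda>b. dg_diff Om (aw b [])) as) =
    aw a (bs @ as)"
  using assms(2,3)
proof (induction as arbitrary: bs)
  case (Cons b as)
  have "aw a bs \<cdot> dg_diff Om (aw b []) = aw a (bs @ [b])"
    using assms(1) Cons.prems by (simp add: omega_diff_word omega_word_mult omega_dlefts_diff omega_left_word)
  then show ?case using Cons.IH[of "bs @ [b]"] Cons.prems by simp
qed simp

end

context nonunital_entwining
begin

lemma mlin_rotate:
  assumes P: "module K P" and f: "mlin (\<lambda>_. C) A {Suc m} P f"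
  shows "mlin (\<lambda>_. C) A {Suc m} P (\<lambda>c as. sw P (c \<rhd> (hd as)) (\<lambda>a' c'. f c' (tl as @ [a'])))"
proof -
  have b: "bilin A C P (\<lambda>a' c'. f c' (as @ [a']))" if "set as \<subseteq> carrier A" "length as = m" for as
  proof (rule bilinI)
    fix a' assume "a' \<in> carrier A"
    then show "lin C P (\<lambda>c'. f c' (as @ [a']))" using mlinD(1)[OF f, of "as @ [a']"] that by simp
  next
    fix c' assume "c' \<in> carrier C"
    then show "lin A P (\<lambda>a'. f c' (as @ [a']))" using mlinD(2)[OF f, of as "[]" c'] that by simp
  qed
  show ?thesis
  proof (rule mlinI)
    fix xs assume "length xs \<in> {Suc m}" "set xs \<subseteq> carrier A"
    then show "lin C P (\<lambda>c. sw P (c \<rhd> (hd xs)) (\<lambda>a' c'. f c' (tl xs @ [a'])))"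
      by (intro lin_sw_psi_coalg P b lin_ident) (cases xs; auto)+
  next
    fix c ys zs
    assume *: "Suc (length ys + length zs) \<in> {Suc m}" "c \<in> carrier C" "set ys \<subseteq> carrier A" "set zs \<subseteq> carrier A"
    show "lin A P (\<lambda>x. sw P (c \<rhd> (hd (ys @ x # zs))) (\<lambda>a' c'. f c' (tl (ys @ x # zs) @ [a'])))"
    proof (cases ys)
      case Nil
      then show ?thesis using * by (auto intro!: lin_sw_psi_alg P b lin_ident)
    next
      case (Cons y ys')
      have "lin A P (\<lambda>x. f c' (ys' @ x # zs @ [a']))" if "a' \<in> carrier A" "c' \<in> carrier C" for a' c'
        using mlinD(2)[OF f, of ys' "zs @ [a']" c'] * Cons that by simp
      then show ?thesis using * Cons by (auto intro!: lin_sw_psi_param P)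
    qed
  qed
qed

text \<open>
  A closed trace with character \<open>g\<close> is determined by \<open>g\<close> on words \<open>a\<^sub>0 da\<^sub>1 \<dots> da\<^sub>n\<close> and has to vanish on the
  exact words \<open>da\<^sub>1 \<dots> da\<^sub>n\<close>, so the scalar part of the head is ignored. The value zero in other degrees
  is a choice that makes the functional linear on all of \<open>C \<otimes> \<Omega>A\<close>.
\<close>

definition omega_trace where
  "omega_trace n g X = sw (scalars K) X (\<lambda>c x. sw (scalars K) x
     (\<lambda>h as. if length as = n then g (ca K A C (n + 1) c (fst h # as)) else \<zero>))"

context
  fixes g and n :: nat
  assumes g: "lin (CA K A C (n + 1)) (scalars K) g"
begin

abbreviation G where "G c as \<equiv> g (ca K A C (n + 1) c as)"
abbreviation tr where "tr c x \<equiv> omega_trace n g (tens K C Om c x)"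

lemma G_mlin: "mlin (\<lambda>_. C) A {Suc n} (scalars K) G"
  using mlin_comp[OF g mlin_word[of "{n + 1}" "\<lambda>_. C" A]] by simp

lemma G_closed: "c \<in> carrier C \<Longrightarrow> set as \<subseteq> carrier A \<Longrightarrow> length as = Suc n \<Longrightarrow> G c as \<in> carrier K"
  using mlinD(3)[OF G_mlin, of as c] by simp

lemma omega_trace_mlin:
  assumes c: "c \<in> carrier C"
  shows "mlin (omega_head K A) A UNIV (scalars K) (\<lambda>h as. if length as = n then G c (fst h # as) else \<zero>)"
proof (rule mlinI)
  fix xs assume xs: "set xs \<subseteq> carrier A"
  have 1: "lin A (scalars K) (\<lambda>x. G c (x # xs))" if "length xs = n"
    using mlinD(2)[OF G_mlin, of "[]" xs c] c xs that by simp
  have 2: "lin (omega_head K A (length xs)) A fst" by (rule linI) (auto elim!: omega_head_cases)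
  show "lin (omega_head K A (length xs)) (scalars K) (\<lambda>h. if length xs = n then G c (fst h # xs) else \<zero>)"
    using lin_comp[OF 1 2] lin_zero_map[OF module_scalars] by (cases "length xs = n") auto
next
  fix h ys zs
  assume *: "h \<in> carrier (omega_head K A (Suc (length ys + length zs)))" "set ys \<subseteq> carrier A" "set zs \<subseteq> carrier A"
  then have h: "fst h \<in> carrier A" by (auto elim!: omega_head_cases)
  show "lin A (scalars K) (\<lambda>x. if length (ys @ x # zs) = n then G c (fst h # ys @ x # zs) else \<zero>)"
    using mlinD(2)[OF G_mlin, of "fst h # ys" zs c] lin_zero_map[OF module_scalars] * h c
    by (cases "Suc (length ys + length zs) = n") auto
qed

lemma omega_trace_bilin:
  "bilin C Om (scalars K) (\<lambda>c x. sw (scalars K) x (\<lambda>h as. if length as = n then G c (fst h # as) else \<zero>))"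
proof (rule bilinI)
  fix c assume "c \<in> carrier C"
  from lin_omega_lift[OF module_scalars omega_trace_mlin[OF this]]
  show "lin Om (scalars K) (\<lambda>x. sw (scalars K) x (\<lambda>h as. if length as = n then G c (fst h # as) else \<zero>))" .
next
  fix x assume x: "x \<in> carrier Om"
  show "lin C (scalars K) (\<lambda>c. sw (scalars K) x (\<lambda>h as. if length as = n then G c (fst h # as) else \<zero>))"
  proof (rule lin_lift_word_param[of UNIV "omega_head K A" A])
    fix h xs assume *: "set xs \<subseteq> carrier A" "h \<in> carrier (omega_head K A (length xs))"
    then have "fst h \<in> carrier A" by (auto elim!: omega_head_cases)
    then show "lin C (scalars K) (\<lambda>c. if length xs = n then G c (fst h # xs) else \<zero>)"
      using mlinD(1)[OF G_mlin, of "fst h # xs"] lin_zero_map[OF module_scalars] *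
      by (cases "length xs = n") auto
  qed (use x in \<open>auto simp: omega_space_eq\<close>)
qed

lemma lin_omega_trace: "lin (tensor K C Om) (scalars K) (omega_trace n g)"
  unfolding omega_trace_def using lin_sw[OF _ _ _ omega_trace_bilin] by simp

lemma lin_tr: "c \<in> carrier C \<Longrightarrow> lin Om (scalars K) (\<lambda>x. tr c x)"
  by (intro lin_comp[OF lin_omega_trace] lin_tens_right) auto

lemma lin_tr_coalg: "x \<in> carrier Om \<Longrightarrow> lin C (scalars K) (\<lambda>c. tr c x)"
  by (intro lin_comp[OF lin_omega_trace] lin_tens_left) auto

lemma tr_closed: "c \<in> carrier C \<Longrightarrow> x \<in> carrier Om \<Longrightarrow> tr c x \<in> carrier K"
  using lin_closed[OF lin_tr] by simp

lemma tr_word: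
  assumes "c \<in> carrier C" "set as \<subseteq> carrier A" "h \<in> carrier (omega_head K A (length as))"
  shows "tr c (ow h as) = (if length as = n then G c (fst h # as) else \<zero>)"
proof -
  have "tr c (ow h as) = sw (scalars K) (ow h as) (\<lambda>h as. if length as = n then G c (fst h # as) else \<zero>)"
    unfolding omega_trace_def by (rule sw_tens[OF _ _ _ omega_trace_bilin]) (use assms in auto)
  also have "\<dots> = (if length as = n then G c (fst h # as) else \<zero>)"
    by (rule omega_lift_word[OF module_scalars omega_trace_mlin]) (use assms in auto)
  finally show ?thesis .
qed

lemma G_zero: "c \<in> carrier C \<Longrightarrow> set as \<subseteq> carrier A \<Longrightarrow> length as = n \<Longrightarrow> G c (\<zero>\<^bsub>A\<^esub> # as) = \<zero>"
  using lin_zero[where f = "\<lambda>x. G c (x # as)" and V = A and W = "scalars K"]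
    mlinD(2)[OF G_mlin, of "[]" as c] by simp

lemma tr_diff_word: "c \<in> carrier C \<Longrightarrow> set as \<subseteq> carrier A \<Longrightarrow> as \<noteq> [] \<Longrightarrow> tr c (dw as) = \<zero>"
  using tr_word[of c as "(\<zero>\<^bsub>A\<^esub>, \<one>)"] G_zero[of c as] by (cases "length as = n"; cases as) simp_all

lemma tr_exact:
  assumes c: "c \<in> carrier C" and x: "x \<in> carrier Om"
  shows "tr c (dg_diff Om x) = \<zero>"
proof -
  have "tr c (dg_diff Om x) = \<zero>\<^bsub>scalars K\<^esub>"
    by (rule omega_eqI[OF module_scalars lin_comp[OF lin_tr lin_omega_diff] lin_zero_map[OF module_scalars] _ _ x])
      (use c lin_zero[OF _ _ lin_omega_trace] in \<open>auto simp: omega_diff_word tr_diff_word\<close>)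
  then show ?thesis by simp
qed

lemma coboundary_word:
  assumes c: "c \<in> carrier C" and as: "set as \<subseteq> carrier A" "length as = n + 2"
  shows "coboundary K A C \<psi> n g (ca K A C (n + 2) c as) =
    sw (scalars K) (c \<rhd> (hd as)) (\<lambda>a' c'. G c' (contract A n (tl as @ [a'])))
     \<oplus> (\<Oplus>i\<in>{1..n + 1}. alt_sign K i (G c (contract A (i - 1) as)))"
proof -
  let ?S = "scalars K"
  let ?F = "\<lambda>c as. g (sw (CA K A C (n + 1)) (c \<rhd> (hd as))
         (\<lambda>a' c'. ca K A C (n + 1) c' (butlast (tl as) @ [last as \<otimes>\<^bsub>A\<^esub> a'])))
     \<oplus> (\<Oplus>i\<in>{1..n + 1}. alt_sign K i (g (ca K A C (n + 1) c (contract A (i - 1) as))))"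
  let ?G1 = "\<lambda>c as. sw ?S (c \<rhd> (hd as)) (\<lambda>a' c'. G c' (contract A n (tl as @ [a'])))"
  let ?G2 = "\<lambda>c as. (\<Oplus>\<^bsub>?S\<^esub>i\<in>{1..n + 1}. alt_sign ?S i (G c (contract A (i - 1) as)))"
  note [simp] = word_space_module[of "{m}" "\<lambda>_. C" A for m, OF coalgebra_module algebra_module]
  have m1: "mlin (\<lambda>_. C) A {n + 2} ?S ?G1"
    using mlin_rotate[OF module_scalars mlin_contract[OF G_mlin, of n]] by simp
  have m2: "mlin (\<lambda>_. C) A {n + 2} ?S ?G2"
  proof (rule mlin_finsum)
    fix i assume "i \<in> {1..n + 1}"
    then have "i - 1 < Suc n" by auto
    from mlin_alt[OF module_scalars mlin_contract[OF G_mlin this], of i]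
    show "mlin (\<lambda>_. C) A {n + 2} ?S (\<lambda>c as. alt_sign ?S i (G c (contract A (i - 1) as)))" by simp
  qed simp_all
  have m: "mlin (\<lambda>_. C) A {n + 2} ?S (\<lambda>c as. ?G1 c as \<oplus>\<^bsub>?S\<^esub> ?G2 c as)"
    by (rule mlin_add[OF module_scalars m1 m2])
  have FG: "?F c as = ?G1 c as \<oplus>\<^bsub>?S\<^esub> ?G2 c as"
    if cas: "c \<in> carrier C" "set as \<subseteq> carrier A" "length as = n + 2" for c as
  proof -
    obtain a xs where ax: "as = a # xs" using cas by (cases as) auto
    obtain bs b where xb: "xs = bs @ [b]" using ax cas by (cases xs rule: rev_cases) auto
    have mem: "a \<in> carrier A" "b \<in> carrier A" "set bs \<subseteq> carrier A" "length bs = n" using ax xb cas by auto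
    have ct: "contract A n (tl as @ [a']) = bs @ [b \<otimes>\<^bsub>A\<^esub> a']" for a'
      using contract_skip[of bs 0 "[b, a']"] mem by (simp add: ax xb contract_def)
    have "g (sw (CA K A C (n + 1)) (c \<rhd> a) (\<lambda>a' c'. ca K A C (n + 1) c' (bs @ [b \<otimes>\<^bsub>A\<^esub> a']))) =
        sw ?S (c \<rhd> a) (\<lambda>a' c'. G c' (bs @ [b \<otimes>\<^bsub>A\<^esub> a']))"
      by (rule lin_of_sw_psi[OF _ _ g]) (use cas mem in \<open>auto intro!: word_closed\<close>)
    then show ?thesis unfolding ct by (simp add: ax xb)
  qed
  have w: "ca K A C (n + 2) c as \<in> carrier (CA K A C (n + 2))"
    using c as by (intro word_closed) auto
  have "coboundary K A C \<psi> n g (ca K A C (n + 2) c as) = sw ?S (ca K A C (n + 2) c as) ?F"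
    by (simp add: coboundary_def)
  also have "\<dots> = sw ?S (ca K A C (n + 2) c as) (\<lambda>c as. ?G1 c as \<oplus>\<^bsub>?S\<^esub> ?G2 c as)"
  proof (rule lift_word_cong[OF _ _ _ w])
    fix h xs assume "length xs \<in> {n + 2}" "set xs \<subseteq> carrier A" "h \<in> carrier C"
    then have *: "h \<in> carrier C" "set xs \<subseteq> carrier A" "length xs = n + 2" by auto
    show "?F h xs = ?G1 h xs \<oplus>\<^bsub>?S\<^esub> ?G2 h xs" by (rule FG[OF *])
    then show "?F h xs \<in> carrier ?S" using mlinD(3)[OF m, of xs h] * by simp
  qed auto
  also have "\<dots> = ?G1 c as \<oplus>\<^bsub>?S\<^esub> ?G2 c as"
    by (rule lift_word[OF _ _ _ m]) (use c as in auto)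
  finally show ?thesis by simp
qed

context
  assumes cyc: "\<And>c a as. c \<in> carrier C \<Longrightarrow> a \<in> carrier A \<Longrightarrow> set as \<subseteq> carrier A \<Longrightarrow> length as = n \<Longrightarrow>
      G c (a # as) = alt_sign K n (sw (scalars K) (c \<rhd> a) (\<lambda>a' c'. G c' (as @ [a'])))"
    and coc: "\<And>x. x \<in> carrier (CA K A C (n + 2)) \<Longrightarrow> coboundary K A C \<psi> n g x = \<zero>"
begin

text \<open>
  The trace property for a left factor \<open>\<rho>(a)\<close> and a word that begins with an element of \<open>A\<close>: by the
  telescoping formula, \<open>(-1)\<^sup>n\<^sup>+\<^sup>1\<close> times the right hand side is an alternating sum of values of \<open>g\<close>. Its
  last term is the entwined summand of the coboundary at \<open>a, q, qs\<close>, cyclicity turns the other ones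
  into further summands of this coboundary, and the one that remains there is the left hand side.
\<close>

lemma tr_rho_plain:
  assumes [simp]: "c \<in> carrier C" "a \<in> carrier A" "q \<in> carrier A" "set qs \<subseteq> carrier A" "length qs = n"
  shows "tr c (rho a \<cdot> aw q qs) =
    sw (scalars K) (c \<rhd> a) (\<lambda>a' c'. tr c' (aw q qs \<cdot> rho a'))"
proof -
  let ?S = "scalars K" and ?y = "aw q qs"
  interpret S: module K ?S by simp
  note alt = alt_sign_simps[OF module_scalars, unfolded scalars_group scalars_simps]
  let ?s = "\<lambda>i. sw ?S (c \<rhd> a) (\<lambda>a' c'. G c' (contract A (i - 1) (q # qs @ [a'])))"
  let ?L = "sw ?S (c \<rhd> a) (\<lambda>a' c'. tr c' (?y \<cdot> rho a'))"
  have cc: "set (contract A (i - 1) (q # qs @ [a'])) \<subseteq> carrier A" "length (contract A (i - 1) (q # qs @ [a'])) = Suc n"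
    if "i \<in> {1..n + 1}" "a' \<in> carrier A" for i a'
    subgoal using that by (intro contract_closed) auto
    subgoal using that by (subst length_contract) auto
    done
  have Gc: "G c' (contract A (i - 1) (q # qs @ [a'])) \<in> carrier K" if "i \<in> {1..n + 1}" "a' \<in> carrier A" "c' \<in> carrier C" for i a' c'
    using G_closed[OF that(3) cc[OF that(1,2)]] .
  have sK: "?s i \<in> carrier K" if "i \<in> {1..n + 1}" for i
    using sw_psi_closed[OF module_scalars, of c a] Gc that by simp
  have yr: "?y \<cdot> rho a' \<in> carrier Om" if "a' \<in> carrier A" for a' using that by simp
  have LK: "?L \<in> carrier K"
    using sw_psi_closed[OF module_scalars, of c a] tr_closed yr by simp
  \<comment> \<open>the telescoping sum in the universal algebra itself, with \<open>\<rho>\<close> the inclusion of \<open>A\<close>\<close>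
  have tele: "alt_sign K (n + 1) (tr c' (?y \<cdot> rho a')) =
      (\<Oplus>\<^bsub>?S\<^esub>i\<in>{1..n + 1}. alt_sign K i (G c' (contract A (i - 1) (q # qs @ [a']))))"
    if [simp]: "a' \<in> carrier A" "c' \<in> carrier C" for a' c'
  proof -
    let ?form = "\<lambda>as. foldl (\<lambda>x y. x \<cdot> y) (rho (hd as)) (map (\<lambda>b. dg_diff Om (rho b)) (tl as))"
    have rd: "\<forall>a\<in>carrier A. rho a \<in> dg_part Om 0" "\<forall>a\<in>carrier A. \<forall>b\<in>carrier A. rho (a \<otimes>\<^bsub>A\<^esub> b) = rho a \<cdot> rho b"
      using omega_word_part[of "[]" "(a, \<zero>)" for a] by (auto simp: omega_word_mult omega_left_word)
    have fw: "?form as = aw (hd as) (tl as)" if "as \<noteq> []" "set as \<subseteq> carrier A" for as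
      using omega_form[of "hd as" "tl as" "[]"] that by (cases as) auto
    have t: "(\<Oplus>\<^bsub>Om\<^esub>i\<in>{1..n + 1}. alt_sign Om i (?form (contract A (i - 1) (q # qs @ [a'])))) =
        alt_sign Om (n + 1) (?form (q # qs) \<cdot> rho a')"
      using dg_algebra.form_telescope[OF omega_dg_algebra nonunital_algebra_axioms lin_rho rd, of "q # qs @ [a']" n]
      by (simp del: foldl.simps)
    note l = lin_tr[OF \<open>c' \<in> carrier C\<close>]
    have fo: "?form (contract A (i - 1) (q # qs @ [a'])) = ow (hd (contract A (i - 1) (q # qs @ [a'])), \<zero>) (tl (contract A (i - 1) (q # qs @ [a'])))"
      if "i \<in> {1..n + 1}" for i
      using cc[OF that \<open>a' \<in> carrier A\<close>] by (intro fw) auto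
    have oc: "ow (hd (contract A (i - 1) (q # qs @ [a'])), \<zero>) (tl (contract A (i - 1) (q # qs @ [a']))) \<in> carrier Om"
      "tr c' (ow (hd (contract A (i - 1) (q # qs @ [a'])), \<zero>) (tl (contract A (i - 1) (q # qs @ [a'])))) = G c' (contract A (i - 1) (q # qs @ [a']))"
      if i: "i \<in> {1..n + 1}" for i
    proof -
      obtain d ds where d: "contract A (i - 1) (q # qs @ [a']) = d # ds"
        using cc(2)[OF i \<open>a' \<in> carrier A\<close>] by (cases "contract A (i - 1) (q # qs @ [a'])") auto
      have dd: "d \<in> carrier A" "set ds \<subseteq> carrier A" "length ds = n"
        using cc[OF i \<open>a' \<in> carrier A\<close>] unfolding d by auto
      show "ow (hd (contract A (i - 1) (q # qs @ [a'])), \<zero>) (tl (contract A (i - 1) (q # qs @ [a']))) \<in> carrier Om"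
        "tr c' (ow (hd (contract A (i - 1) (q # qs @ [a'])), \<zero>) (tl (contract A (i - 1) (q # qs @ [a'])))) = G c' (contract A (i - 1) (q # qs @ [a']))"
        unfolding d using dd by (simp_all add: tr_word)
    qed
    have "alt_sign K (n + 1) (tr c' (?y \<cdot> rho a')) = tr c' (alt_sign Om (n + 1) (?form (q # qs) \<cdot> rho a'))"
      using fw[of "q # qs"] lin_alt_sign[OF _ _ l, of "?y \<cdot> rho a'" "n + 1"] by (simp del: foldl.simps)
    also have "\<dots> = tr c' (\<Oplus>\<^bsub>Om\<^esub>i\<in>{1..n + 1}. alt_sign Om i (?form (contract A (i - 1) (q # qs @ [a']))))"
      by (simp only: t)
    also have "\<dots> = (\<Oplus>\<^bsub>?S\<^esub>i\<in>{1..n + 1}. tr c' (alt_sign Om i (?form (contract A (i - 1) (q # qs @ [a'])))))"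
      using fo oc(1) by (intro lin_finsum[OF omega_module module_scalars l]) auto
    also have "\<dots> = (\<Oplus>\<^bsub>?S\<^esub>i\<in>{1..n + 1}. alt_sign K i (G c' (contract A (i - 1) (q # qs @ [a']))))"
    proof (rule S.finsum_cong', rule refl)
      fix i assume i: "i \<in> {1..n + 1}"
      show "tr c' (alt_sign Om i (?form (contract A (i - 1) (q # qs @ [a'])))) = alt_sign K i (G c' (contract A (i - 1) (q # qs @ [a'])))"
        unfolding fo[OF i] using lin_alt_sign[OF _ _ l oc(1)[OF i], of i] oc(2)[OF i] by simp
    next
      show "(\<lambda>i. alt_sign K i (G c' (contract A (i - 1) (q # qs @ [a'])))) \<in> {1..n + 1} \<rightarrow> carrier ?S"
        using Gc mod_closed(6)[OF module_scalars] by simp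
    qed
    finally show ?thesis .
  qed
  have lalt: "lin ?S ?S (alt_sign K i)" for i using lin_alt_map[OF module_scalars lin_ident, of i] by simp
  have altK: "alt_sign K i x \<in> carrier K" if "x \<in> carrier K" for i x
    using lin_closed[OF lalt] that by simp
  have psc: "c \<rhd> a \<in> carrier (tensor K A C)" by (rule psi_closed) auto
  have "alt_sign K (n + 1) ?L = sw ?S (c \<rhd> a) (\<lambda>a' c'. alt_sign K (n + 1) (tr c' (?y \<cdot> rho a')))"
    by (rule lin_of_sw_psi[OF _ _ lalt]) (use tr_closed yr in auto)
  also have "\<dots> = sw ?S (c \<rhd> a) (\<lambda>a' c'. \<Oplus>\<^bsub>?S\<^esub>i\<in>{1..n + 1}. alt_sign K i (G c' (contract A (i - 1) (q # qs @ [a']))))"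
    by (rule sw_psi_cong, simp_all only: tele) (use altK[OF tr_closed[OF _ yr]] tele[symmetric] in simp_all)
  also have "\<dots> = (\<Oplus>\<^bsub>?S\<^esub>i\<in>{1..n + 1}. sw ?S (c \<rhd> a) (\<lambda>a' c'. alt_sign K i (G c' (contract A (i - 1) (q # qs @ [a'])))))"
    by (rule sw_finsum[OF algebra_module coalgebra_module module_scalars psc]) (use Gc altK in auto)
  also have "\<dots> = (\<Oplus>\<^bsub>?S\<^esub>i\<in>{1..n + 1}. alt_sign K i (?s i))"
  proof (rule S.finsum_cong', rule refl)
    fix i assume i: "i \<in> {1..n + 1}"
    show "sw ?S (c \<rhd> a) (\<lambda>a' c'. alt_sign K i (G c' (contract A (i - 1) (q # qs @ [a'])))) = alt_sign K i (?s i)"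
      by (rule lin_of_sw_psi[OF _ _ lalt, symmetric]) (use Gc[OF i] in auto)
  qed (use sK altK in auto)
  finally have A1: "alt_sign K (n + 1) ?L = (\<Oplus>\<^bsub>?S\<^esub>i\<in>{1..n + 1}. alt_sign K i (?s i))" .
  have ee: "alt_sign K (n + 1) (alt_sign K (n + 1) x) = x" if "x \<in> carrier K" for x
    unfolding alt(1)[OF that] by (simp add: alt_sign_def)
  have "?L = alt_sign K (n + 1) (alt_sign K (n + 1) ?L)" by (rule ee[OF LK, symmetric])
  also have "\<dots> = (\<Oplus>\<^bsub>?S\<^esub>i\<in>{1..n + 1}. alt_sign K (n + 1) (alt_sign K i (?s i)))"
    unfolding A1 by (rule lin_finsum[OF _ _ lalt]) (use sK altK in auto)
  also have "\<dots> = alt_sign K (n + 1) (alt_sign K (n + 1) (?s (n + 1))) \<oplus>\<^bsub>?S\<^esub> (\<Oplus>\<^bsub>?S\<^esub>i\<in>{1..n}. alt_sign K (n + 1) (alt_sign K i (?s i)))"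
  proof -
    have e: "{1..n + 1} = insert (n + 1) {1..n}" by auto
    show ?thesis unfolding e
      by (rule S.finsum_insert) (use sK sK[of "n + 1"] altK in auto)
  qed
  also have "alt_sign K (n + 1) (alt_sign K (n + 1) (?s (n + 1))) = ?s (n + 1)"
    by (rule ee, rule sK) simp
  finally have L: "?L = ?s (n + 1) \<oplus>\<^bsub>?S\<^esub> (\<Oplus>\<^bsub>?S\<^esub>i\<in>{1..n}. alt_sign K (n + 1) (alt_sign K i (?s i)))" .
  let ?M = "\<Oplus>\<^bsub>?S\<^esub>i\<in>{1..n}. alt_sign K (n + 1) (alt_sign K i (?s i))"
  have MK: "?M \<in> carrier K" using mod_finsum_closed[OF module_scalars, of "{1..n}"] sK altK by simp
  let ?g0 = "G c ((a \<otimes>\<^bsub>A\<^esub> q) # qs)"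
  have g0: "?g0 \<in> carrier K" by (rule G_closed) auto
  \<comment> \<open>The cocycle condition at \<open>(c, a, q, qs)\<close>, with cyclicity applied to all terms but the first two.\<close>
  have "?s (n + 1) \<oplus> (\<Oplus>\<^bsub>?S\<^esub>i\<in>{1..n + 1}. alt_sign K i (G c (contract A (i - 1) (a # q # qs)))) = \<zero>"
    using coboundary_word[of c "a # q # qs"] coc[of "ca K A C (n + 2) c (a # q # qs)"]
    by (simp add: word_closed)
  also have "(\<Oplus>\<^bsub>?S\<^esub>i\<in>{1..n + 1}. alt_sign K i (G c (contract A (i - 1) (a # q # qs)))) =
      alt_sign K 1 ?g0 \<oplus>\<^bsub>?S\<^esub> ?M"
  proof -
    let ?h = "\<lambda>i. alt_sign K i (G c (contract A (i - 1) (a # q # qs)))"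
    have e: "{1..n + 1} = insert 1 (Suc ` {1..n})" by (auto simp: image_Suc_atLeastAtMost)
    have h: "?h (Suc i) = alt_sign K (n + 1) (alt_sign K i (?s i))" if i: "i \<in> {1..n}" for i
    proof -
      obtain j where j: "i = Suc j" using i by (cases i) auto
      have jc: "set (contract A j (q # qs)) \<subseteq> carrier A" "length (contract A j (q # qs)) = n"
        subgoal using i j by (intro contract_closed) auto
        subgoal using i j by (subst length_contract) auto
        done
      have "?h (Suc i) = alt_sign K (Suc i) (G c (a # contract A j (q # qs)))" by (simp add: j contract_Cons)
      also have "\<dots> = alt_sign K (Suc i) (alt_sign K n (?s i))"
        using contract_append[of j "q # qs"] i by (subst cyc) (auto simp: jc j)
      also have "\<dots> = alt_sign K (n + 1) (alt_sign K i (?s i))" using sK[of i] i by (simp add: alt(1) add.commute)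
      finally show ?thesis .
    qed
    have hK': "?h i \<in> carrier K" if i: "i \<in> {1..n + 1}" for i
    proof (intro altK G_closed)
      show "set (contract A (i - 1) (a # q # qs)) \<subseteq> carrier A" using i by (intro contract_closed) auto
      show "length (contract A (i - 1) (a # q # qs)) = Suc n" using i by (subst length_contract) auto
    qed auto
    have hK: "?h (Suc i) \<in> carrier K" if "i \<in> {1..n}" for i unfolding h[OF that] using sK[of i] that altK by simp
    have h1: "?h 1 = alt_sign K 1 ?g0" by (simp add: contract_def)
    have "(\<Oplus>\<^bsub>?S\<^esub>i\<in>{1..n + 1}. ?h i) = ?h 1 \<oplus>\<^bsub>?S\<^esub> (\<Oplus>\<^bsub>?S\<^esub>i\<in>Suc ` {1..n}. ?h i)"
      unfolding e by (rule S.finsum_insert) (use hK' altK[OF g0] h1 in auto)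
    also have "(\<Oplus>\<^bsub>?S\<^esub>i\<in>Suc ` {1..n}. ?h i) = (\<Oplus>\<^bsub>?S\<^esub>i\<in>{1..n}. ?h (Suc i))"
      by (rule S.finsum_reindex) (use hK' in auto)
    also have "\<dots> = ?M" by (rule S.finsum_cong') (use h sK altK in auto)
    finally show ?thesis unfolding h1 .
  qed
  finally have "?L \<oplus>\<^bsub>?S\<^esub> alt_sign K 1 ?g0 = \<zero>\<^bsub>?S\<^esub>"
    unfolding L using sK[of "n + 1"] MK altK[OF g0, of 1] S.a_assoc[of "?s (n + 1)" ?M "alt_sign K 1 ?g0"]
      S.a_comm[of ?M "alt_sign K 1 ?g0"] by simp
  then have "?L = ?g0"
    using add_zero_alt[OF module_scalars, of ?L ?g0 1] LK g0 by (simp add: alt_sign_def)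
  moreover have "tr c (rho a \<cdot> ?y) = ?g0"
    by (simp add: omega_word_mult omega_left_word tr_word)
  ultimately show ?thesis by simp
qed

text \<open>
  For a word \<open>d\<omega>\<close>, the functional vanishes on \<open>d(\<omega> \<rho>(a'))\<close>, and the claim becomes cyclicity of \<open>g\<close>.
\<close>

lemma tr_rho_diff:
  assumes [simp]: "c \<in> carrier C" "a \<in> carrier A" "set qs \<subseteq> carrier A" and qs: "length qs = n" "qs \<noteq> []"
  shows "tr c (rho a \<cdot> dw qs) =
    sw (scalars K) (c \<rhd> a) (\<lambda>a' c'. tr c' (dw qs \<cdot> rho a'))"
proof -
  let ?S = "scalars K"
  obtain b bs where q: "qs = b # bs" using qs by (cases qs) auto
  have [simp]: "b \<in> carrier A" "set bs \<subseteq> carrier A" using assms(3) q by auto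
  have n: "n = Suc (length bs)" using qs q by simp
  have lalt: "lin ?S ?S (alt_sign K n)" using lin_alt_map[OF module_scalars lin_ident, of n] by simp
  have Gc: "G c' (qs @ [a']) \<in> carrier K" if "a' \<in> carrier A" "c' \<in> carrier C" for a' c'
    using that qs by (intro G_closed) auto
  have pt: "tr c' (dw qs \<cdot> rho a') = alt_sign K n (G c' (qs @ [a']))"
    if [simp]: "a' \<in> carrier A" "c' \<in> carrier C" for a' c'
  proof -
    let ?y = "aw b bs"
    have y: "?y \<in> dg_part Om (length bs)" by (rule omega_word_part) auto
    have D: "dg_diff Om ?y = dw qs" by (simp add: omega_diff_word q)
    have [simp]: "dw qs \<in> carrier Om" using q by simp
    have e: "?y \<cdot> dg_diff Om (rho a') = aw b (bs @ [a'])"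
      by (simp add: omega_diff_word omega_word_mult omega_dlefts_diff omega_left_word)
    have w: "tr c' (aw b (bs @ [a'])) = G c' (qs @ [a'])"
      using tr_word[of c' "bs @ [a']" "(b, \<zero>)"] by (simp add: q n)
    note l = lin_tr[OF \<open>c' \<in> carrier C\<close>]
    have "\<zero> = tr c' (dg_diff Om (?y \<cdot> rho a'))" by (simp add: tr_exact)
    also have "\<dots> = tr c' (dw qs \<cdot> rho a') \<oplus> alt_sign K (length bs) (G c' (qs @ [a']))"
      using omega_leibniz[OF y, of "rho a'"] lin_add[OF l] lin_alt_sign[OF _ _ l]
      by (simp add: D e w)
    finally show ?thesis
      using add_zero_alt[OF module_scalars, of "tr c' (dw qs \<cdot> rho a')" "G c' (qs @ [a'])" "length bs"]
        tr_closed Gc by (simp add: n)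
  qed
  have "tr c (rho a \<cdot> dw qs) = tr c (aw a qs)"
    using qs(2) assms(3) by (simp add: omega_word_mult omega_left_word)
  also have "\<dots> = G c (a # qs)" using tr_word[of c qs "(a, \<zero>)"] qs by simp
  also have "\<dots> = sw ?S (c \<rhd> a) (\<lambda>a' c'. alt_sign K n (G c' (qs @ [a'])))"
    unfolding cyc[OF assms(1-3) qs(1)] by (rule lin_of_sw_psi[OF _ _ lalt]) (use Gc in auto)
  also have "\<dots> = sw ?S (c \<rhd> a) (\<lambda>a' c'. tr c' (dw qs \<cdot> rho a'))"
    by (rule sw_psi_cong) (use pt lin_closed[OF lalt] Gc in auto)
  finally show ?thesis .
qed

lemma tr_rho:
  assumes [simp]: "c \<in> carrier C" "a \<in> carrier A" and y: "y \<in> dg_part Om n"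
  shows "tr c (rho a \<cdot> y) = sw (scalars K) (c \<rhd> a) (\<lambda>a' c'. tr c' (y \<cdot> rho a'))"
proof (rule omega_part_eqI[OF module_scalars _ _ y])
  let ?f = "\<lambda>y. tr c (rho a \<cdot> y)"
  let ?g = "\<lambda>y. sw (scalars K) (c \<rhd> a) (\<lambda>a' c'. tr c' (y \<cdot> rho a'))"
  show f: "lin Om (scalars K) ?f" by (intro lin_comp[OF lin_tr] bilinD[OF omega_bilin]) auto
  show g: "lin Om (scalars K) ?g"
    by (intro lin_sw_psi_param lin_comp[OF lin_tr] bilinD[OF omega_bilin]) auto
  fix p ps assume ps: "length ps = n" "set ps \<subseteq> carrier A" "p \<in> carrier (omega_head K A (length ps))"
  obtain q m where p: "p = (q, m)" by (cases p)
  show "?f (ow p ps) = ?g (ow p ps)"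
  proof (cases "ps = []")
    case True
    then show ?thesis using ps p tr_rho_plain[of c a q ps] by simp
  next
    case False
    then have [simp]: "q \<in> carrier A" "m \<in> carrier K" using ps p by auto
    have [simp]: "set ps \<subseteq> carrier A" "aw q ps \<in> carrier Om" "dw ps \<in> carrier Om"
      "m \<odot>\<^bsub>Om\<^esub> dw ps \<in> carrier Om"
      using ps False by (auto intro!: mod_closed[OF omega_module])
    have *: "h (ow p ps) = h (aw q ps) \<oplus> m \<otimes> h (dw ps)" if h: "lin Om (scalars K) h" for h
      unfolding p omega_word_split[OF False ps(2) \<open>q \<in> carrier A\<close> \<open>m \<in> carrier K\<close>]
      using lin_add[OF h] lin_smult[OF h] by simp
    show ?thesis unfolding *[OF f] *[OF g]
      using tr_rho_plain[of c a q ps] tr_rho_diff[of c a ps] ps False by simp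
  qed
qed

lemma bilin_tr_mult: "y \<in> carrier Om \<Longrightarrow> bilin Om C (scalars K) (\<lambda>x c. tr c (y \<cdot> x))"
  by (intro bilinI lin_tr_coalg lin_comp[OF lin_tr] bilinD[OF omega_bilin]) auto

lemma tr_parts:
  assumes [simp]: "c \<in> carrier C" "y \<in> carrier Om" and x: "x \<in> dg_part Om i"
  shows "tr c (dg_diff Om x \<cdot> y) = alt_sign K (Suc i) (tr c (x \<cdot> dg_diff Om y))"
proof -
  have [simp]: "x \<in> carrier Om" using x by (simp add: omega_part_closed)
  note l = lin_tr[OF assms(1)]
  have "\<zero> = tr c (dg_diff Om (x \<cdot> y))" by (simp add: tr_exact)
  also have "\<dots> = tr c (dg_diff Om x \<cdot> y) \<oplus> alt_sign K i (tr c (x \<cdot> dg_diff Om y))"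
    using omega_leibniz[OF x, of y] lin_add[OF l] lin_alt_sign[OF _ _ l] by simp
  finally show ?thesis
    using add_zero_alt[OF module_scalars, of "tr c (dg_diff Om x \<cdot> y)" "tr c (x \<cdot> dg_diff Om y)" i]
      tr_closed by simp
qed

text \<open>
  The trace property follows by induction on the construction of \<open>x\<close>: for \<open>\<rho>(a) x\<close> the factor \<open>\<rho>(a)\<close> is
  moved to the right end first, and then \<open>x\<close>; for \<open>dx\<close> the differential is moved to \<open>y\<close> and back, by
  integration by parts.
\<close>

lemma tr_graded:
  assumes "x \<in> dg_part Om i"
  shows "\<forall>j c y. i + j = n \<longrightarrow> c \<in> carrier C \<longrightarrow> y \<in> dg_part Om j \<longrightarrow> tr c (x \<cdot> y) =
    alt_sign K (i * j) (sw (scalars K) (c \<unrhd> x) (\<lambda>x' c'. tr c' (y \<cdot> x')))"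
  using assms
proof (induction x rule: omega_graded_induct)
  case (base a)
  then show ?case
    using tr_rho by (auto simp: alt_sign_def sw_Psi_rho[OF _ bilin_tr_mult] omega_part_closed)
next
  case (mult i a x)
  show ?case
  proof (intro allI impI)
    fix j c y assume ij: "i + j = n" and [simp]: "c \<in> carrier C" and y: "y \<in> dg_part Om j"
    have [simp]: "x \<in> carrier Om" "y \<in> carrier Om" "a \<in> carrier A" using mult.hyps y by (auto simp: omega_part_closed)
    have lalt: "lin (scalars K) (scalars K) (alt_sign K (i * j))"
      using lin_alt_map[OF module_scalars lin_ident, of "i * j"] by simp
    have cl: "sw (scalars K) (c' \<unrhd> x) (\<lambda>x' c''. tr c'' (y \<cdot> (rho a' \<cdot> x'))) \<in> carrier K"
      if "a' \<in> carrier A" "c' \<in> carrier C" for a' c'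
      using sw_Psi_closed[OF module_scalars, of c' x] tr_closed that by simp
    have "tr c ((rho a \<cdot> x) \<cdot> y) = tr c (rho a \<cdot> (x \<cdot> y))"
      by (simp add: omega_mult_assoc)
    also have "\<dots> = sw (scalars K) (c \<rhd> a) (\<lambda>a' c'. tr c' ((x \<cdot> y) \<cdot> rho a'))"
      using omega_mult_part[OF mult.hyps(2) y] ij by (intro tr_rho) auto
    also have "\<dots> = sw (scalars K) (c \<rhd> a) (\<lambda>a' c'. alt_sign K (i * j)
        (sw (scalars K) (c' \<unrhd> x) (\<lambda>x' c''. tr c'' (y \<cdot> (rho a' \<cdot> x')))))"
    proof (rule sw_psi_cong)
      fix a' c' assume [simp]: "a' \<in> carrier A" "c' \<in> carrier C"
      have yr: "y \<cdot> rho a' \<in> dg_part Om j"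
        using omega_mult_part[OF y omega_word_part[of "[]" "(a', \<zero>)"]] by simp
      show "tr c' ((x \<cdot> y) \<cdot> rho a') \<in> carrier (scalars K)" by (simp add: tr_closed)
      have "tr c' ((x \<cdot> y) \<cdot> rho a') = tr c' (x \<cdot> (y \<cdot> rho a'))"
        by (simp add: omega_mult_assoc)
      also have "\<dots> = alt_sign K (i * j) (sw (scalars K) (c' \<unrhd> x) (\<lambda>x' c''. tr c'' ((y \<cdot> rho a') \<cdot> x')))"
        using mult.IH ij yr by simp
      also have "sw (scalars K) (c' \<unrhd> x) (\<lambda>x' c''. tr c'' ((y \<cdot> rho a') \<cdot> x')) =
          sw (scalars K) (c' \<unrhd> x) (\<lambda>x' c''. tr c'' (y \<cdot> (rho a' \<cdot> x')))"
        by (rule sw_Psi_cong) (auto simp: tr_closed omega_mult_assoc)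
      finally show "tr c' ((x \<cdot> y) \<cdot> rho a') = alt_sign K (i * j)
        (sw (scalars K) (c' \<unrhd> x) (\<lambda>x' c''. tr c'' (y \<cdot> (rho a' \<cdot> x'))))" .
    qed auto
    also have "\<dots> = alt_sign K (i * j) (sw (scalars K) (c \<rhd> a) (\<lambda>a' c'.
        sw (scalars K) (c' \<unrhd> x) (\<lambda>x' c''. tr c'' (y \<cdot> (rho a' \<cdot> x')))))"
      by (rule lin_of_sw_psi[OF _ _ lalt, symmetric]) (use cl in auto)
    also have "sw (scalars K) (c \<rhd> a) (\<lambda>a' c'.
        sw (scalars K) (c' \<unrhd> x) (\<lambda>x' c''. tr c'' (y \<cdot> (rho a' \<cdot> x')))) =
        sw (scalars K) (c \<unrhd> (rho a \<cdot> x)) (\<lambda>x' c'. tr c' (y \<cdot> x'))"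
      by (rule sw_Psi_rho_mult[OF _ bilin_tr_mult, symmetric]) auto
    finally show "tr c ((rho a \<cdot> x) \<cdot> y) = alt_sign K (i * j)
        (sw (scalars K) (c \<unrhd> (rho a \<cdot> x)) (\<lambda>x' c'. tr c' (y \<cdot> x')))" .
  qed
next
  case (diff i x)
  let ?S = "scalars K" and ?d = "dg_diff Om"
  note alt = alt_sign_simps[OF module_scalars, unfolded scalars_group scalars_simps]
  show ?case
  proof (intro allI impI)
    fix j c y assume ij: "Suc i + j = n" and [simp]: "c \<in> carrier C" and y: "y \<in> dg_part Om j"
    have [simp]: "x \<in> carrier Om" "y \<in> carrier Om" using diff.hyps y by (auto simp: omega_part_closed)
    have dy: "?d y \<in> dg_part Om (Suc j)" by (rule omega_diff_part[OF y])
    have lalt: "lin ?S ?S (alt_sign K k)" for k using lin_alt_map[OF module_scalars lin_ident, of k] by simp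
    let ?H = "sw ?S (c \<unrhd> x) (\<lambda>x' c'. tr c' (y \<cdot> ?d x'))"
    have HK: "?H \<in> carrier K" using sw_Psi_closed[OF module_scalars, of c x] tr_closed by simp
    have b1: "bilin Om C ?S (\<lambda>x' c'. tr c' (?d y \<cdot> x'))" by (rule bilin_tr_mult) simp
    have b2: "bilin Om C ?S (\<lambda>x' c'. tr c' (y \<cdot> ?d x'))"
      by (intro bilinI lin_tr_coalg lin_comp[OF lin_tr] lin_comp[OF _ lin_omega_diff] bilinD[OF omega_bilin]) auto
    have b3: "bilin Om C ?S (\<lambda>x' c'. alt_sign K (Suc j) (tr c' (y \<cdot> ?d x')))"
      by (intro bilinI lin_comp[OF lalt] bilinD[OF b2]) auto
    have "sw ?S (c \<unrhd> x) (\<lambda>x' c'. tr c' (?d y \<cdot> x')) =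
        sw ?S (c \<unrhd> x) (\<lambda>x' c'. alt_sign K (Suc j) (tr c' (y \<cdot> ?d x')))"
    proof (rule part_left_eqI[OF _ lin_sw[OF _ _ _ b1] lin_sw[OF _ _ _ b3] omega_psi_part[OF _ diff.hyps]])
      fix x' c' assume x': "x' \<in> dg_part Om i" and c': "c' \<in> carrier C"
      then have "x' \<in> carrier Om" by (simp add: omega_part_closed)
      then show "sw ?S (tens K Om C x' c') (\<lambda>x' c'. tr c' (?d y \<cdot> x')) =
          sw ?S (tens K Om C x' c') (\<lambda>x' c'. alt_sign K (Suc j) (tr c' (y \<cdot> ?d x')))"
        using sw_tens[OF _ _ _ b1, of x' c'] sw_tens[OF _ _ _ b3, of x' c'] tr_parts[OF c' _ y, of x'] c' by simp
    qed auto
    also have "\<dots> = alt_sign K (Suc j) ?H"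
      by (rule lin_of_sw_Psi[OF _ _ lalt, symmetric]) (auto simp: tr_closed)
    finally have H: "sw ?S (c \<unrhd> x) (\<lambda>x' c'. tr c' (?d y \<cdot> x')) = alt_sign K (Suc j) ?H" .
    have "tr c (?d x \<cdot> y) = alt_sign K (Suc i) (tr c (x \<cdot> ?d y))"
      by (rule tr_parts[OF _ _ diff.hyps]) auto
    also have "tr c (x \<cdot> ?d y) = alt_sign K (i * Suc j) (alt_sign K (Suc j) ?H)"
      using diff.IH[rule_format, of "Suc j" c "?d y"] ij dy H by simp
    also have "alt_sign K (Suc i) \<dots> = alt_sign K (Suc i + (i * Suc j + Suc j)) ?H"
      using HK lin_closed[OF lalt] by (simp only: alt(1))
    \<comment> \<open>\<open>(i + 1) + i (j + 1) + (j + 1) \<equiv> (i + 1) j\<close> modulo \<open>2\<close>\<close>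
    also have "\<dots> = alt_sign K (Suc i * j) ?H"
      by (cases "even i"; cases "even j") (simp_all add: alt_sign_def)
    also have "?H = sw ?S (c \<unrhd> (?d x)) (\<lambda>x' c'. tr c' (y \<cdot> x'))"
      by (rule sw_Psi_diff[OF _ bilin_tr_mult, symmetric]) auto
    finally show "tr c (?d x \<cdot> y) =
      alt_sign K (Suc i * j) (sw ?S (c \<unrhd> (?d x)) (\<lambda>x' c'. tr c' (y \<cdot> x')))" .
  qed
next
  case (add i x x')
  show ?case
  proof (intro allI impI)
    fix j c y assume ij: "i + j = n" and [simp]: "c \<in> carrier C" and y: "y \<in> dg_part Om j"
    have [simp]: "x \<in> carrier Om" "x' \<in> carrier Om" "y \<in> carrier Om" using add.hyps y by (auto simp: omega_part_closed)
    have l: "lin Om (scalars K) (\<lambda>x. tr c (x \<cdot> y))" by (intro lin_comp[OF lin_tr] bilinD[OF omega_bilin]) auto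
    have r: "lin Om (scalars K) (\<lambda>x. alt_sign (scalars K) (i * j) (sw (scalars K) (c \<unrhd> x) (\<lambda>x' c'. tr c' (y \<cdot> x'))))"
      by (intro lin_alt_map lin_sw_Psi_alg bilin_tr_mult lin_ident) auto
    show "tr c ((x \<oplus>\<^bsub>Om\<^esub> x') \<cdot> y) =
      alt_sign K (i * j) (sw (scalars K) (c \<unrhd> (x \<oplus>\<^bsub>Om\<^esub> x')) (\<lambda>x' c'. tr c' (y \<cdot> x')))"
      using lin_add[OF l, of x x'] lin_add[OF r, of x x'] add.IH ij y by simp
  qed
next
  case (smult i s x)
  show ?case
  proof (intro allI impI)
    fix j c y assume ij: "i + j = n" and [simp]: "c \<in> carrier C" and y: "y \<in> dg_part Om j"
    have [simp]: "s \<in> carrier K" "x \<in> carrier Om" "y \<in> carrier Om" using smult.hyps y by (auto simp: omega_part_closed)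
    have l: "lin Om (scalars K) (\<lambda>x. tr c (x \<cdot> y))" by (intro lin_comp[OF lin_tr] bilinD[OF omega_bilin]) auto
    have r: "lin Om (scalars K) (\<lambda>x. alt_sign (scalars K) (i * j) (sw (scalars K) (c \<unrhd> x) (\<lambda>x' c'. tr c' (y \<cdot> x'))))"
      by (intro lin_alt_map lin_sw_Psi_alg bilin_tr_mult lin_ident) auto
    show "tr c ((s \<odot>\<^bsub>Om\<^esub> x) \<cdot> y) =
      alt_sign K (i * j) (sw (scalars K) (c \<unrhd> (s \<odot>\<^bsub>Om\<^esub> x)) (\<lambda>x' c'. tr c' (y \<cdot> x')))"
      using lin_smult[OF l, of s x] lin_smult[OF r, of s x] smult.IH ij y by simp
  qed
qed

lemma omega_trace_closed_graded: "closed_graded_trace K Om C Psi n (omega_trace n g)"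
  unfolding closed_graded_trace_def
proof (intro conjI allI impI; (elim conjE)?)
  show "lin ((tensor K C Om)\<lparr>carrier := part_right K C Om n\<rparr>) (scalars K) (omega_trace n g)"
    by (rule linI) (use lin_omega_trace submodule_closed(2)[OF _ part_right_submodule] in
      \<open>auto simp: lin_add[OF lin_omega_trace] lin_smult[OF lin_omega_trace] intro: lin_closed[OF lin_omega_trace, simplified]\<close>)
  show "tr c (dg_diff Om r) = \<zero>" if "c \<in> carrier C" "r \<in> dg_part Om i" for i c r
    using that by (simp add: tr_exact omega_part_closed)
  fix i j c x y assume ij: "i + j = n" and c: "c \<in> carrier C" and x: "x \<in> dg_part Om i" and y: "y \<in> dg_part Om j"
  have "omega_trace n g (sw (tensor K C Om) (c \<unrhd> x) (\<lambda>s c'. tens K C Om c' (y \<cdot> s))) =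
      sw (scalars K) (c \<unrhd> x) (\<lambda>s c'. tr c' (y \<cdot> s))"
    by (rule lin_of_sw_Psi[OF _ _ lin_omega_trace]) (use c x y omega_part_closed in auto)
  then show "tr c (x \<cdot> y) = alt_sign K (i * j)
      (omega_trace n g (sw (tensor K C Om) (c \<unrhd> x) (\<lambda>s c'. tens K C Om c' (y \<cdot> s))))"
    using tr_graded[OF x] ij c y by simp
qed

end

end

theorem cocycle_trace:
  assumes g: "g \<in> cyclic_cocycles K A C \<psi> n"
  shows "closed_graded_trace K Om C Psi n (omega_trace n g)"
    and "\<lbrakk>c \<in> carrier C; a \<in> carrier A; set as \<subseteq> carrier A; length as = n\<rbrakk> \<Longrightarrow>
      omega_trace n g (tens K C Om c (aw a as)) = g (ca K A C (n + 1) c (a # as))"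
proof -
  have l: "lin (CA K A C (n + 1)) (scalars K) g"
    using g by (simp add: cyclic_cocycles_def cyclic_cochains_def cochains_def)
  note [simp] = word_space_module[of "{m}" "\<lambda>_. C" A for m, OF coalgebra_module algebra_module]
  show "closed_graded_trace K Om C Psi n (omega_trace n g)"
  proof (rule omega_trace_closed_graded[OF l])
    fix c a as assume *: "c \<in> carrier C" "a \<in> carrier A" "set as \<subseteq> carrier A" "length as = n"
    have "g (sw (CA K A C (n + 1)) (c \<rhd> a) (\<lambda>a' c'. ca K A C (n + 1) c' (as @ [a']))) =
        sw (scalars K) (c \<rhd> a) (\<lambda>a' c'. g (ca K A C (n + 1) c' (as @ [a'])))"
      by (rule lin_of_sw_psi[OF _ _ l]) (use * in \<open>auto intro!: word_closed\<close>)
    then show "g (ca K A C (n + 1) c (a # as)) = alt_sign K n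
        (sw (scalars K) (c \<rhd> a) (\<lambda>a' c'. g (ca K A C (n + 1) c' (as @ [a']))))"
      using g * by (simp add: cyclic_cocycles_def cyclic_cochains_def)
  qed (use g in \<open>auto simp: cyclic_cocycles_def\<close>)
  show "omega_trace n g (tens K C Om c (aw a as)) = g (ca K A C (n + 1) c (a # as))"
    if "c \<in> carrier C" "a \<in> carrier A" "set as \<subseteq> carrier A" "length as = n"
    using tr_word[OF l, of c as "(a, \<zero>)"] that by (cases as) auto
qed

end

section \<open>The equivalence\<close>

theorem theorem4p5:
  fixes K :: "'k ring" and A :: "('k, 'a) module" and C :: "('k, 'c) coalg"
    and \<psi> :: "('c \<times> 'a \<Rightarrow> 'k) set \<Rightarrow> ('a \<times> 'c \<Rightarrow> 'k) set"
    and n :: nat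
    and g :: "('c \<times> 'a list \<Rightarrow> 'k) set \<Rightarrow> 'k"
  assumes "entwining K A C \<psi>"
    and "linear_map K (CA K A C (n + 1)) (scalars K) g"
  shows
    "((\<exists>(R :: ('k, (('a \<times> 'k) \<times> 'a list \<Rightarrow> 'k) set) dga) \<Psi> T \<rho>.
         entwined_cycle K A C \<psi> n R \<Psi> T \<rho> \<and>
         (\<forall>c\<in>carrier C. \<forall>a\<in>carrier A. \<forall>as. set as \<subseteq> carrier A \<and> length as = n \<longrightarrow>
            g (ca K A C (n + 1) c (a # as)) =
            T (tens K C R c (foldl (\<lambda>x y. x \<otimes>\<^bsub>R\<^esub> y) (\<rho> a) (map (\<lambda>b. dg_diff R (\<rho> b)) as)))))
      \<longleftrightarrow>
      (\<exists>t. closed_graded_trace K (omega K A) C (omega_psi K A C \<psi>) n t \<and>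
         (\<forall>c\<in>carrier C. \<forall>a\<in>carrier A. \<forall>as. set as \<subseteq> carrier A \<and> length as = n \<longrightarrow>
            g (ca K A C (n + 1) c (a # as)) =
            t (tens K C (omega K A) c (omega_word K A (a, \<zero>\<^bsub>K\<^esub>) as)))))
     \<and>
     ((\<exists>t. closed_graded_trace K (omega K A) C (omega_psi K A C \<psi>) n t \<and>
         (\<forall>c\<in>carrier C. \<forall>a\<in>carrier A. \<forall>as. set as \<subseteq> carrier A \<and> length as = n \<longrightarrow>
            g (ca K A C (n + 1) c (a # as)) =
            t (tens K C (omega K A) c (omega_word K A (a, \<zero>\<^bsub>K\<^esub>) as))))
      \<longleftrightarrow>
      g \<in> cyclic_cocycles K A C \<psi> n)
     \<and>
     ((\<exists>(R :: ('k, 'r) dga) \<Psi> T \<rho>.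
         entwined_cycle K A C \<psi> n R \<Psi> T \<rho> \<and>
         (\<forall>c\<in>carrier C. \<forall>a\<in>carrier A. \<forall>as. set as \<subseteq> carrier A \<and> length as = n \<longrightarrow>
            g (ca K A C (n + 1) c (a # as)) =
            T (tens K C R c (foldl (\<lambda>x y. x \<otimes>\<^bsub>R\<^esub> y) (\<rho> a) (map (\<lambda>b. dg_diff R (\<rho> b)) as)))))
      \<longrightarrow>
      g \<in> cyclic_cocycles K A C \<psi> n)"
proof -
  interpret entwining K A C \<psi> by fact
  let ?vals = "\<lambda>V. \<forall>c\<in>carrier C. \<forall>a\<in>carrier A. \<forall>as. set as \<subseteq> carrier A \<and> length as = n \<longrightarrow>
    g (ca K A C (n + 1) c (a # as)) = V c a as"
  let ?trace = "\<exists>t. closed_graded_trace K Om C Psi n t \<and> ?vals (\<lambda>c a as. t (tens K C Om c (ow (a, \<zero>\<^bsub>K\<^esub>) as)))"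
  have cocycle: "g \<in> cyclic_cocycles K A C \<psi> n"
    if entw: "entwined_cycle K A C \<psi> n R \<Psi> T \<rho>"
      and eqs: "?vals (\<lambda>c a as. T (tens K C R c (foldl (\<lambda>x y. x \<otimes>\<^bsub>R\<^esub> y) (\<rho> a) (map (\<lambda>b. dg_diff R (\<rho> b)) as))))"
    for R :: "('k, 's) dga" and \<Psi> T \<rho>
  proof (rule dg_entwining_over.cycle_character_cocycle[OF _ assms(1) _ assms(2)])
    show "dg_entwining_over K A C \<psi> R \<Psi> \<rho>" "closed_graded_trace K R C \<Psi> n T"
      using entw by (auto simp: entwined_cycle_def)
    fix c as assume "c \<in> carrier C" "set as \<subseteq> carrier A" "length as = n + 1"
    then show "g (ca K A C (n + 1) c as) =
        T (tens K C R c (foldl (\<lambda>x y. x \<otimes>\<^bsub>R\<^esub> y) (\<rho> (hd as)) (map (\<lambda>b. dg_diff R (\<rho> b)) (tl as))))"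
      using eqs by (cases as) auto
  qed
  have trace: ?trace if "g \<in> cyclic_cocycles K A C \<psi> n"
    using cocycle_trace[OF that] by (intro exI[of _ "omega_trace n g"]) auto
  have cycle: "\<exists>(R :: ('k, (('a \<times> 'k) \<times> 'a list \<Rightarrow> 'k) set) dga) \<Psi> T \<rho>. entwined_cycle K A C \<psi> n R \<Psi> T \<rho> \<and>
      ?vals (\<lambda>c a as. T (tens K C R c (foldl (\<lambda>x y. x \<otimes>\<^bsub>R\<^esub> y) (\<rho> a) (map (\<lambda>b. dg_diff R (\<rho> b)) as))))"
    if tr: ?trace
  proof -
    obtain t where t: "closed_graded_trace K Om C Psi n t"
      and eqs: "?vals (\<lambda>c a as. t (tens K C Om c (ow (a, \<zero>\<^bsub>K\<^esub>) as)))"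
      using tr by blast
    have "entwined_cycle K A C \<psi> n Om Psi t (\<lambda>a. rho a)"
      using t omega_dg_entwining_over by (simp add: entwined_cycle_def)
    moreover have "?vals (\<lambda>c a as. t (tens K C Om c (foldl (\<lambda>x y. x \<otimes>\<^bsub>Om\<^esub> y) (rho a) (map (\<lambda>b. dg_diff Om (rho b)) as))))"
      using eqs omega_form[of _ _ "[]"] by simp
    ultimately show ?thesis by (intro exI conjI)
  qed
  show ?thesis
    apply (intro conjI iffI impI)
    subgoal by (elim exE conjE) (rule trace, erule (1) cocycle)
    subgoal by (rule cycle)
    subgoal by (drule cycle) (elim exE conjE, erule (1) cocycle)
    subgoal by (rule trace)
    subgoal by (elim exE conjE) (erule (1) cocycle)
    done
qed

end
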